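(* Let $H$ be a bipartite graph, let $t\ge 5$ be an odd integer, let $H(t)$ be an odd-ballooning of $H$, and let $n$ be a sufficiently large integer. Then $$f(n,\tilde q(H))+\mathrm{ex}(\tilde q(H)-1,\tilde{\mathcal B}(H))\ \le\ \mathrm{ex}(n,H(t))\ \le\ f(n,\tilde q(H))+\mathrm{ex}(\tilde q(H)-1,\tilde{\mathcal B}(H))+(k(H)-1)^2 .$$ Moreover, if $\mathrm{ex}(n,H(t))=f(n,\tilde q(H))+\mathrm{ex}(\tilde q(H)-1,\tilde{\mathcal B}(H))+(k(H)-1)^2$, then the graphs in $\mathcal F(n,\tilde q(H),k(H)-1,\tilde{\mathcal B}(H))$ are the only extremal graphs for $H(t)$ of order $n$.
   Context: All graphs are simple; $e(G)$ is the number of edges of $G$. $I_m$ denotes the graph with $m$ vertices and no edges; $G\cup G'$ is the (vertex-disjoint) union and $G\vee G'$ is the join (union plus all edges between $V(G)$ and $V(G')$). $T_2(m)$ is the complete bipartite graph on $m$ vertices whose two classes have sizes as equal as possible. Turán numbers: for a family of graphs $\mathcal L$ (or a single graph), a graph is $\mathcal L$-free if it contains no $L\in\mathcal L$ as a subgraph; $\mathrm{ex}(n,\mathcal L)$ is the maximum number of edges of an $\mathcal L$-free graph of order $n$; $\mathrm{EX}(n,\mathcal L)$ is the set of $\mathcal L$-free graphs of order $n$ with $\mathrm{ex}(n,\mathcal L)$ edges, called extremal graphs for $\mathcal L$. Odd-ballooning: for odd $t\ge 3$, $H(t)$ denotes a graph obtained from $H$ by replacing each edge of $H$ by an odd cycle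 of length at least $t$ (containing that edge), where the new vertices of the cycles are all distinct; the lengths of the cycles may differ from edge to edge. $H(t)$ is one fixed such graph. Decomposition family: $\mathcal M_2(H(t))$ is the family of minimal graphs $M$ (with respect to the subgraph relation) for which there is an integer $m$ such that $(M\cup I_m)\vee I_m$ contains a copy of $H(t)$. Coverings: a covering of a graph is a set of vertices meeting all edges; $\beta(G)$ is the minimum size of a covering of $G$. An independent covering of a bipartite graph is an independent set meeting all edges; $\gamma(G)$ is the minimum size of an independent covering of the bipartite graph $G$. For a family $\mathcal L$: $q(\mathcal L)=\min\{\gamma(L): L\in\mathcal L \text{ bipartite}\}$; $\mathcal S(\mathcal L)$ is the family of independent coverings of size $q(\mathcal L)$ of bipartite graphs $L\in\mathcal L$; $\mathcal B(\mathcal L)$ is the set of subgraphs of $L$ induced by a covering of $L$ of size less than $q(\mathcal L)$, over all $L\in\mathcal L$, except that if $\beta(L)\ge q(\mathcal L)$ for every $L\in\mathcal L$ then $\mathcal B(\mathcal L)=\{K_{q(\mathcal L)}\}$. Put $\tilde q(H)=q(\mathcal M_2(H(t)))$, $\tilde{\mathcal S}(H)=\mathcal S(\mathcal M_2(H(t)))$, $\tilde{\mathcal B}(H)=\mathcal B(\mathcal M_2(H(t)))$, and $k(H)=\min\{d_M(x): x\in S,\ S\in\tilde{\mathcal S}(H)\}$, where $M\in\mathcal M_2(H(t))$ is the graph of which $S$ is an independent covering. Set $F(n,q)=I_{q-1}\vee T_2(n-q+1)$ and $f(n,q)=e(F(n,q))$. $\mathcal F(n,q,k,\mathcal L)$ is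 the set of graphs obtained from $F(n,q)$ by putting a copy of $K_{k,k}$ in one class of $T_2(n-q+1)$ and putting a copy of a member of $\mathrm{EX}(q-1,\mathcal L)$ in $I_{q-1}$.
   Formalization: H is assumed to have an edge, and "the only extremal graphs" is proved as: every extremal graph is isomorphic to a member of F(n,q,k-1,B); the converse, that every member of F is extremal, is false in general, since some members may contain H(t). *)

theory Defs
  imports Complex_Main
begin

section \<open>Finite simple graphs\<close>

record 'a graph =
  verts :: "'a set"
  edges :: "'a set set"

text \<open>The graph without vertices is admitted: it is the only graph of order 0.\<close>

definition simple_graph :: "'a graph \<Rightarrow> bool" where
  "simple_graph G \<longleftrightarrow> finite (verts G) \<and> (\<forall>e\<in>edges G. e \<subseteq> verts G \<and> card e = 2)"

definition degree :: "'a graph \<Rightarrow> 'a \<Rightarrow> nat" where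
  "degree G x = card {e \<in> edges G. x \<in> e}"

definition subgraph :: "'a graph \<Rightarrow> 'a graph \<Rightarrow> bool" where
  "subgraph M G \<longleftrightarrow> verts M \<subseteq> verts G \<and> edges M \<subseteq> edges G"

definition induced_subgraph :: "'a graph \<Rightarrow> 'a set \<Rightarrow> 'a graph" where
  "induced_subgraph G S = \<lparr>verts = S, edges = {e \<in> edges G. e \<subseteq> S}\<rparr>"

definition isomorphic :: "'a graph \<Rightarrow> 'b graph \<Rightarrow> bool" where
  "isomorphic G G' \<longleftrightarrow> simple_graph G \<and> simple_graph G' \<and>
     (\<exists>f. bij_betw f (verts G) (verts G') \<and> (\<lambda>e. f ` e) ` edges G = edges G')"

text \<open>\<open>G\<close> has a (not necessarily induced) subgraph isomorphic to \<open>L\<close>.\<close>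

definition contains_copy :: "'b graph \<Rightarrow> 'a graph \<Rightarrow> bool" where
  "contains_copy G L \<longleftrightarrow>
     (\<exists>f. inj_on f (verts L) \<and> f ` verts L \<subseteq> verts G \<and> (\<forall>e\<in>edges L. f ` e \<in> edges G))"

definition independent :: "'a graph \<Rightarrow> 'a set \<Rightarrow> bool" where
  "independent G S \<longleftrightarrow> S \<subseteq> verts G \<and> (\<forall>e\<in>edges G. \<not> e \<subseteq> S)"

definition bipartite :: "'a graph \<Rightarrow> bool" where
  "bipartite G \<longleftrightarrow>
     (\<exists>X Y. X \<union> Y = verts G \<and> X \<inter> Y = {} \<and> independent G X \<and> independent G Y)"

definition disjoint_union :: "'a graph \<Rightarrow> 'b graph \<Rightarrow> ('a + 'b) graph" where
  "disjoint_union G G' =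
     \<lparr>verts = verts G <+> verts G',
      edges = (\<lambda>e. Inl ` e) ` edges G \<union> (\<lambda>e. Inr ` e) ` edges G'\<rparr>"

definition join :: "'a graph \<Rightarrow> 'b graph \<Rightarrow> ('a + 'b) graph" where
  "join G G' =
     \<lparr>verts = verts (disjoint_union G G'),
      edges = edges (disjoint_union G G') \<union> {{Inl u, Inr v} | u v. u \<in> verts G \<and> v \<in> verts G'}\<rparr>"

definition empty_graph :: "nat \<Rightarrow> nat graph" where
  "empty_graph m = \<lparr>verts = {..<m}, edges = {}\<rparr>"

definition complete_graph :: "nat \<Rightarrow> nat graph" where
  "complete_graph m = \<lparr>verts = {..<m}, edges = {e. e \<subseteq> {..<m} \<and> card e = 2}\<rparr>"

definition complete_bipartite :: "nat \<Rightarrow> nat \<Rightarrow> (nat + nat) graph" where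
  "complete_bipartite a b = join (empty_graph a) (empty_graph b)"

definition turan2 :: "nat \<Rightarrow> (nat + nat) graph" where
  "turan2 m = complete_bipartite (m div 2) (m - m div 2)"

definition turan2_classes :: "nat \<Rightarrow> (nat + nat) set set" where
  "turan2_classes m = {Inl ` {..<m div 2}, Inr ` {..<m - m div 2}}"


section \<open>Turan numbers\<close>

definition graph_free :: "'a graph set \<Rightarrow> 'b graph \<Rightarrow> bool" where
  "graph_free \<L> G \<longleftrightarrow> (\<forall>L\<in>\<L>. \<not> contains_copy G L)"

text \<open>Host graphs live on arbitrary finite sets of naturals, so every isomorphism type occurs.\<close>

definition free_graphs :: "nat \<Rightarrow> 'a graph set \<Rightarrow> nat graph set" where
  "free_graphs n \<L> = {G. simple_graph G \<and> card (verts G) = n \<and> graph_free \<L> G}"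

definition turan_number :: "nat \<Rightarrow> 'a graph set \<Rightarrow> nat" where
  "turan_number n \<L> = Max ((\<lambda>G. card (edges G)) ` free_graphs n \<L>)"

definition extremal_graphs :: "nat \<Rightarrow> 'a graph set \<Rightarrow> nat graph set" where
  "extremal_graphs n \<L> = {G \<in> free_graphs n \<L>. card (edges G) = turan_number n \<L>}"


section \<open>Odd-ballooning\<close>

definition cycle_edges :: "'a list \<Rightarrow> 'a set set" where
  "cycle_edges c = {{c ! i, c ! (Suc i mod length c)} | i. i < length c}"

text \<open>
  \<open>c e\<close> lists, in cyclic order, the vertices of the odd cycle replacing the edge \<open>e\<close>;
  its vertices outside \<open>verts H\<close> are the new ones.
\<close>

definition odd_ballooning :: "nat \<Rightarrow> 'a graph \<Rightarrow> 'a graph \<Rightarrow> bool" where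
  "odd_ballooning t H B \<longleftrightarrow>
     (\<exists>c :: 'a set \<Rightarrow> 'a list.
        (\<forall>e\<in>edges H. distinct (c e) \<and> odd (length (c e)) \<and> t \<le> length (c e) \<and>
           e \<in> cycle_edges (c e) \<and> set (c e) \<inter> verts H = e) \<and>
        (\<forall>e\<in>edges H. \<forall>e'\<in>edges H. e \<noteq> e' \<longrightarrow> set (c e) \<inter> set (c e') \<subseteq> verts H) \<and>
        verts B = verts H \<union> (\<Union>e\<in>edges H. set (c e)) \<and>
        edges B = (\<Union>e\<in>edges H. cycle_edges (c e)))"


section \<open>Decomposition family\<close>

definition decomposing :: "'a graph \<Rightarrow> 'b graph \<Rightarrow> bool" where
  "decomposing L M \<longleftrightarrow>
     (\<exists>m. contains_copy (join (disjoint_union M (empty_graph m)) (empty_graph m)) L)"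

definition decomposition_family :: "'a graph \<Rightarrow> nat graph set" where
  "decomposition_family L =
     {M. simple_graph M \<and> decomposing L M \<and>
         (\<forall>M'. simple_graph M' \<and> subgraph M' M \<and> decomposing L M' \<longrightarrow> M' = M)}"


section \<open>Coverings\<close>

text \<open>
  All minima below are infima of sets of naturals; such an infimum is attained whenever the
  set is nonempty.
\<close>

definition covering :: "'a graph \<Rightarrow> 'a set \<Rightarrow> bool" where
  "covering G S \<longleftrightarrow> S \<subseteq> verts G \<and> (\<forall>e\<in>edges G. S \<inter> e \<noteq> {})"

definition independent_covering :: "'a graph \<Rightarrow> 'a set \<Rightarrow> bool" where
  "independent_covering G S \<longleftrightarrow> independent G S \<and> covering G S"

definition covering_number :: "'a graph \<Rightarrow> nat" where
  "covering_number G = Inf {card S | S. covering G S}"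

definition independent_covering_number :: "'a graph \<Rightarrow> nat" where
  "independent_covering_number G = Inf {card S | S. independent_covering G S}"

definition q_number :: "'a graph set \<Rightarrow> nat" where
  "q_number \<L> = Inf {independent_covering_number L | L. L \<in> \<L> \<and> bipartite L}"

text \<open>Each independent covering is paired with the graph it covers.\<close>

definition S_family :: "'a graph set \<Rightarrow> ('a graph \<times> 'a set) set" where
  "S_family \<L> =
     {(L, S). L \<in> \<L> \<and> bipartite L \<and> independent_covering L S \<and> card S = q_number \<L>}"

definition B_family :: "nat graph set \<Rightarrow> nat graph set" where
  "B_family \<L> =
     (if \<forall>L\<in>\<L>. q_number \<L> \<le> covering_number L
      then {complete_graph (q_number \<L>)}
      else {induced_subgraph L S | L S. L \<in> \<L> \<and> covering L S \<and> card S < q_number \<L>})"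

definition k_number :: "'a graph set \<Rightarrow> nat" where
  "k_number \<L> = Inf {degree M x | M S x. (M, S) \<in> S_family \<L> \<and> x \<in> S}"


section \<open>The candidate extremal graphs\<close>

definition F_graph :: "nat \<Rightarrow> nat \<Rightarrow> (nat + (nat + nat)) graph" where
  "F_graph n q = join (empty_graph (q - 1)) (turan2 (n - q + 1))"

definition f_number :: "nat \<Rightarrow> nat \<Rightarrow> nat" where
  "f_number n q = card (edges (F_graph n q))"

text \<open>
  In \<open>F_graph n q\<close>, the vertices of \<open>empty_graph (q - 1)\<close> are \<open>Inl ` {..<q - 1}\<close> and the
  classes of \<open>turan2 (n - q + 1)\<close> are the sets \<open>Inr ` C\<close>.
\<close>

definition F_family ::
  "nat \<Rightarrow> nat \<Rightarrow> nat \<Rightarrow> 'a graph set \<Rightarrow> (nat + (nat + nat)) graph set" where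
  "F_family n q k \<L> =
     {\<lparr>verts = verts (F_graph n q), edges = edges (F_graph n q) \<union> edges X \<union> edges D\<rparr> | X D.
        isomorphic X (complete_bipartite k k) \<and>
        (\<exists>C\<in>turan2_classes (n - q + 1). verts X \<subseteq> Inr ` C) \<and>
        (\<exists>D'\<in>extremal_graphs (q - 1) \<L>. isomorphic D D') \<and>
        verts D \<subseteq> Inl ` {..<q - 1}}"

end

theory Submission
  imports Defs
begin

text \<open>
  A copy of \<open>Ht\<close> in a graph obtained from a large complete bipartite graph by few changes splits
  \<open>Ht\<close> into the part that uses the changes and a bipartite remainder. For the decomposition family
  \<open>\<M>\<close> this means that its members are, up to isomorphism, the minimal ones among the graphs \<open>Ht[A]\<close>,
  stripped of isolated vertices, where the complement of \<open>A\<close> is independent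
  (\<open>decomposition_of_partition\<close>, \<open>partition_of_decomposition\<close>). An independent covering of such a
  member is one class of a proper 3-colouring of \<open>Ht\<close>, so \<open>q\<close> is the least size of a colour class
  (\<open>optimal_classes\<close>), and \<open>k\<close> is a degree inside the union of two classes. Since an odd cycle needs a
  monochromatic edge in every 2-colouring, \<open>k\<close> bounds the number of cycles that become uncovered when
  one vertex is removed from the smallest class (\<open>uncovered_cycles\<close>).

  All copies of \<open>Ht\<close> are found in the same way. If \<open>W\<close> is joined to two mutually joined large pools, then
  every cycle meeting the part of \<open>Ht\<close> placed in \<open>W\<close> can be completed in the pools; each other cycle
  needs one further edge inside a pool's side, at which its alternating colouring breaks. With
  \<open>q - 1\<close> vertices in \<open>W\<close>, it suffices to find \<open>k\<close> such edges forming a star together with a matching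
  (\<open>embed_breaks\<close>, \<open>embed_star\<close>, \<open>embed_matching\<close>).

  For the lower bound, put an extremal \<open>\<B>\<close>-free graph on the \<open>q - 1\<close> vertices of the edgeless part of \<open>F(n, q)\<close>; a copy
  of \<open>Ht\<close> would yield a member of \<open>\<M>\<close> with a covering inside these vertices (\<open>lower_bound\<close>).

  For the upper bound, let \<open>G\<close> be extremal. It contains no balanced complete tripartite graph with \<open>|Ht|\<close>
  vertices in each class and has at least \<open>n^2/4 - O(1)\<close> edges; a dense core with large minimum degree is
  then nearly complete bipartite, and replacing vertices by twins extends the degree condition to all
  vertices (\<open>extremal_near_bipartition\<close>). After removing boundedly many vertices \<open>W\<close> both sides are
  independent (\<open>exceptional_set\<close>). Classify the remaining vertices by their neighbourhood in \<open>W\<close>. The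
  number of edges forces two common types, one on each side, with sizes adding up to at least
  \<open>|W| + q - 1\<close>, while their intersection has fewer than \<open>q\<close> vertices. Hence the intersection \<open>Q\<close> has
  exactly \<open>q - 1\<close> vertices and every other vertex of \<open>W\<close> can be assigned to one of the sides
  (\<open>full_vertices\<close>). Now all but boundedly many pairs between the parts \<open>Q\<close>, \<open>X1\<close>, \<open>X2\<close> are edges,
  so \<open>G[Q]\<close> is \<open>\<B>\<close>-free and the stars and matchings inside \<open>X1\<close> and \<open>X2\<close> are limited by
  \<open>k - 1\<close>. A weighted form of the argument that bounded degree and bounded matching number limit the number of
  edges shows that the edges inside the sides exceed the missing edges between them by at most
  \<open>(k - 1)^2\<close>, with equality only for a single complete bipartite graph with classes of size \<open>k - 1\<close> in one side
  (\<open>inside_excess\<close>). Adding the three contributions gives the bound and, in the case of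
  equality, the shape of \<open>G\<close> (\<open>upper_bound\<close>).
\<close>

section \<open>Neighbourhoods, edge counts and matchings\<close>

definition nbrs :: "'a graph \<Rightarrow> 'a \<Rightarrow> 'a set \<Rightarrow> 'a set" where
  "nbrs G x A = {y \<in> A. {x, y} \<in> edges G}"

definition edges_in :: "'a graph \<Rightarrow> 'a set \<Rightarrow> nat" where
  "edges_in G A = card {e \<in> edges G. e \<subseteq> A}"

definition edges_btw :: "'a graph \<Rightarrow> 'a set \<Rightarrow> 'a set \<Rightarrow> nat" where
  "edges_btw G A B = (\<Sum>x\<in>A. card (nbrs G x B))"

definition joined :: "'a graph \<Rightarrow> 'a set \<Rightarrow> 'a set \<Rightarrow> bool" where
  "joined G A B \<longleftrightarrow> (\<forall>x\<in>A. \<forall>y\<in>B. {x, y} \<in> edges G)"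

definition matching :: "'a graph \<Rightarrow> 'a set set \<Rightarrow> bool" where
  "matching G F \<longleftrightarrow> F \<subseteq> edges G \<and> (\<forall>e\<in>F. \<forall>e'\<in>F. e \<noteq> e' \<longrightarrow> e \<inter> e' = {})"

lemma edge_verts:
  assumes "simple_graph G" "{x, y} \<in> edges G"
  shows "x \<in> verts G" "y \<in> verts G" "x \<noteq> y"
  using assms by (auto simp: simple_graph_def card_insert_if split: if_splits)

lemma edge_ends:
  assumes "simple_graph G" "e \<in> edges G"
  shows "\<exists>x y. e = {x, y} \<and> x \<noteq> y \<and> x \<in> verts G \<and> y \<in> verts G"
proof -
  have "card e = 2" "e \<subseteq> verts G" using assms by (auto simp: simple_graph_def)
  moreover from \<open>card e = 2\<close> obtain x y where "e = {x, y}" "x \<noteq> y" by (auto simp: card_2_iff)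
  ultimately show ?thesis by (intro exI[of _ x] exI[of _ y]) simp
qed

lemma finite_edges:
  assumes "simple_graph G"
  shows "finite (edges G)"
proof -
  have "edges G \<subseteq> Pow (verts G)" using assms by (auto simp: simple_graph_def)
  then show ?thesis using assms by (meson finite_Pow_iff finite_subset simple_graph_def)
qed

lemma nbrs_sym: "y \<in> nbrs G x A \<Longrightarrow> x \<in> B \<Longrightarrow> x \<in> nbrs G y B"
  by (auto simp: nbrs_def insert_commute)

lemma nbrs_subset: "nbrs G x A \<subseteq> A"
  by (auto simp: nbrs_def)

lemma finite_nbrs [simp]: "finite A \<Longrightarrow> finite (nbrs G x A)"
  by (auto simp: nbrs_def)

lemma card_nbrs_le: "finite A \<Longrightarrow> card (nbrs G x A) \<le> card A"
  by (simp add: card_mono nbrs_subset)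

lemma nbrs_Un: "nbrs G x (A \<union> B) = nbrs G x A \<union> nbrs G x B"
  by (auto simp: nbrs_def)

lemma card_nbrs_Un:
  assumes "finite A" "finite B" "A \<inter> B = {}"
  shows "card (nbrs G x (A \<union> B)) = card (nbrs G x A) + card (nbrs G x B)"
  unfolding nbrs_Un using assms by (intro card_Un_disjoint) (auto simp: nbrs_def)

lemma card_nbrs_mono: "finite B \<Longrightarrow> A \<subseteq> B \<Longrightarrow> card (nbrs G x A) \<le> card (nbrs G x B)"
  by (intro card_mono) (auto simp: nbrs_def)

lemma not_self_nbr:
  assumes "simple_graph G" shows "x \<notin> nbrs G x A"
proof
  assume "x \<in> nbrs G x A"
  then have "{x, x} \<in> edges G" by (auto simp: nbrs_def)
  from edge_verts(3)[OF assms this] show False by simp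
qed

lemma edges_btw_swap:
  assumes "finite A" "finite B"
  shows "edges_btw G A B = edges_btw G B A"
proof -
  have *: "card (nbrs G x Y) = (\<Sum>y\<in>Y. if {x, y} \<in> edges G then 1 else 0)" if "finite Y" for x Y
    using that by (simp add: nbrs_def sum.If_cases Int_def)
  have "edges_btw G A B = (\<Sum>x\<in>A. \<Sum>y\<in>B. if {x, y} \<in> edges G then 1 else 0)"
    unfolding edges_btw_def using * assms by simp
  also have "\<dots> = (\<Sum>y\<in>B. \<Sum>x\<in>A. if {x, y} \<in> edges G then 1 else 0)"
    by (rule sum.swap)
  also have "\<dots> = edges_btw G B A"
    unfolding edges_btw_def using * assms by (simp add: insert_commute)
  finally show ?thesis .
qed

lemma edges_in_insert:
  assumes "simple_graph G" "finite A" "v \<notin> A"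
  shows "edges_in G (insert v A) = edges_in G A + card (nbrs G v A)"
proof -
  have eq: "{e \<in> edges G. e \<subseteq> insert v A} = {e \<in> edges G. e \<subseteq> A} \<union> (\<lambda>y. {v, y}) ` nbrs G v A"
    (is "?L = ?R")
  proof (intro subset_antisym subsetI)
    fix e assume e: "e \<in> ?L"
    then obtain x y where xy: "e = {x, y}" "x \<noteq> y" using edge_ends[OF assms(1), of e] by auto
    consider "e \<subseteq> A" | "x = v" "y \<in> A" | "y = v" "x \<in> A"
      using e xy assms(3) by auto
    then show "e \<in> ?R"
    proof cases
      case 1
      then show ?thesis using e by simp
    next
      case 2
      then show ?thesis using e xy by (auto simp: nbrs_def)
    next
      case 3
      then have "x \<in> nbrs G v A" "e = {v, x}" using e xy by (auto simp: nbrs_def insert_commute)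
      then show ?thesis by blast
    qed
  qed (auto simp: nbrs_def)
  have inj: "inj_on (\<lambda>y. {v, y}) (nbrs G v A)"
    by (auto simp: inj_on_def doubleton_eq_iff)
  have dis: "{e \<in> edges G. e \<subseteq> A} \<inter> (\<lambda>y. {v, y}) ` nbrs G v A = {}"
    using assms(3) by auto
  show ?thesis
    unfolding edges_in_def eq
    by (subst card_Un_disjoint) (use dis assms inj finite_edges[OF assms(1)] in \<open>auto simp: card_image\<close>)
qed

lemma edges_in_empty [simp]: "simple_graph G \<Longrightarrow> edges_in G {} = 0"
  by (auto simp: edges_in_def simple_graph_def)

lemma edges_in_Un:
  assumes "simple_graph G" "finite A" "finite B" "A \<inter> B = {}"
  shows "edges_in G (A \<union> B) = edges_in G A + edges_in G B + edges_btw G A B"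
  using assms(3,4)
proof (induction B rule: finite_induct)
  case empty
  then show ?case using assms by (simp add: edges_btw_def nbrs_def)
next
  case (insert v B)
  have "edges_in G (A \<union> insert v B) = edges_in G (insert v (A \<union> B))" by simp
  also have "\<dots> = edges_in G (A \<union> B) + card (nbrs G v (A \<union> B))"
    using insert assms by (intro edges_in_insert) auto
  also have "card (nbrs G v (A \<union> B)) = card (nbrs G v A) + card (nbrs G v B)"
    using insert assms by (intro card_nbrs_Un) auto
  finally show ?case
    using insert assms edges_in_insert[OF assms(1), of B v]
    by (simp add: edges_btw_swap[of A "insert v B"] edges_btw_swap[of A B])
      (simp add: edges_btw_def)
qed

lemma sum_degrees:
  assumes "simple_graph G" "finite A"
  shows "(\<Sum>v\<in>A. card (nbrs G v A)) = 2 * edges_in G A"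
  using assms(2)
proof (induction A rule: finite_induct)
  case empty
  then show ?case using assms by simp
next
  case (insert v A)
  have "(\<Sum>x\<in>A. card (nbrs G x (insert v A))) = (\<Sum>x\<in>A. card (nbrs G x {v}) + card (nbrs G x A))"
    using insert by (intro sum.cong refl) (subst card_nbrs_Un[symmetric], auto)
  also have "\<dots> = edges_btw G A {v} + 2 * edges_in G A"
    using insert by (simp add: sum.distrib edges_btw_def)
  also have "edges_btw G A {v} = card (nbrs G v A)"
    using insert by (subst edges_btw_swap) (auto simp: edges_btw_def)
  finally have 1: "(\<Sum>x\<in>A. card (nbrs G x (insert v A))) = card (nbrs G v A) + 2 * edges_in G A" .
  have "nbrs G v (insert v A) = nbrs G v A"
    using not_self_nbr[OF assms(1), of v "{v}"] by (auto simp: nbrs_def)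
  then show ?case using 1 insert edges_in_insert[OF assms(1), of A v] by simp
qed

lemma edges_in_verts:
  assumes "simple_graph G" shows "edges_in G (verts G) = card (edges G)"
proof -
  have "{e \<in> edges G. e \<subseteq> verts G} = edges G" using assms by (auto simp: simple_graph_def)
  then show ?thesis by (simp add: edges_in_def)
qed

lemma edges_in_le:
  assumes "simple_graph G" "finite A"
  shows "2 * edges_in G A \<le> card A * card A"
proof -
  have "(\<Sum>v\<in>A. card (nbrs G v A)) \<le> (\<Sum>v\<in>A. card A)"
    using assms by (intro sum_mono card_nbrs_le)
  then show ?thesis using sum_degrees[OF assms] by simp
qed

text \<open>
  An edge inside \<open>C\<close> is seen from both of its ends, every other edge inside \<open>U\<close> from exactly one.
\<close>

lemma edges_in_cover:
  assumes "simple_graph G" "finite U" "C \<subseteq> U"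
    and cover: "\<And>e. e \<in> edges G \<Longrightarrow> e \<subseteq> U \<Longrightarrow> e \<inter> C \<noteq> {}"
  shows "edges_in G U + edges_in G C = (\<Sum>v\<in>C. card (nbrs G v U))"
proof -
  have fC: "finite C" using assms finite_subset by blast
  have U: "U = C \<union> (U - C)" using assms by blast
  have e0: "edges_in G (U - C) = 0"
  proof -
    have "{e \<in> edges G. e \<subseteq> U - C} = {}" using cover by blast
    then show ?thesis unfolding edges_in_def by (metis card.empty)
  qed
  have 1: "edges_in G U = edges_in G C + edges_btw G C (U - C)"
    using edges_in_Un[OF assms(1), of C "U - C"] fC assms(2) e0 U[symmetric] by auto
  have "(\<Sum>v\<in>C. card (nbrs G v U)) = (\<Sum>v\<in>C. card (nbrs G v C) + card (nbrs G v (U - C)))"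
    using fC assms(2) U by (intro sum.cong refl) (subst card_nbrs_Un[symmetric], auto)
  also have "\<dots> = 2 * edges_in G C + edges_btw G C (U - C)"
    using sum_degrees[OF assms(1) fC] by (simp add: sum.distrib edges_btw_def)
  finally show ?thesis using 1 by simp
qed

lemma finite_matching: "simple_graph G \<Longrightarrow> matching G F \<Longrightarrow> finite F"
  unfolding matching_def using finite_edges finite_subset by blast

lemma matching_subset: "matching G F \<Longrightarrow> F' \<subseteq> F \<Longrightarrow> matching G F'"
  unfolding matching_def by blast

lemma card_Union_matching:
  assumes "simple_graph G" "matching G F"
  shows "card (\<Union>F) = 2 * card F" "finite (\<Union>F)"
proof -
  have c: "card e = 2" if "e \<in> F" for e
    using that assms by (auto simp: matching_def simple_graph_def)
  have fe: "finite e" if "e \<in> F" for e using c[OF that] card.infinite by fastforce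
  have "card (\<Union>F) = sum card F"
    using fe assms(2) by (intro card_Union_disjoint) (auto simp: matching_def pairwise_def disjnt_def)
  also have "\<dots> = 2 * card F" using c by simp
  finally show "card (\<Union>F) = 2 * card F" .
  show "finite (\<Union>F)" using fe finite_matching[OF assms] by auto
qed

text \<open>
  A matching of maximal size cannot be extended by an edge disjoint from it.
\<close>

lemma max_matching:
  assumes "simple_graph G"
  obtains F where "matching G F" "\<And>e. e \<in> F \<Longrightarrow> P e"
    "\<And>e. e \<in> edges G \<Longrightarrow> P e \<Longrightarrow> e \<inter> \<Union>F \<noteq> {}"
proof -
  define S where "S = {F. matching G F \<and> (\<forall>e\<in>F. P e)}"
  have fin: "finite S"
  proof (rule finite_subset)
    show "S \<subseteq> Pow (edges G)" by (auto simp: S_def matching_def)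
    show "finite (Pow (edges G))" using finite_edges[OF assms] by simp
  qed
  have "{} \<in> S" by (simp add: S_def matching_def)
  then have ne: "S \<noteq> {}" by auto
  obtain F where F: "F \<in> S" "\<And>F'. F' \<in> S \<Longrightarrow> card F' \<le> card F"
    using Max_in[of "card ` S"] Max_ge[of "card ` S"] fin ne by (metis (no_types, lifting) finite_imageI image_iff image_is_empty)
  have "e \<inter> \<Union>F \<noteq> {}" if e: "e \<in> edges G" "P e" for e
  proof
    assume dis: "e \<inter> \<Union>F = {}"
    have "card e = 2" using e assms by (auto simp: simple_graph_def)
    then have "e \<noteq> {}" by auto
    then have "e \<notin> F" using dis by blast
    moreover have "insert e F \<in> S" using F(1) e dis by (auto simp: S_def matching_def)
    moreover have "finite F" using F(1) finite_matching[OF assms] by (auto simp: S_def)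
    ultimately show False using F(2)[of "insert e F"] by simp
  qed
  then show ?thesis using that F(1) by (auto simp: S_def)
qed

lemma card_matching_le_edges_in:
  assumes "simple_graph G" "matching G F"
  shows "card F \<le> edges_in G (\<Union>F)"
  unfolding edges_in_def using assms by (intro card_mono) (auto simp: finite_edges matching_def)

section \<open>Embeddings that break the cycles of an odd-ballooning\<close>

text \<open>
  The general embedding scheme: a part \<open>D\<close> of \<open>L\<close> is placed by hand, the rest is properly 2-coloured by
  \<open>\<chi>\<close> and goes greedily into two pools that are joined to each other. Only the edges between \<open>D\<close> and
  the rest need attention; nothing is required of the colours inside \<open>D\<close>.
\<close>

lemma embed_extend:
  fixes L :: "'a graph" and G :: "'b graph" and N :: "bool \<Rightarrow> 'b set"
  assumes L: "simple_graph L" and D: "D \<subseteq> verts L" and inj: "inj_on f D"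
    and fD: "f ` D \<subseteq> verts G"
    and fE: "\<And>e. e \<in> edges L \<Longrightarrow> e \<subseteq> D \<Longrightarrow> f ` e \<in> edges G"
    and col: "\<And>x y. {x, y} \<in> edges L \<Longrightarrow> x \<notin> D \<Longrightarrow> y \<notin> D \<Longrightarrow> \<chi> x \<noteq> \<chi> y"
    and N: "\<And>i. finite (N i)" "\<And>i. N i \<subseteq> verts G" "\<And>i. card (verts L) \<le> card (N i)"
      "N True \<inter> N False = {}" "\<And>i. N i \<inter> f ` D = {}" "joined G (N True) (N False)"
    and pool: "\<And>d v. d \<in> D \<Longrightarrow> v \<notin> D \<Longrightarrow> {d, v} \<in> edges L \<Longrightarrow> joined G {f d} (N (\<chi> v))"
  shows "contains_copy G L"
proof -
  have fin: "finite (verts L)" using L by (simp add: simple_graph_def)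
  have "\<exists>g. g ` verts L \<subseteq> N i \<and> inj_on g (verts L)" for i
    using card_le_inj[OF fin N(1) N(3)] by blast
  then obtain g where g: "\<And>i. g i ` verts L \<subseteq> N i" "\<And>i. inj_on (g i) (verts L)" by metis
  define h where "h v = (if v \<in> D then f v else g (\<chi> v) v)" for v
  have hN: "h v \<in> N (\<chi> v)" if "v \<in> verts L" "v \<notin> D" for v
    using g(1)[of "\<chi> v"] that by (auto simp: h_def)
  have dis: "N i \<inter> N j = {}" if "i \<noteq> j" for i j
    using that N(4) by (cases i; cases j) auto
  have "inj_on h (verts L)"
  proof (rule inj_onI)
    fix x y assume xy: "x \<in> verts L" "y \<in> verts L" "h x = h y"
    consider "x \<in> D" "y \<in> D" | "x \<in> D" "y \<notin> D" | "x \<notin> D" "y \<in> D" | "x \<notin> D" "y \<notin> D" by blast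
    then show "x = y"
    proof cases
      case 1 then show ?thesis using xy inj by (auto simp: h_def inj_on_def)
    next
      case 2
      then have "f x \<in> N (\<chi> y)" using xy hN[of y] by (simp add: h_def)
      then show ?thesis using 2 N(5)[of "\<chi> y"] by blast
    next
      case 3
      then have "f y \<in> N (\<chi> x)" using xy hN[of x] by (simp add: h_def)
      then show ?thesis using 3 N(5)[of "\<chi> x"] by blast
    next
      case 4
      have "h x \<in> N (\<chi> x)" "h x \<in> N (\<chi> y)" using hN[of x] hN[of y] 4 xy by auto
      then have "\<chi> x = \<chi> y" using dis[of "\<chi> x" "\<chi> y"] by blast
      then show ?thesis using 4 xy g(2)[of "\<chi> x"] by (auto simp: h_def inj_on_def)
    qed
  qed
  moreover have "h ` verts L \<subseteq> verts G"
  proof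
    fix z assume "z \<in> h ` verts L"
    then obtain v where v: "v \<in> verts L" "z = h v" by auto
    show "z \<in> verts G"
    proof (cases "v \<in> D")
      case True then show ?thesis using v fD by (auto simp: h_def)
    next
      case False then show ?thesis using v hN N(2) by blast
    qed
  qed
  moreover have "h ` e \<in> edges G" if e: "e \<in> edges L" for e
  proof -
    obtain x y where xy: "e = {x, y}" "x \<in> verts L" "y \<in> verts L"
      using edge_ends[OF L e] by auto
    have mixed: "{h d, h v} \<in> edges G" if "{d, v} \<in> edges L" "d \<in> D" "v \<notin> D" "v \<in> verts L" for d v
      using pool[of d v] hN[of v] that by (auto simp: joined_def h_def)
    consider "x \<in> D" "y \<in> D" | "x \<in> D" "y \<notin> D" | "x \<notin> D" "y \<in> D" | "x \<notin> D" "y \<notin> D" by blast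
    then show ?thesis
    proof cases
      case 1 then show ?thesis using fE[OF e] xy by (auto simp: h_def)
    next
      case 2 then show ?thesis using mixed[of x y] e xy by auto
    next
      case 3 then show ?thesis using mixed[of y x] e xy by (auto simp: insert_commute)
    next
      case 4
      then have ne: "\<chi> x \<noteq> \<chi> y" using col e xy by auto
      have "h x \<in> N (\<chi> x)" "h y \<in> N (\<chi> y)" using hN 4 xy by auto
      then show ?thesis using N(6) ne xy(1)
        by (cases "\<chi> x"; cases "\<chi> y") (auto simp: joined_def insert_commute)
    qed
  qed
  ultimately show ?thesis unfolding contains_copy_def by blast
qed

lemma cycle_edges_rotate [simp]: "cycle_edges (rotate k l) = cycle_edges l"
proof -
  have *: "cycle_edges (rotate k l) \<subseteq> cycle_edges l" for k and l :: "'a list"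
  proof
    fix e assume "e \<in> cycle_edges (rotate k l)"
    then obtain i where i: "i < length l"
      "e = {rotate k l ! i, rotate k l ! (Suc i mod length l)}"
      by (auto simp: cycle_edges_def)
    let ?n = "length l"
    have "Suc i mod ?n < ?n" using i by (intro mod_less_divisor) auto
    then have e: "e = {l ! ((k + i) mod ?n), l ! ((k + Suc i mod ?n) mod ?n)}"
      using i by (simp add: nth_rotate)
    have "(k + Suc i mod ?n) mod ?n = Suc ((k + i) mod ?n) mod ?n"
      by (simp add: mod_simps)
    moreover have "(k + i) mod ?n < ?n" using i by (intro mod_less_divisor) auto
    ultimately show "e \<in> cycle_edges l" using e by (auto simp: cycle_edges_def)
  qed
  show ?thesis
  proof (cases "l = []")
    case False
    have "rotate (length l - k mod length l) (rotate k l) = l"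
    proof -
      have "(length l - k mod length l + k) mod length l = 0"
        using False by (metis length_greater_0_conv mod_add_right_eq mod_less_divisor
            less_imp_le_nat le_add_diff_inverse2 mod_self)
      then show ?thesis by (simp add: rotate_rotate rotate_id)
    qed
    then have "cycle_edges l \<subseteq> cycle_edges (rotate k l)"
      using *[of "length l - k mod length l" "rotate k l"] by simp
    then show ?thesis using *[of k l] by blast
  qed simp
qed

lemma cycle_edges_rev [simp]: "cycle_edges (rev l) = cycle_edges l"
proof -
  have *: "cycle_edges (rev l) \<subseteq> cycle_edges l" for l :: "'a list"
  proof
    fix e assume "e \<in> cycle_edges (rev l)"
    then obtain i where i: "i < length l"
      "e = {rev l ! i, rev l ! (Suc i mod length l)}"
      by (auto simp: cycle_edges_def)
    let ?n = "length l"
    show "e \<in> cycle_edges l"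
    proof (cases "Suc i < ?n")
      case True
      then have "e = {l ! (?n - Suc (Suc i)), l ! (Suc (?n - Suc (Suc i)) mod ?n)}"
        using i by (simp add: rev_nth insert_commute Suc_diff_Suc)
      moreover have "?n - Suc (Suc i) < ?n" using True by simp
      ultimately show ?thesis unfolding cycle_edges_def by blast
    next
      case False
      then have "Suc i = ?n" using i by simp
      then have "rev l ! i = l ! 0" "rev l ! 0 = l ! (?n - 1)" "Suc (?n - 1) mod ?n = 0"
        using i by (simp_all add: rev_nth flip: \<open>Suc i = ?n\<close>)
      then have "e = {l ! (?n - 1), l ! (Suc (?n - 1) mod ?n)}"
        using i \<open>Suc i = ?n\<close> by (simp add: insert_commute)
      moreover have "?n - 1 < ?n" using i by simp
      ultimately show ?thesis unfolding cycle_edges_def by blast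
    qed
  qed
  show ?thesis using *[of l] *[of "rev l"] by simp
qed

text \<open>
  Rotation, and reversal if necessary, lets the cycle start at the end \<open>u\<close> of the edge \<open>e\<close> and run through \<open>e\<close> first.
\<close>

lemma cycle_orient:
  assumes "distinct l" "e \<in> cycle_edges l" "u \<in> e" "length l \<ge> 3"
  shows "\<exists>l'. distinct l' \<and> set l' = set l \<and> length l' = length l \<and>
           cycle_edges l' = cycle_edges l \<and> l' ! 0 = u \<and> e = {l' ! 0, l' ! 1}"
proof -
  let ?n = "length l"
  obtain i where i: "i < ?n" "e = {l ! i, l ! (Suc i mod ?n)}"
    using assms(2) by (auto simp: cycle_edges_def)
  show ?thesis
  proof (cases "u = l ! i")
    case True
    have "rotate i l ! 0 = l ! i" "rotate i l ! 1 = l ! (Suc i mod ?n)"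
      using i assms(4) by (subst nth_rotate; force)+
    then show ?thesis using assms True i
      by (intro exI[of _ "rotate i l"]) simp
  next
    case False
    then have u: "u = l ! (Suc i mod ?n)" using i assms by auto
    define r where "r = rotate (Suc (Suc i)) l"
    have r: "length r = ?n" "distinct r" "set r = set l" "cycle_edges r = cycle_edges l"
      using assms(1) unfolding r_def by (simp_all del: rotate_Suc)
    have pos: "0 < ?n" "1 < ?n" "?n - 1 < ?n" "?n - 2 < ?n" using assms(4) by linarith+
    have "rev r ! 0 = r ! (?n - 1)" "rev r ! 1 = r ! (?n - 2)"
      using rev_nth[of 0 r] rev_nth[of 1 r] pos r(1) by (simp_all add: numeral_2_eq_2)
    moreover have "r ! (?n - 1) = l ! ((Suc (Suc i) + (?n - 1)) mod ?n)"
      "r ! (?n - 2) = l ! ((Suc (Suc i) + (?n - 2)) mod ?n)"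
      unfolding r_def using pos by (intro nth_rotate; simp)+
    moreover have "Suc (Suc i) + (?n - 1) = Suc i + ?n" "Suc (Suc i) + (?n - 2) = i + ?n"
      using assms(4) by auto
    moreover have "(Suc i + ?n) mod ?n = Suc i mod ?n" "(i + ?n) mod ?n = i"
      using i(1) mod_add_self2[of "Suc i" ?n] mod_add_self2[of i ?n] by simp_all
    ultimately have "rev r ! 0 = u" "rev r ! 1 = l ! i" using u by presburger+
    then show ?thesis using i u r
      by (intro exI[of _ "rev r"]) (simp add: insert_commute)
  qed
qed

text \<open>
  Membership in \<open>Z\<close> would alternate along the cycle, so the last vertex would agree with the first, its neighbour.
\<close>

lemma odd_cycle_monochromatic:
  assumes "odd (length l)"
  shows "\<exists>i<length l. (l ! i \<in> Z) = (l ! (Suc i mod length l) \<in> Z)"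
proof (rule ccontr)
  let ?n = "length l"
  assume "\<not> ?thesis"
  then have alt: "(l ! i \<in> Z) \<noteq> (l ! (Suc i mod ?n) \<in> Z)" if "i < ?n" for i
    using that by blast
  have "(l ! i \<in> Z) = ((l ! 0 \<in> Z) = even i)" if "i < ?n" for i
    using that
  proof (induction i)
    case (Suc i)
    then show ?case using alt[of i] by auto
  qed simp
  moreover have "?n - 1 < ?n" "even (?n - 1)" using assms by (auto elim!: oddE)
  ultimately have "(l ! (?n - 1) \<in> Z) = (l ! 0 \<in> Z)" by blast
  moreover have "Suc (?n - 1) mod ?n = 0" using assms by (auto elim!: oddE)
  ultimately show False using alt[of "?n - 1"] \<open>?n - 1 < ?n\<close> by simp
qed

text \<open>
  The length 5 is what later allows a cycle to have an edge both of whose ends are new vertices and one of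
  which is not adjacent to the replaced edge of \<open>H\<close>.
\<close>

locale ballooning =
  fixes H Ht :: "'a graph" and c :: "'a set \<Rightarrow> 'a list"
  assumes simple_H: "simple_graph H"
    and dist: "e \<in> edges H \<Longrightarrow> distinct (c e)"
    and odd_len: "e \<in> edges H \<Longrightarrow> odd (length (c e))"
    and len: "e \<in> edges H \<Longrightarrow> 5 \<le> length (c e)"
    and on_cycle: "e \<in> edges H \<Longrightarrow> e \<in> cycle_edges (c e)"
    and meet: "e \<in> edges H \<Longrightarrow> set (c e) \<inter> verts H = e"
    and sep: "e \<in> edges H \<Longrightarrow> e' \<in> edges H \<Longrightarrow> e \<noteq> e' \<Longrightarrow> set (c e) \<inter> set (c e') \<subseteq> verts H"
    and verts_Ht: "verts Ht = verts H \<union> (\<Union>e\<in>edges H. set (c e))"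
    and edges_Ht: "edges Ht = (\<Union>e\<in>edges H. cycle_edges (c e))"
begin

lemma simple_Ht: "simple_graph Ht"
proof -
  have fin: "finite (verts Ht)"
    using simple_H finite_edges[OF simple_H] by (auto simp: verts_Ht simple_graph_def)
  have "\<epsilon> \<subseteq> verts Ht \<and> card \<epsilon> = 2" if \<epsilon>: "\<epsilon> \<in> edges Ht" for \<epsilon>
  proof -
    obtain e where e: "e \<in> edges H" "\<epsilon> \<in> cycle_edges (c e)" using \<epsilon> by (auto simp: edges_Ht)
    let ?l = "c e" let ?n = "length (c e)"
    obtain i where i: "i < ?n" "\<epsilon> = {?l ! i, ?l ! (Suc i mod ?n)}"
      using e by (auto simp: cycle_edges_def)
    have n: "?n \<ge> 5" using len e by simp
    have j: "Suc i mod ?n < ?n" using i by (intro mod_less_divisor) auto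
    have "i \<noteq> Suc i mod ?n"
    proof (cases "Suc i = ?n")
      case True then show ?thesis using n by auto
    next
      case False then show ?thesis using i by auto
    qed
    then have "?l ! i \<noteq> ?l ! (Suc i mod ?n)"
      using dist[OF e(1)] i j by (simp add: nth_eq_iff_index_eq)
    moreover have "?l ! i \<in> verts Ht" "?l ! (Suc i mod ?n) \<in> verts Ht"
      using i j e nth_mem[of i ?l] nth_mem[of "Suc i mod ?n" ?l] by (auto simp: verts_Ht simp del: nth_mem)
    ultimately show ?thesis using i by auto
  qed
  then show ?thesis using fin by (auto simp: simple_graph_def)
qed

text \<open>
  The cycle replacing \<open>e\<close>, traversed from the end \<open>u\<close> of \<open>e\<close> with \<open>e\<close> as its first edge.
\<close>

definition cycle_from :: "'a set \<Rightarrow> 'a \<Rightarrow> 'a list" where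
  "cycle_from e u = (SOME l. distinct l \<and> set l = set (c e) \<and> length l = length (c e) \<and>
           cycle_edges l = cycle_edges (c e) \<and> l ! 0 = u \<and> e = {l ! 0, l ! 1})"

lemma cycle_from:
  assumes "e \<in> edges H" "u \<in> e"
  shows "distinct (cycle_from e u)" "set (cycle_from e u) = set (c e)" "length (cycle_from e u) = length (c e)"
    "cycle_edges (cycle_from e u) = cycle_edges (c e)" "cycle_from e u ! 0 = u" "e = {u, cycle_from e u ! 1}"
proof -
  have "length (c e) \<ge> 3" using len[OF assms(1)] by simp
  from someI_ex[OF cycle_orient[OF dist on_cycle assms(2) this, OF assms(1) assms(1)]]
  show "distinct (cycle_from e u)" "set (cycle_from e u) = set (c e)" "length (cycle_from e u) = length (c e)"
    "cycle_edges (cycle_from e u) = cycle_edges (c e)" "cycle_from e u ! 0 = u" "e = {u, cycle_from e u ! 1}"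
    unfolding cycle_from_def by auto
qed

lemma new_vertex_unique:
  assumes "e \<in> edges H" "e' \<in> edges H" "v \<in> set (c e)" "v \<in> set (c e')" "v \<notin> verts H"
  shows "e = e'"
  using sep[OF assms(1,2)] assms by blast

lemma cycle_from_new:
  assumes "e \<in> edges H" "u \<in> e" "2 \<le> j" "j < length (c e)"
  shows "cycle_from e u ! j \<notin> verts H" "cycle_from e u ! j \<in> set (c e)"
proof -
  note o = cycle_from[OF assms(1,2)]
  show in_set: "cycle_from e u ! j \<in> set (c e)" using o(2,3) assms(4) nth_mem by metis
  have l5: "5 \<le> length (c e)" using len assms(1) by simp
  have "cycle_from e u ! j \<noteq> cycle_from e u ! 0" "cycle_from e u ! j \<noteq> cycle_from e u ! 1"
    using o(1,3) assms(3,4) l5 by (subst nth_eq_iff_index_eq; auto)+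
  then have "cycle_from e u ! j \<notin> e" using o(5,6) by auto
  then show "cycle_from e u ! j \<notin> verts H" using meet[OF assms(1)] in_set by auto
qed

text \<open>
  Along the cycle of \<open>e\<close>, read from the end \<open>o' e\<close>, the colours alternate except at the edge from
  position \<open>p e\<close> to the next one. Being odd, the cycle closes up properly, and since \<open>p e\<close> is at least 1 the
  first edge, which is \<open>e\<close>, is properly coloured by \<open>side\<close>. So every cycle has
  exactly one monochromatic edge, and its position may be prescribed.
\<close>

lemma break_coloring:
  assumes side: "\<And>x y. {x, y} \<in> edges H \<Longrightarrow> side x \<noteq> side y"
    and o: "\<And>e. e \<in> edges H \<Longrightarrow> o' e \<in> e"
    and p: "\<And>e. e \<in> edges H \<Longrightarrow> 1 \<le> p e" "\<And>e. e \<in> edges H \<Longrightarrow> p e < length (c e)"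
  shows "\<exists>\<chi>. (\<forall>v\<in>verts H. \<chi> v = side v) \<and>
     (\<forall>e\<in>edges H. \<forall>j<length (c e).
        \<chi> (cycle_from e (o' e) ! j) = (side (o' e) \<noteq> (odd j \<noteq> (p e < j)))) \<and>
     (\<forall>e\<in>edges H. \<forall>j<length (c e). j \<noteq> p e \<longrightarrow>
        \<chi> (cycle_from e (o' e) ! j) \<noteq> \<chi> (cycle_from e (o' e) ! (Suc j mod length (c e))))"
proof -
  define ed where "ed v = (SOME e. e \<in> edges H \<and> v \<in> set (c e))" for v
  define ix where "ix v = (SOME j. j < length (c (ed v)) \<and> cycle_from (ed v) (o' (ed v)) ! j = v)" for v
  define \<chi> where "\<chi> v = (if v \<in> verts H then side v else
      (side (o' (ed v)) \<noteq> (odd (ix v) \<noteq> (p (ed v) < ix v))))" for v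
  have col: "\<chi> (cycle_from e (o' e) ! j) = (side (o' e) \<noteq> (odd j \<noteq> (p e < j)))"
    if e: "e \<in> edges H" and j: "j < length (c e)" for e j
  proof -
    note oe = cycle_from[OF e o[OF e]]
    have n: "5 \<le> length (c e)" using len e by simp
    consider "j = 0" | "j = 1" | "2 \<le> j" by linarith
    then show ?thesis
    proof cases
      case 1
      have "o' e \<in> verts H" using o[OF e] meet[OF e] by auto
      then show ?thesis using 1 oe(5) p(1)[OF e] by (simp add: \<chi>_def)
    next
      case 2
      have "cycle_from e (o' e) ! 1 \<in> verts H" using oe(6) meet[OF e] by auto
      moreover have "side (o' e) \<noteq> side (cycle_from e (o' e) ! 1)" using side oe(6) e by metis
      ultimately show ?thesis using 2 p(1)[OF e] by (auto simp: \<chi>_def)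
    next
      case 3
      let ?v = "cycle_from e (o' e) ! j"
      have new: "?v \<notin> verts H" "?v \<in> set (c e)" using cycle_from_new[OF e o[OF e] 3 j] by auto
      have "ed ?v \<in> edges H \<and> ?v \<in> set (c (ed ?v))"
        unfolding ed_def by (rule someI[of _ e]) (use e new in auto)
      then have ed: "ed ?v = e" using new_vertex_unique[of "ed ?v" e ?v] e new by auto
      have "ix ?v < length (c e) \<and> cycle_from e (o' e) ! ix ?v = ?v"
        using someI[of "\<lambda>i. i < length (c e) \<and> cycle_from e (o' e) ! i = ?v" j] j
        unfolding ix_def ed by auto
      then have "ix ?v = j" using oe(1,3) j nth_eq_iff_index_eq[of "cycle_from e (o' e)" "ix ?v" j] by simp
      then show ?thesis using new ed by (simp add: \<chi>_def)
    qed
  qed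
  have alt: "\<chi> (cycle_from e (o' e) ! j) \<noteq> \<chi> (cycle_from e (o' e) ! (Suc j mod length (c e)))"
    if e: "e \<in> edges H" and j: "j < length (c e)" "j \<noteq> p e" for e j
  proof (cases "Suc j = length (c e)")
    case True
    then have "even j" using odd_len[OF e] by (metis even_Suc)
    moreover have "Suc j mod length (c e) = 0" "0 < length (c e)" using True by auto
    moreover have "p e < j" using p(2)[OF e] j True by linarith
    ultimately show ?thesis using col[OF e j(1)] col[OF e, of 0] by simp
  next
    case False
    then have "Suc j mod length (c e) = Suc j" "Suc j < length (c e)" using j by auto
    then show ?thesis using col[OF e j(1)] col[OF e, of "Suc j"] j
      by (auto simp: less_Suc_eq)
  qed
  have "\<forall>v\<in>verts H. \<chi> v = side v" by (simp add: \<chi>_def)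
  then show ?thesis using col alt by blast
qed

text \<open>
  The embedding behind all copies of \<open>Ht\<close>. The set \<open>S\<close> goes into \<open>W\<close>, which is joined to both pools,
  so a cycle meeting \<open>S\<close> may break at a vertex of \<open>S\<close> and causes no further condition. The cycles in
  \<open>E'\<close> avoid \<open>S\<close> and need an edge of \<open>G\<close> for their break. If \<open>st e\<close> holds, it is an edge at the
  image \<open>a\<close> of the common vertex \<open>y\<close>: the cycle starts at \<open>y\<close> and breaks at its last edge, with
  \<open>lf e\<close> as the image of the vertex before \<open>y\<close>. Otherwise the break is the edge between positions 2
  and 3, which avoids \<open>H\<close> and goes to \<open>{b e, b' e}\<close>; the starting end of \<open>e\<close> is chosen such that both ends of
  the break have the colour \<open>cls e\<close>. In that case \<open>y\<close>, if present, is at position 0 or 1, and at position 1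
  exactly when \<open>cls e\<close> differs from its colour; only then is it adjacent to the break.
\<close>

lemma embed_breaks:
  fixes G :: "'b graph" and N :: "bool \<Rightarrow> 'b set" and st cls :: "'a set \<Rightarrow> bool" and S Y :: "'a set"
  defines "n \<equiv> \<lambda>e. length (c e)"
  defines "E' \<equiv> {e \<in> edges H. set (c e) \<inter> S = {}}"
  assumes G: "simple_graph G"
    and side: "\<And>x y. {x, y} \<in> edges H \<Longrightarrow> side x \<noteq> side y"
    and S: "S \<subseteq> verts Ht" and Y: "Y \<subseteq> {y}" "Y \<subseteq> verts H" "Y \<inter> S = {}"
    and ind: "independent Ht (S \<union> Y)"
    and yE: "\<And>e z. e \<in> E' \<Longrightarrow> z \<in> Y \<Longrightarrow> z \<in> e"
    and g: "inj_on g S" "g ` S \<subseteq> W" "W \<subseteq> verts G"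
    and a: "a \<in> verts G"
    and st: "\<And>e. e \<in> E' \<Longrightarrow> st e \<Longrightarrow> y \<in> Y \<and> {lf e, a} \<in> edges G"
    and inE: "\<And>e. e \<in> E' \<Longrightarrow> \<not> st e \<Longrightarrow> {b e, b' e} \<in> edges G"
    and ab: "\<And>e. e \<in> E' \<Longrightarrow> \<not> st e \<Longrightarrow> y \<in> Y \<Longrightarrow> cls e \<noteq> side y \<Longrightarrow> {a, b e} \<in> edges G"
    and inj: "inj_on lf {e \<in> E'. st e}" "inj_on b {e \<in> E'. \<not> st e}" "inj_on b' {e \<in> E'. \<not> st e}"
    and disj: "lf ` {e \<in> E'. st e} \<subseteq> A1" "b ` {e \<in> E'. \<not> st e} \<subseteq> A2" "b' ` {e \<in> E'. \<not> st e} \<subseteq> A3"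
      "A1 \<inter> A2 = {}" "A1 \<inter> A3 = {}" "A2 \<inter> A3 = {}"
      "W \<inter> A1 = {}" "W \<inter> A2 = {}" "W \<inter> A3 = {}" "a \<notin> A1" "a \<notin> A2" "a \<notin> A3" "a \<notin> W"
    and N: "\<And>i. finite (N i)" "\<And>i. N i \<subseteq> verts G" "\<And>i. card (verts Ht) \<le> card (N i)"
      "N True \<inter> N False = {}" "\<And>i. N i \<inter> ({a} \<union> W \<union> A1 \<union> A2 \<union> A3) = {}"
      "joined G (N True) (N False)"
    and WN: "\<And>i. joined G W (N i)"
    and aN: "y \<in> Y \<Longrightarrow> joined G {a} (N (\<not> side y))"
    and lN: "\<And>e. e \<in> E' \<Longrightarrow> st e \<Longrightarrow> joined G {lf e} (N (\<not> side y))"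
    and bN: "\<And>e. e \<in> E' \<Longrightarrow> \<not> st e \<Longrightarrow> joined G {b e, b' e} (N (\<not> cls e))"
  shows "contains_copy G Ht"
proof -
  have E'H: "e \<in> edges H" if "e \<in> E'" for e using that by (simp add: E'_def)
  define o' where "o' e = (if e \<in> E' then if st e then y else SOME u. u \<in> e \<and> side u = cls e
     else SOME u. u \<in> e)" for e
  have endpoint: "\<exists>u. u \<in> e \<and> side u = i" if e: "e \<in> edges H" for e i
  proof -
    obtain x x' where "e = {x, x'}" using edge_ends[OF simple_H e] by auto
    then show ?thesis using side[of x x'] e by (cases "side x = i") auto
  qed
  have o_cls: "o' e \<in> e \<and> side (o' e) = cls e" if "e \<in> E'" "\<not> st e" for e
    using someI_ex[OF endpoint[OF E'H[OF that(1)], of "cls e"]] that by (auto simp: o'_def)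
  have o_st: "o' e = y \<and> y \<in> e" if "e \<in> E'" "st e" for e
    using that st[OF that] yE[OF that(1)] by (auto simp: o'_def)
  have o: "o' e \<in> e" if e: "e \<in> edges H" for e
  proof (cases "e \<in> E'")
    case True then show ?thesis using o_st o_cls by (cases "st e") auto
  next
    case False
    then show ?thesis using someI_ex[of "\<lambda>u. u \<in> e"] endpoint[OF e] by (auto simp: o'_def)
  qed
  define l where "l e = cycle_from e (o' e)" for e
  have or: "distinct (l e)" "set (l e) = set (c e)" "length (l e) = n e"
    "cycle_edges (l e) = cycle_edges (c e)" "l e ! 0 = o' e" "e = {o' e, l e ! 1}"
    if "e \<in> edges H" "e \<in> edges H" for e
    using cycle_from[OF that(1) o[OF that(1)]] by (simp_all add: l_def n_def)
  have n5: "5 \<le> n e" if "e \<in> edges H" for e using len[OF that] by (simp add: n_def)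
  define hit where "hit e i \<longleftrightarrow> 1 \<le> i \<and> i < n e \<and> (l e ! i \<in> S \<or> l e ! (Suc i mod n e) \<in> S)" for e i
  \<comment> \<open>The break of a cycle meeting \<open>S\<close> is put at an edge with an end in \<open>S\<close>.\<close>
  define p where "p e = (if e \<in> E' then if st e then n e - 1 else 2 else SOME i. hit e i)" for e
  have hit: "hit e (p e)" if e: "e \<in> edges H" "e \<notin> E'" for e
  proof -
    obtain s where s: "s \<in> S" "s \<in> set (c e)" using e by (auto simp: E'_def)
    then have "s \<in> set (l e)" using or(2)[OF e(1) e(1)] by simp
    then obtain j where j: "j < n e" "l e ! j = s"
      using or(3)[OF e(1) e(1)] by (auto simp: in_set_conv_nth n_def)
    have "hit e (if j = 0 then n e - 1 else j)"
    proof (cases "j = 0")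
      case True
      have "Suc (n e - 1) mod n e = 0" using n5[OF e(1)] by simp
      then show ?thesis using True j s n5[OF e(1)] by (simp add: hit_def)
    qed (use j s in \<open>auto simp: hit_def\<close>)
    then show ?thesis using e someI[of "hit e"] by (simp add: p_def)
  qed
  have p: "1 \<le> p e \<and> p e < n e" if "e \<in> edges H" for e
    using hit[OF that] n5[OF that] by (cases "e \<in> E'") (auto simp: p_def hit_def)
  have p1: "1 \<le> p e" if "e \<in> edges H" for e using p[OF that] by simp
  have p2: "p e < length (c e)" if "e \<in> edges H" for e using p[OF that] by (simp add: n_def)
  obtain \<chi> where \<chi>0: "(\<forall>v\<in>verts H. \<chi> v = side v) \<and>
     (\<forall>e\<in>edges H. \<forall>j<length (c e).
        \<chi> (cycle_from e (o' e) ! j) = (side (o' e) \<noteq> (odd j \<noteq> (p e < j)))) \<and>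
     (\<forall>e\<in>edges H. \<forall>j<length (c e). j \<noteq> p e \<longrightarrow>
        \<chi> (cycle_from e (o' e) ! j) \<noteq> \<chi> (cycle_from e (o' e) ! (Suc j mod length (c e))))"
    using break_coloring[OF side o p1 p2] by (rule exE)
  have \<chi>: "\<And>v. v \<in> verts H \<Longrightarrow> \<chi> v = side v"
    "\<And>e j. e \<in> edges H \<Longrightarrow> j < n e \<Longrightarrow> \<chi> (l e ! j) = (side (o' e) \<noteq> (odd j \<noteq> (p e < j)))"
    "\<And>e j. e \<in> edges H \<Longrightarrow> j < n e \<Longrightarrow> j \<noteq> p e \<Longrightarrow> \<chi> (l e ! j) \<noteq> \<chi> (l e ! (Suc j mod n e))"
    using \<chi>0 unfolding l_def n_def by blast+
  define ed where "ed v = (SOME e. e \<in> edges H \<and> v \<in> set (c e))" for v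
  have new: "l e ! j \<notin> verts H \<and> l e ! j \<in> set (c e) \<and> ed (l e ! j) = e"
    if e: "e \<in> edges H" and j: "2 \<le> j" "j < n e" for e j
  proof -
    have 1: "l e ! j \<notin> verts H" "l e ! j \<in> set (c e)"
      using cycle_from_new[OF e o[OF e] j(1)] j(2) by (auto simp: l_def n_def)
    have "ed (l e ! j) \<in> edges H \<and> l e ! j \<in> set (c (ed (l e ! j)))"
      unfolding ed_def by (rule someI[of _ e]) (use e 1 in auto)
    then show ?thesis using new_vertex_unique[of "ed (l e ! j)" e "l e ! j"] e 1 by auto
  qed
  have nth_eq: "l e ! i = l e ! j \<longleftrightarrow> i = j" if "e \<in> edges H" "i < n e" "j < n e" for e i j
    using or(1,3)[OF that(1) that(1)] that by (simp add: nth_eq_iff_index_eq)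
  \<comment> \<open>The ends of the breaks other than \<open>y\<close>, which are placed by hand.\<close>
  define DL where "DL = (\<lambda>e. l e ! (n e - 1)) ` {e \<in> E'. st e}"
  define DB where "DB = (\<lambda>e. l e ! 2) ` {e \<in> E'. \<not> st e}"
  define DC where "DC = (\<lambda>e. l e ! 3) ` {e \<in> E'. \<not> st e}"
  define D where "D = S \<union> Y \<union> (DL \<union> (DB \<union> DC))"
  define f where "f v = (if v \<in> S then g v else if v \<in> Y then a else
     if st (ed v) then lf (ed v) else if v = l (ed v) ! 2 then b (ed v) else b' (ed v))" for v
  have notS: "l e ! j \<notin> S" if "e \<in> E'" "j < n e" for e j
    using that or(2,3)[OF E'H[OF that(1)] E'H[OF that(1)]] nth_mem[of j "l e"] by (auto simp: E'_def)
  have fS: "f v = g v" if "v \<in> S" for v using that by (simp add: f_def)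
  have fY: "f v = a" if "v \<in> Y" for v using that Y(3) by (auto simp: f_def)
  have newD: "l e ! j \<notin> S \<and> l e ! j \<notin> Y \<and> ed (l e ! j) = e" if "e \<in> E'" "2 \<le> j" "j < n e" for e j
    using new[OF E'H[OF that(1)] that(2,3)] notS[OF that(1,3)] Y(2) by auto
  have bnds: "2 \<le> n e - 1" "n e - 1 < n e" "2 < n e" "3 < n e" "2 \<le> (3::nat)" if "e \<in> E'" for e
    using n5[OF E'H[OF that]] by auto
  have fL: "f (l e ! (n e - 1)) = lf e" if "e \<in> E'" "st e" for e
    using newD[OF that(1) bnds(1,2)[OF that(1)]] that by (simp add: f_def)
  have fB: "f (l e ! 2) = b e" if "e \<in> E'" "\<not> st e" for e
    using newD[OF that(1) _ bnds(3)[OF that(1)]] that by (simp add: f_def)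
  have fC: "f (l e ! 3) = b' e" if "e \<in> E'" "\<not> st e" for e
    using newD[OF that(1) _ bnds(4)[OF that(1)]] that nth_eq[OF E'H[OF that(1)], of 3 2] bnds[OF that(1)]
    by (simp add: f_def)
  have injL: "inj_on f DL" unfolding DL_def
    using inj(1) fL by (auto simp: inj_on_def)
  have injB: "inj_on f DB" unfolding DB_def
    using inj(2) fB by (auto simp: inj_on_def)
  have injC: "inj_on f DC" unfolding DC_def
    using inj(3) fC by (auto simp: inj_on_def)
  have imgs: "f ` S \<subseteq> W" "f ` Y \<subseteq> {a}" "f ` DL \<subseteq> A1" "f ` DB \<subseteq> A2" "f ` DC \<subseteq> A3"
    using g(2) fS fY fL fB fC disj(1,2,3) by (auto simp: DL_def DB_def DC_def)
  have injD: "inj_on f D"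
  proof -
    have i1: "inj_on f S" using g(1) fS by (auto simp: inj_on_def)
    have i2: "inj_on f Y" using Y(1) by (auto simp: inj_on_def)
    have Un: "inj_on f (A \<union> B)" if "inj_on f A" "inj_on f B" "f ` A \<subseteq> X" "f ` B \<subseteq> Z" "X \<inter> Z = {}" for A B X Z
    proof -
      have "f ` (A - B) \<inter> f ` (B - A) = {}" using that(3-5) by auto
      then show ?thesis using that(1,2) by (simp add: inj_on_Un)
    qed
    have "inj_on f (DB \<union> DC)" by (rule Un[OF injB injC imgs(4,5) disj(6)])
    moreover have "f ` (DB \<union> DC) \<subseteq> A2 \<union> A3" using imgs(4,5) by blast
    moreover have "A1 \<inter> (A2 \<union> A3) = {}" using disj(4,5) by blast
    ultimately have u1: "inj_on f (DL \<union> (DB \<union> DC))"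
      using Un[OF injL _ imgs(3)] by blast
    have u2: "inj_on f (S \<union> Y)" by (rule Un[OF i1 i2 imgs(1,2)]) (use disj(13) in blast)
    have u3: "f ` (S \<union> Y) \<subseteq> W \<union> {a}" using imgs(1,2) by blast
    have u4: "f ` (DL \<union> (DB \<union> DC)) \<subseteq> A1 \<union> A2 \<union> A3" using imgs(3-5) by blast
    have "(W \<union> {a}) \<inter> (A1 \<union> A2 \<union> A3) = {}" using disj(7-12) by blast
    then show ?thesis unfolding D_def by (rule Un[OF u2 u1 u3 u4])
  qed
  have lv: "l e ! j \<in> verts Ht" if "e \<in> edges H" "j < n e" for e j
    using that or(2,3)[OF that(1) that(1)] nth_mem[of j "l e"] by (auto simp: verts_Ht)
  have DHt: "D \<subseteq> verts Ht"
  proof -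
    have "DL \<union> (DB \<union> DC) \<subseteq> verts Ht"
      unfolding DL_def DB_def DC_def using lv[OF E'H] bnds by blast
    moreover have "verts H \<subseteq> verts Ht" by (auto simp: verts_Ht)
    ultimately show ?thesis using S Y(2) unfolding D_def by blast
  qed
  have fV: "f ` D \<subseteq> verts G"
  proof -
    have "lf e \<in> verts G" if "e \<in> E'" "st e" for e using edge_verts[OF G] st[OF that] by blast
    moreover have "b e \<in> verts G" "b' e \<in> verts G" if "e \<in> E'" "\<not> st e" for e
      using edge_verts[OF G] inE[OF that] by blast+
    ultimately have "f ` DL \<subseteq> verts G" "f ` DB \<subseteq> verts G" "f ` DC \<subseteq> verts G"
      using fL fB fC by (auto simp: DL_def DB_def DC_def)
    then show ?thesis using imgs(1,2) g(3) a by (auto simp: D_def)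
  qed
  have yv: "v = y" if "v \<in> Y" for v using that Y(1) by auto
  \<comment> \<open>A cycle avoiding \<open>S\<close> meets the hand-placed set only at its break and at \<open>y\<close>.\<close>
  have inD: "l e ! j \<in> D \<longleftrightarrow> (if st e then j = 0 \<or> j = n e - 1 else j = 2 \<or> j = 3 \<or> l e ! j \<in> Y)"
    if e: "e \<in> E'" and j: "j < n e" for e j
  proof -
    have eH: "e \<in> edges H" by (rule E'H[OF e])
    have DLe: "l e ! j \<in> DL \<longleftrightarrow> st e \<and> j = n e - 1"
    proof
      assume "l e ! j \<in> DL"
      then obtain e' where e': "e' \<in> E'" "st e'" "l e ! j = l e' ! (n e' - 1)" by (auto simp: DL_def)
      have "l e ! j \<notin> verts H" "l e ! j \<in> set (c e')" using new[OF E'H bnds(1,2), of e'] e' by auto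
      moreover have "l e ! j \<in> set (c e)" using or(2,3)[OF eH eH] j nth_mem[of j "l e"] by auto
      ultimately have "e' = e" using new_vertex_unique[OF E'H[OF e'(1)] eH] by blast
      then show "st e \<and> j = n e - 1" using e' nth_eq[OF eH j bnds(2)[OF e]] by auto
    qed (use e in \<open>auto simp: DL_def\<close>)
    have DBe: "l e ! j \<in> DB \<longleftrightarrow> \<not> st e \<and> j = 2"
    proof
      assume "l e ! j \<in> DB"
      then obtain e' where e': "e' \<in> E'" "\<not> st e'" "l e ! j = l e' ! 2" by (auto simp: DB_def)
      have "l e ! j \<notin> verts H" "l e ! j \<in> set (c e')" using new[OF E'H _ bnds(3), of e'] e' by auto
      moreover have "l e ! j \<in> set (c e)" using or(2,3)[OF eH eH] j nth_mem[of j "l e"] by auto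
      ultimately have "e' = e" using new_vertex_unique[OF E'H[OF e'(1)] eH] by blast
      then show "\<not> st e \<and> j = 2" using e' nth_eq[OF eH j bnds(3)[OF e]] by auto
    qed (use e in \<open>auto simp: DB_def\<close>)
    have DCe: "l e ! j \<in> DC \<longleftrightarrow> \<not> st e \<and> j = 3"
    proof
      assume "l e ! j \<in> DC"
      then obtain e' where e': "e' \<in> E'" "\<not> st e'" "l e ! j = l e' ! 3" by (auto simp: DC_def)
      have "l e ! j \<notin> verts H" "l e ! j \<in> set (c e')" using new[OF E'H _ bnds(4), of e'] e' by auto
      moreover have "l e ! j \<in> set (c e)" using or(2,3)[OF eH eH] j nth_mem[of j "l e"] by auto
      ultimately have "e' = e" using new_vertex_unique[OF E'H[OF e'(1)] eH] by blast
      then show "\<not> st e \<and> j = 3" using e' nth_eq[OF eH j bnds(4)[OF e]] by auto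
    qed (use e in \<open>auto simp: DC_def\<close>)
    have "l e ! j \<in> Y \<longleftrightarrow> j = 0" if "st e"
    proof -
      have "l e ! 0 = y" using or(5)[OF eH eH] o_st[OF e that] by simp
      moreover have "y \<in> Y" using st[OF e that] by simp
      moreover have "0 < n e" using bnds[OF e] by linarith
      ultimately show ?thesis using nth_eq[OF eH j, of 0] yv[of "l e ! j"] by metis
    qed
    then show ?thesis using DLe DBe DCe notS[OF e j] by (auto simp: D_def)
  qed
  have Y01: "j \<le> 1" if "e \<in> edges H" "j < n e" "l e ! j \<in> Y" for e j
  proof (rule ccontr)
    assume "\<not> j \<le> 1"
    then have "l e ! j \<notin> verts H" using new[OF that(1) _ that(2)] by simp
    then show False using that(3) Y(2) by blast
  qed
  have DoutE': "l e ! j \<in> S \<union> Y" if e: "e \<in> edges H" "e \<notin> E'" and j: "j < n e" "l e ! j \<in> D" for e j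
  proof (rule ccontr)
    assume "\<not> ?thesis"
    then consider e' where "e' \<in> E'" "l e ! j = l e' ! (n e' - 1)"
      | e' where "e' \<in> E'" "l e ! j = l e' ! 2" | e' where "e' \<in> E'" "l e ! j = l e' ! 3"
      using j(2) unfolding D_def DL_def DB_def DC_def by blast
    then obtain e' i where e': "e' \<in> E'" "l e ! j = l e' ! i" "2 \<le> i" "i < n e'"
    proof cases
      case 1 then show ?thesis using bnds(1,2)[OF 1(1)] that by blast
    next
      case 2 then show ?thesis using bnds(3)[OF 2(1)] that by blast
    next
      case 3 then show ?thesis using bnds(4,5)[OF 3(1)] that by blast
    qed
    have "l e ! j \<in> set (c e)" using or(2,3)[OF e(1) e(1)] j nth_mem[of j "l e"] by auto
    moreover have "l e ! j \<notin> verts H" "l e ! j \<in> set (c e')" using new[OF E'H[OF e'(1)] e'(3,4)] e' by auto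
    ultimately have "e = e'" using new_vertex_unique[OF e(1) E'H[OF e'(1)]] by blast
    then show False using e e' by simp
  qed
  have edge: "\<exists>e\<in>edges H. \<exists>j<n e. \<epsilon> = {l e ! j, l e ! (Suc j mod n e)}" if \<epsilon>: "\<epsilon> \<in> edges Ht" for \<epsilon>
  proof -
    obtain e where e: "e \<in> edges H" "\<epsilon> \<in> cycle_edges (c e)" using \<epsilon> by (auto simp: edges_Ht)
    then have "\<epsilon> \<in> cycle_edges (l e)" using or(4)[OF e(1) e(1)] by simp
    then show ?thesis using e or(3)[OF e(1) e(1)] by (auto simp: cycle_edges_def)
  qed
  \<comment> \<open>The only monochromatic edges are the breaks; they lie in \<open>D\<close> or meet \<open>S\<close>.\<close>
  have mono: "\<epsilon> \<subseteq> D \<or> \<epsilon> \<inter> S \<noteq> {}" if \<epsilon>: "\<epsilon> \<in> edges Ht" "\<epsilon> = {x, x'}" "\<chi> x = \<chi> x'" for \<epsilon> x x'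
  proof -
    obtain e j where e: "e \<in> edges H" "j < n e" "\<epsilon> = {l e ! j, l e ! (Suc j mod n e)}"
      using edge[OF \<epsilon>(1)] by blast
    then have "\<chi> (l e ! j) = \<chi> (l e ! (Suc j mod n e))" using \<epsilon> by (auto simp: doubleton_eq_iff)
    then have j: "j = p e" using \<chi>(3)[OF e(1,2)] by blast
    show ?thesis
    proof (cases "e \<in> E'")
      case False
      then show ?thesis using hit[OF e(1)] e j by (auto simp: hit_def)
    next
      case True
      note bn = bnds[OF True]
      have "Suc (n e - 1) mod n e = 0" "0 < n e" "Suc 2 mod n e = 3" using n5[OF e(1)] by auto
      then show ?thesis using inD[OF True] e j True bn by (auto simp: p_def)
    qed
  qed
  have SD: "S \<subseteq> D" unfolding D_def by blast
  show ?thesis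
  proof (rule embed_extend[OF simple_Ht DHt injD fV, of \<chi> N])
    fix \<epsilon> assume \<epsilon>: "\<epsilon> \<in> edges Ht" "\<epsilon> \<subseteq> D"
    obtain e j where e: "e \<in> edges H" and j: "j < n e" and \<epsilon>e: "\<epsilon> = {l e ! j, l e ! (Suc j mod n e)}"
      using edge[OF \<epsilon>(1)] by blast
    have j': "Suc j mod n e < n e" using j by (intro mod_less_divisor) auto
    have n5e: "5 \<le> n e" by (rule n5[OF e])
    have jD: "l e ! j \<in> D" "l e ! (Suc j mod n e) \<in> D" using \<epsilon>(2) \<epsilon>e by auto
    have jc: "Suc j mod n e = (if j = n e - 1 then 0 else Suc j)" using j by auto
    show "f ` \<epsilon> \<in> edges G"
    proof (cases "e \<in> E'")
      case False
      then have "\<epsilon> \<subseteq> S \<union> Y" using DoutE'[OF e False j] DoutE'[OF e False j'] jD \<epsilon>e by auto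
      then show ?thesis using ind \<epsilon>(1) by (auto simp: independent_def)
    next
      case True
      show ?thesis
      proof (cases "st e")
        case st': True
        then have "j = n e - 1" using inD[OF True j] inD[OF True j'] jD jc n5e by (auto split: if_splits)
        moreover have "l e ! 0 = y" using or(5)[OF e e] o_st[OF True st'] by simp
        ultimately show ?thesis
          using \<epsilon>e jc fL[OF True st'] fY[of y] st[OF True st'] by simp
      next
        case nst: False
        have A: "j = 2 \<or> j = 3 \<or> l e ! j \<in> Y"
          using inD[OF True j] jD(1) nst by simp
        have B: "Suc j mod n e = 2 \<or> Suc j mod n e = 3 \<or> l e ! (Suc j mod n e) \<in> Y"
          using inD[OF True j'] jD(2) nst by simp
        have not_both: "\<not> (l e ! 0 \<in> Y \<and> l e ! 1 \<in> Y)"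
          using yv[of "l e ! 0"] yv[of "l e ! 1"] nth_eq[OF e, of 0 1] n5e by force
        have jn: "j \<noteq> n e - 1"
        proof
          assume "j = n e - 1"
          then have "4 \<le> j" using n5e by linarith
          then show False using A Y01[OF e j] by auto
        qed
        then have jS: "Suc j mod n e = Suc j" using jc by simp
        have B': "Suc j = 2 \<or> Suc j = 3 \<or> l e ! Suc j \<in> Y" "l e ! Suc j \<in> Y \<Longrightarrow> j = 0"
          using B Y01[OF e j'] jS by auto
        have "j = 2 \<or> j = 1 \<and> l e ! 1 \<in> Y"
        proof -
          have "j \<noteq> 3" using B' by auto
          moreover have "j \<noteq> 0"
          proof
            assume "j = 0"
            then have "l e ! 0 \<in> Y" "l e ! 1 \<in> Y" using A B'(1) by auto
            then show False using not_both by simp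
          qed
          ultimately show ?thesis using A Y01[OF e j] by (cases "j = 1") auto
        qed
        then consider "j = 2" | "j = 1" "l e ! 1 \<in> Y" by blast
        then show ?thesis
        proof cases
          case 1
          then have "\<epsilon> = {l e ! 2, l e ! 3}" using \<epsilon>e jc n5e by (simp add: numeral_3_eq_3 numeral_2_eq_2)
          then show ?thesis using fB[OF True nst] fC[OF True nst] inE[OF True nst] by simp
        next
          case 2
          then have \<epsilon>2: "\<epsilon> = {l e ! 1, l e ! 2}" using \<epsilon>e jc n5e by (simp add: numeral_2_eq_2)
          have y1: "l e ! 1 = y" "y \<in> Y" using 2(2) yv[OF 2(2)] by simp_all
          have "e = {o' e, y}" using or(6)[OF e e] y1 by simp
          then have "side (o' e) \<noteq> side y" using side e by metis
          then have "cls e \<noteq> side y" using o_cls[OF True nst] by simp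
          then have "{a, b e} \<in> edges G" using ab[OF True nst] y1 by simp
          then show ?thesis using \<epsilon>2 y1 fY fB[OF True nst] by simp
        qed
      qed
    qed
  next
    fix x x' assume x: "{x, x'} \<in> edges Ht" "x \<notin> D" "x' \<notin> D"
    then have "\<not> {x, x'} \<subseteq> D" "{x, x'} \<inter> S = {}" using SD by blast+
    then show "\<chi> x \<noteq> \<chi> x'" using mono[OF x(1) refl] by blast
  next
    fix i show "N i \<inter> f ` D = {}"
    proof -
      define X where "X = f ` D"
      have "X \<subseteq> W \<union> {a} \<union> (A1 \<union> (A2 \<union> A3))"
        unfolding X_def D_def image_Un
        by (rule Un_mono[OF Un_mono[OF imgs(1,2)] Un_mono[OF imgs(3) Un_mono[OF imgs(4,5)]]])
      then have "N i \<inter> X = {}" using N(5)[of i] by blast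
      then show ?thesis unfolding X_def .
    qed
  next
    fix d v assume d: "d \<in> D" "v \<notin> D" "{d, v} \<in> edges Ht"
    show "joined G {f d} (N (\<chi> v))"
    proof (cases "d \<in> S")
      case True
      then show ?thesis using WN[of "\<chi> v"] imgs(1) by (auto simp: joined_def)
    next
      case False
      have "\<not> {d, v} \<subseteq> D" "{d, v} \<inter> S = {}" using SD d(2) False by blast+
      then have "\<chi> d \<noteq> \<chi> v" using mono[OF d(3) refl] by blast
      then have cv: "\<chi> v = (\<not> \<chi> d)" by simp
      consider "d \<in> Y" | e where "e \<in> E'" "st e" "d = l e ! (n e - 1)"
        | e where "e \<in> E'" "\<not> st e" "d = l e ! 2" | e where "e \<in> E'" "\<not> st e" "d = l e ! 3"
        using d(1) False unfolding D_def DL_def DB_def DC_def by blast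
      then show ?thesis
      proof cases
        case 1
        then have "d = y" "f d = a" "\<chi> d = side y" using yv[OF 1] fY[OF 1] \<chi>(1)[of d] Y(2) by auto
        then show ?thesis using cv aN 1 by simp
      next
        case 2
        have "even (n e - 1)" using odd_len[OF E'H[OF 2(1)]] by (simp add: n_def)
        then have "\<chi> d = side y"
          using \<chi>(2)[OF E'H[OF 2(1)] bnds(2)[OF 2(1)]] 2 o_st[OF 2(1,2)] by (simp add: p_def)
        then show ?thesis using cv 2 fL[OF 2(1,2)] lN[OF 2(1,2)] by simp
      next
        case 3
        have "\<chi> d = cls e"
          using \<chi>(2)[OF E'H[OF 3(1)] bnds(3)[OF 3(1)]] 3 o_cls[OF 3(1,2)] by (simp add: p_def)
        then show ?thesis using cv 3 fB[OF 3(1,2)] bN[OF 3(1,2)] by (auto simp: joined_def)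
      next
        case 4
        have "\<chi> d = cls e"
          using \<chi>(2)[OF E'H[OF 4(1)] bnds(4)[OF 4(1)]] 4 o_cls[OF 4(1,2)] by (simp add: p_def)
        then show ?thesis using cv 4 fC[OF 4(1,2)] bN[OF 4(1,2)] by (auto simp: joined_def)
      qed
    qed
  qed (use N in auto)
qed

end

section \<open>The decomposition family and three-colourings\<close>

text \<open>
  The independent complement of \<open>A\<close> goes to the joined copy of \<open>I\<close>, the vertices isolated in \<open>L[A]\<close> to the
  other copy.
\<close>

lemma decomposing_if_partition:
  fixes L :: "'a graph" and M :: "nat graph"
  assumes L: "simple_graph L" and A: "A \<subseteq> verts L" "independent L (verts L - A)"
    and inj: "inj_on \<pi> (\<Union>{e \<in> edges L. e \<subseteq> A})"
    and im: "\<pi> ` (\<Union>{e \<in> edges L. e \<subseteq> A}) \<subseteq> verts M"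
    and E: "\<And>e. e \<in> edges L \<Longrightarrow> e \<subseteq> A \<Longrightarrow> \<pi> ` e \<in> edges M"
  shows "decomposing L M"
proof -
  define A1 where "A1 = \<Union>{e \<in> edges L. e \<subseteq> A}"
  have fin: "finite (verts L)" using L by (simp add: simple_graph_def)
  obtain j where j: "bij_betw j (verts L) {0..<card (verts L)}"
    using ex_bij_betw_finite_nat[OF fin] by blast
  define m where "m = card (verts L)"
  have jm: "j v < m" if "v \<in> verts L" for v
    using j that by (auto simp: bij_betw_def m_def)
  have jinj: "j u = j v \<Longrightarrow> u = v" if "u \<in> verts L" "v \<in> verts L" for u v
    using j that by (auto simp: bij_betw_def inj_on_def)
  define f :: "'a \<Rightarrow> (nat + nat) + nat"
    where "f v = (if v \<in> A1 then Inl (Inl (\<pi> v)) else if v \<in> A then Inl (Inr (j v)) else Inr (j v))" for v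
  have A1A: "A1 \<subseteq> A" by (auto simp: A1_def)
  let ?J = "join (disjoint_union M (empty_graph m)) (empty_graph m)"
  have 1: "inj_on f (verts L)"
    using inj jinj by (auto simp: inj_on_def f_def A1_def[symmetric] split: if_splits)
  have 2: "f ` verts L \<subseteq> verts ?J"
    using im jm by (auto simp: f_def join_def disjoint_union_def empty_graph_def A1_def[symmetric])
  have 3: "f ` e \<in> edges ?J" if e: "e \<in> edges L" for e
  proof (cases "e \<subseteq> A")
    case True
    then have "e \<subseteq> A1" using e by (auto simp: A1_def)
    then have "f ` e = Inl ` Inl ` \<pi> ` e" by (auto simp: f_def image_image)
    then show ?thesis using E[OF e True] by (auto simp: join_def disjoint_union_def)
  next
    case False
    obtain x y where xy: "e = {x, y}" "x \<in> verts L" "y \<in> verts L" using edge_ends[OF L e] by auto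
    have "\<not> e \<subseteq> verts L - A" using A(2) e by (auto simp: independent_def)
    then consider "x \<in> A" "y \<notin> A" | "x \<notin> A" "y \<in> A" using False xy by auto
    then obtain u v where uv: "e = {u, v}" "u \<in> A" "v \<notin> A" "u \<in> verts L" "v \<in> verts L"
      using xy by cases (auto simp: insert_commute)
    have "v \<notin> A1" using uv A1A by auto
    then have fv: "f v = Inr (j v)" using uv by (simp add: f_def)
    have "\<exists>w. f u = Inl w \<and> w \<in> verts (disjoint_union M (empty_graph m))"
      using uv im jm[of u] by (cases "u \<in> A1")
        (auto simp: f_def disjoint_union_def empty_graph_def A1_def[symmetric])
    then obtain w where w: "f u = Inl w" "w \<in> verts (disjoint_union M (empty_graph m))" by auto
    have "f ` e = {Inl w, Inr (j v)}" using uv w fv by simp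
    moreover have "j v \<in> verts (empty_graph m)" using jm[of v] uv by (simp add: empty_graph_def)
    ultimately show ?thesis using w(2) by (auto simp: join_def)
  qed
  show ?thesis unfolding decomposing_def contains_copy_def using 1 2 3 by blast
qed

lemma minimal_decomposing:
  assumes M0: "simple_graph M0" "decomposing L M0"
  shows "\<exists>M. subgraph M M0 \<and> M \<in> decomposition_family L"
proof -
  let ?P = "\<lambda>M. simple_graph M \<and> subgraph M M0 \<and> decomposing L M"
  let ?m = "\<lambda>M. card (verts M) + card (edges M)"
  have "?P M0" using M0 by (simp add: subgraph_def)
  from ex_has_least_nat[of ?P, OF this, of ?m]
  obtain M where M: "?P M" "\<And>M'. ?P M' \<Longrightarrow> ?m M \<le> ?m M'" by blast
  have "M' = M" if M': "simple_graph M'" "subgraph M' M" "decomposing L M'" for M'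
  proof -
    have "subgraph M' M0" using M(1) M'(2) by (auto simp: subgraph_def)
    then have le: "?m M \<le> ?m M'" using M(2) M' by blast
    have fin: "finite (verts M)" "finite (edges M)"
      using M(1) finite_edges by (auto simp: simple_graph_def)
    have sub: "verts M' \<subseteq> verts M" "edges M' \<subseteq> edges M" using M'(2) by (auto simp: subgraph_def)
    have "card (verts M') \<le> card (verts M)" "card (edges M') \<le> card (edges M)"
      using sub fin by (auto intro: card_mono)
    then have "card (verts M') = card (verts M)" "card (edges M') = card (edges M)" using le by auto
    then have "verts M' = verts M" "edges M' = edges M"
      using sub fin card_subset_eq by metis+
    then show ?thesis by simp
  qed
  then have "M \<in> decomposition_family L" using M(1) by (auto simp: decomposition_family_def)
  then show ?thesis using M(1) by blast
qed

text \<open>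
  Every choice of \<open>A\<close> with independent complement contains a member of the family, by minimality.
\<close>

lemma decomposition_of_partition:
  assumes L: "simple_graph L" and A: "A \<subseteq> verts L" "independent L (verts L - A)"
  shows "\<exists>M \<phi>. M \<in> decomposition_family L \<and> inj_on \<phi> (verts M) \<and> \<phi> ` verts M \<subseteq> A \<and>
    (\<forall>e\<in>edges M. \<phi> ` e \<in> edges L)"
proof -
  have fin: "finite A" using A(1) L finite_subset by (auto simp: simple_graph_def)
  obtain h where h: "bij_betw h A {0..<card A}"
    using ex_bij_betw_finite_nat[OF fin] by blast
  then have hi: "inj_on h A" by (simp add: bij_betw_def)
  define M0 where "M0 = \<lparr>verts = h ` A, edges = (\<lambda>e. h ` e) ` {e \<in> edges L. e \<subseteq> A}\<rparr>"
  have "card (h ` e) = 2" if "e \<in> edges L" "e \<subseteq> A" for e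
  proof -
    have "card (h ` e) = card e" using hi that(2) by (intro card_image) (meson inj_on_subset)
    then show ?thesis using that(1) L by (simp add: simple_graph_def)
  qed
  then have s: "simple_graph M0" using fin by (auto simp: M0_def simple_graph_def)
  have "decomposing L M0"
  proof (rule decomposing_if_partition[OF L A, of h])
    show "inj_on h (\<Union>{e \<in> edges L. e \<subseteq> A})" by (rule inj_on_subset[OF hi]) auto
  qed (auto simp: M0_def)
  from minimal_decomposing[OF s this] obtain M where M: "subgraph M M0" "M \<in> decomposition_family L"
    by blast
  define \<phi> where "\<phi> = inv_into A h"
  have \<phi>h: "\<phi> (h x) = x" if "x \<in> A" for x using that hi by (simp add: \<phi>_def)
  have vM: "verts M \<subseteq> h ` A" "edges M \<subseteq> (\<lambda>e. h ` e) ` {e \<in> edges L. e \<subseteq> A}"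
    using M(1) by (auto simp: subgraph_def M0_def)
  have "inj_on \<phi> (verts M)" unfolding \<phi>_def by (rule inj_on_inv_into) (use vM in auto)
  moreover have "\<phi> ` verts M \<subseteq> A" using vM(1) \<phi>h by auto
  moreover have "\<phi> ` e \<in> edges L" if e: "e \<in> edges M" for e
  proof -
    obtain e0 where e0: "e0 \<in> edges L" "e0 \<subseteq> A" "e = h ` e0" using vM(2) e by auto
    have "\<phi> ` e = (\<lambda>x. \<phi> (h x)) ` e0" using e0 by (simp add: image_image)
    also have "\<dots> = e0" using \<phi>h e0(2) by (metis (mono_tags, lifting) image_cong image_ident subsetD)
    finally show ?thesis using e0 by simp
  qed
  ultimately show ?thesis using M(2) by blast
qed

text \<open>
  Conversely, let \<open>A\<close> be the set of vertices placed outside the joined copy of \<open>I\<close>. The edges of \<open>L[A]\<close> lie in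
  \<open>M\<close> and form a subgraph that is itself decomposing, hence all of \<open>M\<close>.
\<close>

lemma partition_of_decomposition:
  fixes L :: "'a graph"
  assumes L: "simple_graph L" and M: "M \<in> decomposition_family L"
  shows "\<exists>A \<pi>. A \<subseteq> verts L \<and> independent L (verts L - A) \<and>
    bij_betw \<pi> (\<Union>{e \<in> edges L. e \<subseteq> A}) (verts M) \<and>
    edges M = (\<lambda>e. \<pi> ` e) ` {e \<in> edges L. e \<subseteq> A}"
proof -
  from M obtain m f where f: "inj_on f (verts L)"
    "f ` verts L \<subseteq> verts (join (disjoint_union M (empty_graph m)) (empty_graph m))"
    "\<And>e. e \<in> edges L \<Longrightarrow> f ` e \<in> edges (join (disjoint_union M (empty_graph m)) (empty_graph m))"
    by (auto simp: decomposition_family_def decomposing_def contains_copy_def)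
  define A where "A = {v \<in> verts L. \<exists>x. f v = Inl x}"
  define \<pi> where "\<pi> v = projl (projl (f v))" for v
  define A1 where "A1 = \<Union>{e \<in> edges L. e \<subseteq> A}"
  have AL: "A \<subseteq> verts L" by (auto simp: A_def)
  have edgeA: "\<exists>e'\<in>edges M. f ` e = Inl ` Inl ` e'" if e: "e \<in> edges L" "e \<subseteq> A" for e
  proof -
    have noInr: "Inr y \<notin> f ` e" for y
    proof
      assume "Inr y \<in> f ` e"
      then obtain v where "v \<in> e" "f v = Inr y" by auto
      moreover then obtain x where "f v = Inl x" using e by (auto simp: A_def)
      ultimately show False by simp
    qed
    have "f ` e \<in> (\<lambda>e. Inl ` e) ` edges (disjoint_union M (empty_graph m))"
    proof -
      have "f ` e \<noteq> {Inl u, Inr v}" for u v using noInr[of v] by blast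
      then show ?thesis
        using f(3)[OF e(1)] unfolding join_def disjoint_union_def[of "disjoint_union M (empty_graph m)"]
        by (auto simp: empty_graph_def)
    qed
    then show ?thesis by (auto simp: disjoint_union_def empty_graph_def)
  qed
  have f\<pi>: "f v = Inl (Inl (\<pi> v))" if v: "v \<in> A1" for v
  proof -
    obtain e where e: "e \<in> edges L" "e \<subseteq> A" "v \<in> e" using v by (auto simp: A1_def)
    obtain e' where "f ` e = Inl ` Inl ` e'" using edgeA[OF e(1,2)] by blast
    then have "f v \<in> Inl ` Inl ` e'" using e(3) by blast
    then show ?thesis by (auto simp: \<pi>_def)
  qed
  have edge\<pi>: "\<pi> ` e \<in> edges M" if e: "e \<in> edges L" "e \<subseteq> A" for e
  proof -
    obtain e' where e': "e' \<in> edges M" "f ` e = Inl ` Inl ` e'" using edgeA[OF e] by blast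
    have "\<pi> ` e = projl ` projl ` f ` e" by (simp add: \<pi>_def image_image)
    also have "\<dots> = e'" using e'(2) by (simp add: image_image)
    finally show ?thesis using e'(1) by simp
  qed
  have A1L: "A1 \<subseteq> verts L" using AL by (auto simp: A1_def)
  have inj: "inj_on \<pi> A1"
  proof (rule inj_onI)
    fix x y assume "x \<in> A1" "y \<in> A1" "\<pi> x = \<pi> y"
    then have "f x = f y" using f\<pi> by simp
    then show "x = y" using f(1) \<open>x \<in> A1\<close> \<open>y \<in> A1\<close> A1L by (auto simp: inj_on_def)
  qed
  have ind: "independent L (verts L - A)"
    unfolding independent_def
  proof (intro conjI ballI)
    fix e assume e: "e \<in> edges L"
    show "\<not> e \<subseteq> verts L - A"
    proof
      assume sub: "e \<subseteq> verts L - A"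
      have allInr: "\<exists>y. z = Inr y" if "z \<in> f ` e" for z
      proof -
        obtain v where v: "v \<in> verts L" "v \<notin> A" "z = f v" using \<open>z \<in> f ` e\<close> sub by blast
        then have "z \<noteq> Inl x" for x by (auto simp: A_def)
        then show ?thesis by (cases z) blast+
      qed
      have "f ` e \<noteq> {}" using edge_ends[OF L e] by auto
      have "f ` e \<in> edges (disjoint_union (disjoint_union M (empty_graph m)) (empty_graph m))
         \<or> (\<exists>u v. f ` e = {Inl u, Inr v})"
        using f(3)[OF e] unfolding join_def by auto
      then show False
      proof
        assume "f ` e \<in> edges (disjoint_union (disjoint_union M (empty_graph m)) (empty_graph m))"
        then have "f ` e \<in> (\<lambda>e. Inl ` e) ` edges (disjoint_union M (empty_graph m))"
          by (simp add: disjoint_union_def[of "disjoint_union M (empty_graph m)"])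
            (simp add: empty_graph_def)
        then obtain e' where e': "f ` e = Inl ` e'" by blast
        then obtain z where "z \<in> e'" using \<open>f ` e \<noteq> {}\<close> by auto
        then have "Inl z \<in> f ` e" using e' by auto
        then show False using allInr by blast
      next
        assume "\<exists>u v. f ` e = {Inl u, Inr v}"
        then obtain u where "Inl u \<in> f ` e" by auto
        then show False using allInr by blast
      qed
    qed
  qed auto
  define M' where "M' = \<lparr>verts = \<pi> ` A1, edges = (\<lambda>e. \<pi> ` e) ` {e \<in> edges L. e \<subseteq> A}\<rparr>"
  have sM: "simple_graph M" using M by (simp add: decomposition_family_def)
  have sub: "subgraph M' M"
  proof -
    have "\<pi> ` A1 \<subseteq> verts M"
    proof
      fix z assume "z \<in> \<pi> ` A1"
      then obtain e v where "e \<in> edges L" "e \<subseteq> A" "v \<in> e" "z = \<pi> v" by (auto simp: A1_def)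
      then have "z \<in> \<pi> ` e" "\<pi> ` e \<in> edges M" using edge\<pi> by auto
      moreover from this have "\<pi> ` e \<subseteq> verts M" using sM unfolding simple_graph_def by blast
      ultimately show "z \<in> verts M" by blast
    qed
    then show ?thesis using edge\<pi> by (auto simp: subgraph_def M'_def)
  qed
  have "simple_graph M'"
  proof -
    have "finite A1" using A1L L finite_subset by (auto simp: simple_graph_def)
    moreover have "edges M' \<subseteq> edges M" using sub by (simp add: subgraph_def)
    moreover have "\<pi> ` e \<subseteq> \<pi> ` A1" if "e \<in> edges L" "e \<subseteq> A" for e
      using that by (auto simp: A1_def)
    ultimately show ?thesis using sM by (auto simp: simple_graph_def M'_def)
  qed
  moreover have "decomposing L M'"
    by (rule decomposing_if_partition[OF L AL ind, of \<pi>]) (use inj in \<open>auto simp: M'_def A1_def\<close>)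
  ultimately have "M' = M" using sub M by (auto simp: decomposition_family_def)
  then have "verts M = \<pi> ` A1" "edges M = (\<lambda>e. \<pi> ` e) ` {e \<in> edges L. e \<subseteq> A}"
    by (auto simp: M'_def)
  then show ?thesis using AL ind inj unfolding A1_def[symmetric]
    by (intro exI[of _ A] exI[of _ \<pi>]) (auto simp: bij_betw_def A1_def)
qed

text \<open>
  A proper 3-colouring with named classes, \<open>S\<close> being the one that is to be small.
\<close>

definition three_classes :: "'a graph \<Rightarrow> 'a set \<Rightarrow> 'a set \<Rightarrow> 'a set \<Rightarrow> bool" where
  "three_classes L S Y B \<longleftrightarrow> verts L = S \<union> Y \<union> B \<and> S \<inter> Y = {} \<and> S \<inter> B = {} \<and> Y \<inter> B = {} \<and>
     independent L S \<and> independent L Y \<and> independent L B"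

lemma three_classes_decomposition:
  assumes L: "simple_graph L" and T: "three_classes L S Y B"
  shows "\<exists>M\<in>decomposition_family L. bipartite M"
proof -
  have SY: "S \<union> Y \<subseteq> verts L" "verts L - (S \<union> Y) = B" using T by (auto simp: three_classes_def)
  have "independent L (verts L - (S \<union> Y))" unfolding SY(2) using T by (simp add: three_classes_def)
  from decomposition_of_partition[OF L SY(1) this]
  obtain M \<phi> where M: "M \<in> decomposition_family L" "inj_on \<phi> (verts M)" "\<phi> ` verts M \<subseteq> S \<union> Y"
    "\<forall>e\<in>edges M. \<phi> ` e \<in> edges L" by blast
  let ?X = "{v \<in> verts M. \<phi> v \<in> S}" and ?Z = "{v \<in> verts M. \<phi> v \<in> Y}"
  have "?X \<union> ?Z = verts M" "?X \<inter> ?Z = {}" using M(3) T by (auto simp: three_classes_def)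
  moreover have "\<not> e \<subseteq> {v \<in> verts M. \<phi> v \<in> R}" if "e \<in> edges M" "independent L R" for e R
  proof
    assume "e \<subseteq> {v \<in> verts M. \<phi> v \<in> R}"
    then have "\<phi> ` e \<subseteq> R" by auto
    then show False using M(4) that by (auto simp: independent_def)
  qed
  then have "independent M ?X" "independent M ?Z"
    using T by (auto simp: independent_def three_classes_def)
  ultimately show ?thesis using M(1) unfolding bipartite_def by blast
qed

text \<open>
  Infima over the empty set are 0; this ensures that \<open>q\<close> is a genuine minimum.
\<close>

lemma S_family_nonempty:
  assumes "M0 \<in> \<L>" "bipartite M0" and sL: "\<And>M. M \<in> \<L> \<Longrightarrow> simple_graph M"
  shows "\<exists>M S. (M, S) \<in> S_family \<L>"
proof -
  let ?Q = "{independent_covering_number L | L. L \<in> \<L> \<and> bipartite L}"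
  have "?Q \<noteq> {}" using assms by auto
  then have "Inf ?Q \<in> ?Q" by (rule Inf_nat_def1)
  then obtain M where M: "M \<in> \<L>" "bipartite M" "q_number \<L> = independent_covering_number M"
    by (auto simp: q_number_def)
  obtain X Y where XY: "X \<union> Y = verts M" "independent M X" "independent M Y"
    using M(2) by (auto simp: bipartite_def)
  have "X \<inter> e \<noteq> {}" if "e \<in> edges M" for e
  proof -
    have "e \<subseteq> verts M" using sL[OF M(1)] that by (simp add: simple_graph_def)
    moreover have "\<not> e \<subseteq> Y" using XY(3) that by (simp add: independent_def)
    ultimately show ?thesis using XY(1) by blast
  qed
  then have "independent_covering M X"
    using XY(2) by (auto simp: independent_covering_def covering_def independent_def)
  then have "{card S | S. independent_covering M S} \<noteq> {}" by auto
  from Inf_nat_def1[OF this] obtain S where "independent_covering M S"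
    "card S = independent_covering_number M" by (auto simp: independent_covering_number_def)
  then show ?thesis using M by (auto simp: S_family_def)
qed

lemma k_attained:
  assumes "(M0, S0) \<in> S_family \<L>" "S0 \<noteq> {}"
  shows "\<exists>M S x. (M, S) \<in> S_family \<L> \<and> x \<in> S \<and> degree M x = k_number \<L>"
proof -
  have "{degree M x | M S x. (M, S) \<in> S_family \<L> \<and> x \<in> S} \<noteq> {}" using assms by auto
  from Inf_nat_def1[OF this] show ?thesis unfolding k_number_def[symmetric] by (simp, metis)
qed

lemma independent_covering_ge_q:
  assumes "L \<in> \<L>" "bipartite L" "independent_covering L S"
  shows "q_number \<L> \<le> card S"
proof -
  have "independent_covering_number L \<le> card S"
    unfolding independent_covering_number_def using assms(3) by (intro cInf_lower) auto
  moreover have "q_number \<L> \<le> independent_covering_number L"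
    unfolding q_number_def using assms by (intro cInf_lower) auto
  ultimately show ?thesis by simp
qed

text \<open>
  The bijection \<open>\<pi>\<close> of \<open>partition_of_decomposition\<close> pulls the covering back to a colour class; what
  remains of \<open>A\<close> is independent since every edge of \<open>M\<close> meets the covering.
\<close>

lemma classes_of_independent_covering:
  fixes L :: "'a graph"
  assumes L: "simple_graph L" and M: "M \<in> decomposition_family L" and S: "independent_covering M S"
  shows "\<exists>S' Y B \<pi>. three_classes L S' Y B \<and> bij_betw \<pi> (\<Union>{e \<in> edges L. e \<subseteq> S' \<union> Y}) (verts M) \<and>
    edges M = (\<lambda>e. \<pi> ` e) ` {e \<in> edges L. e \<subseteq> S' \<union> Y} \<and> bij_betw \<pi> S' S \<and>
    S' \<subseteq> \<Union>{e \<in> edges L. e \<subseteq> S' \<union> Y}"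
proof -
  obtain A \<pi> where A: "A \<subseteq> verts L" "independent L (verts L - A)"
    and \<pi>: "bij_betw \<pi> (\<Union>{e \<in> edges L. e \<subseteq> A}) (verts M)"
    and E: "edges M = (\<lambda>e. \<pi> ` e) ` {e \<in> edges L. e \<subseteq> A}"
    using partition_of_decomposition[OF L M] by (elim exE conjE)
  define A1 where "A1 = \<Union>{e \<in> edges L. e \<subseteq> A}"
  define S' where "S' = {v \<in> A1. \<pi> v \<in> S}"
  have S'A: "S' \<subseteq> A1" "A1 \<subseteq> A" by (auto simp: S'_def A1_def)
  have SA: "S' \<union> (A - S') = A" using S'A by blast
  have cov: "covering M S" "independent M S" using S by (auto simp: independent_covering_def)
  have "S \<subseteq> verts M" using cov by (simp add: covering_def)
  then have bS: "bij_betw \<pi> S' S"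
  proof -
    have "inj_on \<pi> S'" using \<pi> S'A(1) unfolding A1_def[symmetric] bij_betw_def
      by (blast intro: inj_on_subset)
    moreover have "\<pi> ` S' = S"
    proof (intro subset_antisym subsetI)
      fix s assume s: "s \<in> S"
      then have "s \<in> \<pi> ` A1" using \<pi> \<open>S \<subseteq> verts M\<close> unfolding A1_def[symmetric] by (auto simp: bij_betw_def)
      then show "s \<in> \<pi> ` S'" using s by (auto simp: S'_def)
    qed (auto simp: S'_def)
    ultimately show ?thesis by (simp add: bij_betw_def)
  qed
  have "independent L S'"
    unfolding independent_def
  proof (intro conjI ballI notI)
    fix e assume e: "e \<in> edges L" "e \<subseteq> S'"
    then have "\<pi> ` e \<in> edges M" using E S'A by blast
    moreover have "\<pi> ` e \<subseteq> S" using e by (auto simp: S'_def)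
    ultimately show False using cov(2) by (auto simp: independent_def)
  qed (use S'A A in blast)
  moreover have "independent L (A - S')"
    unfolding independent_def
  proof (intro conjI ballI notI)
    fix e assume e: "e \<in> edges L" "e \<subseteq> A - S'"
    then have "e \<subseteq> A" by blast
    then have "\<pi> ` e \<in> edges M" "e \<subseteq> A1" using E e by (auto simp: A1_def)
    then obtain v where "v \<in> e" "\<pi> v \<in> S" using cov(1) unfolding covering_def by blast
    then show False using e \<open>e \<subseteq> A1\<close> by (auto simp: S'_def)
  qed (use A in blast)
  ultimately have "three_classes L S' (A - S') (verts L - A)"
    using A S'A by (auto simp: three_classes_def)
  then show ?thesis using \<pi> E bS S'A(1) unfolding A1_def
    by (intro exI[of _ S'] exI[of _ "A - S'"] exI[of _ "verts L - A"] exI[of _ \<pi>])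
      (unfold SA, intro conjI)
qed

lemma embed_three_classes:
  assumes L: "simple_graph L" and T: "three_classes L S Y B" and CG: "C \<subseteq> verts G"
    and C: "finite C" "card S \<le> card C"
    and N: "\<And>i. finite (N i)" "\<And>i. N i \<subseteq> verts G" "\<And>i. card (verts L) \<le> card (N i)"
      "N True \<inter> N False = {}" "\<And>i. N i \<inter> C = {}" "joined G (N True) (N False)"
    and CN: "\<And>i. joined G C (N i)"
  shows "contains_copy G L"
proof -
  have "finite S" using T L by (auto simp: three_classes_def simple_graph_def)
  then obtain f where f: "f ` S \<subseteq> C" "inj_on f S" using card_le_inj[OF _ C] by blast
  show ?thesis
  proof (rule embed_extend[OF L _ f(2), of G "\<lambda>v. v \<in> Y" N])
    show "S \<subseteq> verts L" using T by (auto simp: three_classes_def)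
    show "f ` S \<subseteq> verts G" using f CG by blast
    fix e assume "e \<in> edges L" "e \<subseteq> S"
    then show "f ` e \<in> edges G" using T by (auto simp: three_classes_def independent_def)
  next
    fix x y assume xy: "{x, y} \<in> edges L" "x \<notin> S" "y \<notin> S"
    have "x \<in> verts L" "y \<in> verts L" using edge_verts[OF L xy(1)] by auto
    moreover have "\<not> {x, y} \<subseteq> Y" "\<not> {x, y} \<subseteq> B" using T xy(1) unfolding three_classes_def independent_def by blast+
    ultimately show "(x \<in> Y) \<noteq> (y \<in> Y)" using T xy unfolding three_classes_def by blast
  next
    fix i show "N i \<inter> f ` S = {}" using N(5)[of i] f(1) by blast
  next
    fix d v assume "d \<in> S"
    then show "joined G {f d} (N (v \<in> Y))" using CN f(1) by (auto simp: joined_def)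
  qed (use N in auto)
qed

text \<open>
  Only the preimage of the covering \<open>S\<close> is placed in \<open>W\<close>. As \<open>S\<close> meets all edges of \<open>M\<close>, the rest of
  \<open>A\<close> is independent in \<open>L\<close>, so the remainder of \<open>L\<close> is bipartite and fits into the pools. This is why
  the graph on \<open>W\<close> must avoid the members of \<open>\<B>\<close>.
\<close>

lemma embed_covering:
  assumes L: "simple_graph L" and M: "M \<in> decomposition_family L" and S: "covering M S"
    and \<phi>: "inj_on \<phi> S" "\<phi> ` S \<subseteq> W" "\<And>e. e \<in> edges M \<Longrightarrow> e \<subseteq> S \<Longrightarrow> \<phi> ` e \<in> edges G"
    and W: "W \<subseteq> verts G"
    and N: "\<And>i. finite (N i)" "\<And>i. N i \<subseteq> verts G" "\<And>i. card (verts L) \<le> card (N i)"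
      "N True \<inter> N False = {}" "\<And>i. N i \<inter> W = {}" "joined G (N True) (N False)"
    and WN: "\<And>i. joined G W (N i)"
  shows "contains_copy G L"
proof -
  obtain A \<pi> where A: "A \<subseteq> verts L" "independent L (verts L - A)"
    and \<pi>: "bij_betw \<pi> (\<Union>{e \<in> edges L. e \<subseteq> A}) (verts M)"
    and E: "edges M = (\<lambda>e. \<pi> ` e) ` {e \<in> edges L. e \<subseteq> A}"
    using partition_of_decomposition[OF L M] by (elim exE conjE)
  define A1 where "A1 = \<Union>{e \<in> edges L. e \<subseteq> A}"
  define D where "D = {v \<in> A1. \<pi> v \<in> S}"
  have DA: "D \<subseteq> A1" "A1 \<subseteq> A" by (auto simp: D_def A1_def)
  have fD: "\<phi> (\<pi> v) \<in> W" if "v \<in> D" for v using that \<phi>(2) by (auto simp: D_def)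
  show ?thesis
  proof (rule embed_extend[OF L, of D "\<lambda>v. \<phi> (\<pi> v)" G "\<lambda>v. v \<in> A" N])
    show "D \<subseteq> verts L" using DA A(1) by blast
    show "inj_on (\<lambda>v. \<phi> (\<pi> v)) D"
    proof (rule inj_onI)
      fix x y assume xy: "x \<in> D" "y \<in> D" "\<phi> (\<pi> x) = \<phi> (\<pi> y)"
      then have "\<pi> x = \<pi> y" using \<phi>(1) by (auto simp: D_def inj_on_def)
      then show "x = y" using \<pi> xy(1,2) unfolding A1_def[symmetric] by (auto simp: D_def bij_betw_def inj_on_def)
    qed
    show "(\<lambda>v. \<phi> (\<pi> v)) ` D \<subseteq> verts G" using fD W by blast
    fix e assume e: "e \<in> edges L" "e \<subseteq> D"
    have "\<pi> ` e \<in> edges M" using E e DA by blast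
    moreover have "\<pi> ` e \<subseteq> S" using e(2) by (auto simp: D_def)
    ultimately have "\<phi> ` \<pi> ` e \<in> edges G" by (rule \<phi>(3))
    then show "(\<lambda>v. \<phi> (\<pi> v)) ` e \<in> edges G" by (simp add: image_image)
  next
    fix x y assume xy: "{x, y} \<in> edges L" "x \<notin> D" "y \<notin> D"
    have v: "x \<in> verts L" "y \<in> verts L" using edge_verts(1,2)[OF L xy(1)] by simp_all
    show "(x \<in> A) \<noteq> (y \<in> A)"
    proof (rule ccontr)
      assume "\<not> ?thesis"
      then consider "{x, y} \<subseteq> A" | "{x, y} \<subseteq> verts L - A" using v by blast
      then show False
      proof cases
        case 1
        have "\<pi> ` {x, y} \<in> edges M" unfolding E by (rule imageI) (use xy(1) 1 in simp)
        moreover have "x \<in> A1" "y \<in> A1" using 1 xy(1) by (auto simp: A1_def)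
        ultimately show False using S xy(2,3) by (auto simp: covering_def D_def)
      next
        case 2 then show False using A(2) xy(1) unfolding independent_def by blast
      qed
    qed
  next
    fix i show "N i \<inter> (\<lambda>v. \<phi> (\<pi> v)) ` D = {}" using N(5)[of i] fD by blast
  next
    fix d v assume "d \<in> D"
    then show "joined G {\<phi> (\<pi> d)} (N (v \<in> A))" using WN fD by (auto simp: joined_def)
  qed (use N in auto)
qed

lemma bipartite_side:
  assumes "simple_graph H" "bipartite H"
  shows "\<exists>side. side y \<and> (\<forall>u v. {u, v} \<in> edges H \<longrightarrow> side u \<noteq> side v)"
proof -
  obtain X Z where XZ: "X \<union> Z = verts H" "X \<inter> Z = {}" "independent H X" "independent H Z"
    using assms(2) by (auto simp: bipartite_def)
  have "(u \<in> X) \<noteq> (v \<in> X)" if "{u, v} \<in> edges H" for u v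
  proof -
    have "u \<in> X \<union> Z" "v \<in> X \<union> Z" using edge_verts[OF assms(1) that] XZ by auto
    moreover have "\<not> {u, v} \<subseteq> X" "\<not> {u, v} \<subseteq> Z" using XZ that unfolding independent_def by blast+
    ultimately show ?thesis using XZ(2) by blast
  qed
  then show ?thesis by (intro exI[of _ "\<lambda>v. (v \<in> X) = (y \<in> X)"]) auto
qed

context ballooning
begin

text \<open>
  Each cycle avoiding \<open>S\<close> is assigned injectively a leaf in \<open>\<Lambda>\<close> of the star at \<open>a\<close> or an edge
  of one of the two matchings; \<open>embed_breaks\<close> then uses it as the break of that cycle.
  The matching \<open>F1\<close> lies on the side of \<open>N1\<close>, \<open>F2\<close> on that of \<open>N2\<close>, and \<open>a\<close> on the side of
  \<open>N1\<close>. A cycle through \<open>y\<close> that breaks on the other side than \<open>a\<close> has \<open>y\<close> next to its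
  break, which explains the condition on \<open>F2\<close>.
\<close>

lemma embed_inside_edges:
  fixes G :: "'b graph" and S Y :: "'a set"
  assumes bip: "bipartite H" and G: "simple_graph G"
    and S: "S \<subseteq> verts Ht" "finite W" "card S \<le> card W"
    and Y: "Y \<subseteq> {y}" "Y \<subseteq> verts H" "Y \<inter> S = {}" and ind: "independent Ht (S \<union> Y)"
    and yE: "\<And>e z. e \<in> edges H \<Longrightarrow> set (c e) \<inter> S = {} \<Longrightarrow> z \<in> Y \<Longrightarrow> z \<in> e"
    and W: "W \<subseteq> verts G" and a: "a \<in> verts G"
    and \<Lambda>: "finite \<Lambda>" "\<Lambda> \<noteq> {} \<Longrightarrow> Y = {y}" "\<And>x. x \<in> \<Lambda> \<Longrightarrow> {a, x} \<in> edges G"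
    and F: "matching G (F1 \<union> F2)" "F1 \<inter> F2 = {}"
    and many: "card {e \<in> edges H. set (c e) \<inter> S = {}} \<le> card \<Lambda> + card F1 + card F2"
    and F2: "\<And>e. e \<in> F2 \<Longrightarrow> Y = {y} \<Longrightarrow> \<exists>b\<in>e. {a, b} \<in> edges G"
    and dis: "W \<inter> \<Lambda> = {}" "W \<inter> \<Union>(F1 \<union> F2) = {}" "\<Lambda> \<inter> \<Union>(F1 \<union> F2) = {}" "a \<notin> W" "a \<notin> \<Lambda>"
      "a \<notin> \<Union>(F1 \<union> F2)"
    and N: "finite N1" "finite N2" "N1 \<subseteq> verts G" "N2 \<subseteq> verts G" "card (verts Ht) \<le> card N1"
      "card (verts Ht) \<le> card N2" "N1 \<inter> N2 = {}"
      "(N1 \<union> N2) \<inter> ({a} \<union> W \<union> \<Lambda> \<union> \<Union>(F1 \<union> F2)) = {}" "joined G N1 N2"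
    and WN: "joined G W N1" "joined G W N2" and aN: "Y = {y} \<Longrightarrow> joined G {a} N2"
    and lN: "joined G \<Lambda> N2" and F1N: "joined G (\<Union>F1) N2" and F2N: "joined G (\<Union>F2) N1"
  shows "contains_copy G Ht"
proof -
  obtain side where side: "side y" "\<And>u v. {u, v} \<in> edges H \<Longrightarrow> side u \<noteq> side v"
    using bipartite_side[OF simple_H bip, of y] by blast
  have finS: "finite S" using S(1) simple_Ht finite_subset by (auto simp: simple_graph_def)
  obtain g where g: "g ` S \<subseteq> W" "inj_on g S" using card_le_inj[OF finS S(2,3)] by blast
  let ?E' = "{e \<in> edges H. set (c e) \<inter> S = {}}"
  have finF: "finite F1" "finite F2" using finite_matching[OF G F(1)] by auto
  have "card ?E' \<le> card (\<Lambda> <+> (F1 \<union> F2))"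
    using many \<Lambda>(1) finF F(2) by (simp add: card_Plus card_Un_disjoint)
  moreover have "finite ?E'" using finite_edges[OF simple_H] by auto
  moreover have "finite (\<Lambda> <+> (F1 \<union> F2))" using \<Lambda>(1) finF by simp
  ultimately have "\<exists>\<phi>. \<phi> ` ?E' \<subseteq> \<Lambda> <+> (F1 \<union> F2) \<and> inj_on \<phi> ?E'"
    by (intro card_le_inj)
  then obtain \<phi> where \<phi>: "\<phi> ` ?E' \<subseteq> \<Lambda> <+> (F1 \<union> F2)" "inj_on \<phi> ?E'"
    by (elim exE conjE)
  have ex: "\<exists>b b'. \<mu> \<in> F1 \<union> F2 \<longrightarrow> \<mu> = {b, b'} \<and> b \<noteq> b' \<and> (\<mu> \<in> F2 \<and> Y = {y} \<longrightarrow> {a, b} \<in> edges G)" for \<mu>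
  proof (cases "\<mu> \<in> F1 \<union> F2")
    case True
    then have "\<mu> \<in> edges G" using F(1) by (auto simp: matching_def)
    then obtain u v where uv: "\<mu> = {u, v}" "u \<noteq> v" using edge_ends[OF G] by blast
    show ?thesis
    proof (cases "\<mu> \<in> F2 \<and> Y = {y} \<and> {a, u} \<notin> edges G")
      case True
      then obtain b where "b \<in> \<mu>" "{a, b} \<in> edges G" using F2[of \<mu>] by blast
      then have av: "{a, v} \<in> edges G" using uv(1) True by blast
      show ?thesis
        by (rule exI[of _ v], rule exI[of _ u]) (simp add: av uv uv(2)[symmetric] insert_commute[of u v])
    next
      case False
      show ?thesis by (rule exI[of _ u], rule exI[of _ v]) (use uv False in simp)
    qed
  qed auto
  obtain B where B0: "\<forall>\<mu>. \<exists>b'. \<mu> \<in> F1 \<union> F2 \<longrightarrow> \<mu> = {B \<mu>, b'} \<and> B \<mu> \<noteq> b' \<and>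
      (\<mu> \<in> F2 \<and> Y = {y} \<longrightarrow> {a, B \<mu>} \<in> edges G)"
    using choice[OF allI[of "\<lambda>\<mu>. \<exists>b b'. \<mu> \<in> F1 \<union> F2 \<longrightarrow> \<mu> = {b, b'} \<and> b \<noteq> b' \<and>
      (\<mu> \<in> F2 \<and> Y = {y} \<longrightarrow> {a, b} \<in> edges G)", OF ex]] by (elim exE)
  obtain B' where B1: "\<forall>\<mu>. \<mu> \<in> F1 \<union> F2 \<longrightarrow> \<mu> = {B \<mu>, B' \<mu>} \<and> B \<mu> \<noteq> B' \<mu> \<and>
      (\<mu> \<in> F2 \<and> Y = {y} \<longrightarrow> {a, B \<mu>} \<in> edges G)"
    using choice[OF B0] by (elim exE)
  have B: "\<mu> = {B \<mu>, B' \<mu>} \<and> B \<mu> \<noteq> B' \<mu> \<and> (\<mu> \<in> F2 \<and> Y = {y} \<longrightarrow> {a, B \<mu>} \<in> edges G)"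
    if "\<mu> \<in> F1 \<union> F2" for \<mu>
    by (rule mp[OF spec[OF B1, of \<mu>] that])
  have Bin: "B \<mu> \<in> \<mu>" "B' \<mu> \<in> \<mu>" if "\<mu> \<in> F1 \<union> F2" for \<mu> using B[OF that] by blast+
  have Bneq: "B \<mu> \<noteq> B' \<mu>" if "\<mu> \<in> F1 \<union> F2" for \<mu> using B[OF that] by blast
  have same: "\<mu> = \<nu>" if "\<mu> \<in> F1 \<union> F2" "\<nu> \<in> F1 \<union> F2" "z \<in> \<mu>" "z \<in> \<nu>" for \<mu> \<nu> z
    using F(1) that unfolding matching_def by blast
  have Bedge: "{B \<mu>, B' \<mu>} \<in> edges G" if "\<mu> \<in> F1 \<union> F2" for \<mu>
  proof -
    have "\<mu> \<in> edges G" using F(1) that unfolding matching_def by blast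
    then show ?thesis using B[OF that] by simp
  qed
  define st where "st e = isl (\<phi> e)" for e
  define lf where "lf e = projl (\<phi> e)" for e
  define me where "me e = projr (\<phi> e)" for e
  have st: "lf e \<in> \<Lambda> \<and> \<phi> e = Inl (lf e)" if "e \<in> ?E'" "st e" for e
    using that \<phi>(1) by (cases "\<phi> e") (auto simp: st_def lf_def)
  have nst: "me e \<in> F1 \<union> F2 \<and> \<phi> e = Inr (me e)" if "e \<in> ?E'" "\<not> st e" for e
    using that \<phi>(1) by (cases "\<phi> e") (auto simp: st_def me_def)
  have inj1: "inj_on lf {e \<in> ?E'. st e}"
  proof (rule inj_onI)
    fix e e' assume "e \<in> {e \<in> ?E'. st e}" "e' \<in> {e \<in> ?E'. st e}" "lf e = lf e'"
    then have "e \<in> ?E'" "e' \<in> ?E'" "\<phi> e = \<phi> e'" using st[of e] st[of e'] by auto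
    then show "e = e'" using \<phi>(2) by (auto dest: inj_onD)
  qed
  have inj2: "e = e'" if "e \<in> {e \<in> ?E'. \<not> st e}" "e' \<in> {e \<in> ?E'. \<not> st e}" "me e = me e'" for e e'
  proof -
    have "e \<in> ?E'" "e' \<in> ?E'" "\<phi> e = \<phi> e'" using nst[of e] nst[of e'] that by auto
    then show "e = e'" using \<phi>(2) by (auto dest: inj_onD)
  qed
  have injB: "inj_on (\<lambda>e. B (me e)) {e \<in> ?E'. \<not> st e}" "inj_on (\<lambda>e. B' (me e)) {e \<in> ?E'. \<not> st e}"
  proof -
    have m: "me e \<in> F1 \<union> F2" if "e \<in> {e \<in> ?E'. \<not> st e}" for e using nst that by blast
    show "inj_on (\<lambda>e. B (me e)) {e \<in> ?E'. \<not> st e}"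
    proof (rule inj_onI)
      fix e e' assume e: "e \<in> {e \<in> ?E'. \<not> st e}" "e' \<in> {e \<in> ?E'. \<not> st e}" "B (me e) = B (me e')"
      have "B (me e) \<in> me e'" using Bin(1)[OF m[OF e(2)]] e(3) by simp
      from same[OF m[OF e(1)] m[OF e(2)] Bin(1)[OF m[OF e(1)]] this]
      show "e = e'" by (rule inj2[OF e(1,2)])
    qed
    show "inj_on (\<lambda>e. B' (me e)) {e \<in> ?E'. \<not> st e}"
    proof (rule inj_onI)
      fix e e' assume e: "e \<in> {e \<in> ?E'. \<not> st e}" "e' \<in> {e \<in> ?E'. \<not> st e}" "B' (me e) = B' (me e')"
      have "B' (me e) \<in> me e'" using Bin(2)[OF m[OF e(2)]] e(3) by simp
      from same[OF m[OF e(1)] m[OF e(2)] Bin(2)[OF m[OF e(1)]] this]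
      show "e = e'" by (rule inj2[OF e(1,2)])
    qed
  qed
  define M where "M = \<Union>(F1 \<union> F2)"
  define A2 where "A2 = B ` (F1 \<union> F2)"
  define A3 where "A3 = B' ` (F1 \<union> F2)"
  have A23: "A2 \<subseteq> M" "A3 \<subseteq> M" using Bin unfolding A2_def A3_def M_def by blast+
  have A2A3: "A2 \<inter> A3 = {}"
  proof (rule ccontr)
    assume "A2 \<inter> A3 \<noteq> {}"
    then obtain \<mu> \<nu> where mn: "\<mu> \<in> F1 \<union> F2" "\<nu> \<in> F1 \<union> F2" "B \<mu> = B' \<nu>" unfolding A2_def A3_def by blast
    then have "\<mu> = \<nu>" using same[OF mn(1,2), of "B \<mu>"] Bin(1)[OF mn(1)] Bin(2)[OF mn(2)] by simp
    then show False using Bneq[OF mn(1)] mn(3) by simp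
  qed
  have m: "me e \<in> F1 \<union> F2" if "e \<in> ?E'" "\<not> st e" for e using nst[OF that] by blast
  define N where "N i = (if i then N1 else N2)" for i
  note dis' = dis[folded M_def] and N8 = N(8)[folded M_def]
  show ?thesis
  proof (rule embed_breaks[of G side S Y y g W a st lf "\<lambda>e. B (me e)" "\<lambda>e. B' (me e)" "\<lambda>e. me e \<in> F1" \<Lambda> A2 A3 N])
    fix e assume e: "e \<in> ?E'" "st e"
    have "lf e \<in> \<Lambda>" using st[OF e] by blast
    then show "y \<in> Y \<and> {lf e, a} \<in> edges G"
      using \<Lambda>(2) \<Lambda>(3)[of "lf e"] by (auto simp: insert_commute[of a "lf e"])
    show "joined G {lf e} (N (\<not> side y))" using \<open>lf e \<in> \<Lambda>\<close> lN side(1) by (auto simp: N_def joined_def)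
  next
    fix e assume e: "e \<in> ?E'" "\<not> st e"
    show "{B (me e), B' (me e)} \<in> edges G" by (rule Bedge[OF m[OF e]])
    show "joined G {B (me e), B' (me e)} (N (\<not> me e \<in> F1))"
    proof (cases "me e \<in> F1")
      case True
      then have "{B (me e), B' (me e)} \<subseteq> \<Union>F1" using Bin[OF m[OF e]] by blast
      then show ?thesis using F1N True by (auto simp: N_def joined_def)
    next
      case False
      then have "me e \<in> F2" using m[OF e] by blast
      then have "{B (me e), B' (me e)} \<subseteq> \<Union>F2" using Bin[OF m[OF e]] by blast
      then show ?thesis using F2N False by (auto simp: N_def joined_def)
    qed
    assume "y \<in> Y" "(me e \<in> F1) \<noteq> side y"
    then have "me e \<in> F2" "Y = {y}" using side(1) m[OF e] Y(1) by blast+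
    then show "{a, B (me e)} \<in> edges G" using B[OF m[OF e]] by blast
  next
    show "lf ` {e \<in> ?E'. st e} \<subseteq> \<Lambda>" using st by blast
    show "(\<lambda>e. B (me e)) ` {e \<in> ?E'. \<not> st e} \<subseteq> A2" using m unfolding A2_def by blast
    show "(\<lambda>e. B' (me e)) ` {e \<in> ?E'. \<not> st e} \<subseteq> A3" using m unfolding A3_def by blast
    show "\<Lambda> \<inter> A2 = {}" "\<Lambda> \<inter> A3 = {}" "W \<inter> A2 = {}" "W \<inter> A3 = {}" "a \<notin> A2" "a \<notin> A3"
      using dis'(2,3,6) A23 by blast+
    fix i show "N i \<inter> ({a} \<union> W \<union> \<Lambda> \<union> A2 \<union> A3) = {}"
      using N8 A23 unfolding N_def by (cases i) (simp, blast)+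
  next
    assume "y \<in> Y"
    then have "Y = {y}" using Y(1) by blast
    then show "joined G {a} (N (\<not> side y))" using aN side(1) by (simp add: N_def)
  next
    fix i show "joined G W (N i)" using WN by (simp add: N_def)
  next
    show "joined G (N True) (N False)" using N(9) by (simp add: N_def)
    show "N True \<inter> N False = {}" using N(7) by (simp add: N_def)
  next
    fix i show "finite (N i)" using N by (simp add: N_def)
    show "N i \<subseteq> verts G" using N by (simp add: N_def)
    show "card (verts Ht) \<le> card (N i)" using N by (simp add: N_def)
  next
    fix e z assume "e \<in> ?E'" "z \<in> Y"
    then show "z \<in> e" using yE by blast
  qed (use G side(2) S Y ind g W a inj1 injB A2A3 dis in auto)
qed

section \<open>Smallest colour classes of an odd-ballooning\<close>

text \<open>
  Breaking every cycle at a new vertex and putting these vertices into a class of their own leaves a bipartite graph.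
\<close>

lemma bipartite_three_classes:
  assumes "bipartite H"
  shows "\<exists>S Y B. three_classes Ht S Y B"
proof -
  obtain side where side0: "side undefined \<and> (\<forall>u v. {u, v} \<in> edges H \<longrightarrow> side u \<noteq> side v)"
    using bipartite_side[OF simple_H assms, of undefined] by (rule exE)
  then have side: "side u \<noteq> side v" if "{u, v} \<in> edges H" for u v using that by blast
  define o' where "o' e = (SOME u. u \<in> e)" for e :: "'a set"
  have o: "o' e \<in> e" if e: "e \<in> edges H" for e
  proof -
    obtain u v where "e = {u, v}" using edge_ends[OF simple_H e] by (elim exE conjE)
    then have "u \<in> e" by simp
    then show ?thesis unfolding o'_def by (rule someI)
  qed
  have two: "1 \<le> (2::nat)" by simp
  have len2: "2 < length (c e)" if "e \<in> edges H" for e using len[OF that] by simp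
  obtain \<chi> where \<chi>: "(\<forall>v\<in>verts H. \<chi> v = side v) \<and>
     (\<forall>e\<in>edges H. \<forall>j<length (c e).
        \<chi> (cycle_from e (o' e) ! j) = (side (o' e) \<noteq> (odd j \<noteq> (2 < j)))) \<and>
     (\<forall>e\<in>edges H. \<forall>j<length (c e). j \<noteq> 2 \<longrightarrow>
        \<chi> (cycle_from e (o' e) ! j) \<noteq> \<chi> (cycle_from e (o' e) ! (Suc j mod length (c e))))"
    using break_coloring[of side o' "\<lambda>_. 2", OF side o two len2] by (rule exE)
  have alt: "\<chi> (cycle_from e (o' e) ! j) \<noteq> \<chi> (cycle_from e (o' e) ! (Suc j mod length (c e)))"
    if "e \<in> edges H" "j < length (c e)" "j \<noteq> 2" for e j using \<chi> that by blast
  \<comment> \<open>Position 2 is a new vertex incident with the break between positions 2 and 3.\<close>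
  define S where "S = (\<lambda>e. cycle_from e (o' e) ! 2) ` edges H"
  have Ssub: "S \<subseteq> verts Ht"
    using cycle_from_new(2)[OF _ o, of _ 2] len2 by (auto simp: S_def verts_Ht)
  have edge: "\<exists>e\<in>edges H. \<exists>j<length (c e). \<epsilon> = {cycle_from e (o' e) ! j, cycle_from e (o' e) ! (Suc j mod length (c e))}"
    if \<epsilon>: "\<epsilon> \<in> edges Ht" for \<epsilon>
  proof -
    obtain e where e: "e \<in> edges H" "\<epsilon> \<in> cycle_edges (c e)" using \<epsilon> by (auto simp: edges_Ht)
    then have "\<epsilon> \<in> cycle_edges (cycle_from e (o' e))" using cycle_from(4)[OF e(1) o[OF e(1)]] by simp
    then show ?thesis using e cycle_from(3)[OF e(1) o[OF e(1)]] by (auto simp: cycle_edges_def)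
  qed
  have inS: "j = 2" if e: "e \<in> edges H" and j: "j < length (c e)" and v: "cycle_from e (o' e) ! j \<in> S" for e j
  proof -
    obtain e' where e': "e' \<in> edges H" "cycle_from e (o' e) ! j = cycle_from e' (o' e') ! 2" using v by (auto simp: S_def)
    have new: "cycle_from e' (o' e') ! 2 \<notin> verts H" "cycle_from e' (o' e') ! 2 \<in> set (c e')"
      using cycle_from_new[OF e'(1) o[OF e'(1)] _ len2[OF e'(1)]] by auto
    have "cycle_from e (o' e) ! j \<in> set (c e)"
      using cycle_from(2,3)[OF e o[OF e]] j nth_mem[of j "cycle_from e (o' e)"] by auto
    then have "e = e'" using new_vertex_unique[OF e e'(1)] new e'(2) by simp
    then show ?thesis using e' cycle_from(1,3)[OF e o[OF e]] j len2[OF e]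
        nth_eq_iff_index_eq[of "cycle_from e (o' e)" j 2] by simp
  qed
  have indS: "independent Ht S"
    unfolding independent_def
  proof (intro conjI ballI notI)
    fix \<epsilon> assume \<epsilon>: "\<epsilon> \<in> edges Ht" "\<epsilon> \<subseteq> S"
    obtain e j where e: "e \<in> edges H" "j < length (c e)"
      "\<epsilon> = {cycle_from e (o' e) ! j, cycle_from e (o' e) ! (Suc j mod length (c e))}" using edge[OF \<epsilon>(1)] by blast
    have "Suc j mod length (c e) < length (c e)" using e(2) by (intro mod_less_divisor) auto
    then have "j = 2" "Suc j mod length (c e) = 2"
      using inS[OF e(1) e(2)] inS[OF e(1), of "Suc j mod length (c e)"] e(3) \<epsilon>(2) by blast+
    then show False using len[OF e(1)] by simp
  qed (use Ssub in auto)
  have ind: "independent Ht {v \<in> verts Ht - S. \<chi> v = i}" for i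
    unfolding independent_def
  proof (intro conjI ballI notI)
    fix \<epsilon> assume \<epsilon>: "\<epsilon> \<in> edges Ht" "\<epsilon> \<subseteq> {v \<in> verts Ht - S. \<chi> v = i}"
    obtain e j where e: "e \<in> edges H" "j < length (c e)"
      "\<epsilon> = {cycle_from e (o' e) ! j, cycle_from e (o' e) ! (Suc j mod length (c e))}" using edge[OF \<epsilon>(1)] by blast
    show False
    proof (cases "j = 2")
      case True
      then have "cycle_from e (o' e) ! 2 \<in> \<epsilon>" using e(3) by simp
      then have "cycle_from e (o' e) ! 2 \<notin> S" using \<epsilon>(2) by blast
      then show False using e(1) by (auto simp: S_def)
    next
      case False
      then show False using alt[OF e(1,2) False] \<epsilon>(2) e(3) by auto
    qed
  qed auto
  have "three_classes Ht S {v \<in> verts Ht - S. \<chi> v = True} {v \<in> verts Ht - S. \<chi> v = False}"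
    using Ssub indS ind[of True] ind[of False] unfolding three_classes_def by blast
  then show ?thesis by blast
qed

abbreviation "fam \<equiv> decomposition_family Ht"
abbreviation "qn \<equiv> q_number fam"
abbreviation "kn \<equiv> k_number fam"

lemma fam_simple: "M \<in> fam \<Longrightarrow> simple_graph M"
  by (simp add: decomposition_family_def)

text \<open>
  Every set with independent complement contains an edge, as \<open>Ht\<close> has an odd cycle.
\<close>

lemma no_two_classes:
  assumes "edges H \<noteq> {}" "independent Ht X" "independent Ht (verts Ht - X)"
  shows False
proof -
  obtain e where e: "e \<in> edges H" using assms(1) by blast
  obtain i where i: "i < length (c e)" "(c e ! i \<in> X) = (c e ! (Suc i mod length (c e)) \<in> X)"
    using odd_cycle_monochromatic[OF odd_len[OF e], of X] by blast
  let ?\<epsilon> = "{c e ! i, c e ! (Suc i mod length (c e))}"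
  have \<epsilon>: "?\<epsilon> \<in> edges Ht" using e i(1) by (auto simp: edges_Ht cycle_edges_def)
  have "?\<epsilon> \<subseteq> verts Ht" using edge_verts[OF simple_Ht \<epsilon>] by blast
  then have "?\<epsilon> \<subseteq> X \<or> ?\<epsilon> \<subseteq> verts Ht - X" using i(2) by blast
  then show False using assms(2,3) \<epsilon> unfolding independent_def by blast
qed

text \<open>
  The minimum defining \<open>k\<close> is attained at a vertex of an independent covering of size \<open>q\<close>. The correspondence between
  coverings and colour classes turns it into a vertex \<open>x\<close> of a smallest class with at most \<open>k\<close> neighbours in
  \<open>S \<union> Y\<close>.
\<close>

lemma optimal_classes:
  assumes bip: "bipartite H" and ne: "edges H \<noteq> {}"
  shows "qn \<ge> 1" "\<exists>S Y B. three_classes Ht S Y B \<and> card S = qn"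
    "\<exists>S x Y B. three_classes Ht S Y B \<and> card S = qn \<and> x \<in> S \<and>
       card {\<epsilon> \<in> edges Ht. x \<in> \<epsilon> \<and> \<epsilon> \<subseteq> S \<union> Y} \<le> kn"
proof -
  obtain S Y B where "three_classes Ht S Y B" using bipartite_three_classes[OF bip] by (elim exE)
  then obtain M0 where M0: "M0 \<in> fam" "bipartite M0"
    using three_classes_decomposition[OF simple_Ht] by blast
  have "\<exists>M S. (M, S) \<in> S_family fam" by (rule S_family_nonempty[OF M0]) (rule fam_simple)
  then obtain M S where MS: "(M, S) \<in> S_family fam" by (elim exE)
  have conv: "\<exists>S' Y B \<pi>. three_classes Ht S' Y B \<and> bij_betw \<pi> (\<Union>{e \<in> edges Ht. e \<subseteq> S' \<union> Y}) (verts M) \<and>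
    edges M = (\<lambda>e. \<pi> ` e) ` {e \<in> edges Ht. e \<subseteq> S' \<union> Y} \<and> bij_betw \<pi> S' S \<and>
    S' \<subseteq> \<Union>{e \<in> edges Ht. e \<subseteq> S' \<union> Y} \<and> card S' = qn" if MS: "(M, S) \<in> S_family fam" for M S
  proof -
    have "M \<in> fam" "independent_covering M S" "card S = qn" using MS by (auto simp: S_family_def)
    from classes_of_independent_covering[OF simple_Ht this(1,2)]
    obtain S' Y B \<pi> where c: "three_classes Ht S' Y B \<and> bij_betw \<pi> (\<Union>{e \<in> edges Ht. e \<subseteq> S' \<union> Y}) (verts M) \<and>
    edges M = (\<lambda>e. \<pi> ` e) ` {e \<in> edges Ht. e \<subseteq> S' \<union> Y} \<and> bij_betw \<pi> S' S \<and>
    S' \<subseteq> \<Union>{e \<in> edges Ht. e \<subseteq> S' \<union> Y}" by (elim exE)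
    then have "card S' = qn" using bij_betw_same_card[of \<pi> S' S] \<open>card S = qn\<close> by simp
    then show ?thesis using c
      by (intro exI[of _ S'] exI[of _ Y] exI[of _ B] exI[of _ \<pi>]) (intro conjI; simp only:)
  qed
  obtain S' Y B where T: "three_classes Ht S' Y B" "card S' = qn" using conv[OF MS] by (elim exE conjE)
  then show ex: "\<exists>S Y B. three_classes Ht S Y B \<and> card S = qn" by (intro exI conjI)
  have "S' \<noteq> {}"
  proof
    assume "S' = {}"
    then have "independent Ht Y" "verts Ht - Y = B" "independent Ht B"
      using T(1) by (auto simp: three_classes_def)
    then show False using no_two_classes[OF ne, of Y] by simp
  qed
  moreover have "finite S'" using T(1) simple_Ht by (auto simp: three_classes_def simple_graph_def)
  ultimately show q1: "qn \<ge> 1" using T(2) by (simp add: Suc_le_eq card_gt_0_iff flip: T(2))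
  have "S \<noteq> {}" using MS q1 by (auto simp: S_family_def)
  obtain M S x where MSx: "(M, S) \<in> S_family fam" "x \<in> S" "degree M x = kn"
    using k_attained[OF MS \<open>S \<noteq> {}\<close>] by (elim exE conjE)
  obtain S' Y B \<pi> where T: "three_classes Ht S' Y B"
      "bij_betw \<pi> (\<Union>{e \<in> edges Ht. e \<subseteq> S' \<union> Y}) (verts M)"
      "edges M = (\<lambda>e. \<pi> ` e) ` {e \<in> edges Ht. e \<subseteq> S' \<union> Y}" "bij_betw \<pi> S' S" "card S' = qn"
    using conv[OF MSx(1)] by (elim exE conjE)
  obtain x' where x': "x' \<in> S'" "\<pi> x' = x" using T(4) MSx(2) by (auto simp: bij_betw_def)
  let ?A = "{\<epsilon> \<in> edges Ht. x' \<in> \<epsilon> \<and> \<epsilon> \<subseteq> S' \<union> Y}"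
  have "inj_on (\<lambda>e. \<pi> ` e) ?A"
  proof (rule inj_on_subset[of _ "Pow (\<Union>{e \<in> edges Ht. e \<subseteq> S' \<union> Y})"])
    show "inj_on (\<lambda>e. \<pi> ` e) (Pow (\<Union>{e \<in> edges Ht. e \<subseteq> S' \<union> Y}))"
      by (rule inj_on_image_Pow) (use T(2) in \<open>simp add: bij_betw_def\<close>)
  qed auto
  then have "card ?A = card ((\<lambda>e. \<pi> ` e) ` ?A)" by (simp add: card_image)
  also have "\<dots> \<le> degree M x"
    unfolding degree_def
  proof (rule card_mono)
    have "simple_graph M" using MSx(1) fam_simple by (auto simp: S_family_def)
    then show "finite {e \<in> edges M. x \<in> e}" using finite_edges[of M] by simp
    show "(\<lambda>e. \<pi> ` e) ` ?A \<subseteq> {e \<in> edges M. x \<in> e}" using T(3) x'(2) by blast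
  qed
  finally show "\<exists>S x Y B. three_classes Ht S Y B \<and> card S = qn \<and> x \<in> S \<and>
       card {\<epsilon> \<in> edges Ht. x \<in> \<epsilon> \<and> \<epsilon> \<subseteq> S \<union> Y} \<le> kn"
    using T(1,5) x'(1) MSx(3)
    by (intro exI[of _ S'] exI[of _ x'] exI[of _ Y] exI[of _ B]) simp
qed

text \<open>
  Remove the vertex \<open>x\<close> of minimal degree from the smallest class. Every cycle has an edge inside
  \<open>S \<union> Y\<close>, by parity; if the cycle avoids the rest of \<open>S\<close>, this edge contains \<open>x\<close>. So there are at most \<open>k\<close>
  such cycles, all of them passing through \<open>x\<close>. If \<open>x\<close> is a vertex of \<open>H\<close> it is the centre
  \<open>y\<close> of the star of these cycles, and otherwise \<open>x\<close> lies on a single cycle.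
\<close>

lemma uncovered_cycles:
  assumes bip: "bipartite H" and ne: "edges H \<noteq> {}"
  shows "\<exists>S Y y. S \<subseteq> verts Ht \<and> card S = qn - 1 \<and> card {e \<in> edges H. set (c e) \<inter> S = {}} \<le> kn \<and>
    Y \<subseteq> {y} \<and> Y \<subseteq> verts H \<and> Y \<inter> S = {} \<and> independent Ht (S \<union> Y) \<and>
    (\<forall>e\<in>edges H. set (c e) \<inter> S = {} \<longrightarrow> Y \<subseteq> e) \<and>
    (Y = {} \<longrightarrow> card {e \<in> edges H. set (c e) \<inter> S = {}} \<le> 1)"
proof -
  obtain S x Y B where T: "three_classes Ht S Y B" "card S = qn" "x \<in> S"
    and k: "card {\<epsilon> \<in> edges Ht. x \<in> \<epsilon> \<and> \<epsilon> \<subseteq> S \<union> Y} \<le> kn"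
    using optimal_classes(3)[OF bip ne] by (elim exE conjE)
  have SHt: "S \<subseteq> verts Ht" using T(1) by (auto simp: three_classes_def)
  have finS: "finite S" using SHt simple_Ht finite_subset by (auto simp: simple_graph_def)
  define S' where "S' = S - {x}"
  let ?E = "{e \<in> edges H. set (c e) \<inter> S' = {}}"
  have ex: "\<exists>\<epsilon>. \<epsilon> \<in> cycle_edges (c e) \<and> x \<in> \<epsilon> \<and> \<epsilon> \<subseteq> S \<union> Y" if e: "e \<in> ?E" for e
  proof -
    have eH: "e \<in> edges H" using e by simp
    obtain i where i: "i < length (c e)" "(c e ! i \<in> B) = (c e ! (Suc i mod length (c e)) \<in> B)"
      using odd_cycle_monochromatic[OF odd_len[OF eH], of B] by blast
    let ?\<epsilon> = "{c e ! i, c e ! (Suc i mod length (c e))}"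
    have \<epsilon>c: "?\<epsilon> \<in> cycle_edges (c e)" using i(1) by (auto simp: cycle_edges_def)
    then have \<epsilon>: "?\<epsilon> \<in> edges Ht" using eH by (auto simp: edges_Ht)
    have j: "Suc i mod length (c e) < length (c e)" using i(1) by (intro mod_less_divisor) auto
    have sub: "?\<epsilon> \<subseteq> set (c e)" using i(1) j by simp
    have v: "?\<epsilon> \<subseteq> verts Ht" using edge_verts[OF simple_Ht \<epsilon>] by blast
    have "\<not> ?\<epsilon> \<subseteq> B" using T(1) \<epsilon> unfolding three_classes_def independent_def by blast
    then have "?\<epsilon> \<inter> B = {}" using i(2) by blast
    then have SY: "?\<epsilon> \<subseteq> S \<union> Y" using v T(1) by (auto simp: three_classes_def)
    have "\<not> ?\<epsilon> \<subseteq> Y" using T(1) \<epsilon> unfolding three_classes_def independent_def by blast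
    then have "?\<epsilon> \<inter> S \<noteq> {}" using SY by blast
    moreover have "?\<epsilon> \<inter> S' = {}" using e sub by blast
    ultimately have "x \<in> ?\<epsilon>" unfolding S'_def by blast
    then show ?thesis using \<epsilon>c SY by blast
  qed
  define \<psi> where "\<psi> e = (SOME \<epsilon>. \<epsilon> \<in> cycle_edges (c e) \<and> x \<in> \<epsilon> \<and> \<epsilon> \<subseteq> S \<union> Y)" for e
  have \<psi>: "\<psi> e \<in> cycle_edges (c e) \<and> x \<in> \<psi> e \<and> \<psi> e \<subseteq> S \<union> Y" if "e \<in> ?E" for e
    unfolding \<psi>_def by (rule someI_ex[OF ex[OF that]])
  have cyc_sub: "\<epsilon> \<subseteq> set (c e) \<and> card \<epsilon> = 2" if "e \<in> edges H" and \<epsilon>c: "\<epsilon> \<in> cycle_edges (c e)" for e \<epsilon>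
  proof -
    have "\<epsilon> \<in> edges Ht" using that by (auto simp: edges_Ht)
    then have "card \<epsilon> = 2" using simple_Ht by (simp add: simple_graph_def)
    moreover obtain i where i: "i < length (c e)" "\<epsilon> = {c e ! i, c e ! (Suc i mod length (c e))}"
      using \<epsilon>c by (auto simp: cycle_edges_def)
    moreover have "Suc i mod length (c e) < length (c e)" using i(1) by (intro mod_less_divisor) auto
    ultimately show ?thesis by simp
  qed
  have card_e: "card e = 2" "finite e" if "e \<in> edges H" for e
    using that simple_H card.infinite by (fastforce simp: simple_graph_def)+
  \<comment> \<open>Two of the cycles share only vertices of \<open>H\<close>, so an edge common to both would equal two different edges of \<open>H\<close>.\<close>
  have inj: "inj_on \<psi> ?E"
  proof (rule inj_onI, rule ccontr)
    fix e e' assume e: "e \<in> ?E" "e' \<in> ?E" "\<psi> e = \<psi> e'" "e \<noteq> e'"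
    have eH: "e \<in> edges H" "e' \<in> edges H" using e by auto
    have "\<psi> e \<subseteq> set (c e)" "\<psi> e \<subseteq> set (c e')" "card (\<psi> e) = 2"
      using cyc_sub[OF eH(1)] cyc_sub[OF eH(2)] \<psi>[OF e(1)] \<psi>[OF e(2)] e(3) by auto
    then have "\<psi> e \<subseteq> e" "\<psi> e \<subseteq> e'" using sep[OF eH e(4)] meet[OF eH(1)] meet[OF eH(2)] by blast+
    then have "\<psi> e = e" "\<psi> e = e'"
      using card_subset_eq[of e "\<psi> e"] card_subset_eq[of e' "\<psi> e"] card_e[OF eH(1)] card_e[OF eH(2)]
        \<open>card (\<psi> e) = 2\<close> by simp_all
    then show False using e(4) by simp
  qed
  have "card ?E = card (\<psi> ` ?E)" using inj by (simp add: card_image)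
  also have "\<dots> \<le> card {\<epsilon> \<in> edges Ht. x \<in> \<epsilon> \<and> \<epsilon> \<subseteq> S \<union> Y}"
  proof (rule card_mono)
    show "\<psi> ` ?E \<subseteq> {\<epsilon> \<in> edges Ht. x \<in> \<epsilon> \<and> \<epsilon> \<subseteq> S \<union> Y}" using \<psi> by (auto simp: edges_Ht)
  qed (use finite_edges[OF simple_Ht] in simp)
  finally have cE: "card ?E \<le> kn" using k by simp
  have xc: "x \<in> set (c e)" if e: "e \<in> ?E" for e
    using cyc_sub[of e "\<psi> e"] \<psi>[OF e] e by blast
  have cS': "card S' = qn - 1" using T(2,3) finS by (simp add: S'_def)
  have indS: "independent Ht S" using T(1) by (simp add: three_classes_def)
  have indS': "independent Ht (S' \<union> Z)" if "Z \<subseteq> {x}" for Z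
  proof -
    have "S' \<union> Z \<subseteq> S" using that T(3) by (auto simp: S'_def)
    then show ?thesis using indS unfolding independent_def by blast
  qed
  show ?thesis
  proof (cases "x \<in> verts H")
    case True
    have "x \<in> e" if e: "e \<in> ?E" for e using xc[OF e] meet[of e] e True by blast
    then have "\<forall>e\<in>edges H. set (c e) \<inter> S' = {} \<longrightarrow> {x} \<subseteq> e" by simp
    moreover have "S' \<subseteq> verts Ht" "{x} \<inter> S' = {}" using SHt by (auto simp: S'_def)
    ultimately show ?thesis using cE cS' True indS'[of "{x}"]
      by (intro exI[of _ S'] exI[of _ "{x}"] exI[of _ x] conjI) simp_all
  next
    case False
    have "e = e'" if e: "e \<in> ?E" "e' \<in> ?E" for e e'
      using new_vertex_unique[of e e' x] xc[OF e(1)] xc[OF e(2)] e False by blast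
    then have "card ?E \<le> 1"
      using card_le_Suc0_iff_eq[of ?E] finite_edges[OF simple_H] by simp
    moreover have "S' \<subseteq> verts Ht" using SHt by (auto simp: S'_def)
    ultimately show ?thesis using cE cS' indS'[of "{}"]
      by (intro exI[of _ S'] exI[of _ "{}"] exI[of _ x] conjI) simp_all
  qed
qed

text \<open>
  Without the star, the vertex \<open>a\<close> of \<open>embed_inside_edges\<close> may be any vertex of the first pool.
\<close>

lemma embed_matching:
  fixes G :: "'b graph"
  assumes bip: "bipartite H" and G: "simple_graph G"
    and S: "S \<subseteq> verts Ht" "independent Ht S" "finite W" "card S \<le> card W" and W: "W \<subseteq> verts G"
    and F: "matching G (F1 \<union> F2)" "F1 \<inter> F2 = {}"
    and many: "card {e \<in> edges H. set (c e) \<inter> S = {}} \<le> card F1 + card F2"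
    and dis: "W \<inter> \<Union>(F1 \<union> F2) = {}"
    and N: "finite N1" "finite N2" "N1 \<subseteq> verts G" "N2 \<subseteq> verts G" "card (verts Ht) < card N1"
      "card (verts Ht) < card N2" "N1 \<inter> N2 = {}"
      "(N1 \<union> N2) \<inter> (W \<union> \<Union>(F1 \<union> F2)) = {}" "joined G N1 N2"
    and WN: "joined G W N1" "joined G W N2"
    and F1N: "joined G (\<Union>F1) N2" and F2N: "joined G (\<Union>F2) N1"
  shows "contains_copy G Ht"
proof -
  have "N1 \<noteq> {}" using N(5) by auto
  then obtain a where a: "a \<in> N1" by blast
  show ?thesis
  proof (rule embed_inside_edges[OF bip G S(1,3,4), of "{}" undefined a "{}" F1 F2 "N1 - {a}" N2])
    show "card (verts Ht) \<le> card (N1 - {a})" using N(1,5) a by (simp add: card_Diff_singleton)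
    show "(N1 - {a} \<union> N2) \<inter> ({a} \<union> W \<union> {} \<union> \<Union>(F1 \<union> F2)) = {}" using N(7,8) a by blast
    show "a \<notin> W" "a \<notin> \<Union>(F1 \<union> F2)" using N(8) a by blast+
    show "joined G (N1 - {a}) N2" "joined G W (N1 - {a})" "joined G (\<Union>F2) (N1 - {a})"
      using N(9) WN(1) F2N by (auto simp: joined_def)
  qed (use S W F many dis N WN F1N a in \<open>auto simp: joined_def\<close>)
qed

text \<open>
  The star at \<open>a\<close> and the two matchings replace one vertex of the smallest class: together they provide a break for
  each of the at most \<open>k\<close> cycles that \<open>q - 1\<close> vertices leave uncovered.
\<close>

lemma embed_star:
  fixes G :: "'b graph"
  assumes bip: "bipartite H" and ne: "edges H \<noteq> {}" and G: "simple_graph G"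
    and W: "W \<subseteq> verts G" "finite W" "qn - 1 \<le> card W" and a: "a \<in> verts G"
    and \<Lambda>: "finite \<Lambda>" "\<And>x. x \<in> \<Lambda> \<Longrightarrow> {a, x} \<in> edges G"
    and F: "matching G (F1 \<union> F2)" "F1 \<inter> F2 = {}"
    and many: "kn - 1 < card \<Lambda> + card F1 + card F2"
    and F2: "\<And>e. e \<in> F2 \<Longrightarrow> \<exists>b\<in>e. {a, b} \<in> edges G"
    and dis: "W \<inter> \<Lambda> = {}" "W \<inter> \<Union>(F1 \<union> F2) = {}" "\<Lambda> \<inter> \<Union>(F1 \<union> F2) = {}" "a \<notin> W" "a \<notin> \<Lambda>"
      "a \<notin> \<Union>(F1 \<union> F2)"
    and N: "finite N1" "finite N2" "N1 \<subseteq> verts G" "N2 \<subseteq> verts G" "card (verts Ht) < card N1"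
      "card (verts Ht) < card N2" "N1 \<inter> N2 = {}"
      "(N1 \<union> N2) \<inter> ({a} \<union> W \<union> \<Lambda> \<union> \<Union>(F1 \<union> F2)) = {}" "joined G N1 N2"
    and WN: "joined G W N1" "joined G W N2" and aN: "joined G {a} N2"
    and lN: "joined G \<Lambda> N2" and F1N: "joined G (\<Union>F1) N2" and F2N: "joined G (\<Union>F2) N1"
  shows "contains_copy G Ht"
proof -
  obtain S Y y where S: "S \<subseteq> verts Ht" "card S = qn - 1"
    "card {e \<in> edges H. set (c e) \<inter> S = {}} \<le> kn"
    and Y: "Y \<subseteq> {y}" "Y \<subseteq> verts H" "Y \<inter> S = {}" "independent Ht (S \<union> Y)"
    and yE: "\<forall>e\<in>edges H. set (c e) \<inter> S = {} \<longrightarrow> Y \<subseteq> e"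
    and Y0: "Y = {} \<longrightarrow> card {e \<in> edges H. set (c e) \<inter> S = {}} \<le> 1"
    using uncovered_cycles[OF bip ne] by (elim exE conjE)
  have SW: "card S \<le> card W" using S(2) W(3) by simp
  show ?thesis
  proof (cases "Y = {}")
    case False
    then have Yy: "Y = {y}" using Y(1) by blast
    show ?thesis
    proof (rule embed_inside_edges[OF bip G S(1) W(2) SW Y(1-4) _ W(1) a \<Lambda>(1) _ \<Lambda>(2) F _ F2 dis])
      show "card {e \<in> edges H. set (c e) \<inter> S = {}} \<le> card \<Lambda> + card F1 + card F2"
        using S(3) many by simp
      fix e z assume "e \<in> edges H" "set (c e) \<inter> S = {}" "z \<in> Y"
      then show "z \<in> e" using yE by blast
    qed (use N WN aN lN F1N F2N Yy in auto)
  next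
    case True
    have indS: "independent Ht S" using Y(4) True by simp
    have le1: "card {e \<in> edges H. set (c e) \<inter> S = {}} \<le> 1" using Y0 True by simp
    have finF: "finite F1" "finite F2" using finite_matching[OF G F(1)] by auto
    show ?thesis
    proof (cases "\<Lambda> = {}")
      case True
      then have "1 \<le> card F1 + card F2" using many by simp
      then have "card {e \<in> edges H. set (c e) \<inter> S = {}} \<le> card F1 + card F2" using le1 by linarith
      moreover have "(N1 \<union> N2) \<inter> (W \<union> \<Union>(F1 \<union> F2)) = {}" using N(8) by blast
      ultimately show ?thesis
        using embed_matching[OF bip G S(1) indS W(2) SW W(1) F _ dis(2) N(1-7) _ N(9) WN F1N F2N]
        by blast
    next
      case False
      then obtain x where x: "x \<in> \<Lambda>" by blast
      have "matching G ({{a, x}} \<union> {})" using \<Lambda>(2)[OF x] by (simp add: matching_def)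
      then show ?thesis
      proof (rule embed_matching[where ?F1.0 = "{{a, x}}" and ?F2.0 = "{}" and ?N1.0 = N1 and ?N2.0 = N2,
            OF bip G S(1) indS W(2) SW W(1)])
        show "joined G (\<Union>{{a, x}}) N2" using aN lN x by (simp add: joined_def)
        show "W \<inter> \<Union>({{a, x}} \<union> {}) = {}" using dis x by auto
        show "(N1 \<union> N2) \<inter> (W \<union> \<Union>({{a, x}} \<union> {})) = {}" using N(8) x by auto
      qed (use le1 N WN in \<open>auto simp: joined_def\<close>)
    qed
  qed
qed

end

section \<open>Dense graphs without a complete tripartite subgraph\<close>

text \<open>
  No complete tripartite subgraph with \<open>h\<close> vertices in each class; the classes are disjoint since they are pairwise joined.
\<close>

definition triple_free :: "'a graph \<Rightarrow> nat \<Rightarrow> bool" where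
  "triple_free G h \<longleftrightarrow> \<not> (\<exists>A B C. A \<subseteq> verts G \<and> B \<subseteq> verts G \<and> C \<subseteq> verts G \<and>
     joined G A B \<and> joined G A C \<and> joined G B C \<and> card A = h \<and> card B = h \<and> card C = h)"

lemma ex_subset_card:
  assumes "n \<le> card S" shows "\<exists>T. T \<subseteq> S \<and> card T = n \<and> finite T"
  using obtain_subset_with_card_n[OF assms] by metis

lemma joined_sym: "joined G A B \<Longrightarrow> joined G B A"
proof -
  assume a: "joined G A B"
  show "joined G B A" unfolding joined_def
  proof (intro ballI)
    fix x y assume "x \<in> B" "y \<in> A"
    then have "{y, x} \<in> edges G" using a by (simp add: joined_def)
    then show "{x, y} \<in> edges G" by (simp add: insert_commute)
  qed
qed

lemma joined_mono: "joined G A B \<Longrightarrow> A' \<subseteq> A \<Longrightarrow> B' \<subseteq> B \<Longrightarrow> joined G A' B'"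
  unfolding joined_def by blast

lemma joined_disjoint: "simple_graph G \<Longrightarrow> joined G A B \<Longrightarrow> A \<inter> B = {}"
  unfolding joined_def using edge_verts(3) by fast

lemma triple_freeD:
  assumes "triple_free G h" "A \<subseteq> verts G" "B \<subseteq> verts G" "C \<subseteq> verts G"
    "joined G A B" "joined G A C" "joined G B C" "h \<le> card A" "h \<le> card B" "h \<le> card C"
  shows False
proof -
  obtain A' where A: "A' \<subseteq> A" "card A' = h" using obtain_subset_with_card_n[OF assms(8)] by auto
  obtain B' where B: "B' \<subseteq> B" "card B' = h" using obtain_subset_with_card_n[OF assms(9)] by auto
  obtain C' where C: "C' \<subseteq> C" "card C' = h" using obtain_subset_with_card_n[OF assms(10)] by auto
  have "A' \<subseteq> verts G" "B' \<subseteq> verts G" "C' \<subseteq> verts G" using A B C assms by auto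
  moreover have "joined G A' B'" "joined G A' C'" "joined G B' C'"
    using joined_mono[OF assms(5) A(1) B(1)] joined_mono[OF assms(6) A(1) C(1)]
      joined_mono[OF assms(7) B(1) C(1)] by auto
  ultimately show False using assms(1) A(2) B(2) C(2) unfolding triple_free_def by blast
qed

text \<open>
  There are only \<open>2 ^ card A\<close> possible neighbourhoods in \<open>A\<close>.
\<close>

lemma pigeonhole_nbrs:
  assumes "finite A" "finite X" "X \<noteq> {}" and s: "\<forall>x\<in>X. s \<le> card (nbrs G x A)"
  shows "\<exists>A' X'. A' \<subseteq> A \<and> card A' = s \<and> X' \<subseteq> X \<and> joined G A' X' \<and> card X \<le> card X' * 2 ^ card A"
proof -
  let ?f = "\<lambda>t. {x \<in> X. nbrs G x A = t}"
  have "(\<Sum>t\<in>Pow A. \<Sum>x\<in>?f t. 1) = (\<Sum>x\<in>X. (1::nat))"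
    using assms(1,2) by (intro sum.group) (auto simp: nbrs_def)
  then have sum: "(\<Sum>t\<in>Pow A. card (?f t)) = card X" by simp
  have "\<exists>t\<in>Pow A. card X \<le> card (?f t) * card (Pow A)"
  proof (rule ccontr)
    assume "\<not> ?thesis"
    then have "(\<Sum>t\<in>Pow A. card (?f t) * card (Pow A)) < (\<Sum>t\<in>Pow A. card X)"
      using assms(1) by (intro sum_strict_mono) (auto simp: not_le)
    then have "(\<Sum>t\<in>Pow A. card (?f t)) * card (Pow A) < card (Pow A) * card X"
      unfolding sum_distrib_right by simp
    then show False unfolding sum by simp
  qed
  then obtain t where t: "card X \<le> card (?f t) * 2 ^ card A" using assms(1) by (auto simp: card_Pow)
  have "card X > 0" using assms(2,3) by (simp add: card_gt_0_iff)
  then have "?f t \<noteq> {}" using t by (metis card.empty leD mult_0)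
  then obtain x where "x \<in> X" "nbrs G x A = t" by blast
  then have "s \<le> card t" using s by blast
  then obtain A' where A': "A' \<subseteq> t" "card A' = s" using obtain_subset_with_card_n[of s t] by auto
  have "t \<subseteq> A" using \<open>nbrs G x A = t\<close> nbrs_subset[of G x A] by simp
  moreover have "joined G A' (?f t)"
    unfolding joined_def
  proof (intro ballI)
    fix a x assume "a \<in> A'" "x \<in> ?f t"
    then have "a \<in> nbrs G x A" using A'(1) by auto
    then show "{a, x} \<in> edges G" by (simp add: nbrs_def insert_commute)
  qed
  moreover have "A' \<subseteq> A" using A'(1) \<open>t \<subseteq> A\<close> by blast
  ultimately show ?thesis using A'(2) t by (intro exI[of _ A'] exI[of _ "?f t"] conjI) simp_all
qed

text \<open>
  Double counting of the edges between \<open>A\<close> and \<open>X\<close> gives many vertices of \<open>X\<close> with at least \<open>s\<close>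
  neighbours in \<open>A\<close>; the pigeonhole principle then selects the same \<open>s\<close> neighbours for a positive proportion of them.
  This is a linear form of the Kovari-Sos-Turan theorem.
\<close>

lemma many_common_nbrs:
  fixes c :: real
  assumes fin: "finite A" "finite X" and deg: "\<forall>v\<in>A. c * n \<le> card (nbrs G v X)"
    and X: "card X \<le> n" and s: "1 \<le> s" "1 \<le> n" and c: "2 * real s \<le> c * card A"
  shows "\<exists>A' X'. A' \<subseteq> A \<and> card A' = s \<and> X' \<subseteq> X \<and> joined G A' X' \<and>
    s * n \<le> card X' * (card A * 2 ^ card A)"
proof -
  define a where "a = card A"
  define X1 where "X1 = {x \<in> X. s \<le> card (nbrs G x A)}"
  have fX1: "finite X1" using fin by (simp add: X1_def)
  have "c * n * a = (\<Sum>v\<in>A. c * n)" by (simp add: a_def)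
  also have "\<dots> \<le> (\<Sum>v\<in>A. real (card (nbrs G v X)))" using deg by (intro sum_mono) simp
  also have "\<dots> = real (edges_btw G A X)" by (simp add: edges_btw_def)
  also have "edges_btw G A X = (\<Sum>x\<in>X. card (nbrs G x A))"
    using edges_btw_swap[OF fin] by (simp add: edges_btw_def)
  also have "\<dots> \<le> (\<Sum>x\<in>X. (if x \<in> X1 then a else 0) + s)"
    using card_nbrs_le[OF fin(1)] by (intro sum_mono) (auto simp: X1_def a_def trans_le_add1)
  also have "\<dots> = a * card X1 + s * card X"
    using fin by (simp add: sum.distrib sum.If_cases X1_def Int_def)
  also have "\<dots> \<le> a * card X1 + s * n" using X by simp
  finally have 1: "c * n * a \<le> a * card X1 + s * n" by simp
  have "2 * real s * n \<le> c * a * n" using c unfolding a_def by (intro mult_right_mono) auto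
  then have "real (s * n) \<le> real (a * card X1)" using 1 by (simp add: algebra_simps)
  then have 2: "s * n \<le> a * card X1" using of_nat_le_iff by blast
  then have X1: "X1 \<noteq> {}" using s by auto
  have sX: "\<forall>x\<in>X1. s \<le> card (nbrs G x A)" by (simp add: X1_def)
  obtain A' X' where A: "A' \<subseteq> A" "card A' = s" "X' \<subseteq> X1" "joined G A' X'"
    "card X1 \<le> card X' * 2 ^ card A"
    using pigeonhole_nbrs[OF fin(1) fX1 X1 sX] by (elim exE conjE)
  have "s * n \<le> a * (card X' * 2 ^ card A)"
    using 2 A(5) by (meson le_trans mult_le_mono2)
  then show ?thesis using A by (intro exI[of _ A'] exI[of _ X'])
    (auto simp: X1_def a_def mult.commute mult.left_commute)
qed

lemma common_nbrs_card:
  fixes d :: real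
  assumes fin: "finite T" "finite A" and d: "\<And>v. v \<in> A \<Longrightarrow> real (card (T - nbrs G v T)) \<le> d"
  shows "real (card T) - card A * d \<le> card {t \<in> T. \<forall>v\<in>A. {v, t} \<in> edges G}"
  using fin(2) d
proof (induction A rule: finite_induct)
  case (insert v A)
  let ?K = "{t \<in> T. \<forall>v\<in>A. {v, t} \<in> edges G}"
  have "{t \<in> T. \<forall>w\<in>insert v A. {w, t} \<in> edges G} = ?K - (T - nbrs G v T)"
    by (auto simp: nbrs_def)
  moreover have "card ?K - card (T - nbrs G v T) \<le> card (?K - (T - nbrs G v T))"
    using fin(1) by (intro diff_card_le_card_Diff) auto
  ultimately have "real (card ?K) - d \<le> card {t \<in> T. \<forall>w\<in>insert v A. {w, t} \<in> edges G}"
    using insert.prems[of v] by simp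
  then show ?case using insert by (simp add: algebra_simps)
qed simp

text \<open>
  Applying the pigeonhole principle to \<open>T1\<close> and then to \<open>T2\<close>, too many such vertices would include
  \<open>h\<close> that are joined to the same \<open>h\<close> vertices of \<open>T1\<close> and the same \<open>h\<close> vertices of \<open>T2\<close>.
\<close>

lemma large_codegree_bound:
  assumes G: "simple_graph G" and tf: "triple_free G h" and h: "1 \<le> h"
    and T: "T1 \<subseteq> verts G" "T2 \<subseteq> verts G" "joined G T1 T2" and U: "U \<subseteq> verts G"
    and X: "X \<subseteq> {v \<in> U. h \<le> card (nbrs G v T1) \<and> h \<le> card (nbrs G v T2)}"
  shows "card X \<le> h * (2 ^ card T1 * 2 ^ card T2)"
proof (cases "X = {}")
  case False
  have fV: "finite (verts G)" using G by (simp add: simple_graph_def)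
  have "X \<subseteq> verts G" using X U by auto
  then have fin: "finite T1" "finite T2" "finite X"
    using T(1,2) fV by (auto intro: finite_subset)
  have hX: "\<forall>v\<in>X. h \<le> card (nbrs G v T1)" "\<forall>v\<in>X. h \<le> card (nbrs G v T2)" using X by auto
  obtain A X1 where A: "A \<subseteq> T1" "card A = h" "X1 \<subseteq> X" "joined G A X1" "card X \<le> card X1 * 2 ^ card T1"
    using pigeonhole_nbrs[OF fin(1,3) False hX(1)] by (elim exE conjE)
  have X1: "X1 \<noteq> {}" "finite X1" using A(3,5) False fin(3) finite_subset
    by (auto simp: card_eq_0_iff)
  have hX1: "\<forall>v\<in>X1. h \<le> card (nbrs G v T2)" using hX(2) A(3) by auto
  obtain B X2 where B: "B \<subseteq> T2" "card B = h" "X2 \<subseteq> X1" "joined G B X2" "card X1 \<le> card X2 * 2 ^ card T2"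
    using pigeonhole_nbrs[OF fin(2) X1(2,1) hX1] by (elim exE conjE)
  have "\<not> h \<le> card X2"
  proof
    assume "h \<le> card X2"
    moreover have "joined G A B" using joined_mono[OF T(3) A(1) B(1)] .
    moreover have "joined G A X2" using joined_mono[OF A(4) order_refl B(3)] .
    moreover have "A \<subseteq> verts G" "B \<subseteq> verts G" "X2 \<subseteq> verts G" using A B T U X by blast+
    ultimately show False using triple_freeD[OF tf, of A B X2] A(2) B(2,4) by simp
  qed
  then have "card X2 \<le> h" by simp
  have "card X \<le> card X1 * 2 ^ card T1" by (rule A(5))
  also have "\<dots> \<le> card X2 * 2 ^ card T2 * 2 ^ card T1" using B(5) by simp
  also have "\<dots> \<le> h * 2 ^ card T2 * 2 ^ card T1" using \<open>card X2 \<le> h\<close> by simp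
  finally show ?thesis by (simp add: mult.commute mult.left_commute)
qed simp

lemma complete_pair:
  assumes G: "simple_graph G" and U: "U \<subseteq> verts G" and s: "1 \<le> s" and m: "s * (8 * 2 ^ (8 * s)) \<le> card U"
    and deg: "\<forall>v\<in>U. real (card U) / 4 \<le> card (nbrs G v U)"
  shows "\<exists>T1 T2. T1 \<subseteq> U \<and> T2 \<subseteq> U \<and> card T1 = s \<and> card T2 = s \<and> joined G T1 T2"
proof -
  have finU: "finite U" using G U finite_subset by (auto simp: simple_graph_def)
  have "1 \<le> (2::nat) ^ (8 * s)" by simp
  then have "8 * s \<le> s * (8 * 2 ^ (8 * s))" by (metis mult.commute mult.left_commute mult_le_mono2 nat_mult_1_right)
  then have "8 * s \<le> card U" using m by (rule le_trans)
  from ex_subset_card[OF this]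
  obtain A where A: "A \<subseteq> U" "card A = 8 * s" "finite A" by (elim exE conjE)
  have "1 \<le> card U" using \<open>8 * s \<le> card U\<close> s by simp
  have degA: "\<forall>v\<in>A. 1/4 * real (card U) \<le> card (nbrs G v U)"
    using deg A(1) by auto
  have cA: "2 * real s \<le> 1/4 * real (card A)" by (simp add: A(2))
  obtain T1 X where T: "T1 \<subseteq> A" "card T1 = s" "X \<subseteq> U" "joined G T1 X"
    "s * card U \<le> card X * (card A * 2 ^ card A)"
    using many_common_nbrs[OF A(3) finU degA order_refl s \<open>1 \<le> card U\<close> cA] by (elim exE conjE)
  have "s * card U \<le> s * (card X * (8 * 2 ^ (8 * s)))" using T(5) A(2) by (simp add: algebra_simps)
  then have "card U \<le> card X * (8 * 2 ^ (8 * s))" using s by simp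
  then have "s * (8 * 2 ^ (8 * s)) \<le> card X * (8 * 2 ^ (8 * s))" using m by (rule order_trans[rotated])
  then have "s \<le> card X" by simp
  from ex_subset_card[OF this] obtain T2 where "T2 \<subseteq> X" "card T2 = s" by (elim exE conjE)
  then show ?thesis using T A(1) joined_mono[OF T(4)] by (intro exI[of _ T1] exI[of _ T2]) auto
qed

text \<open>
  Counted from the other side, the edges leaving a complete pair show how often the vertices of \<open>U\<close> see it.
\<close>

lemma degree_sum_pair:
  fixes \<delta> :: real
  assumes G: "simple_graph G" and U: "U \<subseteq> verts G" and T: "T1 \<subseteq> U" "T2 \<subseteq> U" "card T1 = s" "card T2 = s"
      "joined G T1 T2"
    and deg: "\<And>v. v \<in> U \<Longrightarrow> \<delta> \<le> card (nbrs G v U)"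
  shows "2 * s * \<delta> \<le> (\<Sum>v\<in>U. real (card (nbrs G v T1) + card (nbrs G v T2)))"
proof -
  have finU: "finite U" using G U finite_subset by (auto simp: simple_graph_def)
  have fin: "finite T1" "finite T2" using T finU finite_subset by auto
  have dis: "T1 \<inter> T2 = {}" using joined_disjoint[OF G T(5)] .
  have "2 * s * \<delta> = (\<Sum>v\<in>T1\<union>T2. \<delta>)" using fin dis T by (simp add: card_Un_disjoint)
  also have "\<dots> \<le> (\<Sum>v\<in>T1\<union>T2. real (card (nbrs G v U)))"
    using deg T by (intro sum_mono) auto
  also have "\<dots> = real (edges_btw G (T1 \<union> T2) U)" by (simp add: edges_btw_def)
  also have "edges_btw G (T1 \<union> T2) U = (\<Sum>v\<in>U. card (nbrs G v (T1 \<union> T2)))"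
    using edges_btw_swap[of "T1 \<union> T2" U G] fin finU by (simp add: edges_btw_def)
  also have "\<dots> = (\<Sum>v\<in>U. card (nbrs G v T1) + card (nbrs G v T2))"
    using card_nbrs_Un[OF fin dis] by simp
  finally show ?thesis by simp
qed

text \<open>
  On a complete pair \<open>T1\<close>, \<open>T2\<close> the degree condition makes the average number of neighbours in the pair
  at least \<open>(1 + 2 * \<delta>) * s\<close>. A vertex with fewer than \<open>h\<close> neighbours in one of the two sets has at most
  \<open>s + h\<close>, so many vertices see at least \<open>h\<close> on both, which is impossible.
\<close>

lemma min_degree_above_half:
  fixes \<delta> :: real
  assumes "\<delta> > 0" "1 \<le> h"
  shows "\<exists>m0. \<forall>(G::'a graph) U. simple_graph G \<longrightarrow> triple_free G h \<longrightarrow> U \<subseteq> verts G \<longrightarrow> m0 \<le> card U \<longrightarrow>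
    (\<exists>v\<in>U. real (card (nbrs G v U)) < (1/2 + \<delta>) * card U)"
proof -
  obtain s where s0: "real h / \<delta> < real s" using reals_Archimedean2 by blast
  have s: "h \<le> \<delta> * s" "1 \<le> s"
  proof -
    show "h \<le> \<delta> * s" using s0 assms(1) by (simp add: field_simps)
    have "0 < real s" using s0 assms by (meson divide_nonneg_pos le_less_trans of_nat_0_le_iff)
    then show "1 \<le> s" by simp
  qed
  \<comment> \<open>The bound of \<open>large_codegree_bound\<close> for a pair of size \<open>s\<close>.\<close>
  define K where "K = h * (2 ^ s * 2 ^ s)"
  obtain m1 where m1: "2 * real K / \<delta> < real m1" using reals_Archimedean2 by blast
  define m0 where "m0 = max m1 (s * (8 * 2 ^ (8 * s)))"
  have bad: False if G: "simple_graph G" and tf: "triple_free G h" and U: "U \<subseteq> verts G" and m: "m0 \<le> card U"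
    and deg: "\<And>v. v \<in> U \<Longrightarrow> (1/2 + \<delta>) * card U \<le> card (nbrs G v U)" for G :: "'a graph" and U
  proof -
    have finU: "finite U" using G U finite_subset by (auto simp: simple_graph_def)
    have "real (card U) / 4 \<le> (1/2 + \<delta>) * card U" using assms(1) by (simp add: field_simps)
    then have "real (card U) / 4 \<le> card (nbrs G v U)" if "v \<in> U" for v using deg[OF that] by linarith
    then have deg4: "\<forall>v\<in>U. real (card U) / 4 \<le> card (nbrs G v U)" by blast
    have m8: "s * (8 * 2 ^ (8 * s)) \<le> card U" using m by (simp add: m0_def)
    obtain T1 T2 where T: "T1 \<subseteq> U" "T2 \<subseteq> U" "card T1 = s" "card T2 = s" "joined G T1 T2"
      using complete_pair[OF G U s(2) m8 deg4] by (elim exE conjE)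
    have fin: "finite T1" "finite T2" using T finU finite_subset by auto
    define X where "X = {v \<in> U. h \<le> card (nbrs G v T1) \<and> h \<le> card (nbrs G v T2)}"
    have "card X \<le> h * (2 ^ card T1 * 2 ^ card T2)"
      by (rule large_codegree_bound[OF G tf assms(2) _ _ T(5) U]) (use T U in \<open>auto simp: X_def\<close>)
    then have XK: "card X \<le> K" unfolding T(3,4) K_def .
    have "2 * s * ((1/2 + \<delta>) * card U) \<le> (\<Sum>v\<in>U. real (card (nbrs G v T1) + card (nbrs G v T2)))"
      using degree_sum_pair[OF G U T deg] by simp
    also have "\<dots> \<le> (\<Sum>v\<in>U. real (s + h) + (if v \<in> X then real (2 * s) else 0))"
    proof (rule sum_mono)
      fix v assume v: "v \<in> U"
      have "card (nbrs G v T1) \<le> s" "card (nbrs G v T2) \<le> s"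
        using card_nbrs_le[OF fin(1)] card_nbrs_le[OF fin(2)] T by metis+
      moreover have "v \<in> X \<or> card (nbrs G v T1) < h \<or> card (nbrs G v T2) < h" using v by (auto simp: X_def)
      ultimately show "real (card (nbrs G v T1) + card (nbrs G v T2))
          \<le> real (s + h) + (if v \<in> X then real (2 * s) else 0)" by auto
    qed
    also have "\<dots> = real (s + h) * card U + 2 * s * card X"
      using finU by (simp add: sum.distrib sum.If_cases X_def Int_def)
    also have "\<dots> \<le> real (s + h) * card U + 2 * s * K" using XK by (simp add: mult_left_mono)
    finally have "2 * real s * \<delta> * card U \<le> real h * card U + 2 * real s * K" by (simp add: algebra_simps)
    also have "real h * card U \<le> \<delta> * s * card U" using s(1) by (intro mult_right_mono) auto
    finally have "s * (\<delta> * card U) \<le> s * (2 * K)" by (simp add: algebra_simps)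
    then have "\<delta> * card U \<le> 2 * K" using s(2) by simp
    moreover have "2 * real K < \<delta> * real m1" using m1 assms(1) by (simp add: field_simps)
    moreover have "\<delta> * real m1 \<le> \<delta> * card U" using m assms(1) by (simp add: m0_def)
    ultimately show False by linarith
  qed
  show ?thesis
  proof (intro exI[of _ m0] allI impI, rule ccontr)
    fix G :: "'a graph" and U
    assume G: "simple_graph G" "triple_free G h" "U \<subseteq> verts G" "m0 \<le> card U"
      and no: "\<not> (\<exists>v\<in>U. real (card (nbrs G v U)) < (1/2 + \<delta>) * card U)"
    have "(1/2 + \<delta>) * card U \<le> card (nbrs G v U)" if "v \<in> U" for v
      using no that by (meson not_less)
    then show False by (rule bad[OF G])
  qed
qed

text \<open>
  Take \<open>U\<close> to maximise \<open>edges_in G U - \<alpha> * (card U ^ 2 + card U)\<close>. Deleting a vertex \<open>v\<close> of \<open>U\<close> lowers the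
  second term by \<open>2 * \<alpha> * card U\<close>, so the degree of \<open>v\<close> in \<open>U\<close> is at least that.
\<close>

lemma dense_core:
  fixes \<alpha> :: real
  assumes G: "simple_graph G" and V: "V0 \<subseteq> verts G" and \<alpha>: "0 \<le> \<alpha>"
  shows "\<exists>U\<subseteq>V0. edges_in G V0 - \<alpha> * (real (card V0)^2 + card V0) \<le> edges_in G U - \<alpha> * (real (card U)^2 + card U)
    \<and> (\<forall>v\<in>U. 2 * \<alpha> * card U \<le> card (nbrs G v U))"
proof -
  define \<Phi> where "\<Phi> U = real (edges_in G U) - \<alpha> * (real (card U)^2 + card U)" for U
  have finV: "finite V0" using G V finite_subset by (auto simp: simple_graph_def)
  have "finite (\<Phi> ` Pow V0)" "\<Phi> ` Pow V0 \<noteq> {}" using finV by auto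
  then have "Max (\<Phi> ` Pow V0) \<in> \<Phi> ` Pow V0" by (rule Max_in)
  then obtain U where U: "U \<subseteq> V0" "\<Phi> U = Max (\<Phi> ` Pow V0)" by auto
  have best: "\<Phi> U' \<le> \<Phi> U" if "U' \<subseteq> V0" for U'
    unfolding U(2) using that finV by (intro Max_ge) auto
  have "2 * \<alpha> * card U \<le> card (nbrs G v U)" if v: "v \<in> U" for v
  proof -
    have finU: "finite U" using U finV finite_subset by auto
    have ie: "edges_in G (insert v (U - {v})) = edges_in G (U - {v}) + card (nbrs G v (U - {v}))"
      using finU by (intro edges_in_insert[OF G]) auto
    have iv: "insert v (U - {v}) = U" using v by auto
    have nv: "nbrs G v (U - {v}) = nbrs G v U"
    proof -
      have "nbrs G v (U - {v}) = nbrs G v U - {v}" unfolding nbrs_def by (rule set_eqI) (simp add: conj_ac)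
      then show ?thesis using not_self_nbr[OF G, of v U] by simp
    qed
    have e: "edges_in G U = edges_in G (U - {v}) + card (nbrs G v U)" using ie unfolding iv nv .
    have "card U = Suc (card (U - {v}))" using card_Suc_Diff1[OF finU v] by simp
    then have c: "real (card U) = real (card (U - {v})) + 1" by simp
    have "\<Phi> (U - {v}) \<le> \<Phi> U" using U(1) by (intro best) auto
    then show ?thesis unfolding \<Phi>_def e c by (simp add: algebra_simps power2_eq_square)
  qed
  then show ?thesis using best[of V0] U(1) by (auto simp: \<Phi>_def)
qed

text \<open>
  A graph with more edges would have a core of minimum degree above half of its order. The core is large because its
  number of edges is at least that much above the quadratic term, while a small set has few edges.
\<close>

lemma quarter_density:
  fixes \<epsilon> :: real
  assumes "\<epsilon> > 0" "1 \<le> h"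
  shows "\<exists>n0. \<forall>(G::'a graph) V0. simple_graph G \<longrightarrow> triple_free G h \<longrightarrow> V0 \<subseteq> verts G \<longrightarrow> n0 \<le> card V0 \<longrightarrow>
    real (edges_in G V0) \<le> (1/4 + \<epsilon>) * real (card V0)^2"
proof -
  obtain m0 where m0: "\<forall>(G::'a graph) U. simple_graph G \<longrightarrow> triple_free G h \<longrightarrow> U \<subseteq> verts G \<longrightarrow> m0 \<le> card U \<longrightarrow>
    (\<exists>v\<in>U. real (card (nbrs G v U)) < (1/2 + \<epsilon>) * card U)"
    using min_degree_above_half[where ?'a = 'a, OF assms] by (rule exE)
  define \<alpha> where "\<alpha> = 1/4 + \<epsilon>/2"
  obtain n0 where n0: "(\<alpha> + real m0 * m0 + 1) * 2 / \<epsilon> < real n0" using reals_Archimedean2 by blast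
  have "real (edges_in G V0) \<le> (1/4 + \<epsilon>) * real (card V0)^2"
    if G: "simple_graph G" and tf: "triple_free G h" and V: "V0 \<subseteq> verts G" and n: "max n0 1 \<le> card V0"
    for G :: "'a graph" and V0
  proof (rule ccontr)
    let ?n = "real (card V0)"
    assume "\<not> ?thesis"
    then have big: "(1/4 + \<epsilon>) * ?n^2 < edges_in G V0" by simp
    have "0 \<le> \<alpha>" using assms(1) by (simp add: \<alpha>_def)
    obtain U where U0: "U \<subseteq> V0"
      "edges_in G V0 - \<alpha> * (?n^2 + ?n) \<le> edges_in G U - \<alpha> * (real (card U)^2 + card U)"
      "\<forall>v\<in>U. 2 * \<alpha> * card U \<le> card (nbrs G v U)"
      using dense_core[OF G V \<open>0 \<le> \<alpha>\<close>] by (elim exE conjE)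
    note U = U0(1,2) U0(3)[rule_format]
    have "\<not> m0 \<le> card U"
    proof
      assume "m0 \<le> card U"
      then have "\<exists>v\<in>U. real (card (nbrs G v U)) < (1/2 + \<epsilon>) * card U"
        using m0[rule_format, OF G tf, of U] U(1) V by simp
      then obtain v where v: "v \<in> U" "card (nbrs G v U) < (1/2 + \<epsilon>) * card U" by (elim bexE)
      moreover have "2 * \<alpha> * card U = (1/2 + \<epsilon>) * card U" by (simp add: \<alpha>_def algebra_simps)
      ultimately show False using U(3)[OF v(1)] by linarith
    qed
    then have Um: "card U \<le> m0" by simp
    have "finite (verts G)" using G by (simp add: simple_graph_def)
    then have "finite U" using U(1) V by (meson finite_subset subset_trans)
    then have "2 * edges_in G U \<le> card U * card U" by (rule edges_in_le[OF G])
    also have "\<dots> \<le> m0 * m0" using Um by (intro mult_le_mono)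
    finally have "edges_in G U \<le> m0 * m0" by simp
    then have "real (edges_in G U) \<le> real m0 * m0" by (metis of_nat_le_iff of_nat_mult)
    moreover have "0 \<le> \<alpha> * (real (card U)^2 + card U)" using assms(1) by (simp add: \<alpha>_def)
    ultimately have "edges_in G V0 - \<alpha> * (?n^2 + ?n) \<le> real m0 * m0" using U(2) by linarith
    then have "(1/4 + \<epsilon>) * ?n^2 - \<alpha> * (?n^2 + ?n) < real m0 * m0" using big by linarith
    then have "?n * (\<epsilon>/2 * ?n - \<alpha>) < real m0 * m0"
      by (simp add: \<alpha>_def algebra_simps power2_eq_square)
    moreover have "real m0 * m0 + 1 \<le> \<epsilon>/2 * ?n - \<alpha>"
    proof -
      have "(\<alpha> + real m0 * m0 + 1) \<le> \<epsilon>/2 * real n0" using n0 assms(1) by (simp add: field_simps)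
      also have "\<dots> \<le> \<epsilon>/2 * ?n" using n assms(1) by (intro mult_left_mono) auto
      finally show ?thesis by simp
    qed
    moreover have "1 * (real m0 * m0 + 1) \<le> ?n * (\<epsilon>/2 * ?n - \<alpha>)"
      using calculation(2) n by (intro mult_mono) auto
    ultimately have "real m0 * real m0 + 1 < real m0 * real m0" by (simp only: mult_1 le_less_trans)
    then show False by simp
  qed
  then show ?thesis by (intro exI[of _ "max n0 1"]) simp
qed

text \<open>
  Many vertices with many neighbours inside \<open>V1\<close> produce a complete pair inside \<open>V1\<close>, and almost all of
  \<open>T\<close> is joined to the boundedly many vertices of this pair.
\<close>

lemma few_large_inner_degrees:
  fixes \<gamma> :: real
  assumes G: "simple_graph G" and tf: "triple_free G h" and h: "1 \<le> h" and \<gamma>: "0 < \<gamma>"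
    and T: "T \<subseteq> verts G" "4 * h \<le> card T"
    and V: "V1 \<subseteq> verts G" "card V1 \<le> m" and m: "a * 2 ^ a \<le> m" "1 \<le> m" and a: "2 * real h \<le> \<gamma> * a"
    and miss: "\<forall>v\<in>V1. real (card (T - nbrs G v T)) \<le> card T / (4 * real h)"
  shows "card {v \<in> V1. \<gamma> * m \<le> card (nbrs G v V1)} < a"
proof (rule ccontr)
  assume "\<not> ?thesis"
  then have "a \<le> card {v \<in> V1. \<gamma> * m \<le> card (nbrs G v V1)}" by simp
  from ex_subset_card[OF this]
  obtain A where A: "A \<subseteq> {v \<in> V1. \<gamma> * m \<le> card (nbrs G v V1)}" "card A = a" "finite A"
    by (elim exE conjE)
  have fV: "finite (verts G)" using G by (simp add: simple_graph_def)
  have fin: "finite V1" "finite T" using T V fV by (auto intro: finite_subset)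
  have degA: "\<forall>v\<in>A. \<gamma> * m \<le> card (nbrs G v V1)" using A(1) by auto
  have cA: "2 * real h \<le> \<gamma> * card A" using a A(2) by simp
  obtain A' X where AX: "A' \<subseteq> A" "card A' = h" "X \<subseteq> V1" "joined G A' X"
    "h * m \<le> card X * (card A * 2 ^ card A)"
    using many_common_nbrs[OF A(3) fin(1) degA V(2) h m(2) cA] by (elim exE conjE)
  have apos: "0 < a * 2 ^ a" using a h \<gamma> by (cases "a = 0") auto
  have "h * (a * 2 ^ a) \<le> h * m" using m(1) by simp
  also have "\<dots> \<le> card X * (a * 2 ^ a)" using AX(5) A(2) by simp
  finally have "h \<le> card X" using apos by simp
  from ex_subset_card[OF this]
  obtain X' where X': "X' \<subseteq> X" "card X' = h" "finite X'" by (elim exE conjE)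
  have AV: "A' \<subseteq> V1" using AX(1) A(1) by auto
  define C where "C = {t \<in> T. \<forall>v\<in>A' \<union> X'. {v, t} \<in> edges G}"
  have finA': "finite A'" using AV fin(1) by (rule finite_subset)
  have "card (A' \<union> X') \<le> 2 * h" using card_Un_le[of A' X'] AX(2) X'(2) by simp
  moreover have "real (card T) - card (A' \<union> X') * (card T / (4 * real h)) \<le> card C"
    unfolding C_def by (rule common_nbrs_card) (use fin finA' X' AV AX(3) miss in auto)
  moreover have "real (card (A' \<union> X')) * (card T / (4 * real h)) \<le> (2 * h) * (card T / (4 * real h))"
    using calculation(1) by (intro mult_right_mono) auto
  moreover have "(2 * real h) * (card T / (4 * real h)) = card T / 2" using h by simp
  ultimately have "real (card T) / 2 \<le> card C" by linarith
  then have "h \<le> card C" using T(2) by linarith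
  moreover have "joined G A' C" "joined G X' C" by (auto simp: joined_def C_def)
  moreover have "joined G A' X'" using joined_mono[OF AX(4) order_refl X'(1)] .
  moreover have "A' \<subseteq> verts G" "X' \<subseteq> verts G" "C \<subseteq> verts G"
    using AV V(1) X'(1) AX(3) T(1) by (auto simp: C_def)
  ultimately show False using triple_freeD[OF tf, of A' X' C] AX(2) X'(2) by simp
qed

definition near_bipartition :: "'a graph \<Rightarrow> real \<Rightarrow> real \<Rightarrow> 'a set \<Rightarrow> 'a set \<Rightarrow> bool" where
  "near_bipartition G \<epsilon> m V1 V2 \<longleftrightarrow> V1 \<inter> V2 = {} \<and> (1/2 - \<epsilon>) * m \<le> card V1 \<and> (1/2 - \<epsilon>) * m \<le> card V2 \<and>
    (\<forall>v\<in>V1. real (card (V2 - nbrs G v V2)) \<le> \<epsilon> * m) \<and>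
    (\<forall>v\<in>V2. real (card (V1 - nbrs G v V1)) \<le> \<epsilon> * m)"

text \<open>
  A vertex of \<open>V1\<close> has few neighbours in \<open>V1\<close>, hence almost \<open>m/2\<close> in \<open>V2\<close>. So \<open>V2\<close> is large, by symmetry so is
  \<open>V1\<close>, and neither can then be much larger than \<open>m/2\<close>.
\<close>

lemma near_bipartition_of_degrees:
  fixes \<gamma> :: real
  assumes G: "simple_graph G" and U: "U \<subseteq> verts G" "m = card U" and m: "1 \<le> m"
    and \<gamma>: "0 < \<gamma>" "\<gamma> \<le> 1/40"
    and V: "V1 \<subseteq> U" "V2 \<subseteq> U" "V1 \<inter> V2 = {}" and junk: "card (U - (V1 \<union> V2)) \<le> \<gamma> * m"
    and deg: "\<forall>v\<in>U. (1/2 - \<gamma>) * m \<le> card (nbrs G v U)"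
    and inner: "\<forall>v\<in>V1. card (nbrs G v V1) \<le> \<gamma> * m" "\<forall>v\<in>V2. card (nbrs G v V2) \<le> \<gamma> * m"
  shows "near_bipartition G (6 * \<gamma>) m V1 V2"
proof -
  have fV: "finite (verts G)" using G by (simp add: simple_graph_def)
  have fin: "finite U" using U(1) fV by (rule finite_subset)
  have fin': "finite V1" "finite V2" using V(1,2) fin by (auto intro: finite_subset)
  have Usplit: "U = V1 \<union> V2 \<union> (U - (V1 \<union> V2))" using V by blast
  have split: "real (card (nbrs G v U)) \<le> card (nbrs G v V1) + card (nbrs G v V2) + \<gamma> * m" for v
  proof -
    have "nbrs G v U \<subseteq> nbrs G v V1 \<union> nbrs G v V2 \<union> (U - (V1 \<union> V2))" by (auto simp: nbrs_def)
    then have "card (nbrs G v U) \<le> card (nbrs G v V1 \<union> nbrs G v V2 \<union> (U - (V1 \<union> V2)))"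
      using fin fin' by (intro card_mono) auto
    also have "\<dots> \<le> card (nbrs G v V1) + card (nbrs G v V2) + card (U - (V1 \<union> V2))"
      using card_Un_le[of "nbrs G v V1 \<union> nbrs G v V2" "U - (V1 \<union> V2)"]
        card_Un_le[of "nbrs G v V1" "nbrs G v V2"] by linarith
    finally show ?thesis using junk by linarith
  qed
  have d1: "(1/2 - 3 * \<gamma>) * m \<le> card (nbrs G v V2)" if "v \<in> V1" for v
    using split[of v] inner(1)[rule_format, OF that] deg[rule_format, of v] V(1) that
    by (auto simp: algebra_simps subset_iff)
  have d2: "(1/2 - 3 * \<gamma>) * m \<le> card (nbrs G v V1)" if "v \<in> V2" for v
    using split[of v] inner(2)[rule_format, OF that] deg[rule_format, of v] V(2) that
    by (auto simp: algebra_simps subset_iff)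
  have pos: "0 < (1/2 - 3 * \<gamma>) * m" using \<gamma>(2) m by (intro mult_pos_pos) auto
  have c1: "(1/2 - 3 * \<gamma>) * m \<le> card V2" if "V1 \<noteq> {}"
  proof -
    obtain v where "v \<in> V1" using \<open>V1 \<noteq> {}\<close> by blast
    then show ?thesis using d1[of v] card_nbrs_le[OF fin'(2), of G v] by linarith
  qed
  have c2: "(1/2 - 3 * \<gamma>) * m \<le> card V1" if "V2 \<noteq> {}"
  proof -
    obtain v where "v \<in> V2" using \<open>V2 \<noteq> {}\<close> by blast
    then show ?thesis using d2[of v] card_nbrs_le[OF fin'(1), of G v] by linarith
  qed
  have "V1 \<union> V2 \<noteq> {}"
  proof
    assume "V1 \<union> V2 = {}"
    then have "real m \<le> \<gamma> * m" using junk U(2) by simp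
    moreover have "\<gamma> * real m < 1 * real m" using \<gamma>(2) m by (intro mult_strict_right_mono) auto
    ultimately show False by simp
  qed
  moreover have "V2 \<noteq> {}" if "V1 \<noteq> {}" using c1[OF that] pos by auto
  moreover have "V1 \<noteq> {}" if "V2 \<noteq> {}" using c2[OF that] pos by auto
  ultimately have ne: "V1 \<noteq> {}" "V2 \<noteq> {}" by blast+
  have tot: "card V1 + card V2 \<le> m"
    using card_mono[OF fin, of "V1 \<union> V2"] V fin' U(2) by (simp add: card_Un_disjoint)
  have miss: "real (card (X - nbrs G v X)) \<le> 6 * \<gamma> * m"
    if "finite X" "(1/2 - 3 * \<gamma>) * m \<le> card (nbrs G v X)" "card X \<le> m - (1/2 - 3 * \<gamma>) * m" for X v
  proof -
    have "card (X - nbrs G v X) = card X - card (nbrs G v X)"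
      using that(1) nbrs_subset[of G v] by (intro card_Diff_subset finite_nbrs)
    moreover have "card (nbrs G v X) \<le> card X" using that(1) by (rule card_nbrs_le)
    ultimately have "real (card (X - nbrs G v X)) = real (card X) - card (nbrs G v X)" by simp
    then show ?thesis using that(2,3) by (simp add: algebra_simps)
  qed
  have le: "(1/2 - 6 * \<gamma>) * real m \<le> (1/2 - 3 * \<gamma>) * m" using \<gamma>(1) by (intro mult_right_mono) auto
  have b: "card V1 \<le> m - (1/2 - 3 * \<gamma>) * m" "card V2 \<le> m - (1/2 - 3 * \<gamma>) * m"
    using c1[OF ne(1)] c2[OF ne(2)] tot by linarith+
  show ?thesis unfolding near_bipartition_def
    using V(3) c1[OF ne(1)] c2[OF ne(2)] le miss[OF fin'(2) d1 b(2)] miss[OF fin'(1) d2 b(1)]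
    by (auto intro: order_trans)
qed

text \<open>
  Fix a complete pair \<open>T1\<close>, \<open>T2\<close> of large constant size \<open>s\<close>. Only boundedly many vertices see
  \<open>h\<close> vertices on both sides, so by the degree condition almost every vertex sees nearly all of one
  side and almost nothing of the other. This defines the bipartition, apart from boundedly many vertices with a
  large degree inside their own class, which are discarded.
\<close>

lemma degree_stability:
  fixes \<epsilon> :: real
  assumes "0 < \<epsilon>" "1 \<le> h"
  shows "\<exists>\<delta>>0. \<exists>m0. \<forall>(G::'a graph) U. simple_graph G \<longrightarrow> triple_free G h \<longrightarrow> U \<subseteq> verts G \<longrightarrow> m0 \<le> card U \<longrightarrow>
    (\<forall>v\<in>U. (1/2 - \<delta>) * card U \<le> card (nbrs G v U)) \<longrightarrow>
    (\<exists>V1 V2. V1 \<subseteq> U \<and> V2 \<subseteq> U \<and> near_bipartition G \<epsilon> (card U) V1 V2)"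
proof -
  define \<gamma> where "\<gamma> = min \<epsilon> (1/4) / 20"
  have \<gamma>: "0 < \<gamma>" "\<gamma> \<le> 1/40" "6 * \<gamma> \<le> \<epsilon>" using assms(1) by (auto simp: \<gamma>_def)
  define \<rho> where "\<rho> = 1 / (8 * real h)"
  have \<rho>: "0 < \<rho>" "\<rho> \<le> 1" using assms(2) by (auto simp: \<rho>_def)
  define \<delta> where "\<delta> = \<gamma> * \<rho> / 8"
  have \<delta>: "0 < \<delta>" "\<delta> \<le> \<gamma>" using \<gamma>(1) \<rho> mult_left_le[of \<rho> \<gamma>] by (auto simp: \<delta>_def)
  obtain s where s0: "8 * real h / (\<gamma> * \<rho>) < real s" using reals_Archimedean2 by blast
  have s1: "8 * real h < \<gamma> * \<rho> * s" using s0 \<gamma>(1) \<rho>(1) by (simp add: field_simps)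
  have "\<gamma> * (\<rho> * s) \<le> 1 * (\<rho> * s)" using \<gamma> \<rho>(1) by (intro mult_right_mono) auto
  then have s2: "real h \<le> \<rho> * s" using s1 by simp
  have s3: "1 \<le> s" using s2 assms(2) by (cases "s = 0") auto
  have s4: "4 * h \<le> s"
  proof -
    have "8 * real h * real h \<le> s" using s2 assms(2) by (simp add: \<rho>_def field_simps)
    moreover have "8 * real h * 1 \<le> 8 * real h * real h" using assms(2) by (intro mult_left_mono) auto
    ultimately show ?thesis by linarith
  qed
  define K where "K = h * (2 ^ s * 2 ^ s)"
  obtain a where a: "2 * real h / \<gamma> < real a" using reals_Archimedean2 by blast
  have a': "2 * real h \<le> \<gamma> * a" using a \<gamma>(1) by (simp add: field_simps)
  obtain m1 where m1: "16 * (real K / \<rho> + K + a + 1) / \<gamma> < real m1" using reals_Archimedean2 by blast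
  define m0 where "m0 = Max {1, m1, a * 2 ^ a, s * (8 * 2 ^ (8 * s))}"
  have m0: "1 \<le> m0" "m1 \<le> m0" "a * 2 ^ a \<le> m0" "s * (8 * 2 ^ (8 * s)) \<le> m0"
    unfolding m0_def by (intro Max_ge; simp)+
  have main: "\<exists>V1 V2. V1 \<subseteq> U \<and> V2 \<subseteq> U \<and> near_bipartition G \<epsilon> (card U) V1 V2"
    if G: "simple_graph G" and tf: "triple_free G h" and U: "U \<subseteq> verts G" and mU: "m0 \<le> card U"
    and deg: "\<forall>v\<in>U. (1/2 - \<delta>) * card U \<le> card (nbrs G v U)" for G :: "'a graph" and U
  proof -
    define m where "m = card U"
    have m: "1 \<le> m" "a * 2 ^ a \<le> m" "s * (8 * 2 ^ (8 * s)) \<le> card U" using m0 mU by (auto simp: m_def)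
    have "16 * (real K / \<rho> + K + a + 1) < \<gamma> * real m1" using m1 \<gamma>(1) by (simp add: field_simps)
    also have "\<dots> \<le> \<gamma> * m" using m0(2) mU \<gamma>(1) by (intro mult_left_mono) (auto simp: m_def)
    finally have big: "16 * (real K / \<rho> + K + a + 1) < \<gamma> * m" .
    have Kr: "0 \<le> real K / \<rho>" using \<rho>(1) by simp
    have gen: "16 * x \<le> w \<and> 16 * y \<le> w \<and> 16 * z \<le> w"
      if "16 * (x + y + z + 1) < w" "0 \<le> x" "0 \<le> y" "0 \<le> z" for x y z w :: real
      using that by simp
    have small: "16 * (real K / \<rho>) \<le> \<gamma> * m" using gen[OF big Kr] by simp
    have "0 \<le> real K" "0 \<le> real a" by simp_all
    then have small': "16 * real K \<le> \<gamma> * m \<and> 16 * real a \<le> \<gamma> * m" using gen[OF big Kr] by simp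
    have fV: "finite (verts G)" using G by (simp add: simple_graph_def)
    have fin: "finite U" using U fV by (rule finite_subset)
    have deg4: "\<forall>v\<in>U. real (card U) / 4 \<le> card (nbrs G v U)"
    proof
      fix v assume "v \<in> U"
      then have "(1/2 - \<delta>) * card U \<le> card (nbrs G v U)" using deg by blast
      moreover have "(1/4) * real (card U) \<le> (1/2 - \<delta>) * card U"
        using \<delta> \<gamma> by (intro mult_right_mono) auto
      ultimately show "real (card U) / 4 \<le> card (nbrs G v U)" by linarith
    qed
    obtain T1 T2 where T: "T1 \<subseteq> U" "T2 \<subseteq> U" "card T1 = s" "card T2 = s" "joined G T1 T2"
      using complete_pair[OF G U s3 m(3) deg4] by (elim exE conjE)
    have fT: "finite T1" "finite T2" using T fin by (auto intro: finite_subset)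
    have TV: "T1 \<subseteq> verts G" "T2 \<subseteq> verts G" using T U by auto
    define X where "X = {v \<in> U. h \<le> card (nbrs G v T1) \<and> h \<le> card (nbrs G v T2)}"
    have "card X \<le> h * (2 ^ card T1 * 2 ^ card T2)"
      by (rule large_codegree_bound[OF G tf assms(2) TV T(5) U]) (auto simp: X_def)
    then have XK: "card X \<le> K" unfolding T(3,4) K_def .
    define d where "d v = card (nbrs G v T1) + card (nbrs G v T2)" for v
    \<comment> \<open>The vertices that see noticeably fewer than \<open>s\<close> vertices of the pair.\<close>
    define Lt where "Lt = {v \<in> U - X. d v < (1 - \<rho>) * s}"
    have fXL: "finite X" "finite Lt" using fin by (auto simp: X_def Lt_def)
    have le_s: "card (nbrs G v T1) \<le> s" "card (nbrs G v T2) \<le> s" for v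
      using card_nbrs_le[OF fT(1), of G v] card_nbrs_le[OF fT(2), of G v] T by auto
    have Lt: "card Lt \<le> \<gamma> * m / 2"
    proof -
      have "2 * s * ((1/2 - \<delta>) * m) \<le> (\<Sum>v\<in>U. real (d v))"
        unfolding d_def m_def using degree_sum_pair[OF G U T, of "(1/2 - \<delta>) * card U"] deg by simp
      also have "\<dots> \<le> (\<Sum>v\<in>U. real (s + h) + (if v \<in> X then real s else 0) - (if v \<in> Lt then \<rho> * s else 0))"
      proof (rule sum_mono)
        fix v assume v: "v \<in> U"
        show "real (d v) \<le> real (s + h) + (if v \<in> X then real s else 0) - (if v \<in> Lt then \<rho> * s else 0)"
        proof (cases "v \<in> X")
          case True
          then have "v \<notin> Lt" by (simp add: Lt_def)
          then show ?thesis using True le_s[of v] by (simp add: d_def)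
        next
          case False
          then have "card (nbrs G v T1) < h \<or> card (nbrs G v T2) < h" using v by (auto simp: X_def)
          then have "d v \<le> s + h" using le_s[of v] by (auto simp: d_def)
          moreover have "v \<in> Lt \<Longrightarrow> real (d v) < s - \<rho> * s" by (simp add: Lt_def algebra_simps)
          ultimately show ?thesis using False by (cases "v \<in> Lt") auto
        qed
      qed
      also have "\<dots> = real (s + h) * m + s * card X - \<rho> * s * card Lt"
      proof -
        have "U \<inter> {v. v \<in> X} = X" "U \<inter> {v. v \<in> Lt} = Lt" unfolding Lt_def X_def by blast+
        then show ?thesis using fin by (simp add: sum.distrib sum_subtractf sum.If_cases m_def)
      qed
      also have "\<dots> \<le> real (s + h) * m + s * K - \<rho> * s * card Lt" using XK by (simp add: mult_left_mono)
      finally have "s * (\<rho> * card Lt) \<le> real h * real m + real s * K + 2 * real s * \<delta> * m" by (simp add: algebra_simps)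
      also have "real h * m \<le> (\<gamma> * \<rho> * s / 8) * m" using s1 by (intro mult_right_mono) auto
      finally have "s * (\<rho> * card Lt) \<le> s * (\<gamma> * \<rho> / 8 * m + K + 2 * \<delta> * m)"
        by (simp add: algebra_simps)
      then have "\<rho> * card Lt \<le> \<gamma> * \<rho> / 8 * m + K + 2 * \<delta> * m" using s3 by simp
      also have "\<dots> = \<rho> * (3 * \<gamma> / 8 * m + K / \<rho>)" using \<rho>(1) by (simp add: \<delta>_def field_simps)
      finally have "card Lt \<le> 3 * \<gamma> / 8 * m + K / \<rho>" using \<rho>(1) by simp
      then show ?thesis using small by linarith
    qed
    \<comment> \<open>Each of the other vertices sees fewer than \<open>h\<close> on exactly one side of the pair.\<close>
    define Y1 where "Y1 = {v \<in> U - X - Lt. card (nbrs G v T1) < h}"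
    define Y2 where "Y2 = {v \<in> U - X - Lt. \<not> card (nbrs G v T1) < h}"
    have miss: "real (card (T - nbrs G v T)) \<le> card T / (4 * real h)"
      if "finite T" "card T = s" "(1 - \<rho>) * s - h \<le> card (nbrs G v T)" for T v
    proof -
      have "card (T - nbrs G v T) = card T - card (nbrs G v T)"
        using that(1) nbrs_subset[of G v] by (intro card_Diff_subset finite_nbrs)
      moreover have "card (nbrs G v T) \<le> card T" using that(1) by (rule card_nbrs_le)
      ultimately have "real (card (T - nbrs G v T)) = s - card (nbrs G v T)" using that(2) by simp
      also have "\<dots> \<le> 2 * (\<rho> * s)" using that(3) s2 by (simp add: algebra_simps)
      also have "\<dots> = s / (4 * real h)" by (simp add: \<rho>_def)
      finally show ?thesis using that(2) by simp
    qed
    have m1': "\<forall>v\<in>Y1. real (card (T2 - nbrs G v T2)) \<le> card T2 / (4 * real h)"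
    proof
      fix v assume v: "v \<in> Y1"
      then have "(1 - \<rho>) * s \<le> d v" "card (nbrs G v T1) < h" by (auto simp: Y1_def Lt_def)
      then show "real (card (T2 - nbrs G v T2)) \<le> card T2 / (4 * real h)"
        by (intro miss[OF fT(2) T(4)]) (simp add: d_def)
    qed
    have m2': "\<forall>v\<in>Y2. real (card (T1 - nbrs G v T1)) \<le> card T1 / (4 * real h)"
    proof
      fix v assume v: "v \<in> Y2"
      then have "(1 - \<rho>) * s \<le> d v" "card (nbrs G v T2) < h" by (auto simp: Y2_def Lt_def X_def)
      then show "real (card (T1 - nbrs G v T1)) \<le> card T1 / (4 * real h)"
        by (intro miss[OF fT(1) T(3)]) (simp add: d_def)
    qed
    have YU: "Y1 \<subseteq> U" "Y2 \<subseteq> U" by (auto simp: Y1_def Y2_def)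
    have Yc: "card Y1 \<le> m" "card Y2 \<le> m" using YU fin by (auto simp: m_def intro: card_mono)
    define B1 where "B1 = {v \<in> Y1. \<gamma> * m \<le> card (nbrs G v Y1)}"
    define B2 where "B2 = {v \<in> Y2. \<gamma> * m \<le> card (nbrs G v Y2)}"
    have "4 * h \<le> card T2" "4 * h \<le> card T1" "Y1 \<subseteq> verts G" "Y2 \<subseteq> verts G"
      using YU U T(3,4) s4 by auto
    then have B: "card B1 < a" "card B2 < a"
      unfolding B1_def B2_def
      using few_large_inner_degrees[OF G tf assms(2) \<gamma>(1) TV(2) _ _ Yc(1) m(2,1) a' m1']
        few_large_inner_degrees[OF G tf assms(2) \<gamma>(1) TV(1) _ _ Yc(2) m(2,1) a' m2'] by blast+
    define V1 where "V1 = Y1 - B1"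
    define V2 where "V2 = Y2 - B2"
    have fY: "finite Y1" "finite Y2" using YU fin by (auto intro: finite_subset)
    have "U - (V1 \<union> V2) \<subseteq> X \<union> Lt \<union> B1 \<union> B2" by (auto simp: V1_def V2_def Y1_def Y2_def)
    then have "card (U - (V1 \<union> V2)) \<le> card (X \<union> Lt \<union> B1 \<union> B2)"
      using fXL fY by (intro card_mono) (auto simp: B1_def B2_def)
    also have "\<dots> \<le> card X + card Lt + card B1 + card B2"
      using card_Un_le[of "X \<union> Lt \<union> B1" B2] card_Un_le[of "X \<union> Lt" B1] card_Un_le[of X Lt] by linarith
    finally have junk: "card (U - (V1 \<union> V2)) \<le> \<gamma> * m" using XK Lt B conjunct1[OF small'] conjunct2[OF small'] by linarith
    have inner: "\<forall>v\<in>V1. card (nbrs G v V1) \<le> \<gamma> * m" "\<forall>v\<in>V2. card (nbrs G v V2) \<le> \<gamma> * m"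
    proof -
      have "card (nbrs G v V1) \<le> \<gamma> * m" if "v \<in> V1" for v
      proof -
        have "card (nbrs G v V1) \<le> card (nbrs G v Y1)" using fY by (intro card_nbrs_mono) (auto simp: V1_def)
        moreover have "card (nbrs G v Y1) < \<gamma> * m" using that by (auto simp: V1_def B1_def)
        ultimately show ?thesis by linarith
      qed
      moreover have "card (nbrs G v V2) \<le> \<gamma> * m" if "v \<in> V2" for v
      proof -
        have "card (nbrs G v V2) \<le> card (nbrs G v Y2)" using fY by (intro card_nbrs_mono) (auto simp: V2_def)
        moreover have "card (nbrs G v Y2) < \<gamma> * m" using that by (auto simp: V2_def B2_def)
        ultimately show ?thesis by linarith
      qed
      ultimately show "\<forall>v\<in>V1. card (nbrs G v V1) \<le> \<gamma> * m" "\<forall>v\<in>V2. card (nbrs G v V2) \<le> \<gamma> * m" by auto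
    qed
    have degm: "\<forall>v\<in>U. (1/2 - \<gamma>) * m \<le> card (nbrs G v U)"
    proof
      fix v assume "v \<in> U"
      then have "(1/2 - \<delta>) * m \<le> card (nbrs G v U)" using deg by (simp add: m_def)
      moreover have "(1/2 - \<gamma>) * real m \<le> (1/2 - \<delta>) * m" using \<delta>(2) by (intro mult_right_mono) auto
      ultimately show "(1/2 - \<gamma>) * m \<le> card (nbrs G v U)" by linarith
    qed
    have VU: "V1 \<subseteq> U" "V2 \<subseteq> U" "V1 \<inter> V2 = {}" using YU by (auto simp: V1_def V2_def Y1_def Y2_def)
    have nb: "near_bipartition G (6 * \<gamma>) m V1 V2"
      by (rule near_bipartition_of_degrees[OF G U m_def m(1) \<gamma>(1,2) VU junk degm inner])
    have "near_bipartition G \<epsilon> m V1 V2"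
    proof -
      have "(1/2 - \<epsilon>) * real m \<le> (1/2 - 6 * \<gamma>) * m" "6 * \<gamma> * m \<le> \<epsilon> * m"
        using \<gamma>(3) by (auto intro: mult_right_mono)
      then show ?thesis using nb unfolding near_bipartition_def by (auto intro: order_trans)
    qed
    then show ?thesis using VU by (auto simp: m_def)
  qed
  then show ?thesis using \<delta>(1) by (intro exI[of _ \<delta>] exI[of _ m0] conjI allI impI) simp_all
qed

section \<open>Extremal graphs are nearly complete bipartite\<close>

lemma card_edges_split:
  assumes G: "simple_graph G" and v: "v \<in> verts G"
  shows "card (edges G) = card {e \<in> edges G. v \<notin> e} + card (nbrs G v (verts G))"
proof -
  have fin: "finite (verts G)" using G by (simp add: simple_graph_def)
  have sub: "e \<subseteq> verts G" if "e \<in> edges G" for e using G that by (simp add: simple_graph_def)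
  have iv: "insert v (verts G - {v}) = verts G" using v by auto
  have nv: "nbrs G v (verts G - {v}) = nbrs G v (verts G)"
  proof -
    have "nbrs G v (verts G - {v}) = nbrs G v (verts G) - {v}"
      unfolding nbrs_def by (rule set_eqI) (simp add: conj_ac)
    then show ?thesis using not_self_nbr[OF G, of v "verts G"] by simp
  qed
  have "edges_in G (insert v (verts G - {v})) = edges_in G (verts G - {v}) + card (nbrs G v (verts G - {v}))"
    using fin by (intro edges_in_insert[OF G]) auto
  then have "card (edges G) = edges_in G (verts G - {v}) + card (nbrs G v (verts G))"
    unfolding iv nv edges_in_verts[OF G] .
  moreover have "{e \<in> edges G. e \<subseteq> verts G - {v}} = {e \<in> edges G. v \<notin> e}" using sub by blast
  ultimately show ?thesis by (simp add: edges_in_def)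
qed

lemma edges_le_square:
  assumes "simple_graph G" shows "card (edges G) \<le> card (verts G) * card (verts G)"
  using edges_in_le[OF assms, of "verts G"] edges_in_verts[OF assms] assms by (simp add: simple_graph_def)

lemma finite_free_edges: "finite ((\<lambda>G. card (edges G)) ` free_graphs n \<L>)"
proof (rule finite_subset)
  show "(\<lambda>G. card (edges G)) ` free_graphs n \<L> \<subseteq> {..n * n}"
    using edges_le_square by (auto simp: free_graphs_def)
qed simp

lemma free_edges_le_turan: "G \<in> free_graphs n \<L> \<Longrightarrow> card (edges G) \<le> turan_number n \<L>"
  unfolding turan_number_def by (intro Max_ge finite_free_edges) auto

lemma extremalD:
  assumes "G \<in> extremal_graphs n \<L>"
  shows "simple_graph G" "card (verts G) = n" "graph_free \<L> G" "card (edges G) = turan_number n \<L>"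
  using assms by (auto simp: extremal_graphs_def free_graphs_def)

text \<open>
  Delete the edges at \<open>v\<close> and join \<open>v\<close> to the common neighbours of \<open>T\<close> instead. A copy of \<open>L\<close> that uses \<open>v\<close>
  misses some vertex of \<open>T\<close>, and this vertex can take the place of \<open>v\<close>. So the new graph is again
  \<open>L\<close>-free and has at most as many edges.
\<close>

lemma extremal_degree:
  fixes L :: "'a graph"
  assumes ext: "G \<in> extremal_graphs n {L}" and L: "simple_graph L"
    and v: "v \<in> verts G" and T: "T \<subseteq> verts G" "v \<notin> T" "card (verts L) \<le> card T"
  shows "card {x \<in> verts G - {v}. \<forall>u\<in>T. {u, x} \<in> edges G} \<le> card (nbrs G v (verts G))"
proof -
  note G = extremalD[OF ext]
  define C where "C = {x \<in> verts G - {v}. \<forall>u\<in>T. {u, x} \<in> edges G}"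
  define G' where "G' = \<lparr>verts = verts G, edges = {e \<in> edges G. v \<notin> e} \<union> (\<lambda>x. {v, x}) ` C\<rparr>"
  have fin: "finite (verts G)" using G(1) by (simp add: simple_graph_def)
  have finT: "finite T" using T(1) fin by (rule finite_subset)
  have Cv: "v \<notin> C" "C \<subseteq> verts G" by (auto simp: C_def)
  have sG': "simple_graph G'"
    unfolding simple_graph_def
  proof (intro conjI ballI)
    show "finite (verts G')" using fin by (simp add: G'_def)
    fix e assume "e \<in> edges G'"
    then consider "e \<in> edges G" | x where "x \<in> C" "e = {v, x}" by (auto simp: G'_def)
    then have "e \<subseteq> verts G' \<and> card e = 2"
    proof cases
      case 1 then show ?thesis using G(1) by (simp add: simple_graph_def G'_def)
    next
      case 2
      then have "x \<noteq> v" "x \<in> verts G" using Cv by auto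
      then show ?thesis using 2 v by (simp add: G'_def)
    qed
    then show "e \<subseteq> verts G'" "card e = 2" by simp_all
  qed
  have free: "\<not> contains_copy G' L"
  proof
    assume "contains_copy G' L"
    then obtain f where f: "inj_on f (verts L)" "f ` verts L \<subseteq> verts G" "\<forall>e\<in>edges L. f ` e \<in> edges G'"
      by (auto simp: contains_copy_def G'_def)
    have noG: "\<not> contains_copy G L" using G(3) by (simp add: graph_free_def)
    have eG: "f ` e \<in> edges G" if "e \<in> edges L" "v \<notin> f ` e" for e
    proof -
      have "f ` e \<in> edges G'" using f(3) that(1) by blast
      then show ?thesis using that(2) by (auto simp: G'_def)
    qed
    have eV: "e \<subseteq> verts L" if "e \<in> edges L" for e using L that by (simp add: simple_graph_def)
    show False
    proof (cases "v \<in> f ` verts L")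
      case False
      then have "f ` e \<in> edges G" if "e \<in> edges L" for e using eG[OF that] eV[OF that] by blast
      then show False using f(1,2) noG unfolding contains_copy_def by blast
    next
      case True
      then obtain x0 where x0: "x0 \<in> verts L" "f x0 = v" by blast
      have finL: "finite (verts L)" using L by (simp add: simple_graph_def)
      have "card (f ` (verts L - {x0})) \<le> card (verts L - {x0})" using finL by (intro card_image_le) auto
      also have "\<dots> < card (verts L)" using finL x0(1) by (intro psubset_card_mono) auto
      finally have lt: "card (f ` (verts L - {x0})) < card T" using T(3) by simp
      have "\<not> T \<subseteq> f ` (verts L - {x0})"
      proof
        assume "T \<subseteq> f ` (verts L - {x0})"
        then have "card T \<le> card (f ` (verts L - {x0}))" using finL by (intro card_mono) auto
        then show False using lt by simp
      qed
      then obtain u where u: "u \<in> T" "u \<notin> f ` (verts L - {x0})" by blast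
      define f' where "f' = f(x0 := u)"
      have "inj_on f' (verts L)"
      proof (rule inj_onI)
        fix x y assume xy: "x \<in> verts L" "y \<in> verts L" "f' x = f' y"
        show "x = y"
        proof (cases "x = x0"; cases "y = x0")
          assume "x \<noteq> x0" "y \<noteq> x0"
          then show ?thesis using xy f(1) by (simp add: f'_def inj_on_def)
        qed (use xy u(2) in \<open>auto simp: f'_def\<close>)
      qed
      moreover have "f' ` verts L \<subseteq> verts G" using f(2) u(1) T(1) by (auto simp: f'_def)
      moreover have "f' ` e \<in> edges G" if e: "e \<in> edges L" for e
      proof (cases "x0 \<in> e")
        case False
        then have "f' ` e = f ` e" by (auto simp: f'_def)
        moreover have "v \<notin> f ` e"
        proof
          assume "v \<in> f ` e"
          then obtain z where "z \<in> e" "f z = v" by blast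
          then have "z = x0" using f(1) x0 eV[OF e] by (auto simp: inj_on_def)
          then show False using False \<open>z \<in> e\<close> by simp
        qed
        ultimately show ?thesis using eG[OF e] by simp
      next
        case True
        obtain a b where ab: "e = {a, b}" "a \<noteq> b" using edge_ends[OF L e] by (elim exE conjE)
        then obtain z where z: "e = {x0, z}" "z \<noteq> x0" using True by (metis doubleton_eq_iff insertE singletonD)
        have "f ` e \<in> edges G'" using f(3) e by blast
        then have "{v, f z} \<in> edges G'" using z x0 by simp
        then obtain w where "w \<in> C" "{v, f z} = {v, w}" by (auto simp: G'_def)
        then have "f z \<in> C" by (auto simp: doubleton_eq_iff)
        then have "{u, f z} \<in> edges G" using u(1) by (simp add: C_def)
        then show ?thesis using z by (simp add: f'_def insert_commute[of u "f z"])
      qed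
      ultimately show False using noG unfolding contains_copy_def by blast
    qed
  qed
  have "card (edges G') \<le> turan_number n {L}"
    using sG' G(2) free by (intro free_edges_le_turan) (auto simp: free_graphs_def graph_free_def G'_def)
  also have "\<dots> = card (edges G)" using G(4) by simp
  also have "\<dots> = card {e \<in> edges G. v \<notin> e} + card (nbrs G v (verts G))" by (rule card_edges_split[OF G(1) v])
  finally have le: "card (edges G') \<le> card {e \<in> edges G. v \<notin> e} + card (nbrs G v (verts G))" .
  have "card (edges G') = card {e \<in> edges G. v \<notin> e} + card ((\<lambda>x. {v, x}) ` C)"
    unfolding G'_def using finite_edges[OF G(1)] fin by (simp, subst card_Un_disjoint) (auto simp: C_def)
  also have "card ((\<lambda>x. {v, x}) ` C) = card C"
    by (intro card_image) (auto simp: inj_on_def doubleton_eq_iff)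
  finally show ?thesis using le by (simp add: C_def)
qed

lemma large_square:
  fixes A B n :: real
  assumes "0 \<le> B" "A + B + 1 \<le> c * n" "1 \<le> n"
  shows "A * n + B < c * n^2"
proof -
  have "(A + B + 1) * n \<le> c * n * n" using assms by (intro mult_right_mono) auto
  moreover have "B * 1 \<le> B * n" using assms by (intro mult_left_mono) auto
  ultimately show ?thesis using assms(3) by (simp add: algebra_simps power2_eq_square)
qed

text \<open>
  The dense core of an extremal graph has minimum degree almost half of its order, and it misses only few vertices since
  \<open>quarter_density\<close> limits the edges. So degree stability applies to the core. The vertices outside
  it have large degree as well: they cannot have fewer neighbours than a set of \<open>|L|\<close> vertices in one class of the core
  has in common.
\<close>

lemma extremal_near_bipartition:
  fixes L :: "'a graph" and \<epsilon> C :: real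
  assumes L: "simple_graph L" "1 \<le> card (verts L)" and \<epsilon>: "0 < \<epsilon>"
    and tf: "\<And>G::nat graph. simple_graph G \<Longrightarrow> \<not> contains_copy G L \<Longrightarrow> triple_free G (card (verts L))"
    and low: "\<forall>n\<ge>n1. \<forall>G\<in>extremal_graphs n {L}. real n^2 / 4 - C \<le> card (edges G)" and C: "0 \<le> C"
  shows "\<exists>n0. \<forall>n\<ge>n0. \<forall>G\<in>extremal_graphs n {L}. \<exists>V1 V2. V1 \<subseteq> verts G \<and> V2 \<subseteq> verts G \<and>
    near_bipartition G \<epsilon> n V1 V2 \<and> (\<forall>v\<in>verts G. (1/2 - \<epsilon>) * n \<le> card (nbrs G v (verts G)))"
proof -
  define h where "h = card (verts L)"
  define \<eta> where "\<eta> = min \<epsilon> 1 / (4 * (real h + 4))"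
  have h1: "1 \<le> h" using L(2) by (simp add: h_def)
  have \<eta>0: "0 < \<eta>" using \<epsilon> by (simp add: \<eta>_def)
  have "\<eta> * (4 * (real h + 4)) = min \<epsilon> 1" by (simp add: \<eta>_def)
  then have \<eta>': "4 * \<eta> * h + 16 * \<eta> \<le> \<epsilon>" "4 * \<eta> * h + 16 * \<eta> \<le> 1" by (auto simp: algebra_simps)
  have \<eta>h: "0 \<le> \<eta> * h" using \<eta>0 by simp
  obtain \<delta>0 m0 where \<delta>0: "0 < \<delta>0" and st: "\<forall>(G::nat graph) U. simple_graph G \<longrightarrow> triple_free G h \<longrightarrow> U \<subseteq> verts G \<longrightarrow> m0 \<le> card U \<longrightarrow>
    (\<forall>v\<in>U. (1/2 - \<delta>0) * card U \<le> card (nbrs G v U)) \<longrightarrow>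
    (\<exists>V1 V2. V1 \<subseteq> U \<and> V2 \<subseteq> U \<and> near_bipartition G \<eta> (card U) V1 V2)"
    using degree_stability[where ?'a = nat, OF \<eta>0 h1] by (elim exE conjE)
  define \<delta> where "\<delta> = min \<delta>0 (1/4)"
  have \<delta>: "0 < \<delta>" "\<delta> \<le> \<delta>0" "\<delta> \<le> 1/4" using \<delta>0 by (auto simp: \<delta>_def)
  define \<alpha> where "\<alpha> = 1/4 - \<delta>/2"
  have \<alpha>: "0 \<le> \<alpha>" "\<alpha> \<le> 1/4" using \<delta> by (auto simp: \<alpha>_def)
  define \<gamma> where "\<gamma> = \<delta> * \<eta> / 4"
  have \<gamma>0: "0 < \<gamma>" using \<delta> \<eta>0 by (simp add: \<gamma>_def)
  obtain m1 where qd: "\<forall>(G::nat graph) V0. simple_graph G \<longrightarrow> triple_free G h \<longrightarrow> V0 \<subseteq> verts G \<longrightarrow> m1 \<le> card V0 \<longrightarrow>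
    real (edges_in G V0) \<le> (1/4 + \<gamma>) * real (card V0)^2"
    using quarter_density[where ?'a = nat, OF \<gamma>0 h1] by (elim exE)
  define M where "M = max m0 m1"
  define D where "D = C + real M * M"
  have D: "0 \<le> D" "C \<le> D" "C + real M * M \<le> D" using C by (auto simp: D_def)
  obtain N1 where N1: "(1/4 + D + 1) / (\<delta>/2 * \<eta>) < real N1" using reals_Archimedean2 by blast
  obtain N2 where N2: "(real h + 2) / \<eta> < real N2" using reals_Archimedean2 by blast
  define n0 where "n0 = Max {1, n1, N1, N2}"
  have n0: "1 \<le> n0" "n1 \<le> n0" "N1 \<le> n0" "N2 \<le> n0" unfolding n0_def by (intro Max_ge; simp)+
  have main: "\<exists>V1 V2. V1 \<subseteq> verts G \<and> V2 \<subseteq> verts G \<and>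
    near_bipartition G \<epsilon> n V1 V2 \<and> (\<forall>v\<in>verts G. (1/2 - \<epsilon>) * n \<le> card (nbrs G v (verts G)))"
    if n: "n0 \<le> n" and ext: "G \<in> extremal_graphs n {L}" for n G
  proof -
    note G = extremalD[OF ext]
    have tG: "triple_free G h" using tf[OF G(1)] G(3) by (simp add: h_def graph_free_def)
    have fin: "finite (verts G)" using G(1) by (simp add: simple_graph_def)
    have low': "real n^2 / 4 - C \<le> edges_in G (verts G)"
      using low n n0(2) ext edges_in_verts[OF G(1)] by auto
    obtain U where U: "U \<subseteq> verts G"
      "edges_in G (verts G) - \<alpha> * (real (card (verts G))^2 + card (verts G)) \<le> edges_in G U - \<alpha> * (real (card U)^2 + card U)"
      "\<forall>v\<in>U. 2 * \<alpha> * card U \<le> card (nbrs G v U)"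
      using dense_core[OF G(1) order_refl \<alpha>(1)] by (elim exE conjE)
    define m where "m = card U"
    have finU: "finite U" using U(1) fin by (rule finite_subset)
    have mn: "m \<le> n" using card_mono[OF fin U(1)] G(2) by (simp add: m_def)
    have n1': "1 \<le> real n" using n n0(1) by simp
    have "1/4 + D + 1 \<le> \<delta>/2 * \<eta> * real N1" using N1 \<delta>(1) \<eta>0 by (simp add: field_simps)
    also have "\<dots> \<le> \<delta>/2 * \<eta> * real n" using n0(3) n \<delta>(1) \<eta>0 by (intro mult_left_mono) auto
    finally have big: "1/4 * real n + D < \<delta>/2 * \<eta> * real n^2" using D(1) n1' by (intro large_square)
    have \<eta>1: "\<eta> \<le> 1" using \<eta>'(2) \<eta>h \<eta>0 by linarith
    have "\<delta>/2 * \<eta> * real n^2 \<le> \<delta>/2 * 1 * real n^2"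
      using \<delta>(1) \<eta>0 \<eta>1 by (intro mult_right_mono mult_left_mono) auto
    then have big': "1/4 * real n + D < \<delta>/2 * real n^2" using big by simp
    have "\<alpha> * real n \<le> 1/4 * real n" using \<alpha>(2) by (intro mult_right_mono) auto
    moreover have "real n^2 / 4 - \<alpha> * real n^2 = \<delta>/2 * real n^2" by (simp add: \<alpha>_def algebra_simps)
    moreover have "\<alpha> * (real n^2 + n) = \<alpha> * real n^2 + \<alpha> * real n" by (simp add: algebra_simps)
    ultimately have key: "\<delta>/2 * real n^2 - 1/4 * real n - C \<le> edges_in G U - \<alpha> * (real m^2 + m)"
      using low' U(2) unfolding G(2) m_def by linarith
    have pos\<alpha>: "0 \<le> \<alpha> * (real m^2 + m)" using \<alpha>(1) by simp
    have Mm: "M \<le> m"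
    proof (rule ccontr)
      assume "\<not> M \<le> m"
      then have "m * m \<le> M * M" by (intro mult_le_mono) auto
      moreover have "2 * edges_in G U \<le> m * m" using edges_in_le[OF G(1) finU] by (simp add: m_def)
      ultimately have "edges_in G U \<le> M * M" by linarith
      then have "real (edges_in G U) \<le> real M * real M" by (metis of_nat_le_iff of_nat_mult)
      then show False using key pos\<alpha> big' D(3) by linarith
    qed
    have "real (edges_in G U) \<le> (1/4 + \<gamma>) * real m^2"
      using qd[rule_format, OF G(1) tG U(1)] Mm by (simp add: M_def m_def)
    moreover have "\<alpha> * real m^2 \<le> \<alpha> * (real m^2 + m)" using \<alpha>(1) by (intro mult_left_mono) auto
    moreover have "(1/4 + \<gamma>) * real m^2 - \<alpha> * real m^2 = (\<delta>/2 * (1 + \<eta>/2)) * real m^2"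
      by (simp add: \<alpha>_def \<gamma>_def algebra_simps)
    ultimately have key2: "\<delta>/2 * real n^2 - 1/4 * real n - C \<le> (\<delta>/2 * (1 + \<eta>/2)) * real m^2"
      using key by linarith
    have mbig: "(1 - \<eta>) * n \<le> m"
    proof (rule ccontr)
      assume "\<not> ?thesis"
      then have "real m^2 \<le> ((1 - \<eta>) * n)^2" by (intro power_mono) auto
      then have "(\<delta>/2 * (1 + \<eta>/2)) * real m^2 \<le> (\<delta>/2 * (1 + \<eta>/2)) * ((1 - \<eta>) * n)^2"
        using \<delta>(1) \<eta>0 by (intro mult_left_mono) auto
      also have "\<dots> = \<delta>/2 * real n^2 * ((1 + \<eta>/2) * (1 - \<eta>)) * (1 - \<eta>)"
        by (simp add: power2_eq_square)
      also have "\<dots> \<le> \<delta>/2 * real n^2 * 1 * (1 - \<eta>)"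
      proof (intro mult_right_mono mult_left_mono)
        have "(1 + \<eta>/2) * (1 - \<eta>) = 1 - \<eta>/2 - \<eta> * \<eta> / 2" by (simp add: field_simps)
        moreover have "0 \<le> \<eta> * \<eta>" by simp
        ultimately show "(1 + \<eta>/2) * (1 - \<eta>) \<le> 1" using \<eta>0 by linarith
        show "0 \<le> 1 - \<eta>" using \<eta>' \<eta>h \<eta>0 by linarith
      qed (use \<delta> in auto)
      finally have "\<delta>/2 * real n^2 - 1/4 * real n - C \<le> \<delta>/2 * real n^2 - \<delta>/2 * \<eta> * real n^2"
        using key2 by (simp add: algebra_simps)
      then show False using big D(2) by linarith
    qed
    have deg: "\<forall>v\<in>U. (1/2 - \<delta>0) * card U \<le> card (nbrs G v U)"
    proof
      fix v assume "v \<in> U"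
      then have "2 * \<alpha> * card U \<le> card (nbrs G v U)" using U(3) by blast
      moreover have "(1/2 - \<delta>0) * real (card U) \<le> 2 * \<alpha> * card U"
        using \<delta>(2) by (intro mult_right_mono) (auto simp: \<alpha>_def)
      ultimately show "(1/2 - \<delta>0) * card U \<le> card (nbrs G v U)" by linarith
    qed
    have "m0 \<le> card U" using Mm by (simp add: M_def m_def)
    then have "\<exists>V1 V2. V1 \<subseteq> U \<and> V2 \<subseteq> U \<and> near_bipartition G \<eta> (card U) V1 V2"
      using st G(1) tG U(1) deg by blast
    then obtain V1 V2 where V: "V1 \<subseteq> U" "V2 \<subseteq> U" "near_bipartition G \<eta> (card U) V1 V2"
      by (elim exE conjE)
    have \<eta>m: "\<eta> * m \<le> \<eta> * n" using mn \<eta>0 by (intro mult_left_mono) auto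
    have half: "(1/2 - 2 * \<eta>) * n \<le> (1/2 - \<eta>) * m"
    proof -
      have "(1/2 - 2 * \<eta>) * n \<le> (1/2 - \<eta>) * ((1 - \<eta>) * n)"
      proof -
        have "(1/2 - \<eta>) * (1 - \<eta>) = 1/2 - 3/2 * \<eta> + \<eta> * \<eta>" by (simp add: field_simps)
        moreover have "0 \<le> \<eta> * \<eta>" by simp
        ultimately have "1/2 - 2 * \<eta> \<le> (1/2 - \<eta>) * (1 - \<eta>)" using \<eta>0 by linarith
        then have "(1/2 - 2 * \<eta>) * n \<le> (1/2 - \<eta>) * (1 - \<eta>) * n" by (intro mult_right_mono) auto
        then show ?thesis by simp
      qed
      also have "\<dots> \<le> (1/2 - \<eta>) * m"
      proof (rule mult_left_mono[OF mbig])
        show "0 \<le> 1/2 - \<eta>" using \<eta>'(2) \<eta>0 \<eta>h by linarith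
      qed
      finally show ?thesis .
    qed
    have nb: "V1 \<inter> V2 = {}" "(1/2 - \<eta>) * m \<le> card V1" "(1/2 - \<eta>) * m \<le> card V2"
      "\<forall>v\<in>V1. real (card (V2 - nbrs G v V2)) \<le> \<eta> * m" "\<forall>v\<in>V2. real (card (V1 - nbrs G v V1)) \<le> \<eta> * m"
      using V(3) unfolding near_bipartition_def m_def by auto
    have V12: "(1/2 - 2 * \<eta>) * n \<le> card V1" "(1/2 - 2 * \<eta>) * n \<le> card V2" using half nb(2,3) by linarith+
    have VG: "V1 \<subseteq> verts G" "V2 \<subseteq> verts G" using V U(1) by auto
    have finV: "finite V1" "finite V2" using VG fin by (auto intro: finite_subset)
    have "real h + 2 \<le> \<eta> * N2" using N2 \<eta>0 by (simp add: field_simps)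
    also have "\<dots> \<le> \<eta> * n" using n0(4) n \<eta>0 by (intro mult_left_mono) auto
    finally have hn: "real h + 2 \<le> \<eta> * n" .
    have \<eta>8: "\<eta> \<le> 1/8" "2 * \<eta> \<le> \<epsilon>" using \<eta>' \<eta>h \<eta>0 by linarith+
    have "\<eta> * n \<le> (1/2 - 2 * \<eta>) * n" using \<eta>8 by (intro mult_right_mono) auto
    then have "real h + 2 \<le> card V1" using hn V12(1) by linarith
    then have hV: "h + 2 \<le> card V1" by linarith
    have degree: "(1/2 - \<epsilon>) * n \<le> card (nbrs G v (verts G))" if v: "v \<in> verts G" for v
    proof -
      have "card V1 - 1 \<le> card (V1 - {v})" using finV by (simp add: card_Diff_singleton_if)
      then have "h \<le> card (V1 - {v})" using hV by linarith
      from ex_subset_card[OF this] obtain T where T: "T \<subseteq> V1 - {v}" "card T = h" "finite T"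
        by (elim exE conjE)
      have missT: "real (card (V2 - nbrs G u V2)) \<le> \<eta> * n" if "u \<in> T" for u
        using nb(4) T(1) that \<eta>m by (meson DiffD1 order_trans subsetD)
      define K where "K = {t \<in> V2. \<forall>u\<in>T. {u, t} \<in> edges G}"
      have K: "real (card V2) - card T * (\<eta> * n) \<le> card K"
        unfolding K_def by (rule common_nbrs_card[OF finV(2) T(3) missT])
      have "card K - 1 \<le> card (K - {v})" using finV by (simp add: card_Diff_singleton_if K_def)
      also have "\<dots> \<le> card {x \<in> verts G - {v}. \<forall>u\<in>T. {u, x} \<in> edges G}"
        using fin VG by (intro card_mono) (auto simp: K_def)
      also have "\<dots> \<le> card (nbrs G v (verts G))"
        using T VG by (intro extremal_degree[OF ext L(1) v]) (auto simp: h_def)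
      finally have "real (card K) - 1 \<le> card (nbrs G v (verts G))" by linarith
      then have "(1/2 - 2 * \<eta>) * n - h * (\<eta> * n) - 1 \<le> card (nbrs G v (verts G))"
        using K V12(2) unfolding T(2) by linarith
      moreover have "(1/2 - \<epsilon>) * n \<le> (1/2 - 2 * \<eta>) * n - h * (\<eta> * n) - \<eta> * n"
      proof -
        have "(1/2 - \<epsilon>) * n \<le> (1/2 - 2 * \<eta> - h * \<eta> - \<eta>) * n"
        proof (rule mult_right_mono)
          show "1/2 - \<epsilon> \<le> 1/2 - 2 * \<eta> - h * \<eta> - \<eta>"
          proof -
            have "\<eta> * real h + 3 * \<eta> \<le> \<epsilon>" using \<eta>'(1) \<eta>h \<eta>0 by linarith
            then show ?thesis by (simp add: mult.commute[of "real h" \<eta>])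
          qed
        qed simp
        then show ?thesis by (simp add: algebra_simps)
      qed
      ultimately show ?thesis using hn by linarith
    qed
    have "(1/2 - \<epsilon>) * n \<le> (1/2 - 2 * \<eta>) * n" "\<eta> * real n \<le> \<epsilon> * n"
      using \<eta>8 \<eta>0 by (auto intro: mult_right_mono)
    then have "near_bipartition G \<epsilon> n V1 V2"
      unfolding near_bipartition_def using nb V12 \<eta>m by (auto intro: order_trans)
    then show ?thesis using VG degree by blast
  qed
  then show ?thesis by blast
qed

section \<open>A bounded set of exceptional vertices\<close>

lemma card_missing:
  "finite X \<Longrightarrow> real (card (X - nbrs G v X)) = real (card X) - card (nbrs G v X)"
proof -
  assume fin: "finite X"
  have "card (X - nbrs G v X) = card X - card (nbrs G v X)"
    using fin nbrs_subset[of G v X] by (intro card_Diff_subset finite_nbrs)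
  moreover have "card (nbrs G v X) \<le> card X" using fin by (rule card_nbrs_le)
  ultimately show ?thesis by simp
qed

lemma missing_mono:
  "finite Y \<Longrightarrow> X \<subseteq> Y \<Longrightarrow> card (X - nbrs G v X) \<le> card (Y - nbrs G v Y)"
  by (intro card_mono) (auto simp: nbrs_def)

context ballooning
begin

text \<open>
  The smallest colour class goes to \<open>C\<close>, the other two to the pools; \<open>q\<close> vertices in \<open>C\<close> suffice.
\<close>

lemma triple_free_if_no_copy:
  fixes G :: "'b graph"
  assumes bip: "bipartite H" and ne: "edges H \<noteq> {}" and G: "simple_graph G" and no: "\<not> contains_copy G Ht"
    and C: "C \<subseteq> verts G" "qn \<le> card C" and N: "N1 \<subseteq> verts G" "N2 \<subseteq> verts G"
      "card (verts Ht) \<le> card N1" "card (verts Ht) \<le> card N2"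
    and j: "joined G C N1" "joined G C N2" "joined G N1 N2"
  shows False
proof -
  obtain S Y B where T: "three_classes Ht S Y B" "card S = qn"
    using optimal_classes(2)[OF bip ne] by (elim exE conjE)
  have fV: "finite (verts G)" using G by (simp add: simple_graph_def)
  have fin: "finite C" "finite N1" "finite N2" using C(1) N(1,2) fV by (auto intro: finite_subset)
  define N where "N i = (if i then N1 else N2)" for i
  have d: "C \<inter> N1 = {}" "C \<inter> N2 = {}" "N1 \<inter> N2 = {}"
    using joined_disjoint[OF G j(1)] joined_disjoint[OF G j(2)] joined_disjoint[OF G j(3)] by auto
  have "contains_copy G Ht"
    by (rule embed_three_classes[OF simple_Ht T(1) C(1) fin(1), of N])
      (use T(2) C(2) fin N j d in \<open>auto simp: N_def\<close>)
  then show False using no by simp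
qed

lemma qn_le: "bipartite H \<Longrightarrow> edges H \<noteq> {} \<Longrightarrow> qn \<le> card (verts Ht)"
proof -
  assume a: "bipartite H" "edges H \<noteq> {}"
  obtain S Y B where T: "three_classes Ht S Y B" "card S = qn"
    using optimal_classes(2)[OF a] by (elim exE conjE)
  have "S \<subseteq> verts Ht" using T(1) by (auto simp: three_classes_def)
  then show ?thesis using T(2) simple_Ht card_mono[of "verts Ht" S] by (simp add: simple_graph_def)
qed

lemma triple_free_Ht:
  fixes G :: "'b graph"
  assumes bip: "bipartite H" and ne: "edges H \<noteq> {}" and G: "simple_graph G" and no: "\<not> contains_copy G Ht"
  shows "triple_free G (card (verts Ht))"
  unfolding triple_free_def
proof (intro notI, elim exE conjE)
  fix A B C assume "A \<subseteq> verts G" "B \<subseteq> verts G" "C \<subseteq> verts G" "joined G A B" "joined G A C" "joined G B C"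
    and c: "card A = card (verts Ht)" "card B = card (verts Ht)" "card C = card (verts Ht)"
  then show False
    using triple_free_if_no_copy[OF bip ne G no, of A B C] qn_le[OF bip ne] by simp
qed

text \<open>
  The exceptional vertices are of two kinds. Those with many neighbours on both sides number less than \<open>a\<close>: otherwise
  \<open>s\<close> of them have many common neighbours in \<open>V1\<close>, and \<open>q\<close> of these \<open>s\<close> vertices have many in \<open>V2\<close>, which gives a
  copy. All other vertices are assigned to the side on which they have few neighbours. A
  matching inside the two sides has fewer than \<open>card (edges H)\<close> edges, as otherwise it would provide a break for every
  cycle; the ends of a maximal matching are the exceptional vertices of the second kind, and what remains of either side
  is independent.
\<close>

lemma exceptional_set:
  fixes G :: "nat graph" and \<epsilon> :: real
  assumes bip: "bipartite H" and ne: "edges H \<noteq> {}" and G: "simple_graph G" and no: "\<not> contains_copy G Ht"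
    and n: "n = card (verts G)" and V: "V1 \<subseteq> verts G" "V2 \<subseteq> verts G" and nb: "near_bipartition G \<epsilon> n V1 V2"
    and deg: "\<forall>v\<in>verts G. (1/2 - \<epsilon>) * n \<le> card (nbrs G v (verts G))" and \<epsilon>0: "0 < \<epsilon>"
  defines "h \<equiv> card (verts Ht) + card (edges H) + 2"
  defines "s \<equiv> 32 * h * qn"
  defines "a \<equiv> 32 * h * s"
  assumes e1: "64 * h * \<epsilon> \<le> 1" and e2: "2 * h * (s * 2 ^ s) * \<epsilon> \<le> 1"
    and n1: "h * (a * 2 ^ a) \<le> n" and n2: "2 * h * (s * 2 ^ s) \<le> n" and n3: "64 * h \<le> n" and n4: "4 * (a + 2 * h) < n"
  shows "\<exists>W U1 U2. verts G = W \<union> U1 \<union> U2 \<and> W \<inter> U1 = {} \<and> W \<inter> U2 = {} \<and> U1 \<inter> U2 = {} \<and> card W \<le> a + 2 * h \<and>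
    independent G U1 \<and> independent G U2 \<and> U1 \<noteq> {} \<and> U2 \<noteq> {}"
proof -
  have q1: "1 \<le> qn" by (rule optimal_classes(1)[OF bip ne])
  have h2: "2 \<le> h" "card (verts Ht) + 2 \<le> h" "card (edges H) \<le> h" by (auto simp: h_def)
  have hr: "2 \<le> real h" using h2(1) by simp
  have s1: "1 \<le> s" using h2 q1 by (simp add: s_def)
  have fV: "finite (verts G)" using G by (simp add: simple_graph_def)
  have fin: "finite V1" "finite V2" using V fV by (auto intro: finite_subset)
  have npos: "1 \<le> n" "0 < real n" using n3 h2 by auto
  define \<eta> where "\<eta> = 1 / (16 * real h)"
  have \<eta>: "0 < \<eta>" "\<eta> * h = 1/16" "4 * \<epsilon> \<le> \<eta>"
    using hr e1 by (auto simp: \<eta>_def field_simps)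
  have \<epsilon>64: "64 * \<epsilon> \<le> 1/2"
  proof -
    have "64 * \<epsilon> * 2 \<le> 64 * \<epsilon> * h" using \<epsilon>0 hr by (intro mult_left_mono) auto
    then show ?thesis using e1 by (simp add: algebra_simps)
  qed
  have \<eta>32: "\<eta> \<le> 1/32" using hr by (simp add: \<eta>_def field_simps)
  have N: "V1 \<inter> V2 = {}" "(1/2 - \<epsilon>) * n \<le> card V1" "(1/2 - \<epsilon>) * n \<le> card V2"
    "\<forall>v\<in>V1. real (card (V2 - nbrs G v V2)) \<le> \<epsilon> * n" "\<forall>v\<in>V2. real (card (V1 - nbrs G v V1)) \<le> \<epsilon> * n"
    using nb unfolding near_bipartition_def by auto
  have tot: "card V1 + card V2 \<le> n"
    using card_mono[OF fV, of "V1 \<union> V2"] V fin N(1) n by (simp add: card_Un_disjoint)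
  have Vc: "card V1 \<le> n" "card V2 \<le> n" using tot by auto
  have up: "card V1 \<le> (1/2 + \<epsilon>) * n" "card V2 \<le> (1/2 + \<epsilon>) * n"
    using tot N(2,3) by (simp_all add: algebra_simps)
  define W' where "W' = {v \<in> verts G. \<eta> * n \<le> card (nbrs G v V1) \<and> \<eta> * n \<le> card (nbrs G v V2)}"
  have W'a: "card W' < a"
  proof (rule ccontr)
    assume "\<not> card W' < a"
    then have "a \<le> card W'" by simp
    from ex_subset_card[OF this] obtain A0 where A0: "A0 \<subseteq> W'" "card A0 = a" "finite A0" by (elim exE conjE)
    have d0: "\<forall>v\<in>A0. \<eta> * n \<le> card (nbrs G v V1)" using A0(1) by (auto simp: W'_def)
    have c0: "2 * real s \<le> \<eta> * card A0" using hr by (simp add: A0(2) a_def \<eta>_def)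
    obtain A1 X1 where A1: "A1 \<subseteq> A0" "card A1 = s" "X1 \<subseteq> V1" "joined G A1 X1"
      "s * n \<le> card X1 * (card A0 * 2 ^ card A0)"
      using many_common_nbrs[OF A0(3) fin(1) d0 Vc(1) s1 npos(1) c0] by (elim exE conjE)
    have finA1: "finite A1" using A1(1) A0(3) by (rule finite_subset)
    have d1: "\<forall>v\<in>A1. \<eta> * n \<le> card (nbrs G v V2)" using A0(1) A1(1) by (auto simp: W'_def)
    have c1: "2 * real qn \<le> \<eta> * card A1" using hr by (simp add: A1(2) s_def \<eta>_def)
    obtain A2 X2 where A2: "A2 \<subseteq> A1" "card A2 = qn" "X2 \<subseteq> V2" "joined G A2 X2"
      "qn * n \<le> card X2 * (card A1 * 2 ^ card A1)"
      using many_common_nbrs[OF finA1 fin(2) d1 Vc(2) q1 npos(1) c1] by (elim exE conjE)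
    have fX: "finite X1" "finite X2" using A1(3) A2(3) fin by (auto intro: finite_subset)
    have "h * (a * 2 ^ a) \<le> s * n"
    proof -
      have "1 * n \<le> s * n" using s1 by (intro mult_le_mono1)
      then show ?thesis using n1 by linarith
    qed
    also have "\<dots> \<le> card X1 * (a * 2 ^ a)" using A1(5) A0(2) by simp
    finally have "h \<le> card X1" using h2 s1 by (simp add: a_def)
    then have "card (verts Ht) \<le> card X1" using h2 by simp
    from ex_subset_card[OF this] obtain N1 where N1: "N1 \<subseteq> X1" "card N1 = card (verts Ht)" "finite N1"
      by (elim exE conjE)
    have "1 * n \<le> qn * n" using q1 by (intro mult_le_mono1)
    then have nX: "n \<le> card X2 * (s * 2 ^ s)" using A2(5) unfolding A1(2) by linarith
    have "2 * h * (s * 2 ^ s) \<le> card X2 * (s * 2 ^ s)" using n2 nX by (rule le_trans)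
    then have X2a: "2 * h \<le> card X2" using s1 by simp
    have "real n \<le> card X2 * real (s * 2 ^ s)" using nX by (metis of_nat_le_iff of_nat_mult)
    then have "2 * h * \<epsilon> * n \<le> 2 * h * \<epsilon> * (card X2 * real (s * 2 ^ s))"
      using \<epsilon>0 by (intro mult_left_mono) auto
    also have "\<dots> = (2 * real h * (real s * 2 ^ s) * \<epsilon>) * real (card X2)" by simp
    also have "\<dots> \<le> 1 * real (card X2)" using e2 by (intro mult_right_mono) auto
    finally have X2b: "2 * h * \<epsilon> * n \<le> card X2" by simp
    define N2 where "N2 = {t \<in> X2. \<forall>v\<in>N1. {v, t} \<in> edges G}"
    have "real (card X2) - card N1 * (\<epsilon> * n) \<le> card N2"
      unfolding N2_def
    proof (rule common_nbrs_card[OF fX(2) N1(3)])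
      fix v assume "v \<in> N1"
      then have "v \<in> V1" using N1(1) A1(3) by auto
      then have "real (card (V2 - nbrs G v V2)) \<le> \<epsilon> * n" using N(4) by blast
      then show "real (card (X2 - nbrs G v X2)) \<le> \<epsilon> * n"
        using missing_mono[OF fin(2) A2(3), of G v] by linarith
    qed
    moreover have "card N1 * (\<epsilon> * n) \<le> h * (\<epsilon> * n)" using N1(2) h2 \<epsilon>0 by (intro mult_right_mono) auto
    ultimately have "2 * real (card N2) \<ge> card X2" using X2b by simp
    then have N2h: "h \<le> card N2" using X2a by linarith
    show False
    proof (rule triple_free_if_no_copy[OF bip ne G no, of A2 N1 N2])
      show "A2 \<subseteq> verts G" using A2(1) A1(1) A0(1) by (auto simp: W'_def)
      show "N1 \<subseteq> verts G" "N2 \<subseteq> verts G" using N1(1) A1(3) A2(3) V by (auto simp: N2_def)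
      show "joined G A2 N1" using joined_mono[OF A1(4) A2(1) N1(1)] .
      show "joined G A2 N2" using A2(4) by (auto simp: N2_def joined_def)
      show "joined G N1 N2" by (auto simp: N2_def joined_def)
    qed (use A2(2) N1(2) N2h h2 in auto)
  qed
  define P1 where "P1 = {v \<in> verts G - W'. card (nbrs G v V1) < \<eta> * n}"
  define P2 where "P2 = verts G - W' - P1"
  have P: "P1 \<inter> P2 = {}" "verts G = W' \<union> P1 \<union> P2" "W' \<inter> P1 = {}" "W' \<inter> P2 = {}"
    by (auto simp: P1_def P2_def W'_def)
  have P2small: "card (nbrs G v V2) < \<eta> * n" if "v \<in> P2" for v using that by (auto simp: P2_def P1_def W'_def)
  have J: "real (card (verts G - (V1 \<union> V2))) \<le> 2 * \<epsilon> * n"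
  proof -
    have "card (verts G - (V1 \<union> V2)) = n - (card V1 + card V2)"
      using V fin N(1) n by (simp add: card_Diff_subset card_Un_disjoint)
    then show ?thesis using N(2,3) tot by (simp add: algebra_simps of_nat_diff)
  qed
  have split: "real (card (nbrs G v (verts G))) \<le> card (nbrs G v V1) + card (nbrs G v V2) + 2 * \<epsilon> * n" for v
  proof -
    have "nbrs G v (verts G) \<subseteq> nbrs G v V1 \<union> nbrs G v V2 \<union> (verts G - (V1 \<union> V2))" by (auto simp: nbrs_def)
    then have "card (nbrs G v (verts G)) \<le> card (nbrs G v V1 \<union> nbrs G v V2 \<union> (verts G - (V1 \<union> V2)))"
      using fV fin by (intro card_mono) auto
    also have "\<dots> \<le> card (nbrs G v V1) + card (nbrs G v V2) + card (verts G - (V1 \<union> V2))"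
      using card_Un_le[of "nbrs G v V1 \<union> nbrs G v V2" "verts G - (V1 \<union> V2)"]
        card_Un_le[of "nbrs G v V1" "nbrs G v V2"] by linarith
    finally show ?thesis using J by linarith
  qed
  have \<epsilon>\<eta>n: "4 * \<epsilon> * n \<le> \<eta> * n" using \<eta>(3) by (intro mult_right_mono) auto
  have miss1: "real (card (V2 - nbrs G v V2)) \<le> 2 * \<eta> * n" if v: "v \<in> P1" for v
  proof -
    have "(1/2 - \<epsilon>) * n \<le> card (nbrs G v (verts G))" using deg v by (auto simp: P1_def)
    moreover have "card (nbrs G v V1) < \<eta> * n" using v by (simp add: P1_def)
    ultimately show ?thesis using split[of v] up(2) card_missing[OF fin(2), of G v] \<epsilon>\<eta>n
      by (simp add: algebra_simps)
  qed
  have miss2: "real (card (V1 - nbrs G v V1)) \<le> 2 * \<eta> * n" if v: "v \<in> P2" for v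
  proof -
    have "(1/2 - \<epsilon>) * n \<le> card (nbrs G v (verts G))" using deg v by (auto simp: P2_def)
    then show ?thesis using split[of v] up(1) card_missing[OF fin(1), of G v] \<epsilon>\<eta>n P2small[OF v]
      by (simp add: algebra_simps)
  qed
  obtain F where F: "matching G F" "\<And>e. e \<in> F \<Longrightarrow> e \<subseteq> P1 \<or> e \<subseteq> P2"
    "\<And>e. e \<in> edges G \<Longrightarrow> e \<subseteq> P1 \<or> e \<subseteq> P2 \<Longrightarrow> e \<inter> \<Union>F \<noteq> {}"
    using max_matching[OF G, of "\<lambda>e. e \<subseteq> P1 \<or> e \<subseteq> P2"] by blast
  have Fl: "card F < card (edges H)"
  proof (rule ccontr)
    assume "\<not> card F < card (edges H)"
    then have "card (edges H) \<le> card F" by simp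
    from ex_subset_card[OF this] obtain F' where F': "F' \<subseteq> F" "card F' = card (edges H)" "finite F'"
      by (elim exE conjE)
    \<comment> \<open>All \<open>card (edges H)\<close> edges of \<open>F'\<close> are used, with the empty set in place of a colour class.\<close>
    define F1 where "F1 = {e \<in> F'. e \<subseteq> P1}"
    define F2 where "F2 = {e \<in> F'. \<not> e \<subseteq> P1}"
    have F12: "F1 \<union> F2 = F'" "F1 \<inter> F2 = {}" by (auto simp: F1_def F2_def)
    have cF: "card F1 + card F2 = card (edges H)"
      using card_Un_disjoint[of F1 F2] F12 F'(2,3) by (metis finite_Un)
    have mF': "matching G F'" using matching_subset[OF F(1) F'(1)] .
    define M where "M = \<Union>F'"
    have M: "card M = 2 * card (edges H)" "finite M"
      using card_Union_matching[OF G mF'] F'(2) by (auto simp: M_def)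
    have Mh: "card M \<le> 2 * h" using M(1) h2 by simp
    have MF: "\<Union>F1 \<subseteq> M \<inter> P1" "\<Union>F2 \<subseteq> M \<inter> P2" using F(2) F'(1) by (auto simp: F1_def F2_def M_def)
    have \<eta>n0: "0 \<le> 2 * \<eta> * n" using \<eta>(1) by simp
    have pool: "\<exists>N\<subseteq>X - M. card N = h \<and> finite N \<and> joined G Z N"
      if X: "finite X" "(1/2 - \<epsilon>) * n \<le> card X" and Z: "finite Z" "card Z \<le> 3 * h"
        and mZ: "\<And>v. v \<in> Z \<Longrightarrow> real (card (X - nbrs G v X)) \<le> 2 * \<eta> * n" for X Z
    proof -
      let ?K = "{t \<in> X - M. \<forall>v\<in>Z. {v, t} \<in> edges G}"
      have "real (card (X - M)) - card Z * (2 * \<eta> * n) \<le> card ?K"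
      proof (rule common_nbrs_card)
        fix v assume "v \<in> Z"
        then show "real (card (X - M - nbrs G v (X - M))) \<le> 2 * \<eta> * n"
          using mZ[of v] missing_mono[OF X(1), of "X - M" G v] by fastforce
      qed (use X Z in auto)
      moreover have "real (card X) - card M \<le> card (X - M)"
        using diff_card_le_card_Diff[OF M(2), of X] by linarith
      moreover have "card Z * (2 * \<eta> * n) \<le> (3 * h) * (2 * \<eta> * n)"
        using Z(2) \<eta>n0 by (intro mult_right_mono) auto
      moreover have "(3 * real h) * (2 * \<eta> * n) = 6 * (\<eta> * h) * n" by simp
      moreover have "(1/2 - \<epsilon>) * real n \<ge> (31/64) * n" using \<epsilon>64 by (intro mult_right_mono) auto
      moreover have "64 * real h \<le> n" using n3 by linarith
      ultimately have "real h \<le> card ?K" using X(2) Mh \<eta>(2) by simp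
      then have "h \<le> card ?K" by simp
      from ex_subset_card[OF this] obtain N where "N \<subseteq> ?K" "card N = h" "finite N" by (elim exE conjE)
      then show ?thesis by (intro exI[of _ N]) (auto simp: joined_def)
    qed
    have "card (M \<inter> P1) \<le> 3 * h" "card (M \<inter> P2) \<le> 2 * h"
      using card_mono[OF M(2), of "M \<inter> P1"] card_mono[OF M(2), of "M \<inter> P2"] Mh by auto
    obtain N2 where N2: "N2 \<subseteq> V2 - M" "card N2 = h" "finite N2" "joined G (M \<inter> P1) N2"
      using pool[OF fin(2) N(3) _ \<open>card (M \<inter> P1) \<le> 3 * h\<close>] M(2) miss1 by auto
    have "card (M \<inter> P2 \<union> N2) \<le> 3 * h"
      using card_Un_le[of "M \<inter> P2" N2] \<open>card (M \<inter> P2) \<le> 2 * h\<close> N2(2) by simp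
    moreover have "real (card (V1 - nbrs G v V1)) \<le> 2 * \<eta> * n" if v: "v \<in> M \<inter> P2 \<union> N2" for v
    proof (cases "v \<in> P2")
      case False
      then have "v \<in> V2" using v N2(1) by auto
      then have "real (card (V1 - nbrs G v V1)) \<le> \<epsilon> * n" using N(5) by blast
      moreover have "0 \<le> \<epsilon> * n" "0 \<le> \<eta> * n" using \<epsilon>0 \<eta>(1) by auto
      ultimately show ?thesis using \<epsilon>\<eta>n by linarith
    qed (rule miss2)
    ultimately obtain N1 where N1: "N1 \<subseteq> V1 - M" "card N1 = h" "finite N1" "joined G (M \<inter> P2 \<union> N2) N1"
      using pool[OF fin(1) N(2), of "M \<inter> P2 \<union> N2"] M(2) N2(3) by auto
    have "contains_copy G Ht"
    proof (rule embed_matching[where ?F1.0 = F1 and ?F2.0 = F2 and ?N1.0 = N1 and ?N2.0 = N2 and S = "{}" and W = "{}", OF bip G])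
      show "matching G (F1 \<union> F2)" unfolding F12 by (rule mF')
      show "joined G (\<Union>F1) N2" by (rule joined_mono[OF N2(4) MF(1) order_refl])
      show "joined G (\<Union>F2) N1" by (rule joined_mono[OF N1(4) _ order_refl]) (use MF(2) in blast)
      show "joined G N1 N2" by (rule joined_mono[OF joined_sym[OF N1(4)]]) auto
      show "N1 \<inter> N2 = {}" using N1(1) N2(1) N(1) by blast
      show "(N1 \<union> N2) \<inter> ({} \<union> \<Union>(F1 \<union> F2)) = {}" using N1(1) N2(1) unfolding F12 M_def by blast
      show "N1 \<subseteq> verts G" "N2 \<subseteq> verts G" using N1(1) N2(1) V by auto
      show "card {e \<in> edges H. set (c e) \<inter> {} = {}} \<le> card F1 + card F2" using cF by simp
      have "{} \<notin> edges Ht" using simple_Ht by (auto simp: simple_graph_def)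
      then show "independent Ht {}" unfolding independent_def by auto
    qed (use F12 h2 N1 N2 in \<open>auto simp: joined_def\<close>)
    then show False using no by simp
  qed
  define W where "W = W' \<union> \<Union>F"
  have cF: "card (\<Union>F) \<le> 2 * h" "finite (\<Union>F)" using card_Union_matching[OF G F(1)] Fl h2 by auto
  have finW': "finite W'" using fV by (simp add: W'_def)
  have cW: "card W \<le> a + 2 * h" using card_Un_le[of W' "\<Union>F"] W'a cF(1) by (simp add: W_def)
  have FV: "\<Union>F \<subseteq> verts G" using F(2) P(2) by blast
  define U1 where "U1 = P1 - \<Union>F"
  define U2 where "U2 = P2 - \<Union>F"
  have part: "verts G = W \<union> U1 \<union> U2" "W \<inter> U1 = {}" "W \<inter> U2 = {}" "U1 \<inter> U2 = {}"
    using P FV unfolding W_def U1_def U2_def by blast+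
  have ind: "independent G U1" "independent G U2"
    unfolding independent_def
    using F(3) part(1) by (auto simp: U1_def U2_def)
  have cV: "real (a + 2 * h) < card V1" "real (a + 2 * h) < card V2"
  proof -
    have q: "(1/4) * real n \<le> (1/2 - \<epsilon>) * n" using \<epsilon>64 by (intro mult_right_mono) auto
    have n4': "4 * (a + 2 * h) < n" by (rule n4)
    have "(1/4) * real n \<le> card V1" "(1/4) * real n \<le> card V2"
      using order_trans[OF q N(2)] order_trans[OF q N(3)] .
    then have "n \<le> 4 * card V1" "n \<le> 4 * card V2" by linarith+
    from less_le_trans[OF n4' this(1)] less_le_trans[OF n4' this(2)]
    have "a + 2 * h < card V1" "a + 2 * h < card V2" unfolding nat_mult_less_cancel_disj by blast+
    then show "real (a + 2 * h) < card V1" "real (a + 2 * h) < card V2" by (simp_all only: of_nat_less_iff)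
  qed
  have big: "\<eta> * n < (1/2 - 2 * \<epsilon>) * n" using \<eta>32 \<epsilon>64 npos by (intro mult_strict_right_mono) auto
  have V1P: "V1 \<subseteq> W' \<union> P1"
  proof
    fix v assume v: "v \<in> V1"
    have "real (card (V2 - nbrs G v V2)) \<le> \<epsilon> * n" using N(4) v by blast
    then have "(1/2 - 2 * \<epsilon>) * n \<le> card (nbrs G v V2)"
      using card_missing[OF fin(2), of G v] N(3) by (simp add: algebra_simps)
    then have "v \<notin> P2" using P2small[of v] big by auto
    then show "v \<in> W' \<union> P1" using v V(1) P(2) by blast
  qed
  have V2P: "V2 \<subseteq> W' \<union> P2"
  proof
    fix v assume v: "v \<in> V2"
    have "real (card (V1 - nbrs G v V1)) \<le> \<epsilon> * n" using N(5) v by blast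
    then have "(1/2 - 2 * \<epsilon>) * n \<le> card (nbrs G v V1)"
      using card_missing[OF fin(1), of G v] N(2) by (simp add: algebra_simps)
    then have "v \<notin> P1" using big by (auto simp: P1_def)
    then show "v \<in> W' \<union> P2" using v V(2) P(2) by blast
  qed
  have finW: "finite W" using finW' cF(2) by (simp add: W_def)
  have "U1 \<noteq> {}"
  proof
    assume "U1 = {}"
    then have "V1 \<subseteq> W" using V1P by (auto simp: U1_def W_def)
    then have "card V1 \<le> card W" by (rule card_mono[OF finW])
    then show False using cW cV(1) by linarith
  qed
  moreover have "U2 \<noteq> {}"
  proof
    assume "U2 = {}"
    then have "V2 \<subseteq> W" using V2P by (auto simp: U2_def W_def)
    then have "card V2 \<le> card W" by (rule card_mono[OF finW])
    then show False using cW cV(2) by linarith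
  qed
  ultimately show ?thesis using part cW ind
    by (intro exI[of _ W] exI[of _ U1] exI[of _ U2]) simp
qed

end

section \<open>The vertices joined to both sides\<close>

lemma edges_in_independent:
  assumes "independent G U" shows "edges_in G U = 0"
proof -
  have "{e \<in> edges G. e \<subseteq> U} = {}" using assms unfolding independent_def by blast
  then show ?thesis unfolding edges_in_def by (simp only: card.empty)
qed

context ballooning
begin

text \<open>
  Few vertices, each missing few elements of \<open>X\<close>, still have many common neighbours in \<open>X\<close>.
\<close>

lemma common_pool:
  fixes d :: real and G :: "'b graph"
  assumes fin: "finite X" "finite Z" and miss: "\<forall>v\<in>Z. real (card (X - nbrs G v X)) \<le> d"
    and big: "real (card Z) * d + k \<le> card X"
  shows "\<exists>N\<subseteq>X. card N = k \<and> finite N \<and> joined G Z N"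
proof -
  let ?K = "{t \<in> X. \<forall>v\<in>Z. {v, t} \<in> edges G}"
  have "real (card X) - card Z * d \<le> card ?K"
    by (rule common_nbrs_card[OF fin]) (use miss in blast)
  then have "real k \<le> card ?K" using big by linarith
  then have "k \<le> card ?K" by simp
  from ex_subset_card[OF this] obtain N where "N \<subseteq> ?K" "card N = k" "finite N" by (elim exE conjE)
  then show ?thesis by (intro exI[of _ N]) (auto simp: joined_def)
qed

text \<open>
  With \<open>Q\<close> as the \<open>q - 1\<close> vertices joined to both pools, \<open>w\<close> can serve as the centre of the star in \<open>embed_star\<close>:
  it is joined to the pool on the opposite side, and its neighbours on its own side are the leaves.
\<close>

lemma few_nbrs_on_own_side:
  fixes G :: "'b graph" and d :: real
  assumes bip: "bipartite H" and ne: "edges H \<noteq> {}" and G: "simple_graph G" and no: "\<not> contains_copy G Ht"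
    and V: "W \<subseteq> verts G" "U1 \<subseteq> verts G" "U2 \<subseteq> verts G" "W \<inter> U1 = {}" "W \<inter> U2 = {}" "U1 \<inter> U2 = {}"
    and X: "X1 \<subseteq> U1" "X2 \<subseteq> U2" and Q: "Q \<subseteq> W" "qn - 1 \<le> card Q"
    and j: "joined G Q X1" "joined G Q X2" "joined G {w} X2" and w: "w \<in> W" "w \<notin> Q"
    and miss: "\<forall>v\<in>U1. real (card (U2 - nbrs G v U2)) \<le> d" "\<forall>v\<in>U2. real (card (U1 - nbrs G v U1)) \<le> d"
    and h: "card (verts Ht) < h" "kn + 1 \<le> h" and d: "0 \<le> d" "h * d + 2 * h \<le> card X1" "h * d + 2 * h \<le> card X2"
  shows "card (nbrs G w U1) \<le> kn"
proof (rule ccontr)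
  assume "\<not> ?thesis"
  then have "kn + 1 \<le> card (nbrs G w U1)" by simp
  from ex_subset_card[OF this] obtain \<Lambda> where L: "\<Lambda> \<subseteq> nbrs G w U1" "card \<Lambda> = kn + 1" "finite \<Lambda>"
    by (elim exE conjE)
  have fV: "finite (verts G)" using G by (simp add: simple_graph_def)
  have fin: "finite U1" "finite U2" "finite W" using V fV by (auto intro: finite_subset)
  have finX: "finite X1" "finite X2" using X fin by (auto intro: finite_subset)
  have LU: "\<Lambda> \<subseteq> U1" using L(1) nbrs_subset[of G w U1] by blast
  have "real (card \<Lambda>) * d \<le> h * d" using L(2) h(2) d(1) by (intro mult_right_mono) auto
  then have b2: "real (card \<Lambda>) * d + h \<le> card X2" using d(3) by linarith
  have m2: "\<forall>v\<in>\<Lambda>. real (card (X2 - nbrs G v X2)) \<le> d"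
  proof
    fix v assume "v \<in> \<Lambda>"
    then show "real (card (X2 - nbrs G v X2)) \<le> d"
      using miss(1) LU missing_mono[OF fin(2) X(2), of G v] by fastforce
  qed
  obtain N2 where N2: "N2 \<subseteq> X2" "card N2 = h" "finite N2" "joined G \<Lambda> N2"
    using common_pool[OF finX(2) L(3) m2 b2] by (elim exE conjE)
  have fXL: "finite (X1 - \<Lambda>)" using finX by simp
  have m1: "\<forall>v\<in>N2. real (card (X1 - \<Lambda> - nbrs G v (X1 - \<Lambda>))) \<le> d"
  proof
    fix v assume "v \<in> N2"
    then have "v \<in> U2" using N2(1) X(2) by auto
    then show "real (card (X1 - \<Lambda> - nbrs G v (X1 - \<Lambda>))) \<le> d"
      using miss(2) missing_mono[OF fin(1), of "X1 - \<Lambda>" G v] X(1) by fastforce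
  qed
  have "card X1 - card \<Lambda> \<le> card (X1 - \<Lambda>)" by (rule diff_card_le_card_Diff[OF L(3)])
  then have "real (card X1) - h \<le> card (X1 - \<Lambda>)" using L(2) h(2) by linarith
  then have b1: "real (card N2) * d + h \<le> card (X1 - \<Lambda>)" using d(2) N2(2) by simp
  obtain N1 where N1: "N1 \<subseteq> X1 - \<Lambda>" "card N1 = h" "finite N1" "joined G N2 N1"
    using common_pool[OF fXL N2(3) m1 b1] by (elim exE conjE)
  have sub: "N1 \<subseteq> U1" "N2 \<subseteq> U2" "N1 \<inter> \<Lambda> = {}" using N1(1) N2(1) X by auto
  have finQ: "finite Q" using Q(1) fin(3) by (rule finite_subset)
  have "contains_copy G Ht"
  proof (rule embed_star[where ?F1.0 = "{}" and ?F2.0 = "{}" and W = Q and a = w and \<Lambda> = \<Lambda> and ?N1.0 = N1 and ?N2.0 = N2,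
        OF bip ne G])
    show "Q \<subseteq> verts G" "w \<in> verts G" using Q(1) w V(1) by auto
    show "N1 \<subseteq> verts G" "N2 \<subseteq> verts G" using sub V by auto
    fix x assume "x \<in> \<Lambda>"
    then show "{w, x} \<in> edges G" using L(1) by (auto simp: nbrs_def)
  next
    show "Q \<inter> \<Lambda> = {}" "w \<notin> \<Lambda>" using Q(1) LU V(4) w by auto
    show "N1 \<inter> N2 = {}" using sub V(6) by blast
    show "(N1 \<union> N2) \<inter> ({w} \<union> Q \<union> \<Lambda> \<union> \<Union>({} \<union> {})) = {}" using sub LU Q(1) w V(4-6) by auto
    show "joined G N1 N2" using joined_sym[OF N1(4)] .
    show "joined G Q N1" "joined G Q N2" "joined G {w} N2" "joined G \<Lambda> N2"
      using j N1(1) N2(1,4) by (auto simp: joined_def)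
  qed (use finQ Q(2) w L h N1 N2 in \<open>auto simp: matching_def joined_def\<close>)
  then show False using no by simp
qed

end

text \<open>
  The type of \<open>u\<close> is its neighbourhood in \<open>W\<close>. There are at most \<open>2 ^ K\<close> types, so the vertices of types occurring less
  than \<open>\<theta>\<close> times are few altogether, and all other vertices have at most \<open>a\<close> neighbours in \<open>W\<close>.
\<close>

lemma rare_types_sum:
  fixes \<theta> :: real
  assumes fin: "finite W" "finite U" and K: "card W \<le> K" and \<theta>: "0 \<le> \<theta>"
    and a: "\<And>\<tau>. \<tau> \<subseteq> W \<Longrightarrow> \<theta> \<le> card {u \<in> U. nbrs G u W = \<tau>} \<Longrightarrow> card \<tau> \<le> a"
  shows "edges_btw G U W \<le> a * card U + K * (2 ^ K * \<theta>)"
    and "(\<And>\<tau>. \<tau> \<subseteq> W \<Longrightarrow> card {u \<in> U. nbrs G u W = \<tau>} < \<theta>) \<Longrightarrow> card U \<le> 2 ^ K * \<theta>"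
proof -
  let ?T = "\<lambda>\<tau>. {u \<in> U. nbrs G u W = \<tau>}"
  define R where "R = {u \<in> U. card (?T (nbrs G u W)) < \<theta>}"
  define P where "P = {\<tau>. \<tau> \<subseteq> W \<and> card (?T \<tau>) < \<theta>}"
  have finP: "finite P" "card P \<le> 2 ^ K"
  proof -
    have sub: "P \<subseteq> Pow W" by (auto simp: P_def)
    show "finite P" using sub fin(1) by (meson finite_Pow_iff finite_subset)
    have "card P \<le> card (Pow W)" using sub fin(1) by (intro card_mono) auto
    also have "\<dots> = 2 ^ card W" using fin(1) by (rule card_Pow)
    also have "\<dots> \<le> 2 ^ K" using K by (intro power_increasing) auto
    finally show "card P \<le> 2 ^ K" .
  qed
  have R: "card R \<le> 2 ^ K * \<theta>"
  proof -
    have "R \<subseteq> (\<Union>\<tau>\<in>P. ?T \<tau>)"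
    proof
      fix u assume "u \<in> R"
      then have "u \<in> U" "nbrs G u W \<in> P" using nbrs_subset[of G u W] by (auto simp: R_def P_def)
      then show "u \<in> (\<Union>\<tau>\<in>P. ?T \<tau>)" by blast
    qed
    then have "card R \<le> card (\<Union>\<tau>\<in>P. ?T \<tau>)" using finP fin by (intro card_mono) auto
    also have "\<dots> \<le> (\<Sum>\<tau>\<in>P. card (?T \<tau>))" by (rule card_UN_le[OF finP(1)])
    finally have "real (card R) \<le> (\<Sum>\<tau>\<in>P. real (card (?T \<tau>)))"
      by (simp flip: of_nat_sum)
    also have "\<dots> \<le> (\<Sum>\<tau>\<in>P. \<theta>)" by (intro sum_mono) (auto simp: P_def)
    also have "\<dots> = card P * \<theta>" by simp
    also have "\<dots> \<le> 2 ^ K * \<theta>"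
    proof (rule mult_right_mono)
      show "real (card P) \<le> 2 ^ K" using of_nat_mono[OF finP(2), where ?'a = real] by simp
    qed (rule \<theta>)
    finally show ?thesis .
  qed
  have RU: "R \<subseteq> U" by (auto simp: R_def)
  have finR: "finite R" using RU fin(2) by (rule finite_subset)
  have "edges_btw G U W \<le> (\<Sum>u\<in>U. a + (if u \<in> R then K else 0))"
    unfolding edges_btw_def
  proof (rule sum_mono)
    fix u assume u: "u \<in> U"
    show "card (nbrs G u W) \<le> a + (if u \<in> R then K else 0)"
    proof (cases "u \<in> R")
      case True
      then show ?thesis using card_nbrs_le[OF fin(1), of G u] K by simp
    next
      case False
      then have "\<theta> \<le> card (?T (nbrs G u W))" using u by (auto simp: R_def)
      then show ?thesis using a[OF nbrs_subset[of G u W]] by simp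
    qed
  qed
  also have "\<dots> = a * card U + K * card R"
  proof -
    have "U \<inter> {u. u \<in> R} = R" using RU by blast
    then show ?thesis using fin(2) by (simp add: sum.distrib sum.If_cases)
  qed
  finally have "real (edges_btw G U W) \<le> real (a * card U + K * card R)" by (rule of_nat_mono)
  also have "\<dots> = a * card U + K * real (card R)" by simp
  also have "\<dots> \<le> a * card U + K * (2 ^ K * \<theta>)" using R by (intro add_left_mono mult_left_mono) auto
  finally show "edges_btw G U W \<le> a * card U + K * (2 ^ K * \<theta>)" .
  assume "\<And>\<tau>. \<tau> \<subseteq> W \<Longrightarrow> card (?T \<tau>) < \<theta>"
  then have "R = U" using nbrs_subset[of G _ W] by (auto simp: R_def)
  then show "card U \<le> 2 ^ K * \<theta>" using R by simp
qed

context ballooning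
begin

text \<open>
  Let \<open>a\<close> and \<open>b\<close> be the largest sizes of common types \<open>\<tau>1\<close> on \<open>U1\<close> and \<open>\<tau>2\<close> on \<open>U2\<close>. Counting edges, there
  are at most \<open>a * |U1| + b * |U2| + |U1| * |U2|\<close> up to a small fraction of \<open>n\<close>. This is bounded by the product of
  \<open>|U1| + b\<close> and \<open>|U2| + a\<close>, whose sum is \<open>n - |W| + a + b\<close>; comparison with the lower bound \<open>low\<close> gives
  \<open>a + b \<ge> |W| + q - 1\<close>. On the other hand
  \<open>\<tau>1 \<inter> \<tau>2\<close> is joined to large sets on both sides, so it has fewer than \<open>q\<close> elements. Both inequalities are
  therefore sharp: \<open>\<tau>1 \<union> \<tau>2 = W\<close> and \<open>Q = \<tau>1 \<inter> \<tau>2\<close> has \<open>q - 1\<close> elements. A vertex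
  of \<open>\<tau>2 - \<tau>1\<close> has many neighbours in \<open>U2\<close>, hence at most \<open>k\<close> in \<open>U1\<close>, and joins the first side.
\<close>

lemma full_vertices:
  fixes G :: "nat graph" and \<epsilon> :: real
  assumes bip: "bipartite H" and ne: "edges H \<noteq> {}" and G: "simple_graph G" and no: "\<not> contains_copy G Ht"
    and n: "n = card (verts G)"
    and part: "verts G = W \<union> U1 \<union> U2" "W \<inter> U1 = {}" "W \<inter> U2 = {}" "U1 \<inter> U2 = {}"
    and K: "card W \<le> K" "1 \<le> K" and ind: "independent G U1" "independent G U2" and nonempty: "U1 \<noteq> {}" "U2 \<noteq> {}"
    and deg: "\<forall>v\<in>verts G. (1/2 - \<epsilon>) * n \<le> card (nbrs G v (verts G))" and \<epsilon>: "0 < \<epsilon>" "\<epsilon> \<le> 1/8"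
    and low: "real n^2/4 + (real qn - 1) * n / 2 - real qn^2 \<le> card (edges G)"
  defines "h \<equiv> card (verts Ht) + kn + 1"
  defines "\<theta> \<equiv> n / (16 * real K * 2 ^ K)"
  assumes d: "h * (2 * \<epsilon> * n + 2 * K) + 2 * h \<le> \<theta>" and nK: "8 * (real K^2 + 2 * real qn^2) < n" "8 * real K \<le> n"
  shows "\<exists>Q X1 X2. verts G = Q \<union> X1 \<union> X2 \<and> Q \<inter> X1 = {} \<and> Q \<inter> X2 = {} \<and> X1 \<inter> X2 = {} \<and> card Q = qn - 1 \<and>
    edges_in G X1 \<le> K * (K + kn) \<and> edges_in G X2 \<le> K * (K + kn) \<and> n / 4 \<le> card X1 \<and> n / 4 \<le> card X2"
proof -
  have q1: "1 \<le> qn" by (rule optimal_classes(1)[OF bip ne])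
  have fV: "finite (verts G)" using G by (simp add: simple_graph_def)
  have fin: "finite W" "finite U1" "finite U2" using part(1) fV by (auto intro: finite_subset)
  have V: "W \<subseteq> verts G" "U1 \<subseteq> verts G" "U2 \<subseteq> verts G" using part(1) by auto
  define dd where "dd = 2 * \<epsilon> * n + 2 * real K"
  have dd0: "0 \<le> dd" using \<epsilon>(1) by (simp add: dd_def)
  have hd: "h * dd + 2 * h \<le> \<theta>" using d by (simp add: dd_def)
  have npos: "0 < real n" using nK(2) K(2) by linarith
  have tot: "card W + card U1 + card U2 = n"
    using part fin n by (simp add: card_Un_disjoint Int_Un_distrib2)
  have none: "nbrs G v U = {}" if "independent G U" "v \<in> U" for v U
    using that unfolding independent_def nbrs_def by fastforce
  have nb1: "(1/2 - \<epsilon>) * n - K \<le> card (nbrs G v U2)" if v: "v \<in> U1" for v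
  proof -
    have "nbrs G v (verts G) \<subseteq> W \<union> nbrs G v U2"
      using none[OF ind(1) v] unfolding part(1) nbrs_Un using nbrs_subset[of G v W] by auto
    then have "card (nbrs G v (verts G)) \<le> card (W \<union> nbrs G v U2)" using fin by (intro card_mono) auto
    also have "\<dots> \<le> K + card (nbrs G v U2)" using card_Un_le[of W "nbrs G v U2"] K(1) by linarith
    finally have "real (card (nbrs G v (verts G))) \<le> K + card (nbrs G v U2)" by linarith
    then show ?thesis using deg v V(2) by fastforce
  qed
  have nb2: "(1/2 - \<epsilon>) * n - K \<le> card (nbrs G v U1)" if v: "v \<in> U2" for v
  proof -
    have "nbrs G v (verts G) \<subseteq> W \<union> nbrs G v U1"
      using none[OF ind(2) v] unfolding part(1) nbrs_Un using nbrs_subset[of G v W] by auto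
    then have "card (nbrs G v (verts G)) \<le> card (W \<union> nbrs G v U1)" using fin by (intro card_mono) auto
    also have "\<dots> \<le> K + card (nbrs G v U1)" using card_Un_le[of W "nbrs G v U1"] K(1) by linarith
    finally have "real (card (nbrs G v (verts G))) \<le> K + card (nbrs G v U1)" by linarith
    then show ?thesis using deg v V(3) by fastforce
  qed
  obtain v1 v2 where v12: "v1 \<in> U1" "v2 \<in> U2" using nonempty by auto
  have lowU: "(1/2 - \<epsilon>) * n - K \<le> card U1" "(1/2 - \<epsilon>) * n - K \<le> card U2"
    using nb1[OF v12(1)] nb2[OF v12(2)] card_nbrs_le[OF fin(2), of G v2] card_nbrs_le[OF fin(3), of G v1]
    by linarith+
  have quarter: "n / 4 \<le> card U1" "n / 4 \<le> card U2"
  proof -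
    have "(3/8) * real n \<le> (1/2 - \<epsilon>) * n" using \<epsilon>(2) by (intro mult_right_mono) auto
    then show "n / 4 \<le> card U1" "n / 4 \<le> card U2" using lowU nK(2) by linarith+
  qed
  have upU: "real (card U1) \<le> (1/2 + \<epsilon>) * n + K" "real (card U2) \<le> (1/2 + \<epsilon>) * n + K"
    using lowU tot by (simp_all add: algebra_simps)
  have miss: "\<forall>v\<in>U1. real (card (U2 - nbrs G v U2)) \<le> dd" "\<forall>v\<in>U2. real (card (U1 - nbrs G v U1)) \<le> dd"
  proof -
    show "\<forall>v\<in>U1. real (card (U2 - nbrs G v U2)) \<le> dd"
    proof
      fix v assume "v \<in> U1"
      then show "real (card (U2 - nbrs G v U2)) \<le> dd"
        using nb1[of v] upU(2) card_missing[OF fin(3), of G v] by (simp add: dd_def algebra_simps)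
    qed
    show "\<forall>v\<in>U2. real (card (U1 - nbrs G v U1)) \<le> dd"
    proof
      fix v assume "v \<in> U2"
      then show "real (card (U1 - nbrs G v U1)) \<le> dd"
        using nb2[of v] upU(1) card_missing[OF fin(2), of G v] by (simp add: dd_def algebra_simps)
    qed
  qed
  let ?T1 = "\<lambda>\<tau>. {u \<in> U1. nbrs G u W = \<tau>}" and ?T2 = "\<lambda>\<tau>. {u \<in> U2. nbrs G u W = \<tau>}"
  define C1 where "C1 = {\<tau>. \<tau> \<subseteq> W \<and> \<theta> \<le> card (?T1 \<tau>)}"
  define C2 where "C2 = {\<tau>. \<tau> \<subseteq> W \<and> \<theta> \<le> card (?T2 \<tau>)}"
  have finC: "finite C1" "finite C2"
    by (rule finite_subset[of _ "Pow W"]; use fin(1) in \<open>auto simp: C1_def C2_def\<close>)+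
  have \<theta>0: "0 \<le> \<theta>" by (simp add: \<theta>_def)
  have K\<theta>: "real K * (2 ^ K * \<theta>) = n / 16" using K(2) by (simp add: \<theta>_def field_simps)
  have K\<theta>': "2 ^ K * \<theta> \<le> n / 16"
  proof -
    have "1 * (2 ^ K * \<theta>) \<le> real K * (2 ^ K * \<theta>)" using K(2) \<theta>0 by (intro mult_right_mono) auto
    then show ?thesis using K\<theta> by simp
  qed
  have neC1: "C1 \<noteq> {}"
  proof
    assume e: "C1 = {}"
    have r: "card (?T1 \<tau>) < \<theta>" if \<tau>: "\<tau> \<subseteq> W" for \<tau>
    proof -
      have "\<tau> \<notin> C1" using e by simp
      then show ?thesis using \<tau> by (simp add: C1_def)
    qed
    have "real (card U1) \<le> 2 ^ K * \<theta>"
      by (rule rare_types_sum(2)[OF fin(1,2) K(1) \<theta>0, of G "card W"]) (use r fin(1) in \<open>auto intro: card_mono\<close>)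
    then show False using K\<theta>' quarter npos by linarith
  qed
  have neC2: "C2 \<noteq> {}"
  proof
    assume e: "C2 = {}"
    have r: "card (?T2 \<tau>) < \<theta>" if \<tau>: "\<tau> \<subseteq> W" for \<tau>
    proof -
      have "\<tau> \<notin> C2" using e by simp
      then show ?thesis using \<tau> by (simp add: C2_def)
    qed
    have "real (card U2) \<le> 2 ^ K * \<theta>"
      by (rule rare_types_sum(2)[OF fin(1,3) K(1) \<theta>0, of G "card W"]) (use r fin(1) in \<open>auto intro: card_mono\<close>)
    then show False using K\<theta>' quarter npos by linarith
  qed
  define a where "a = Max (card ` C1)"
  define b where "b = Max (card ` C2)"
  have "a \<in> card ` C1" unfolding a_def using finC neC1 by (intro Max_in) auto
  then obtain \<tau>1 where \<tau>1: "\<tau>1 \<subseteq> W" "\<theta> \<le> card (?T1 \<tau>1)" "card \<tau>1 = a" by (auto simp: C1_def)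
  have "b \<in> card ` C2" unfolding b_def using finC neC2 by (intro Max_in) auto
  then obtain \<tau>2 where \<tau>2: "\<tau>2 \<subseteq> W" "\<theta> \<le> card (?T2 \<tau>2)" "card \<tau>2 = b" by (auto simp: C2_def)
  have amax: "card \<tau> \<le> a" if "\<tau> \<subseteq> W" "\<theta> \<le> card (?T1 \<tau>)" for \<tau>
    unfolding a_def using finC that by (intro Max_ge) (auto simp: C1_def)
  have bmax: "card \<tau> \<le> b" if "\<tau> \<subseteq> W" "\<theta> \<le> card (?T2 \<tau>)" for \<tau>
    unfolding b_def using finC that by (intro Max_ge) (auto simp: C2_def)
  have count: "real (card (edges G)) \<le> real K^2 + real a * real (card U1) + real b * real (card U2) + n / 8 + real (card U1) * real (card U2)"
  proof -
    have e0: "edges_in G U1 = 0" "edges_in G U2 = 0"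
      using ind by (simp_all add: edges_in_independent)
    have "edges_in G (W \<union> (U1 \<union> U2)) = edges_in G W + edges_in G (U1 \<union> U2) + edges_btw G W (U1 \<union> U2)"
      using fin part by (intro edges_in_Un[OF G]) auto
    also have "edges_in G (U1 \<union> U2) = edges_btw G U1 U2"
      using edges_in_Un[OF G fin(2,3) part(4)] e0 by simp
    also have "edges_btw G W (U1 \<union> U2) = edges_btw G (U1 \<union> U2) W"
      using fin by (intro edges_btw_swap) auto
    also have "\<dots> = edges_btw G U1 W + edges_btw G U2 W"
      unfolding edges_btw_def using fin part by (intro sum.union_disjoint) auto
    finally have e: "card (edges G) = edges_in G W + edges_btw G U1 U2 + (edges_btw G U1 W + edges_btw G U2 W)"
      using edges_in_verts[OF G] part(1) by (simp add: Un_assoc)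
    have "edges_btw G U1 U2 \<le> card U1 * card U2"
      unfolding edges_btw_def using sum_bounded_above[of U1 "\<lambda>x. card (nbrs G x U2)" "card U2"]
        card_nbrs_le[OF fin(3)] by auto
    then have e1: "real (edges_btw G U1 U2) \<le> real (card U1) * card U2" by (metis of_nat_le_iff of_nat_mult)
    have "2 * edges_in G W \<le> K * K" using edges_in_le[OF G fin(1)] mult_le_mono[OF K(1) K(1)] by linarith
    then have "edges_in G W \<le> K * K" by simp
    then have e2: "real (edges_in G W) \<le> real K^2" by (metis of_nat_le_iff of_nat_mult power2_eq_square)
    have e3: "real (edges_btw G U1 W) \<le> real a * real (card U1) + n / 16" "real (edges_btw G U2 W) \<le> real b * real (card U2) + n / 16"
      using rare_types_sum(1)[OF fin(1,2) K(1) \<theta>0, of G a] rare_types_sum(1)[OF fin(1,3) K(1) \<theta>0, of G b]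
        amax bmax K\<theta> by auto
    have "real (card (edges G)) = real (edges_in G W) + real (edges_btw G U1 U2) +
        (real (edges_btw G U1 W) + real (edges_btw G U2 W))" using e by simp
    then show ?thesis using e1 e2 e3 by linarith
  qed
  \<comment> \<open>If \<open>a + b\<close> were smaller by one, the count would fall short by \<open>n/2\<close> up to the error terms.\<close>
  have ab: "card W + qn \<le> a + b + 1"
  proof (rule ccontr)
    assume "\<not> ?thesis"
    then have s: "real a + real b \<le> real (card W) + real qn - 2" using q1 by linarith
    let ?x = "real (card U1) + b" and ?y = "real (card U2) + a"
    have xy: "?x + ?y \<le> n + (real qn - 2)" using s tot by linarith
    have gen: "4 * (x * y) \<le> (x + y)^2" for x y :: real
      using sum_squares_bound[of x y] by (simp add: power2_sum)
    have "4 * (?x * ?y) \<le> (?x + ?y)^2" by (rule gen)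
    also have "\<dots> \<le> (n + (real qn - 2))^2" using xy by (intro power_mono) auto
    also have "\<dots> = real n^2 + 2 * (real qn - 2) * n + (real qn - 2)^2"
      by (subst power2_sum) (simp only: add_ac mult_ac)
    also have "(real qn - 2)^2 \<le> 4 * real qn^2"
    proof -
      have "\<bar>real qn - 2\<bar> \<le> \<bar>2 * real qn\<bar>" using q1 by linarith
      then have "(real qn - 2)^2 \<le> (2 * real qn)^2" by (rule abs_le_square_iff[THEN iffD1])
      then show ?thesis by (simp add: power_mult_distrib)
    qed
    finally have f4: "4 * (?x * ?y) \<le> real n^2 + 2 * (real qn - 2) * n + 4 * real qn^2" by simp
    have gen2: "z \<le> N / 4 + r * x / 2 + y" if "4 * z \<le> N + 2 * r * x + 4 * y" for z N r x y :: real
      using that by (simp add: field_simps)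
    have "?x * ?y \<le> real n^2 / 4 + (real qn - 2) * n / 2 + real qn^2" by (rule gen2[OF f4])
    moreover have "real a * real (card U1) + real b * real (card U2) + real (card U1) * real (card U2) \<le> ?x * ?y"
      by (simp add: algebra_simps)
    moreover have "e \<le> k + n8 + R" if "P \<le> R" "x + y + z \<le> P" "e \<le> k + x + y + n8 + z" for e k n8 R P x y z :: real
      using that by linarith
    ultimately have "real (card (edges G)) \<le> real K^2 + n / 8 + (real n^2 / 4 + (real qn - 2) * n / 2 + real qn^2)"
      using count by blast
    moreover have "(real qn - 1) * n / 2 - (real qn - 2) * n / 2 = n / 2" by (simp add: field_simps)
    ultimately have "n / 2 \<le> real K^2 + n / 8 + 2 * real qn^2" using low by linarith
    moreover have "False" if "x / 2 \<le> X + x / 8 + 2 * Y" "8 * (X + 2 * Y) < x" "0 < x" for x X Y :: real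
      using that by simp
    ultimately show False using nK(1) npos by blast
  qed
  have finT: "finite (?T1 \<tau>)" "finite (?T2 \<tau>)" for \<tau> using fin by auto
  have jT1: "joined G \<tau> (?T1 \<tau>)" and jT2: "joined G \<tau> (?T2 \<tau>)" for \<tau>
    by (auto simp: joined_def nbrs_def insert_commute[of _ "_::nat"])
  have hX: "real h * dd + 2 * real h \<le> card (?T1 \<tau>1)" "real h * dd + 2 * real h \<le> card (?T2 \<tau>2)"
    using hd \<tau>1(2) \<tau>2(2) by simp_all
  have hd0: "0 \<le> h * dd" using dd0 by simp
  have int: "card (\<tau>1 \<inter> \<tau>2) < qn"
  proof (rule ccontr)
    assume "\<not> ?thesis"
    then have qle: "qn \<le> card (\<tau>1 \<inter> \<tau>2)" by simp
    have "h \<le> card (?T1 \<tau>1)" using hX(1) hd0 by linarith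
    from ex_subset_card[OF this] obtain N1 where N1: "N1 \<subseteq> ?T1 \<tau>1" "card N1 = h" "finite N1" by (elim exE conjE)
    have m: "\<forall>v\<in>N1. real (card (?T2 \<tau>2 - nbrs G v (?T2 \<tau>2))) \<le> dd"
    proof
      fix v assume "v \<in> N1"
      then have "v \<in> U1" using N1(1) by auto
      then show "real (card (?T2 \<tau>2 - nbrs G v (?T2 \<tau>2))) \<le> dd"
        using miss(1) missing_mono[OF fin(3), of "?T2 \<tau>2" G v] by fastforce
    qed
    have big: "real (card N1) * dd + h \<le> card (?T2 \<tau>2)" using hX(2) N1(2) by simp
    obtain N2 where N2: "N2 \<subseteq> ?T2 \<tau>2" "card N2 = h" "finite N2" "joined G N1 N2"
      using common_pool[OF finT(2) N1(3) m big] by (elim exE conjE)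
    show False
    proof (rule triple_free_if_no_copy[OF bip ne G no, of "\<tau>1 \<inter> \<tau>2" N1 N2])
      show "joined G (\<tau>1 \<inter> \<tau>2) N1" by (rule joined_mono[OF jT1 _ N1(1)]) auto
      show "joined G (\<tau>1 \<inter> \<tau>2) N2" by (rule joined_mono[OF jT2 _ N2(1)]) auto
      show "\<tau>1 \<inter> \<tau>2 \<subseteq> verts G" using \<tau>1(1) V(1) by auto
      show "N1 \<subseteq> verts G" "N2 \<subseteq> verts G" using N1(1) N2(1) V by auto
    qed (use qle N1 N2 in \<open>auto simp: h_def\<close>)
  qed
  have fin\<tau>: "finite \<tau>1" "finite \<tau>2" using \<tau>1(1) \<tau>2(1) fin(1) by (auto intro: finite_subset)
  have "card (\<tau>1 \<union> \<tau>2) + card (\<tau>1 \<inter> \<tau>2) = a + b" using card_Un_Int[OF fin\<tau>] \<tau>1(3) \<tau>2(3) by simp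
  moreover have Un: "\<tau>1 \<union> \<tau>2 \<subseteq> W" using \<tau>1(1) \<tau>2(1) by blast
  moreover have "card (\<tau>1 \<union> \<tau>2) \<le> card W" using Un fin(1) by (rule card_mono[rotated])
  ultimately have cQ: "card (\<tau>1 \<inter> \<tau>2) = qn - 1" and "card (\<tau>1 \<union> \<tau>2) = card W" using ab int by linarith+
  then have W: "\<tau>1 \<union> \<tau>2 = W" using Un fin(1) card_subset_eq by metis
  define Q where "Q = \<tau>1 \<inter> \<tau>2"
  define A1 where "A1 = \<tau>2 - \<tau>1"
  define A2 where "A2 = \<tau>1 - \<tau>2"
  have QA: "W = Q \<union> A1 \<union> A2" "Q \<inter> A1 = {}" "Q \<inter> A2 = {}" "A1 \<inter> A2 = {}" "Q \<subseteq> \<tau>1" "Q \<subseteq> \<tau>2" "A1 \<subseteq> \<tau>2" "A2 \<subseteq> \<tau>1"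
    using W by (auto simp: Q_def A1_def A2_def)
  have T1s: "?T1 \<tau>1 \<subseteq> U1" and T2s: "?T2 \<tau>2 \<subseteq> U2" by auto
  have h: "card (verts Ht) < h" "kn + 1 \<le> h" by (auto simp: h_def)
  have QW: "Q \<subseteq> W" "qn - 1 \<le> card Q" using QA cQ by (auto simp: Q_def)
  have jQ: "joined G Q (?T1 \<tau>1)" "joined G Q (?T2 \<tau>2)"
    using joined_mono[OF jT1 QA(5) order_refl] joined_mono[OF jT2 QA(6) order_refl] by auto
  have own1: "card (nbrs G w U1) \<le> kn" if w: "w \<in> A1" for w
  proof (rule few_nbrs_on_own_side[OF bip ne G no V part(2-4) T1s T2s QW jQ _ _ _ miss h dd0 hX])
    have "{w} \<subseteq> \<tau>2" using w QA(7) by auto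
    then show "joined G {w} (?T2 \<tau>2)" by (rule joined_mono[OF jT2 _ order_refl])
    show "w \<in> W" "w \<notin> Q" using w QA by auto
  qed
  have own2: "card (nbrs G w U2) \<le> kn" if w: "w \<in> A2" for w
  proof (rule few_nbrs_on_own_side[OF bip ne G no V(1,3,2) part(3,2) _ T2s T1s QW jQ(2,1) _ _ _ miss(2,1) h dd0 hX(2,1)])
    have "{w} \<subseteq> \<tau>1" using w QA(8) by auto
    then show "joined G {w} (?T1 \<tau>1)" by (rule joined_mono[OF jT1 _ order_refl])
    show "w \<in> W" "w \<notin> Q" using w QA by auto
    show "U2 \<inter> U1 = {}" using part(4) by auto
  qed
  have inside: "edges_in G (U \<union> A) \<le> K * (K + kn)"
    if "independent G U" "finite U" "A \<subseteq> W" "A \<inter> U = {}" "\<forall>w\<in>A. card (nbrs G w U) \<le> kn" for U A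
  proof -
    have finA: "finite A" "card A \<le> K" using that(3) fin(1) K(1) card_mono[OF fin(1) that(3)] by (auto intro: finite_subset)
    have "edges_in G U = 0" using that(1) by (rule edges_in_independent)
    moreover have "edges_in G A \<le> K * K"
      using edges_in_le[OF G finA(1)] mult_le_mono[OF finA(2) finA(2)] by linarith
    moreover have "edges_btw G A U \<le> K * kn"
    proof -
      have "edges_btw G A U \<le> card A * kn" unfolding edges_btw_def
        using sum_bounded_above[of A "\<lambda>w. card (nbrs G w U)" kn] that(5) by auto
      also have "\<dots> \<le> K * kn" using finA(2) by (rule mult_le_mono1)
      finally show ?thesis .
    qed
    moreover have "edges_in G (A \<union> U) = edges_in G A + edges_in G U + edges_btw G A U"
      using finA that(2,4) by (intro edges_in_Un[OF G])
    ultimately show ?thesis by (simp add: Un_commute distrib_left)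
  qed
  have E1: "edges_in G (U1 \<union> A1) \<le> K * (K + kn)" by (rule inside[OF ind(1) fin(2)]) (use QA part own1 in auto)
  have E2: "edges_in G (U2 \<union> A2) \<le> K * (K + kn)" by (rule inside[OF ind(2) fin(3)]) (use QA part own2 in auto)
  have finA: "finite A1" "finite A2" using fin\<tau> by (auto simp: A1_def A2_def)
  have "card U1 \<le> card (U1 \<union> A1)" "card U2 \<le> card (U2 \<union> A2)" using fin finA by (auto intro: card_mono)
  then have "n / 4 \<le> card (U1 \<union> A1)" "n / 4 \<le> card (U2 \<union> A2)" using quarter by linarith+
  moreover have "verts G = Q \<union> (U1 \<union> A1) \<union> (U2 \<union> A2)" using part(1) QA(1) by blast
  moreover have "Q \<inter> (U1 \<union> A1) = {}" "Q \<inter> (U2 \<union> A2) = {}" "(U1 \<union> A1) \<inter> (U2 \<union> A2) = {}"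
    using QA part(2-4) by blast+
  moreover have "card Q = qn - 1" using cQ by (simp add: Q_def)
  ultimately show ?thesis using E1 E2
    by (intro exI[of _ Q] exI[of _ "U1 \<union> A1"] exI[of _ "U2 \<union> A2"]) simp
qed

end

section \<open>Edges inside the sides against missing edges between them\<close>

text \<open>
  For disjoint \<open>X\<close> and \<open>Y\<close>, the number of missing edges between them.
\<close>

definition nonadj :: "'a graph \<Rightarrow> 'a set \<Rightarrow> 'a set \<Rightarrow> nat" where
  "nonadj G X Y = (\<Sum>x\<in>X. card (Y - nbrs G x Y))"

lemma nonadj_plus_edges_btw:
  assumes "finite X" "finite Y"
  shows "nonadj G X Y + edges_btw G X Y = card X * card Y"
proof -
  have "card (Y - nbrs G x Y) + card (nbrs G x Y) = card Y" for x
    using assms(2) nbrs_subset[of G x Y] card_mono[OF assms(2), of "nbrs G x Y"] by (simp add: card_Diff_subset)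
  then have "(\<Sum>x\<in>X. card (Y - nbrs G x Y) + card (nbrs G x Y)) = (\<Sum>x\<in>X. card Y)" by simp
  then show ?thesis by (simp add: nonadj_def edges_btw_def sum.distrib)
qed

lemma nonadj_swap:
  assumes "finite X" "finite Y"
  shows "nonadj G X Y = nonadj G Y X"
  using nonadj_plus_edges_btw[OF assms, of G] nonadj_plus_edges_btw[OF assms(2,1), of G] edges_btw_swap[OF assms, of G]
  by (simp add: mult.commute)

lemma nonadj_mono:
  assumes "finite X'" "finite Y'" "X \<subseteq> X'" "Y \<subseteq> Y'"
  shows "nonadj G X Y \<le> nonadj G X' Y'"
proof -
  have "nonadj G X Y \<le> (\<Sum>x\<in>X. card (Y' - nbrs G x Y'))"
    unfolding nonadj_def using assms by (intro sum_mono card_mono) (auto simp: nbrs_def)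
  also have "\<dots> \<le> nonadj G X' Y'" unfolding nonadj_def using assms by (intro sum_mono2) auto
  finally show ?thesis .
qed

text \<open>
  What \<open>embed_star\<close> forbids at each vertex of \<open>U1\<close>: a star inside \<open>U1\<close>, a matching of \<open>U1\<close> avoiding it, and a
  matching of \<open>U2\<close> whose edges are reached from its centre have at most \<open>\<kappa>\<close> edges in total.
\<close>

definition star_bounded :: "'a graph \<Rightarrow> 'a set \<Rightarrow> 'a set \<Rightarrow> nat \<Rightarrow> bool" where
  "star_bounded G U1 U2 \<kappa> \<longleftrightarrow> (\<forall>a\<in>U1. \<forall>F1 F2. matching G F1 \<longrightarrow> (\<forall>e\<in>F1. e \<subseteq> U1 - insert a (nbrs G a U1)) \<longrightarrow>
     matching G F2 \<longrightarrow> (\<forall>e\<in>F2. e \<subseteq> U2 \<and> (\<exists>b\<in>e. {a, b} \<in> edges G)) \<longrightarrow>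
     card (nbrs G a U1) + card F1 + card F2 \<le> \<kappa>)"

definition complete_inside :: "'a graph \<Rightarrow> 'a set \<Rightarrow> nat \<Rightarrow> bool" where
  "complete_inside G U \<kappa> \<longleftrightarrow> (\<exists>A B. A \<subseteq> U \<and> B \<subseteq> U \<and> A \<inter> B = {} \<and> card A = \<kappa> \<and> card B = \<kappa> \<and>
     {e \<in> edges G. e \<subseteq> U} = {{x, y} | x y. x \<in> A \<and> y \<in> B})"

text \<open>
  The edges of \<open>F\<close> that \<open>star_bounded\<close> does not count at \<open>a\<close>; each of them accounts for two missing edges at \<open>a\<close>.
\<close>

definition avoided :: "'a graph \<Rightarrow> 'a set set \<Rightarrow> 'a \<Rightarrow> nat" where
  "avoided G F a = card {e \<in> F. \<forall>b\<in>e. {a, b} \<notin> edges G}"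

lemma max_matching_ex:
  assumes "simple_graph G"
  shows "\<exists>F. matching G F \<and> (\<forall>e\<in>F. P e) \<and> (\<forall>e\<in>edges G. P e \<longrightarrow> e \<inter> \<Union>F \<noteq> {})"
  by (rule max_matching[OF assms, of P]) auto

lemma avoided_le: "finite F \<Longrightarrow> avoided G F a \<le> card F"
  unfolding avoided_def by (intro card_mono) auto

lemma avoided_nonadj:
  assumes "simple_graph G" "matching G F"
  shows "2 * avoided G F a \<le> card (\<Union>F - nbrs G a (\<Union>F))"
proof -
  let ?B = "{e \<in> F. \<forall>b\<in>e. {a, b} \<notin> edges G}"
  have mB: "matching G ?B" by (rule matching_subset[OF assms(2)]) auto
  have "2 * avoided G F a = card (\<Union>?B)"
    using card_Union_matching(1)[OF assms(1) mB] by (simp add: avoided_def)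
  also have "\<dots> \<le> card (\<Union>F - nbrs G a (\<Union>F))"
    using card_Union_matching(2)[OF assms] by (intro card_mono) (auto simp: nbrs_def)
  finally show ?thesis .
qed

lemma star_bounded_avoided:
  assumes G: "simple_graph G" and sb: "star_bounded G U1 U2 \<kappa>" and a: "a \<in> U1"
    and F1: "matching G F1" "\<forall>e\<in>F1. e \<subseteq> U1 - insert a (nbrs G a U1)"
    and F2: "matching G F2" "\<forall>e\<in>F2. e \<subseteq> U2"
  shows "card (nbrs G a U1) + card F1 + card F2 \<le> \<kappa> + avoided G F2 a"
proof -
  let ?B = "{e \<in> F2. \<forall>b\<in>e. {a, b} \<notin> edges G}"
  have fin: "finite F2" by (rule finite_matching[OF G F2(1)])
  have m: "matching G (F2 - ?B)" by (rule matching_subset[OF F2(1)]) auto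
  have p: "\<forall>e\<in>F2 - ?B. e \<subseteq> U2 \<and> (\<exists>b\<in>e. {a, b} \<in> edges G)" using F2(2) by auto
  have "card (nbrs G a U1) + card F1 + card (F2 - ?B) \<le> \<kappa>"
    using sb[unfolded star_bounded_def, rule_format, OF a F1(1) _ m] F1(2) p by simp
  moreover have "card F2 = card (F2 - ?B) + card ?B"
    using fin by (simp add: card_Diff_subset card_mono)
  ultimately show ?thesis by (simp add: avoided_def)
qed

text \<open>
  The ends of a maximal matching form a cover, and the edges of the matching are counted twice.
\<close>

lemma edges_through_matching:
  assumes G: "simple_graph G" and U: "finite U" and M: "matching G M" "\<And>e. e \<in> M \<Longrightarrow> e \<subseteq> U"
    "\<And>e. e \<in> edges G \<Longrightarrow> e \<subseteq> U \<Longrightarrow> e \<inter> \<Union>M \<noteq> {}"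
  shows "edges_in G U + card M \<le> (\<Sum>v\<in>\<Union>M. card (nbrs G v U))"
proof -
  have sub: "\<Union>M \<subseteq> U" using M(2) by blast
  have "edges_in G U + edges_in G (\<Union>M) = (\<Sum>v\<in>\<Union>M. card (nbrs G v U))"
    using M(3) by (intro edges_in_cover[OF G U sub]) auto
  then show ?thesis using card_matching_le_edges_in[OF G M(1)] by linarith
qed

lemma star_sum_bound:
  assumes G: "simple_graph G" and sb: "star_bounded G U1 U2 \<kappa>" and U: "finite U1" "finite U2"
    and F2: "matching G F2" "\<forall>e\<in>F2. e \<subseteq> U2" and C: "C \<subseteq> U1"
  shows "2 * ((\<Sum>v\<in>C. int (card (nbrs G v U1)))) \<le> 2 * card C * (int \<kappa> - card F2) + nonadj G C (\<Union>F2)"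
proof -
  have finC: "finite C" using C U(1) by (rule finite_subset)
  have "2 * int (card (nbrs G v U1)) \<le> 2 * (int \<kappa> - card F2) + card (\<Union>F2 - nbrs G v (\<Union>F2))" if "v \<in> C" for v
  proof -
    have "card (nbrs G v U1) + card ({} :: 'a set set) + card F2 \<le> \<kappa> + avoided G F2 v"
      by (rule star_bounded_avoided[OF G sb _ _ _ F2]) (use that C in \<open>auto simp: matching_def\<close>)
    then show ?thesis using avoided_nonadj[OF G F2(1), of v] by simp
  qed
  then have "(\<Sum>v\<in>C. 2 * int (card (nbrs G v U1))) \<le> (\<Sum>v\<in>C. 2 * (int \<kappa> - card F2) + card (\<Union>F2 - nbrs G v (\<Union>F2)))"
    by (intro sum_mono)
  also have "\<dots> = int (card C) * (2 * (int \<kappa> - card F2)) + nonadj G C (\<Union>F2)"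
    by (simp add: sum.distrib nonadj_def)
  finally show ?thesis by (simp add: sum_distrib_left[symmetric] mult.left_commute mult.assoc)
qed

text \<open>
  The \<open>\<kappa>\<close> neighbours of \<open>a\<close> cover all edges and have degree at most \<open>\<kappa>\<close>. So \<open>\<kappa>^2\<close> edges
  are possible only if the neighbours are pairwise nonadjacent and all have degree \<open>\<kappa>\<close>. The same holds for the
  neighbourhood \<open>N'\<close> of such a neighbour \<open>b\<close>; as \<open>N'\<close> is also a cover, all edges go between the two sets.
\<close>

lemma extremal_star_bounded:
  assumes G: "simple_graph G" and U: "finite U" and sb: "star_bounded G U U' \<kappa>" and \<kappa>: "1 \<le> \<kappa>"
    and e: "edges_in G U = \<kappa>^2" and a: "a \<in> U" "card (nbrs G a U) = \<kappa>"
  shows "complete_inside G U \<kappa>"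
proof -
  have dle: "card (nbrs G v U) \<le> \<kappa>" if "v \<in> U" for v
    using sb[unfolded star_bounded_def, rule_format, OF that, of "{}" "{}"] by (simp add: matching_def)
  have meets: "e \<inter> nbrs G b U \<noteq> {}" if b: "b \<in> U" "card (nbrs G b U) = \<kappa>" and e: "e \<in> edges G" "e \<subseteq> U" for b e
  proof
    assume dis: "e \<inter> nbrs G b U = {}"
    obtain x y where xy: "e = {x, y}" using edge_ends[OF G e(1)] by (elim exE conjE)
    have "b \<notin> e"
    proof
      assume "b \<in> e"
      then obtain z where z: "e = {b, z}" using xy by auto
      then have "z \<in> nbrs G b U" using e by (auto simp: nbrs_def)
      then show False using dis z by auto
    qed
    then have sub: "\<forall>f\<in>{e}. f \<subseteq> U - insert b (nbrs G b U)" using dis e(2) by auto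
    have m: "matching G {e}" using e(1) by (simp add: matching_def)
    have "card (nbrs G b U) + card {e} + card {} \<le> \<kappa>"
      using sb[unfolded star_bounded_def, rule_format, OF b(1) m, of "{}"] sub by (simp add: matching_def)
    then show False using b(2) by simp
  qed
  define N where "N = nbrs G a U"
  have N: "N \<subseteq> U" "card N = \<kappa>" using nbrs_subset[of G a U] a(2) by (auto simp: N_def)
  have finN: "finite N" using N(1) U by (rule finite_subset)
  have sum: "edges_in G U + edges_in G N = (\<Sum>v\<in>N. card (nbrs G v U))"
    using meets[OF a] by (intro edges_in_cover[OF G U N(1)]) (auto simp: N_def)
  have "(\<Sum>v\<in>N. card (nbrs G v U)) \<le> (\<Sum>v\<in>N. \<kappa>)" using dle N(1) by (intro sum_mono) auto
  then have le: "(\<Sum>v\<in>N. card (nbrs G v U)) \<le> \<kappa>^2" using N(2) by (simp add: power2_eq_square)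
  then have e0: "edges_in G N = 0" using sum e by linarith
  have dN: "card (nbrs G v U) = \<kappa>" if v: "v \<in> N" for v
  proof (rule ccontr)
    assume "card (nbrs G v U) \<noteq> \<kappa>"
    then have "card (nbrs G v U) < \<kappa>" using dle[of v] v N(1) by auto
    then have "(\<Sum>v\<in>N. card (nbrs G v U)) < (\<Sum>v\<in>N. \<kappa>)"
      using dle N(1) v finN by (intro sum_strict_mono_ex1) auto
    then show False using sum e N(2) by (simp add: power2_eq_square)
  qed
  have indN: "\<not> f \<subseteq> N" if f: "f \<in> edges G" for f
  proof
    assume "f \<subseteq> N"
    then have "f \<in> {e \<in> edges G. e \<subseteq> N}" using f by simp
    moreover have "finite {e \<in> edges G. e \<subseteq> N}" using finite_edges[OF G] by simp
    ultimately show False using e0 unfolding edges_in_def by (metis card_0_eq empty_iff)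
  qed
  have "N \<noteq> {}" using N(2) \<kappa> by auto
  then obtain b where b: "b \<in> N" by blast
  have bU: "b \<in> U" using b N(1) by blast
  define N' where "N' = nbrs G b U"
  have N': "N' \<subseteq> U" "card N' = \<kappa>" using nbrs_subset[of G b U] dN[OF b] by (auto simp: N'_def)
  have finN': "finite N'" using N'(1) U by (rule finite_subset)
  have NN': "N \<inter> N' = {}"
  proof (rule ccontr)
    assume "N \<inter> N' \<noteq> {}"
    then obtain z where "z \<in> N" "{b, z} \<in> edges G" by (auto simp: N'_def nbrs_def)
    then show False using indN[of "{b, z}"] b by simp
  qed
  have all: "nbrs G v U = N'" if v: "v \<in> N" for v
  proof -
    have "nbrs G v U \<subseteq> N'"
    proof
      fix z assume z: "z \<in> nbrs G v U"
      then have "{v, z} \<in> edges G" "{v, z} \<subseteq> U" using v N(1) by (auto simp: nbrs_def)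
      then have "{v, z} \<inter> N' \<noteq> {}" unfolding N'_def by (rule meets[OF bU dN[OF b]])
      then show "z \<in> N'" using v NN' by auto
    qed
    then show ?thesis using dN[OF v] N'(2) finN' card_subset_eq by metis
  qed
  have "{e \<in> edges G. e \<subseteq> U} = {{x, y} | x y. x \<in> N \<and> y \<in> N'}"
  proof (intro subset_antisym subsetI)
    fix f assume f: "f \<in> {e \<in> edges G. e \<subseteq> U}"
    then have "f \<inter> N \<noteq> {}" using meets[OF a] by (auto simp: N_def)
    then obtain v where v: "v \<in> N" "v \<in> f" by blast
    obtain x y where "f = {x, y}" using edge_ends[OF G, of f] f by blast
    then obtain z where z: "f = {v, z}" using v(2) by auto
    then have "z \<in> nbrs G v U" using f by (auto simp: nbrs_def)
    then show "f \<in> {{x, y} | x y. x \<in> N \<and> y \<in> N'}" using all[OF v(1)] v z by blast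
  next
    fix f assume "f \<in> {{x, y} | x y. x \<in> N \<and> y \<in> N'}"
    then obtain x y where xy: "f = {x, y}" "x \<in> N" "y \<in> N'" by blast
    then have "y \<in> nbrs G x U" using all by simp
    then show "f \<in> {e \<in> edges G. e \<subseteq> U}" using xy N(1) by (auto simp: nbrs_def)
  qed
  then show ?thesis unfolding complete_inside_def using N N' NN' by blast
qed

text \<open>
  With \<open>L = \<kappa> - \<mu>2\<close> the first product is at most \<open>L^2 + \<mu>2 * L\<close>, since \<open>\<nu>\<close> is at most \<open>L - m\<close>
  and \<open>(2 * L - m) * m = L^2 - (L - m)^2\<close>.
\<close>

lemma weight_algebra:
  fixes m \<nu> \<beta> \<mu>2 \<mu>1 \<kappa> :: int
  assumes mn: "m + \<nu> \<le> \<kappa> - \<mu>2" and pos: "0 \<le> \<nu>" "0 \<le> \<beta>" "\<beta> \<le> \<mu>2" "\<mu>1 + \<mu>2 \<le> \<kappa>" "0 \<le> \<mu>1"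
    and big: "\<kappa> < 2 * \<mu>1" and d: "0 \<le> m + \<beta> + 2 * \<nu>"
  shows "(m + \<beta> + 2 * \<nu>) * m + 2 * \<mu>2 * (\<kappa> - \<mu>1) \<le> \<kappa>^2 - \<mu>2"
proof -
  define L where "L = \<kappa> - \<mu>2"
  have L: "0 \<le> L" using pos by (simp add: L_def)
  have A: "(m + \<beta> + 2 * \<nu>) * m \<le> L^2 + \<mu>2 * L"
  proof (cases "0 \<le> m")
    case True
    have "(m + \<beta> + 2 * \<nu>) * m \<le> (m + \<mu>2 + 2 * (L - m)) * m"
      using True mn pos(3) by (intro mult_right_mono) (auto simp: L_def)
    also have "\<dots> = L^2 - (L - m)^2 + \<mu>2 * m" by (simp add: power2_eq_square algebra_simps)
    also have "\<mu>2 * m \<le> \<mu>2 * L" using mn pos by (intro mult_left_mono) (auto simp: L_def)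
    finally show ?thesis using zero_le_power2[of "L - m"] by linarith
  next
    case False
    then have "(m + \<beta> + 2 * \<nu>) * m \<le> 0" using d by (simp add: mult_nonneg_nonpos)
    moreover have "0 \<le> L^2 + \<mu>2 * L" using L pos by simp
    ultimately show ?thesis by linarith
  qed
  have "\<mu>2 * (2 * (\<kappa> - \<mu>1)) \<le> \<mu>2 * (\<kappa> - 1)" using big pos by (intro mult_left_mono) auto
  then have B: "2 * \<mu>2 * (\<kappa> - \<mu>1) \<le> \<mu>2 * \<kappa> - \<mu>2" by (simp add: algebra_simps)
  have "L^2 + \<mu>2 * L + \<mu>2 * \<kappa> = \<kappa>^2" by (simp add: L_def power2_eq_square algebra_simps)
  then show ?thesis using A B by linarith
qed

text \<open>
  The matching number of \<open>U1\<close> exceeds \<open>\<kappa>/2\<close>, that of \<open>U2\<close> is then below it. Each vertex \<open>v\<close> of \<open>U1\<close> has the weight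
  \<open>deg v - \<beta> v\<close>, where \<open>\<beta> v\<close> edges of the matching \<open>M2\<close> are avoided by \<open>v\<close> at the price of two missing edges each.
  Let \<open>a\<close> have maximal weight. Its neighbours, together with the ends of a maximal matching \<open>F\<close> outside the star
  at \<open>a\<close>, cover all edges inside \<open>U1\<close>, so the edges inside \<open>U1\<close> are bounded by the weight of \<open>a\<close> times the size of
  this cover plus half of the missing edges. The other half pays for the edges inside \<open>U2\<close>, which are counted
  at the ends of \<open>M2\<close>. Equality forces \<open>M2\<close> to be empty and \<open>a\<close> to have degree \<open>\<kappa>\<close>.
\<close>

lemma inside_excess_large:
  assumes G: "simple_graph G" and U: "finite U1" "finite U2"
    and sb: "star_bounded G U1 U2 \<kappa>" "star_bounded G U2 U1 \<kappa>"
    and M1: "matching G M1" "\<And>e. e \<in> M1 \<Longrightarrow> e \<subseteq> U1" "\<And>e. e \<in> edges G \<Longrightarrow> e \<subseteq> U1 \<Longrightarrow> e \<inter> \<Union>M1 \<noteq> {}"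
    and M2: "matching G M2" "\<And>e. e \<in> M2 \<Longrightarrow> e \<subseteq> U2" "\<And>e. e \<in> edges G \<Longrightarrow> e \<subseteq> U2 \<Longrightarrow> e \<inter> \<Union>M2 \<noteq> {}"
    and mm: "card M1 + card M2 \<le> \<kappa>" and big: "\<kappa> < 2 * card M1"
  shows "edges_in G U1 + edges_in G U2 \<le> \<kappa>^2 + nonadj G U1 U2"
    "edges_in G U1 + edges_in G U2 = \<kappa>^2 + nonadj G U1 U2 \<Longrightarrow>
      nonadj G U1 U2 = 0 \<and> complete_inside G U1 \<kappa> \<and> edges_in G U2 = 0"
proof -
  define \<mu>1 where "\<mu>1 = card M1"
  define \<mu>2 where "\<mu>2 = card M2"
  define \<beta> where "\<beta> v = avoided G M2 v" for v
  define deg where "deg v = card (nbrs G v U1)" for v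
  define wt where "wt v = int (deg v) - int (\<beta> v)" for v
  have sub: "\<Union>M1 \<subseteq> U1" "\<Union>M2 \<subseteq> U2" using M1(2) M2(2) by blast+
  have M1ne: "\<Union>M1 \<noteq> {}"
  proof
    assume "\<Union>M1 = {}"
    then have "card (\<Union>M1) = 0" by (simp only: card.empty)
    then show False using card_Union_matching(1)[OF G M1(1)] big by simp
  qed
  then have "U1 \<noteq> {}" using sub by blast
  have "finite (wt ` U1)" "wt ` U1 \<noteq> {}" using U \<open>U1 \<noteq> {}\<close> by auto
  then have "Max (wt ` U1) \<in> wt ` U1" by (rule Max_in)
  then obtain a where a: "a \<in> U1" "wt a = Max (wt ` U1)" by auto
  have best: "wt v \<le> wt a" if "v \<in> U1" for v unfolding a(2) using U that by (intro Max_ge) auto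
  define N where "N = nbrs G a U1"
  obtain F where F0: "matching G F" "\<forall>e\<in>F. e \<subseteq> U1 - insert a N"
    "\<forall>e\<in>edges G. e \<subseteq> U1 - insert a N \<longrightarrow> e \<inter> \<Union>F \<noteq> {}"
    using max_matching_ex[OF G, of "\<lambda>e. e \<subseteq> U1 - insert a N"] by (elim exE conjE)
  note F = F0(1) F0(2)[rule_format] F0(3)[rule_format]
  define \<nu> where "\<nu> = card F"
  define C where "C = N \<union> \<Union>F"
  have FU: "\<Union>F \<subseteq> U1 - insert a N" using F(2) by blast
  have NU: "N \<subseteq> U1" using nbrs_subset[of G a U1] by (simp add: N_def)
  have aN: "a \<notin> N" unfolding N_def by (rule not_self_nbr[OF G])
  have CU: "C \<subseteq> U1" "a \<notin> C" using FU NU aN by (auto simp: C_def)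
  have finN: "finite N" using NU U(1) by (rule finite_subset)
  have finC: "finite C" using CU(1) U(1) by (rule finite_subset)
  have cC: "card C = deg a + 2 * \<nu>"
    using card_Union_matching[OF G F(1)] finN FU
    by (subst C_def, subst card_Un_disjoint) (auto simp: deg_def N_def \<nu>_def)
  have cover: "e \<inter> C \<noteq> {}" if e: "e \<in> edges G" "e \<subseteq> U1" for e
  proof (cases "e \<inter> N = {}")
    case True
    obtain x y where xy: "e = {x, y}" using edge_ends[OF G e(1)] by (elim exE conjE)
    have "a \<notin> e"
    proof
      assume "a \<in> e"
      then obtain z where z: "e = {a, z}" using xy by auto
      then have "z \<in> N" using e by (auto simp: N_def nbrs_def)
      then show False using True z by auto
    qed
    then have "e \<subseteq> U1 - insert a N" using True e(2) by auto
    then show ?thesis using F(3)[OF e(1)] by (auto simp: C_def)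
  qed (auto simp: C_def)
  have s1: "edges_in G U1 + edges_in G C = (\<Sum>v\<in>C. deg v)"
    unfolding deg_def using cover by (intro edges_in_cover[OF G U(1) CU(1)]) auto
  have "card F \<le> edges_in G C"
    unfolding edges_in_def using F(1) finite_edges[OF G] by (intro card_mono) (auto simp: C_def matching_def)
  then have s2: "int (edges_in G U1) + \<nu> \<le> (\<Sum>v\<in>C. wt v) + (\<Sum>v\<in>C. int (\<beta> v))"
  proof -
    have "(\<Sum>v\<in>C. wt v) + (\<Sum>v\<in>C. int (\<beta> v)) = (\<Sum>v\<in>C. int (deg v))"
      by (simp add: wt_def sum_subtractf)
    moreover have "(\<Sum>v\<in>C. int (deg v)) = int (\<Sum>v\<in>C. deg v)" by simp
    moreover have "edges_in G U1 + \<nu> \<le> (\<Sum>v\<in>C. deg v)" using \<open>card F \<le> edges_in G C\<close> s1 by (simp add: \<nu>_def)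
    ultimately show ?thesis by (metis of_nat_add of_nat_mono)
  qed
  have s3: "(\<Sum>v\<in>C. wt v) \<le> (int (deg a) + 2 * \<nu>) * wt a"
  proof -
    have "(\<Sum>v\<in>C. wt v) \<le> (\<Sum>v\<in>C. wt a)" using best CU by (intro sum_mono) auto
    then show ?thesis using cC by simp
  qed
  \<comment> \<open>As \<open>a\<close> is outside the cover, \<open>\<beta> a\<close> comes in addition; it compensates the gain of \<open>a\<close> in \<open>Sa\<close>.\<close>
  have s4: "(\<Sum>v\<in>C. int (\<beta> v)) + \<beta> a \<le> (\<Sum>v\<in>U1. int (\<beta> v))"
  proof -
    have "(\<Sum>v\<in>insert a C. int (\<beta> v)) \<le> (\<Sum>v\<in>U1. int (\<beta> v))"
      using U(1) CU a(1) by (intro sum_mono2) auto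
    then show ?thesis using finC CU(2) by simp
  qed
  define Z where "Z = nonadj G U1 (\<Union>M2)"
  have s5: "2 * (\<Sum>v\<in>U1. int (\<beta> v)) \<le> Z"
  proof -
    have "(\<Sum>v\<in>U1. 2 * \<beta> v) \<le> Z"
      unfolding Z_def nonadj_def \<beta>_def by (intro sum_mono avoided_nonadj[OF G M2(1)])
    then have "int (\<Sum>v\<in>U1. 2 * \<beta> v) \<le> int Z" by (rule of_nat_mono)
    then show ?thesis by (simp add: sum_distrib_left)
  qed
  have finC2: "finite (\<Union>M1)" "finite (\<Union>M2)" using card_Union_matching(2)[OF G] M1(1) M2(1) by auto
  have s6: "2 * (int (edges_in G U2) + \<mu>2) \<le> 4 * int \<mu>2 * (int \<kappa> - \<mu>1) + Z"
  proof -
    have "edges_in G U2 + \<mu>2 \<le> (\<Sum>v\<in>\<Union>M2. card (nbrs G v U2))"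
      unfolding \<mu>2_def by (rule edges_through_matching[OF G U(2) M2])
    then have "int (edges_in G U2 + \<mu>2) \<le> int (\<Sum>v\<in>\<Union>M2. card (nbrs G v U2))" by (rule of_nat_mono)
    moreover have "2 * (\<Sum>v\<in>\<Union>M2. int (card (nbrs G v U2))) \<le> 2 * card (\<Union>M2) * (int \<kappa> - card M1) + nonadj G (\<Union>M2) (\<Union>M1)"
      using M1(2) by (intro star_sum_bound[OF G sb(2) U(2,1) M1(1) _ sub(2)]) auto
    moreover have "nonadj G (\<Union>M2) (\<Union>M1) \<le> Z"
      unfolding Z_def using nonadj_swap[OF finC2(2) U(1), of G] nonadj_mono[OF finC2(2) U(1) order_refl sub(1), of G] by simp
    ultimately show ?thesis using card_Union_matching(1)[OF G M2(1)] by (simp add: \<mu>1_def \<mu>2_def)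
  qed
  have Znz: "Z \<le> nonadj G U1 U2" unfolding Z_def by (rule nonadj_mono[OF U order_refl sub(2)])
  have Sa: "deg a + \<nu> + \<mu>2 \<le> \<kappa> + \<beta> a"
    unfolding deg_def \<nu>_def \<mu>2_def \<beta>_def
    by (rule star_bounded_avoided[OF G sb(1) a(1) F(1) _ M2(1)]) (use F(2) M2(2) in \<open>auto simp: N_def\<close>)
  have b2: "\<beta> a \<le> \<mu>2" unfolding \<beta>_def \<mu>2_def by (rule avoided_le[OF finite_matching[OF G M2(1)]])
  have dega: "int (deg a) = wt a + \<beta> a" by (simp add: wt_def)
  have alg: "(wt a + int (\<beta> a) + 2 * int \<nu>) * wt a + 2 * int \<mu>2 * (int \<kappa> - int \<mu>1) \<le> (int \<kappa>)^2 - int \<mu>2"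
    by (rule weight_algebra) (use Sa b2 mm big dega in \<open>auto simp: \<mu>1_def \<mu>2_def\<close>)
  have main: "int (edges_in G U1) + edges_in G U2 + \<nu> + \<beta> a + 2 * \<mu>2 \<le> (int \<kappa>)^2 + Z"
  proof -
    have gen: "u1 + u2 + x + b + 2 * m2 \<le> k2 + z"
      if "u1 + x \<le> sw + sb" "sw \<le> X" "sb + b \<le> su" "2 * su \<le> z" "2 * (u2 + m2) \<le> 2 * Y + z" "X + Y \<le> k2 - m2"
      for u1 u2 x b m2 k2 z sw sb X Y su :: int using that by simp
    have s3': "(\<Sum>v\<in>C. wt v) \<le> (wt a + int (\<beta> a) + 2 * int \<nu>) * wt a" using s3 by (simp add: dega)
    have s6': "2 * (int (edges_in G U2) + int \<mu>2) \<le> 2 * (2 * int \<mu>2 * (int \<kappa> - int \<mu>1)) + int Z" using s6 by simp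
    show ?thesis using gen[OF s2 s3' s4 s5 s6' alg] by simp
  qed
  then have "int (edges_in G U1 + edges_in G U2) \<le> int (\<kappa>^2 + nonadj G U1 U2)" using Znz by simp
  then show "edges_in G U1 + edges_in G U2 \<le> \<kappa>^2 + nonadj G U1 U2" by (simp only: of_nat_le_iff)
  assume eq: "edges_in G U1 + edges_in G U2 = \<kappa>^2 + nonadj G U1 U2"
  then have eqi: "int (edges_in G U1) + edges_in G U2 = (int \<kappa>)^2 + nonadj G U1 U2"
    by (metis of_nat_add of_nat_power)
  have z: "\<mu>2 = 0" "\<nu> = 0" "\<beta> a = 0" "Z = nonadj G U1 U2" using main eqi Znz by linarith+
  then have "M2 = {}" using finite_matching[OF G M2(1)] by (simp add: \<mu>2_def)
  then have Z0: "Z = 0" by (simp add: Z_def nonadj_def)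
  have e2: "edges_in G U2 = 0"
  proof -
    have "{e \<in> edges G. e \<subseteq> U2} = {}" using M2(3) \<open>M2 = {}\<close> by auto
    then show ?thesis unfolding edges_in_def by (simp only: card.empty)
  qed
  have e1: "edges_in G U1 = \<kappa>^2" using eq e2 z(4) Z0 by simp
  have \<kappa>1: "1 \<le> \<kappa>" using mm big by linarith
  have degk: "deg a \<le> \<kappa>" using Sa z by simp
  have "(int \<kappa>)^2 \<le> int (deg a) * deg a"
    using s2 s3 s4 s5 Z0 z e1 dega by simp
  then have "\<kappa> * \<kappa> \<le> deg a * deg a" by (simp add: power2_eq_square flip: of_nat_mult)
  then have "\<not> deg a < \<kappa>" using mult_strict_mono[of "deg a" \<kappa> "deg a" \<kappa>] \<kappa>1 by auto
  then have "card (nbrs G a U1) = \<kappa>" using degk by (simp add: deg_def)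
  then show "nonadj G U1 U2 = 0 \<and> complete_inside G U1 \<kappa> \<and> edges_in G U2 = 0"
    using extremal_star_bounded[OF G U(1) sb(1) \<kappa>1 e1 a(1)] e2 z(4) Z0 by simp
qed

text \<open>
  If both matching numbers are at most \<open>\<kappa>/2\<close>, counting at the ends of maximal matchings suffices and even yields a strict
  inequality unless \<open>\<kappa> = 0\<close>. Otherwise exactly one of them is larger, since their sum is at most \<open>\<kappa>\<close>.
\<close>

lemma inside_excess:
  assumes G: "simple_graph G" and U: "finite U1" "finite U2"
    and sb: "star_bounded G U1 U2 \<kappa>" "star_bounded G U2 U1 \<kappa>"
    and mm: "\<And>M1 M2. matching G M1 \<Longrightarrow> matching G M2 \<Longrightarrow> (\<forall>e\<in>M1. e \<subseteq> U1) \<Longrightarrow> (\<forall>e\<in>M2. e \<subseteq> U2) \<Longrightarrow>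
       card M1 + card M2 \<le> \<kappa>"
  shows "edges_in G U1 + edges_in G U2 \<le> \<kappa>^2 + nonadj G U1 U2 \<and>
    (edges_in G U1 + edges_in G U2 = \<kappa>^2 + nonadj G U1 U2 \<longrightarrow> nonadj G U1 U2 = 0 \<and>
      (complete_inside G U1 \<kappa> \<and> edges_in G U2 = 0 \<or> complete_inside G U2 \<kappa> \<and> edges_in G U1 = 0))"
proof -
  obtain M1 where M1: "matching G M1" "\<And>e. e \<in> M1 \<Longrightarrow> e \<subseteq> U1" "\<And>e. e \<in> edges G \<Longrightarrow> e \<subseteq> U1 \<Longrightarrow> e \<inter> \<Union>M1 \<noteq> {}"
    using max_matching[OF G, of "\<lambda>e. e \<subseteq> U1"] by blast
  obtain M2 where M2: "matching G M2" "\<And>e. e \<in> M2 \<Longrightarrow> e \<subseteq> U2" "\<And>e. e \<in> edges G \<Longrightarrow> e \<subseteq> U2 \<Longrightarrow> e \<inter> \<Union>M2 \<noteq> {}"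
    using max_matching[OF G, of "\<lambda>e. e \<subseteq> U2"] by blast
  have m12: "card M1 + card M2 \<le> \<kappa>" using mm[OF M1(1) M2(1)] M1(2) M2(2) by auto
  then have m21: "card M2 + card M1 \<le> \<kappa>" by simp
  consider "\<kappa> < 2 * card M1" | "\<kappa> < 2 * card M2" | "2 * card M1 \<le> \<kappa>" "2 * card M2 \<le> \<kappa>" by linarith
  then show ?thesis
  proof cases
    case 1
    show ?thesis using inside_excess_large[OF G U sb M1 M2 m12 1] by auto
  next
    case 2
    show ?thesis using inside_excess_large[OF G U(2,1) sb(2,1) M2 M1 m21 2] nonadj_swap[OF U, of G]
      by (auto simp: add.commute)
  next
    case 3
    let ?m1 = "int (card M1)" and ?m2 = "int (card M2)" and ?k = "int \<kappa>"
    have sub: "\<Union>M1 \<subseteq> U1" "\<Union>M2 \<subseteq> U2" using M1(2) M2(2) by blast+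
    have finC: "finite (\<Union>M1)" "finite (\<Union>M2)" using card_Union_matching(2)[OF G] M1(1) M2(1) by auto
    define Z where "Z = nonadj G (\<Union>M1) (\<Union>M2)"
    have Znz: "Z \<le> nonadj G U1 U2" unfolding Z_def by (rule nonadj_mono[OF U sub])
    have "int (edges_in G U1 + card M1) \<le> int (\<Sum>v\<in>\<Union>M1. card (nbrs G v U1))"
      by (rule of_nat_mono[OF edges_through_matching[OF G U(1) M1]])
    moreover have "2 * (\<Sum>v\<in>\<Union>M1. int (card (nbrs G v U1))) \<le> 2 * card (\<Union>M1) * (?k - ?m2) + Z"
      unfolding Z_def using M2(2) by (intro star_sum_bound[OF G sb(1) U M2(1) _ sub(1)]) auto
    ultimately have A: "2 * (int (edges_in G U1) + ?m1) \<le> 4 * ?m1 * (?k - ?m2) + Z"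
      using card_Union_matching(1)[OF G M1(1)] by simp
    have "int (edges_in G U2 + card M2) \<le> int (\<Sum>v\<in>\<Union>M2. card (nbrs G v U2))"
      by (rule of_nat_mono[OF edges_through_matching[OF G U(2) M2]])
    moreover have "2 * (\<Sum>v\<in>\<Union>M2. int (card (nbrs G v U2))) \<le> 2 * card (\<Union>M2) * (?k - ?m1) + nonadj G (\<Union>M2) (\<Union>M1)"
      using M1(2) by (intro star_sum_bound[OF G sb(2) U(2,1) M1(1) _ sub(2)]) auto
    ultimately have B: "2 * (int (edges_in G U2) + ?m2) \<le> 4 * ?m2 * (?k - ?m1) + Z"
      using card_Union_matching(1)[OF G M2(1)] nonadj_swap[OF finC, of G] by (simp add: Z_def)
    have "0 \<le> (?k - 2 * ?m1) * (?k - 2 * ?m2)" using 3 by (intro mult_nonneg_nonneg) auto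
    then have "2 * (?m1 * (?k - ?m2)) + 2 * (?m2 * (?k - ?m1)) \<le> ?k^2"
      by (simp add: power2_eq_square algebra_simps)
    moreover have "2 * (int (edges_in G U1) + ?m1) \<le> 4 * (?m1 * (?k - ?m2)) + Z" using A by (simp only: mult.assoc)
    moreover have "2 * (int (edges_in G U2) + ?m2) \<le> 4 * (?m2 * (?k - ?m1)) + Z" using B by (simp only: mult.assoc)
    moreover have "e1 + e2 + m1 + m2 \<le> k2 + z" if "2 * x + 2 * y \<le> k2" "2 * (e1 + m1) \<le> 4 * x + z"
      "2 * (e2 + m2) \<le> 4 * y + z" for x y k2 e1 e2 m1 m2 z :: int using that by simp
    ultimately have main: "int (edges_in G U1) + int (edges_in G U2) + ?m1 + ?m2 \<le> ?k^2 + int Z" by blast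
    have "int (edges_in G U1 + edges_in G U2) \<le> int (\<kappa>^2 + nonadj G U1 U2)" using main Znz by simp
    then have le: "edges_in G U1 + edges_in G U2 \<le> \<kappa>^2 + nonadj G U1 U2" by (simp only: of_nat_le_iff)
    moreover have "nonadj G U1 U2 = 0 \<and> complete_inside G U1 \<kappa> \<and> edges_in G U2 = 0"
      if eq: "edges_in G U1 + edges_in G U2 = \<kappa>^2 + nonadj G U1 U2"
    proof -
      have eqi: "int (edges_in G U1) + int (edges_in G U2) = ?k^2 + int (nonadj G U1 U2)"
        using eq by (metis of_nat_add of_nat_power)
      have "card M1 = 0" "card M2 = 0" using main eqi Znz by linarith+
      then have em: "M1 = {}" "M2 = {}" using finite_matching[OF G] M1(1) M2(1) by auto
      have E: "{e \<in> edges G. e \<subseteq> U1} = {}" "{e \<in> edges G. e \<subseteq> U2} = {}" using M1(3) M2(3) em by auto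
      then have e0: "edges_in G U1 = 0" "edges_in G U2 = 0" unfolding edges_in_def by (simp_all only: card.empty)
      then have "\<kappa> = 0" "nonadj G U1 U2 = 0" using eq by auto
      moreover have "complete_inside G U1 0" unfolding complete_inside_def E(1)
        by (intro exI[of _ "{}"]) auto
      ultimately show ?thesis using e0 by simp
    qed
    ultimately show ?thesis by blast
  qed
qed

section \<open>The graph F(n,q) and the lower bound\<close>

lemma isomorphic_image:
  assumes G: "simple_graph G" and inj: "inj_on \<psi> (verts G)"
  shows "isomorphic G \<lparr>verts = \<psi> ` verts G, edges = (\<lambda>e. \<psi> ` e) ` edges G\<rparr>"
proof -
  have "card (\<psi> ` e) = 2 \<and> \<psi> ` e \<subseteq> \<psi> ` verts G" if "e \<in> edges G" for e
  proof -
    have e: "e \<subseteq> verts G" "card e = 2" using G that by (auto simp: simple_graph_def)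
    then have "card (\<psi> ` e) = card e" using inj by (intro card_image) (meson inj_on_subset)
    then show ?thesis using e by auto
  qed
  then have "simple_graph \<lparr>verts = \<psi> ` verts G, edges = (\<lambda>e. \<psi> ` e) ` edges G\<rparr>"
    using G by (auto simp: simple_graph_def)
  then show ?thesis unfolding isomorphic_def using G inj
    by (intro conjI exI[of _ \<psi>]) (auto simp: bij_betw_def)
qed

lemma isomorphic_sym:
  assumes "isomorphic G G'" shows "isomorphic G' G"
proof -
  obtain f where G: "simple_graph G" "simple_graph G'" and f: "bij_betw f (verts G) (verts G')"
    "(\<lambda>e. f ` e) ` edges G = edges G'" using assms by (auto simp: isomorphic_def)
  define g where "g = inv_into (verts G) f"
  have g: "bij_betw g (verts G') (verts G)" unfolding g_def by (rule bij_betw_inv_into[OF f(1)])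
  have gf: "g ` f ` e = e" if "e \<in> edges G" for e
  proof -
    have "e \<subseteq> verts G" using G(1) that by (simp add: simple_graph_def)
    then have "g (f x) = x" if "x \<in> e" for x using that f(1) by (auto simp: g_def bij_betw_def)
    then show ?thesis by (force simp: image_image)
  qed
  have "(\<lambda>e. g ` e) ` edges G' = (\<lambda>e. g ` f ` e) ` edges G" unfolding f(2)[symmetric] by (simp add: image_image)
  also have "\<dots> = (\<lambda>e. e) ` edges G" using gf by (intro image_cong) auto
  finally have "(\<lambda>e. g ` e) ` edges G' = edges G" by simp
  then show ?thesis unfolding isomorphic_def using G g by blast
qed

lemma isomorphic_trans:
  assumes "isomorphic G G'" "isomorphic G' G''" shows "isomorphic G G''"
proof -
  obtain f where f: "simple_graph G" "bij_betw f (verts G) (verts G')" "(\<lambda>e. f ` e) ` edges G = edges G'"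
    using assms(1) by (auto simp: isomorphic_def)
  obtain g where g: "simple_graph G''" "bij_betw g (verts G') (verts G'')" "(\<lambda>e. g ` e) ` edges G' = edges G''"
    using assms(2) by (auto simp: isomorphic_def)
  have "bij_betw (g \<circ> f) (verts G) (verts G'')" using f(2) g(2) by (rule bij_betw_trans)
  moreover have "(\<lambda>e. (g \<circ> f) ` e) ` edges G = edges G''"
    unfolding g(3)[symmetric] f(3)[symmetric] by (simp add: image_image image_comp[symmetric])
  ultimately show ?thesis unfolding isomorphic_def using f(1) g(1) by blast
qed

lemma isomorphic_card_edges:
  assumes "isomorphic G G'" shows "card (edges G) = card (edges G')" "card (verts G) = card (verts G')"
proof -
  obtain f where f: "simple_graph G" "bij_betw f (verts G) (verts G')" "(\<lambda>e. f ` e) ` edges G = edges G'"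
    using assms by (auto simp: isomorphic_def)
  have "inj_on (\<lambda>e. f ` e) (Pow (verts G))" using f(2) by (intro inj_on_image_Pow) (simp add: bij_betw_def)
  moreover have "edges G \<subseteq> Pow (verts G)" using f(1) by (auto simp: simple_graph_def)
  ultimately have "inj_on (\<lambda>e. f ` e) (edges G)" by (rule inj_on_subset)
  then show "card (edges G) = card (edges G')" using f(3) card_image by fastforce
  show "card (verts G) = card (verts G')" using f(2) by (rule bij_betw_same_card)
qed

lemma isomorphic_contains_copy:
  assumes "isomorphic G G'" "contains_copy G L" "simple_graph L" shows "contains_copy G' L"
proof -
  obtain f where f: "bij_betw f (verts G) (verts G')" "(\<lambda>e. f ` e) ` edges G = edges G'"
    using assms(1) by (auto simp: isomorphic_def)
  obtain g where g: "inj_on g (verts L)" "g ` verts L \<subseteq> verts G" "\<forall>e\<in>edges L. g ` e \<in> edges G"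
    using assms(2) by (auto simp: contains_copy_def)
  have "inj_on (f \<circ> g) (verts L)" using g(1,2) f(1) by (intro comp_inj_on) (auto simp: bij_betw_def intro: inj_on_subset)
  moreover have "(f \<circ> g) ` verts L \<subseteq> verts G'" using g(2) f(1) by (auto simp: bij_betw_def)
  moreover have "(f \<circ> g) ` e \<in> edges G'" if "e \<in> edges L" for e
    using g(3) that unfolding f(2)[symmetric] image_comp[symmetric] by blast
  ultimately show ?thesis unfolding contains_copy_def by blast
qed

lemma nat_representative:
  assumes "simple_graph G" shows "\<exists>G'::nat graph. isomorphic G G'"
proof -
  have "finite (verts G)" using assms by (simp add: simple_graph_def)
  then obtain \<psi> where "bij_betw \<psi> (verts G) {0..<card (verts G)}" using ex_bij_betw_finite_nat by blast
  then have "inj_on \<psi> (verts G)" by (simp add: bij_betw_def)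
  then show ?thesis using isomorphic_image[OF assms] by blast
qed

abbreviation "half1 N \<equiv> N div (2::nat)"
abbreviation "half2 N \<equiv> N - N div (2::nat)"

lemma F_graph_verts:
  "verts (F_graph n q) = Inl ` {..<q - 1} \<union> Inr ` (Inl ` {..<half1 (n - q + 1)} \<union> Inr ` {..<half2 (n - q + 1)})"
  by (simp add: F_graph_def join_def disjoint_union_def turan2_def complete_bipartite_def empty_graph_def Plus_def)

lemma complete_bipartite_edges:
  "edges (complete_bipartite a b) = {{Inl u, Inr v} | u v. u < a \<and> v < b}"
  by (simp add: complete_bipartite_def join_def disjoint_union_def empty_graph_def)

lemma F_graph_edges:
  "edges (F_graph n q) =
    {{Inl i, Inr (Inl u)} | i u. i < q - 1 \<and> u < half1 (n - q + 1)} \<union>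
    {{Inl i, Inr (Inr v)} | i v. i < q - 1 \<and> v < half2 (n - q + 1)} \<union>
    {{Inr (Inl u), Inr (Inr v)} | u v. u < half1 (n - q + 1) \<and> v < half2 (n - q + 1)}"
proof -
  define a where "a = half1 (n - q + 1)"
  define b where "b = half2 (n - q + 1)"
  have T: "turan2 (n - q + 1) = complete_bipartite a b" by (simp add: turan2_def a_def b_def)
  have V: "verts (complete_bipartite a b) = Inl ` {..<a} \<union> Inr ` {..<b}"
    by (simp add: complete_bipartite_def join_def disjoint_union_def empty_graph_def Plus_def)
  have "edges (F_graph n q) = (\<lambda>e. Inr ` e) ` edges (complete_bipartite a b) \<union>
      {{Inl i, Inr w} | i w. i < q - 1 \<and> w \<in> Inl ` {..<a} \<union> Inr ` {..<b}}"
    unfolding F_graph_def T V[symmetric] by (simp add: join_def disjoint_union_def empty_graph_def)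
  also have "(\<lambda>e. Inr ` e) ` edges (complete_bipartite a b) =
      {{Inr (Inl u), Inr (Inr v)} | u v. u < a \<and> v < b}"
  proof (intro subset_antisym subsetI)
    fix z assume "z \<in> {{Inr (Inl u), Inr (Inr v)} | u v. u < a \<and> v < b}"
    then obtain u v where "u < a" "v < b" "z = {Inr (Inl u), Inr (Inr v)}" by blast
    then show "z \<in> (\<lambda>e. Inr ` e) ` edges (complete_bipartite a b)"
      unfolding complete_bipartite_edges by (intro image_eqI[of _ _ "{Inl u, Inr v}"]) auto
  qed (auto simp: complete_bipartite_edges)
  also have "{{Inl i, Inr w} | i w. i < q - 1 \<and> w \<in> Inl ` {..<a} \<union> Inr ` {..<b}} =
      {{Inl i, Inr (Inl u)} | i u. i < q - 1 \<and> u < a} \<union> {{Inl i, Inr (Inr v)} | i v. i < q - 1 \<and> v < b}"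
    by auto
  finally show ?thesis unfolding a_def b_def by (simp only: Un_ac)
qed

lemma simple_F_graph: "simple_graph (F_graph n q)"
  unfolding simple_graph_def F_graph_edges F_graph_verts by auto

lemma card_F_graph_verts: "1 \<le> q \<Longrightarrow> q \<le> n \<Longrightarrow> card (verts (F_graph n q)) = n"
  unfolding F_graph_verts
  by (subst card_Un_disjoint; (subst card_image)?; (subst card_Un_disjoint)?) (auto simp: card_image inj_on_def)

lemma f_number_eq:
  "f_number n q = (q - 1) * (n - q + 1) + half1 (n - q + 1) * half2 (n - q + 1)"
proof -
  let ?a = "half1 (n - q + 1)" and ?b = "half2 (n - q + 1)"
  let ?A = "(\<lambda>(i, u). {Inl i, Inr (Inl u)}) ` ({..<q - 1} \<times> {..<?a}) :: (nat + (nat + nat)) set set"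
  let ?B = "(\<lambda>(i, v). {Inl i, Inr (Inr v)}) ` ({..<q - 1} \<times> {..<?b}) :: (nat + (nat + nat)) set set"
  let ?C = "(\<lambda>(u, v). {Inr (Inl u), Inr (Inr v)}) ` ({..<?a} \<times> {..<?b}) :: (nat + (nat + nat)) set set"
  have E: "edges (F_graph n q) = ?A \<union> ?B \<union> ?C" unfolding F_graph_edges by auto
  have A: "card ?A = (q - 1) * ?a" by (subst card_image) (auto simp: inj_on_def doubleton_eq_iff card_cartesian_product)
  have B: "card ?B = (q - 1) * ?b" by (subst card_image) (auto simp: inj_on_def doubleton_eq_iff card_cartesian_product)
  have C: "card ?C = ?a * ?b" by (subst card_image) (auto simp: inj_on_def doubleton_eq_iff card_cartesian_product)
  have "?A \<inter> ?B = {}" by (auto simp: doubleton_eq_iff)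
  moreover have "(?A \<union> ?B) \<inter> ?C = {}" by (auto simp: doubleton_eq_iff)
  ultimately have "card (?A \<union> ?B \<union> ?C) = (q - 1) * ?a + (q - 1) * ?b + ?a * ?b"
    using A B C by (simp add: card_Un_disjoint)
  moreover have "(q - 1) * ?a + (q - 1) * ?b = (q - 1) * (n - q + 1)"
    unfolding distrib_left[symmetric] by simp
  ultimately show ?thesis by (simp only: f_number_def E)
qed

lemma half_product: "real (half1 N * half2 N) \<ge> (real N^2 - 1) / 4"
proof (cases "even N")
  case True
  then obtain k where "N = 2 * k" by (elim evenE)
  then show ?thesis by (simp add: power2_eq_square)
next
  case False
  then obtain k where "N = 2 * k + 1" by (elim oddE)
  then have "half1 N = k" "half2 N = k + 1" "real N = 2 * real k + 1" by auto
  then show ?thesis by (simp add: power2_eq_square field_simps)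
qed

lemma product_le_half_product:
  assumes "x + y = N"
  shows "x * y \<le> half1 N * half2 N" "x * y = half1 N * half2 N \<Longrightarrow> x = half1 N \<or> y = half1 N"
proof -
  have *: "x * y \<le> half1 N * half2 N \<and> (x * y = half1 N * half2 N \<longrightarrow> x = half1 N)" if "x \<le> y" "x + y = N" for x y
  proof -
    define d where "d = half1 N - x"
    have x: "x + d = half1 N" "x \<le> half1 N" using that by (auto simp: d_def)
    have h: "half1 N \<le> half2 N" by auto
    have y: "y = half2 N + d" using x(1) that(2) by linarith
    have "x * y + d * (d + (half2 N - half1 N)) = half1 N * half2 N"
    proof -
      obtain c where c: "half2 N = half1 N + c" using h le_Suc_ex by blast
      have "half1 N = x + d" using x(1) by simp
      then show ?thesis unfolding y c by (simp add: algebra_simps)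
    qed
    moreover have "d * (d + (half2 N - half1 N)) = 0 \<Longrightarrow> d = 0" by auto
    ultimately show ?thesis using x(1) by auto
  qed
  have "x \<le> y \<or> y \<le> x" by linarith
  then show "x * y \<le> half1 N * half2 N" "x * y = half1 N * half2 N \<Longrightarrow> x = half1 N \<or> y = half1 N"
    using *[of x y] *[of y x] assms by (auto simp: mult.commute add.commute)
qed

lemma f_number_lower:
  assumes "1 \<le> q" "q \<le> n"
  shows "real n^2/4 + (real q - 1) * n / 2 - real q^2 \<le> f_number n q"
proof -
  define N where "N = n - q + 1"
  have n: "real n = real N + real q - 1" using assms by (simp add: N_def of_nat_diff)
  have "real (f_number n q) = (real q - 1) * N + real (half1 N * half2 N)"
    unfolding f_number_eq N_def[symmetric] using assms(1) by (simp add: of_nat_diff)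
  then have "(real q - 1) * N + (real N^2 - 1) / 4 \<le> f_number n q" using half_product[of N] by linarith
  moreover have "real n^2/4 + (real q - 1) * n / 2 - real q^2 \<le> (real q - 1) * N + (real N^2 - 1) / 4"
  proof -
    have "(real q - 1) * N + (real N^2 - 1) / 4 - (real n^2/4 + (real q - 1) * n / 2 - real q^2) =
       real q^2 / 4 + 3/2 * real q - 1"
      unfolding n by (simp add: power2_eq_square field_simps)
    moreover have "1 \<le> real q^2" using assms(1) by simp
    moreover have "1 \<le> real q" using assms(1) by simp
    moreover have "y \<le> x" if "x - y = z / 4 + 3/2 * w - 1" "1 \<le> z" "1 \<le> w" for x y z w :: real
      using that by linarith
    ultimately show ?thesis by blast
  qed
  ultimately show ?thesis by linarith
qed

context ballooning
begin

abbreviation "Bn \<equiv> B_family fam"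

text \<open>
  A member without edges would be an independent covering of size less than \<open>q\<close>.
\<close>

lemma B_family_cases:
  assumes "bipartite H" "edges H \<noteq> {}"
  shows "B \<in> Bn \<Longrightarrow> B = complete_graph qn \<or> (\<exists>M S. M \<in> fam \<and> covering M S \<and> card S < qn \<and> B = induced_subgraph M S \<and> edges B \<noteq> {})"
proof -
  assume B: "B \<in> Bn"
  have "edges (induced_subgraph M S) \<noteq> {}" if M: "M \<in> fam" "covering M S" "card S < qn" for M S
  proof
    assume e: "edges (induced_subgraph M S) = {}"
    have SM: "S \<subseteq> verts M" using M(2) by (simp add: covering_def)
    have ind: "independent M S" unfolding independent_def using SM e by (auto simp: induced_subgraph_def)
    have "independent M (verts M - S)" unfolding independent_def using M(2) by (auto simp: covering_def)
    then have "bipartite M" unfolding bipartite_def using ind SM by (intro exI[of _ S] exI[of _ "verts M - S"]) auto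
    moreover have "independent_covering M S" using ind M(2) by (simp add: independent_covering_def)
    ultimately have "qn \<le> card S" using independent_covering_ge_q[OF M(1)] by blast
    then show False using M(3) by simp
  qed
  note nonempty = this
  consider "B = complete_graph qn" | M S where "M \<in> fam" "covering M S" "card S < qn" "B = induced_subgraph M S"
    using B unfolding B_family_def by (auto split: if_splits)
  then show ?thesis
  proof cases
    case 2
    then have "edges B \<noteq> {}" using nonempty[OF 2(1-3)] by simp
    then show ?thesis using 2 by (intro disjI2 exI[of _ M] exI[of _ S]) simp
  qed simp
qed

text \<open>
  The edgeless graph on \<open>q - 1\<close> vertices is \<open>\<B>\<close>-free, so the Turan number for \<open>\<B>\<close> is attained.
\<close>

lemma extremal_B_exists:
  assumes "bipartite H" "edges H \<noteq> {}"
  shows "\<exists>D. D \<in> extremal_graphs (qn - 1) Bn"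
proof -
  have q1: "1 \<le> qn" by (rule optimal_classes(1)[OF assms])
  have "graph_free Bn (empty_graph (qn - 1))"
    unfolding graph_free_def
  proof (intro ballI notI)
    fix B assume "B \<in> Bn" "contains_copy (empty_graph (qn - 1)) B"
    then obtain f where f: "inj_on f (verts B)" "f ` verts B \<subseteq> {..<qn - 1}" "\<forall>e\<in>edges B. f ` e \<in> {}"
      by (auto simp: contains_copy_def empty_graph_def)
    from B_family_cases[OF assms \<open>B \<in> Bn\<close>] f(3) have "B = complete_graph qn" by auto
    then have "card (f ` verts B) = qn" using card_image[OF f(1)] by (simp add: complete_graph_def)
    moreover have "card (f ` verts B) \<le> qn - 1" using card_mono[OF _ f(2)] by simp
    ultimately show False using q1 by simp
  qed
  then have "empty_graph (qn - 1) \<in> free_graphs (qn - 1) Bn"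
    by (simp add: free_graphs_def simple_graph_def empty_graph_def)
  then have "(\<lambda>G. card (edges G)) ` free_graphs (qn - 1) Bn \<noteq> {}" by blast
  then have "turan_number (qn - 1) Bn \<in> (\<lambda>G. card (edges G)) ` free_graphs (qn - 1) Bn"
    unfolding turan_number_def by (intro Max_in finite_free_edges)
  then show ?thesis by (auto simp: extremal_graphs_def)
qed

text \<open>
  Suppose that \<open>F(n, q)\<close> with the graph \<open>D\<close> in its small part contains \<open>Ht\<close>. The vertices mapped to one class of the
  bipartite part are independent, so the others contain a member \<open>M\<close> of the decomposition family. The other class being
  independent, the vertices of \<open>M\<close> in the small part cover \<open>M\<close>. There are fewer than \<open>q\<close> of them, so they
  induce a member of \<open>\<B>\<close> in \<open>D\<close>.
\<close>

lemma lower_bound: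
  assumes bip: "bipartite H" and ne: "edges H \<noteq> {}" and n: "qn \<le> n"
  shows "f_number n qn + turan_number (qn - 1) Bn \<le> turan_number n {Ht}"
proof -
  have q1: "1 \<le> qn" by (rule optimal_classes(1)[OF bip ne])
  obtain D where D: "D \<in> extremal_graphs (qn - 1) Bn" using extremal_B_exists[OF bip ne] by (rule exE)
  note D' = extremalD[OF D]
  have finD: "finite (verts D)" using D'(1) by (simp add: simple_graph_def)
  obtain g where g: "bij_betw g (verts D) {0..<card (verts D)}" using ex_bij_betw_finite_nat[OF finD] by blast
  have gi: "inj_on g (verts D)" and gr: "g ` verts D = {..<qn - 1}"
    using g D'(2) by (auto simp: bij_betw_def)
  define \<psi> :: "nat \<Rightarrow> nat + (nat + nat)" where "\<psi> v = Inl (g v)" for v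
  have \<psi>i: "inj_on \<psi> (verts D)" using gi by (auto simp: \<psi>_def inj_on_def)
  define F where "F = F_graph n qn"
  define ED where "ED = (\<lambda>e. \<psi> ` e) ` edges D"
  define G where "G = \<lparr>verts = verts F, edges = edges F \<union> ED\<rparr>"
  have isoD: "isomorphic D \<lparr>verts = \<psi> ` verts D, edges = ED\<rparr>" unfolding ED_def by (rule isomorphic_image[OF D'(1) \<psi>i])
  then have sD: "simple_graph \<lparr>verts = \<psi> ` verts D, edges = ED\<rparr>" and cD: "card ED = card (edges D)"
    using isomorphic_card_edges(1)[OF isoD] by (auto simp: isomorphic_def)
  have \<psi>V: "\<psi> ` verts D = Inl ` {..<qn - 1}" unfolding gr[symmetric] by (auto simp: \<psi>_def)
  have sF: "simple_graph F" unfolding F_def by (rule simple_F_graph)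
  have VF: "verts F = Inl ` {..<qn - 1} \<union> Inr ` (Inl ` {..<half1 (n - qn + 1)} \<union> Inr ` {..<half2 (n - qn + 1)})"
    unfolding F_def by (rule F_graph_verts)
  have EDs: "e \<subseteq> Inl ` {..<qn - 1}" if "e \<in> ED" for e using sD that \<psi>V by (auto simp: simple_graph_def)
  have sG: "simple_graph G"
  proof -
    have 1: "finite (verts F)" "\<forall>e\<in>edges F. e \<subseteq> verts F \<and> card e = 2" using sF by (simp_all add: simple_graph_def)
    have "Inl ` {..<qn - 1} \<subseteq> verts F" unfolding VF by (rule Un_upper1)
    then have 2: "e \<subseteq> verts F" if "e \<in> ED" for e using EDs[OF that] by (rule order_trans[rotated])
    have 3: "card e = 2" if "e \<in> ED" for e using sD that by (simp add: simple_graph_def)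
    show ?thesis unfolding simple_graph_def G_def
    proof (simp, intro conjI ballI 1(1))
      fix e assume "e \<in> edges F \<union> ED"
      then show "e \<subseteq> verts F" "card e = 2" using 1(2) 2 3 by blast+
    qed
  qed
  have noInl: "\<not> e \<subseteq> Inl ` X" if "e \<in> edges F" for e X
    using that unfolding F_def F_graph_edges by auto
  have noInr: "\<not> e \<subseteq> Inr ` Inl ` X" "\<not> e \<subseteq> Inr ` Inr ` X" if "e \<in> edges G" for e X
  proof -
    have "e \<noteq> {}" using edge_ends[OF sG that] by auto
    then show "\<not> e \<subseteq> Inr ` Inl ` X" "\<not> e \<subseteq> Inr ` Inr ` X"
      using that EDs[of e] unfolding G_def F_def F_graph_edges by auto
  qed
  have "edges F \<inter> ED = {}" using noInl EDs by blast
  then have cG: "card (edges G) = f_number n qn + card (edges D)"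
    using finite_edges[OF sF] finite_edges[OF sG] cD
    by (simp add: G_def card_Un_disjoint f_number_def F_def)
  have noHt: "\<not> contains_copy G Ht"
  proof
    assume "contains_copy G Ht"
    then obtain f where f: "inj_on f (verts Ht)" "f ` verts Ht \<subseteq> verts F" "\<forall>e\<in>edges Ht. f ` e \<in> edges G"
      by (auto simp: contains_copy_def G_def)
    define W where "W = {v \<in> verts Ht. f v \<in> Inl ` {..<qn - 1}}"
    define X2 where "X2 = {v \<in> verts Ht. f v \<in> Inr ` Inr ` UNIV}"
    have ind2: "independent Ht X2"
      unfolding independent_def
    proof (intro conjI ballI notI)
      fix e assume e: "e \<in> edges Ht" "e \<subseteq> X2"
      then have "f ` e \<subseteq> Inr ` Inr ` UNIV" by (auto simp: X2_def)
      then show False using noInr(2) f(3) e(1) by blast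
    qed (auto simp: X2_def)
    have sub: "verts Ht - X2 \<subseteq> verts Ht" by blast
    have "verts Ht - (verts Ht - X2) = X2" by (auto simp: X2_def)
    then have "independent Ht (verts Ht - (verts Ht - X2))" using ind2 by simp
    from decomposition_of_partition[OF simple_Ht sub this]
    obtain M \<phi> where M: "M \<in> fam" "inj_on \<phi> (verts M)" "\<phi> ` verts M \<subseteq> verts Ht - X2"
      "\<forall>e\<in>edges M. \<phi> ` e \<in> edges Ht" by (elim exE conjE)
    have sM: "simple_graph M" using M(1) by (rule fam_simple)
    define S where "S = {v \<in> verts M. \<phi> v \<in> W}"
    have cov: "covering M S"
      unfolding covering_def
    proof (intro conjI ballI notI)
      fix e assume e: "e \<in> edges M" "S \<inter> e = {}"
      have eV: "e \<subseteq> verts M" using sM e(1) by (simp add: simple_graph_def)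
      have "f ` \<phi> ` e \<subseteq> Inr ` Inl ` UNIV"
      proof
        fix z assume "z \<in> f ` \<phi> ` e"
        then obtain v where v: "v \<in> e" "z = f (\<phi> v)" by blast
        then have "\<phi> v \<in> verts Ht" "\<phi> v \<notin> X2" "\<phi> v \<notin> W" using M(3) eV e(2) by (auto simp: S_def)
        moreover have "f (\<phi> v) \<in> verts F" using f(2) \<open>\<phi> v \<in> verts Ht\<close> by blast
        ultimately show "z \<in> Inr ` Inl ` UNIV" unfolding VF v(2) by (auto simp: W_def X2_def)
      qed
      moreover have "f ` \<phi> ` e \<in> edges G" using M(4) f(3) e(1) by blast
      ultimately show False using noInr(1) by blast
    qed (auto simp: S_def)
    have f\<phi>: "inj_on (\<lambda>v. f (\<phi> v)) S"
    proof (rule inj_onI)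
      fix x y assume xy: "x \<in> S" "y \<in> S" "f (\<phi> x) = f (\<phi> y)"
      then have "\<phi> x = \<phi> y" using f(1) M(3) by (auto simp: S_def W_def inj_on_def)
      then show "x = y" using M(2) xy(1,2) by (auto simp: S_def inj_on_def)
    qed
    have fS: "(\<lambda>v. f (\<phi> v)) ` S \<subseteq> \<psi> ` verts D" unfolding \<psi>V by (auto simp: S_def W_def)
    have "card S = card ((\<lambda>v. f (\<phi> v)) ` S)" using card_image[OF f\<phi>] by simp
    also have "\<dots> \<le> card (\<psi> ` verts D)" using fS finD by (intro card_mono) auto
    also have "\<dots> = qn - 1" using card_image[OF \<psi>i] D'(2) by simp
    finally have cS: "card S < qn" using q1 by simp
    have "covering_number M \<le> card S"
      unfolding covering_number_def using cov by (intro cInf_lower) auto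
    then have "induced_subgraph M S \<in> Bn"
      using M(1) cov cS unfolding B_family_def by (auto simp: not_le intro!: exI[of _ M] exI[of _ S] bexI[of _ M])
    moreover have "contains_copy D (induced_subgraph M S)"
    proof -
      define \<theta> where "\<theta> = inv_into (verts D) \<psi>"
      have \<theta>\<psi>: "\<theta> (\<psi> v) = v" if "v \<in> verts D" for v using \<psi>i that by (simp add: \<theta>_def)
      have "inj_on (\<lambda>v. \<theta> (f (\<phi> v))) S"
      proof (rule inj_onI)
        fix x y assume xy: "x \<in> S" "y \<in> S" "\<theta> (f (\<phi> x)) = \<theta> (f (\<phi> y))"
        obtain u v where "f (\<phi> x) = \<psi> u" "u \<in> verts D" "f (\<phi> y) = \<psi> v" "v \<in> verts D" using fS xy(1,2) by blast
        then have "f (\<phi> x) = f (\<phi> y)" using xy(3) \<theta>\<psi> by simp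
        then show "x = y" using f\<phi> xy(1,2) by (auto simp: inj_on_def)
      qed
      moreover have "(\<lambda>v. \<theta> (f (\<phi> v))) ` S \<subseteq> verts D" using fS \<theta>\<psi> by fastforce
      moreover have "(\<lambda>v. \<theta> (f (\<phi> v))) ` e \<in> edges D" if e: "e \<in> edges M" "e \<subseteq> S" for e
      proof -
        have "f ` \<phi> ` e \<in> edges G" using M(4) f(3) e(1) by blast
        moreover have sub: "f ` \<phi> ` e \<subseteq> Inl ` {..<qn - 1}" using e(2) by (auto simp: S_def W_def)
        ultimately have "f ` \<phi> ` e \<in> ED" using noInl by (auto simp: G_def)
        then obtain e' where e': "e' \<in> edges D" "f ` \<phi> ` e = \<psi> ` e'" by (auto simp: ED_def)
        have "e' \<subseteq> verts D" using D'(1) e'(1) by (simp add: simple_graph_def)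
        then have "\<theta> ` \<psi> ` e' = e'" using \<theta>\<psi> by (force simp: image_image)
        then have "\<theta> ` f ` \<phi> ` e = e'" using e'(2) by simp
        then show ?thesis using e'(1) by (simp add: image_image)
      qed
      ultimately show ?thesis unfolding contains_copy_def induced_subgraph_def by (intro exI[of _ "\<lambda>v. \<theta> (f (\<phi> v))"]) auto
    qed
    ultimately show False using D'(3) by (auto simp: graph_free_def)
  qed
  obtain G' :: "nat graph" where G': "isomorphic G G'" using nat_representative[OF sG] by (elim exE)
  have "card (verts G') = n"
    using isomorphic_card_edges(2)[OF G'] card_F_graph_verts[OF q1 n] by (simp add: G_def F_def)
  moreover have "\<not> contains_copy G' Ht" using isomorphic_contains_copy[OF isomorphic_sym[OF G'] _ simple_Ht] noHt by blast
  moreover have "simple_graph G'" using G' by (simp add: isomorphic_def)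
  ultimately have "G' \<in> free_graphs n {Ht}" by (simp add: free_graphs_def graph_free_def)
  then have "card (edges G') \<le> turan_number n {Ht}" by (rule free_edges_le_turan)
  then show ?thesis using isomorphic_card_edges(1)[OF G'] cG D'(4) by simp
qed

end

section \<open>The upper bound and the case of equality\<close>

definition pairs :: "'a set \<Rightarrow> 'a set \<Rightarrow> 'a set set" where
  "pairs A B = {{x, y} | x y. x \<in> A \<and> y \<in> B}"

lemma image_pairs: "(\<lambda>e. \<psi> ` e) ` pairs A B = pairs (\<psi> ` A) (\<psi> ` B)"
proof (intro subset_antisym subsetI)
  fix z assume "z \<in> pairs (\<psi> ` A) (\<psi> ` B)"
  then obtain x y where "x \<in> A" "y \<in> B" "z = {\<psi> x, \<psi> y}" by (auto simp: pairs_def)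
  then show "z \<in> (\<lambda>e. \<psi> ` e) ` pairs A B"
    by (intro image_eqI[of _ _ "{x, y}"]) (auto simp: pairs_def)
qed (auto simp: pairs_def)

lemma nonadj_zero:
  assumes "finite X" "finite Y" "nonadj G X Y = 0" shows "joined G X Y"
  unfolding joined_def
proof (intro ballI)
  fix x y assume xy: "x \<in> X" "y \<in> Y"
  have "card (Y - nbrs G x Y) = 0" using assms(1,3) xy(1) by (simp add: nonadj_def)
  then have "Y - nbrs G x Y = {}" using assms(2) by simp
  then show "{x, y} \<in> edges G" using xy(2) by (auto simp: nbrs_def)
qed

lemma complete_inside_isomorphic:
  fixes G :: "nat graph"
  assumes G: "simple_graph G" and U: "finite U" and A: "A \<subseteq> U" "B \<subseteq> U" "A \<inter> B = {}" "card A = \<kappa>" "card B = \<kappa>"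
    and E: "{e \<in> edges G. e \<subseteq> U} = pairs A B"
  shows "isomorphic \<lparr>verts = A \<union> B, edges = pairs A B\<rparr> (complete_bipartite \<kappa> \<kappa>)"
proof -
  have fin: "finite A" "finite B" using A U by (auto intro: finite_subset)
  obtain f where f: "bij_betw f A {0..<card A}" using ex_bij_betw_finite_nat[OF fin(1)] by blast
  obtain g where g: "bij_betw g B {0..<card B}" using ex_bij_betw_finite_nat[OF fin(2)] by blast
  define \<chi> :: "nat \<Rightarrow> nat + nat" where "\<chi> v = (if v \<in> A then Inl (f v) else Inr (g v))" for v
  have fA: "f ` A = {..<\<kappa>}" "inj_on f A" using f A(4) by (auto simp: bij_betw_def)
  have gB: "g ` B = {..<\<kappa>}" "inj_on g B" using g A(5) by (auto simp: bij_betw_def)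
  have \<chi>A: "\<chi> ` A = Inl ` {..<\<kappa>}" unfolding fA(1)[symmetric] by (auto simp: \<chi>_def)
  have \<chi>B: "\<chi> ` B = Inr ` {..<\<kappa>}"
  proof -
    have "\<chi> ` B = (\<lambda>v. Inr (g v)) ` B" using A(3) by (intro image_cong) (auto simp: \<chi>_def)
    then show ?thesis unfolding gB(1)[symmetric] by (simp add: image_image)
  qed
  have inj: "inj_on \<chi> (A \<union> B)"
    using fA(2) gB(2) by (auto simp: inj_on_def \<chi>_def split: if_splits)
  have V: "verts (complete_bipartite \<kappa> \<kappa>) = Inl ` {..<\<kappa>} \<union> Inr ` {..<\<kappa>}"
    by (simp add: complete_bipartite_def join_def disjoint_union_def empty_graph_def Plus_def)
  have sG: "simple_graph \<lparr>verts = A \<union> B, edges = pairs A B\<rparr>"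
  proof -
    have "card e = 2" if "e \<in> pairs A B" for e
    proof -
      have "e \<in> edges G" using E that by blast
      then show ?thesis using G by (simp add: simple_graph_def)
    qed
    then show ?thesis using fin by (auto simp: simple_graph_def pairs_def)
  qed
  have "(\<lambda>e. \<chi> ` e) ` pairs A B = edges (complete_bipartite \<kappa> \<kappa>)"
    unfolding image_pairs \<chi>A \<chi>B complete_bipartite_edges by (auto simp: pairs_def)
  moreover have "\<chi> ` (A \<union> B) = verts (complete_bipartite \<kappa> \<kappa>)" unfolding image_Un \<chi>A \<chi>B V ..
  moreover have "\<lparr>verts = verts R, edges = edges R\<rparr> = R" for R :: "(nat + nat) graph" by (cases R) simp
  ultimately show ?thesis using isomorphic_image[OF sG, of \<chi>] inj by (simp only: graph.simps)
qed

lemma F_family_member: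
  fixes G :: "nat graph"
  assumes G: "simple_graph G" and part: "verts G = Q \<union> Xa \<union> Xb" "Q \<inter> Xa = {}" "Q \<inter> Xb = {}" "Xa \<inter> Xb = {}"
    and card: "card Q = q - 1" "card Xa = half1 (n - q + 1)" "card Xb = half2 (n - q + 1)"
    and j: "joined G Q Xa" "joined G Q Xb" "joined G Xa Xb"
    and U: "U \<in> {Xa, Xb}" "complete_inside G U \<kappa>" and U': "{U, U'} = {Xa, Xb}" "edges_in G U' = 0"
    and ex: "induced_subgraph G Q \<in> extremal_graphs (q - 1) \<B>"
  shows "\<exists>G'\<in>F_family n q \<kappa> \<B>. isomorphic G G'"
proof -
  let ?a = "half1 (n - q + 1)" and ?b = "half2 (n - q + 1)"
  have fV: "finite (verts G)" using G by (simp add: simple_graph_def)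
  have fin: "finite Q" "finite Xa" "finite Xb" using part(1) fV by auto
  obtain g0 where g0: "bij_betw g0 Q {0..<card Q}" using ex_bij_betw_finite_nat[OF fin(1)] by blast
  obtain g1 where g1: "bij_betw g1 Xa {0..<card Xa}" using ex_bij_betw_finite_nat[OF fin(2)] by blast
  obtain g2 where g2: "bij_betw g2 Xb {0..<card Xb}" using ex_bij_betw_finite_nat[OF fin(3)] by blast
  have i0: "inj_on g0 Q" "g0 ` Q = {..<q - 1}" using g0 card(1) by (auto simp: bij_betw_def)
  have i1: "inj_on g1 Xa" "g1 ` Xa = {..<?a}" using g1 card(2) by (auto simp: bij_betw_def)
  have i2: "inj_on g2 Xb" "g2 ` Xb = {..<?b}" using g2 card(3) by (auto simp: bij_betw_def)
  define \<psi> :: "nat \<Rightarrow> nat + (nat + nat)"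
    where "\<psi> v = (if v \<in> Q then Inl (g0 v) else if v \<in> Xa then Inr (Inl (g1 v)) else Inr (Inr (g2 v)))" for v
  have im: "\<psi> ` Q = Inl ` {..<q - 1}" "\<psi> ` Xa = Inr ` Inl ` {..<?a}" "\<psi> ` Xb = Inr ` Inr ` {..<?b}"
  proof -
    have "\<psi> ` Q = (\<lambda>v. Inl (g0 v)) ` Q" by (intro image_cong) (auto simp: \<psi>_def)
    then show "\<psi> ` Q = Inl ` {..<q - 1}" unfolding i0(2)[symmetric] by (simp add: image_image)
    have "\<psi> ` Xa = (\<lambda>v. Inr (Inl (g1 v))) ` Xa" using part(2) by (intro image_cong) (auto simp: \<psi>_def)
    then show "\<psi> ` Xa = Inr ` Inl ` {..<?a}" unfolding i1(2)[symmetric] by (simp add: image_image)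
    have "\<psi> ` Xb = (\<lambda>v. Inr (Inr (g2 v))) ` Xb" using part(3,4) by (intro image_cong) (auto simp: \<psi>_def)
    then show "\<psi> ` Xb = Inr ` Inr ` {..<?b}" unfolding i2(2)[symmetric] by (simp add: image_image)
  qed
  have inj: "inj_on \<psi> (verts G)"
    unfolding part(1) using i0(1) i1(1) i2(1) by (auto simp: inj_on_def \<psi>_def split: if_splits)
  have VF: "\<psi> ` verts G = verts (F_graph n q)"
    unfolding part(1) image_Un im F_graph_verts by (simp add: Un_assoc image_Un)
  have EF: "edges (F_graph n q) = pairs (\<psi> ` Q) (\<psi> ` Xa) \<union> pairs (\<psi> ` Q) (\<psi> ` Xb) \<union> pairs (\<psi> ` Xa) (\<psi> ` Xb)"
  proof -
    have p: "pairs (f ` I) (g ` J) = {{f i, g j} | i j. i \<in> I \<and> j \<in> J}"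
      for f g :: "nat \<Rightarrow> nat + (nat + nat)" and I J by (auto simp: pairs_def)
    show ?thesis unfolding F_graph_edges im image_image p lessThan_iff by (rule refl)
  qed
  have UV: "U \<subseteq> verts G" "finite U" using U(1) part(1) fin by auto
  obtain A B where AB: "A \<subseteq> U" "B \<subseteq> U" "A \<inter> B = {}" "card A = \<kappa>" "card B = \<kappa>" "{e \<in> edges G. e \<subseteq> U} = pairs A B"
    using U(2) unfolding complete_inside_def pairs_def by blast
  have noU': "{e \<in> edges G. e \<subseteq> U'} = {}"
    using U'(2) finite_edges[OF G] unfolding edges_in_def by simp
  define D0 where "D0 = induced_subgraph G Q"
  define Y where "Y = \<lparr>verts = A \<union> B, edges = pairs A B\<rparr>"
  have EG: "edges G = edges D0 \<union> pairs A B \<union> (pairs Q Xa \<union> pairs Q Xb \<union> pairs Xa Xb)"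
  proof (intro subset_antisym subsetI)
    fix e assume e: "e \<in> edges G"
    obtain x y where xy: "e = {x, y}" "x \<in> verts G" "y \<in> verts G" using edge_ends[OF G e] by (elim exE conjE)
    have "e \<subseteq> Q \<or> e \<subseteq> Xa \<or> e \<subseteq> Xb \<or> e \<in> pairs Q Xa \<union> pairs Q Xb \<union> pairs Xa Xb"
    proof -
      have sym: "{x, y} \<in> pairs R T" if "x \<in> R \<and> y \<in> T \<or> x \<in> T \<and> y \<in> R" for R T
        using that unfolding pairs_def by blast
      show ?thesis using xy(2,3) sym unfolding xy(1) part(1) by blast
    qed
    moreover have "e \<in> pairs A B" if "e \<subseteq> Xa \<or> e \<subseteq> Xb"
    proof -
      have "e \<subseteq> U \<or> e \<subseteq> U'" using that U'(1) by blast
      then have "e \<subseteq> U" using noU' e by blast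
      then show ?thesis using AB(6) e by blast
    qed
    ultimately show "e \<in> edges D0 \<union> pairs A B \<union> (pairs Q Xa \<union> pairs Q Xb \<union> pairs Xa Xb)"
      using e by (auto simp: D0_def induced_subgraph_def)
  next
    fix e assume "e \<in> edges D0 \<union> pairs A B \<union> (pairs Q Xa \<union> pairs Q Xb \<union> pairs Xa Xb)"
    moreover have "pairs R T \<subseteq> edges G" if "joined G R T" for R T
      using that by (auto simp: joined_def pairs_def)
    moreover have "edges D0 \<subseteq> edges G" by (auto simp: D0_def induced_subgraph_def)
    ultimately show "e \<in> edges G" using AB(6) j by blast
  qed
  define D where "D = \<lparr>verts = \<psi> ` Q, edges = (\<lambda>e. \<psi> ` e) ` edges D0\<rparr>"
  define X where "X = \<lparr>verts = \<psi> ` (A \<union> B), edges = (\<lambda>e. \<psi> ` e) ` pairs A B\<rparr>"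
  define G' where "G' = \<lparr>verts = \<psi> ` verts G, edges = (\<lambda>e. \<psi> ` e) ` edges G\<rparr>"
  have GG': "isomorphic G G'" unfolding G'_def by (rule isomorphic_image[OF G inj])
  have G'eq: "G' = \<lparr>verts = verts (F_graph n q), edges = edges (F_graph n q) \<union> edges X \<union> edges D\<rparr>"
    unfolding G'_def VF EG image_Un image_pairs EF X_def D_def by (simp add: Un_ac image_pairs)
  have sD0: "simple_graph D0" using extremalD(1)[OF ex] by (simp add: D0_def)
  have iD: "isomorphic D D0"
  proof -
    have "verts D0 = Q" by (simp add: D0_def induced_subgraph_def)
    moreover have "inj_on \<psi> Q" using inj part(1) by (auto intro: inj_on_subset)
    ultimately have "isomorphic D0 D" using isomorphic_image[OF sD0, of \<psi>] by (simp add: D_def)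
    then show ?thesis by (rule isomorphic_sym)
  qed
  have iX: "isomorphic X (complete_bipartite \<kappa> \<kappa>)"
  proof -
    have Y: "isomorphic Y (complete_bipartite \<kappa> \<kappa>)"
      unfolding Y_def by (rule complete_inside_isomorphic[OF G UV(2) AB])
    then have sY: "simple_graph Y" by (simp add: isomorphic_def)
    have "inj_on \<psi> (A \<union> B)" using inj UV(1) AB(1,2) by (auto intro: inj_on_subset)
    then have "isomorphic Y X" using isomorphic_image[OF sY, of \<psi>] by (simp add: X_def Y_def)
    then show ?thesis using Y isomorphic_trans isomorphic_sym by blast
  qed
  have cls: "\<exists>C\<in>turan2_classes (n - q + 1). verts X \<subseteq> Inr ` C"
  proof -
    have sub: "verts X \<subseteq> \<psi> ` U" using AB(1,2) by (auto simp: X_def)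
    have "U = Xa \<or> U = Xb" using U(1) by simp
    then have "verts X \<subseteq> Inr ` Inl ` {..<?a} \<or> verts X \<subseteq> Inr ` Inr ` {..<?b}"
      using sub im(2,3) by (elim disjE) (simp_all only: simp_thms)
    then show ?thesis unfolding turan2_classes_def by simp
  qed
  have "G' \<in> F_family n q \<kappa> \<B>"
    unfolding F_family_def
  proof (intro CollectI exI conjI)
    show "G' = \<lparr>verts = verts (F_graph n q), edges = edges (F_graph n q) \<union> edges X \<union> edges D\<rparr>" by (rule G'eq)
    show "\<exists>D'\<in>extremal_graphs (q - 1) \<B>. isomorphic D D'" using iD ex by (auto simp: D0_def)
    show "verts D \<subseteq> Inl ` {..<q - 1}" using im(1) by (simp add: D_def)
  qed (rule iX, rule cls)
  then show ?thesis using GG' by blast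
qed

context ballooning
begin

text \<open>
  The vertices of \<open>F1\<close> and \<open>F2\<close> are adjacent to everything outside their own side and to nothing inside, so
  after removal of the centre they serve as pools for \<open>embed_star\<close>.
\<close>

lemma full_star_bounded:
  fixes G :: "nat graph"
  assumes bip: "bipartite H" and ne: "edges H \<noteq> {}" and G: "simple_graph G" and no: "\<not> contains_copy G Ht"
    and V: "Q \<subseteq> verts G" "X1 \<subseteq> verts G" "X2 \<subseteq> verts G" "Q \<inter> X1 = {}" "Q \<inter> X2 = {}" "X1 \<inter> X2 = {}"
    and Q: "qn - 1 \<le> card Q" and F: "F1 \<subseteq> X1" "F2 \<subseteq> X2" "card (verts Ht) + 2 \<le> card F1" "card (verts Ht) + 2 \<le> card F2"
    and full: "joined G Q F1" "joined G Q F2" "joined G F1 X2" "joined G F2 X1"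
    and iso: "\<And>u. u \<in> F1 \<Longrightarrow> nbrs G u X1 = {}" "\<And>u. u \<in> F2 \<Longrightarrow> nbrs G u X2 = {}"
  shows "star_bounded G X1 X2 (kn - 1)"
  unfolding star_bounded_def
proof (intro ballI allI impI, rule ccontr)
  fix a Ma Mb
  assume a: "a \<in> X1" and Ma: "matching G Ma" "\<forall>e\<in>Ma. e \<subseteq> X1 - insert a (nbrs G a X1)"
    and Mb: "matching G Mb" "\<forall>e\<in>Mb. e \<subseteq> X2 \<and> (\<exists>b\<in>e. {a, b} \<in> edges G)"
    and "\<not> card (nbrs G a X1) + card Ma + card Mb \<le> kn - 1"
  then have many: "kn - 1 < card (nbrs G a X1) + card Ma + card Mb" by simp
  have fV: "finite (verts G)" using G by (simp add: simple_graph_def)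
  have fin: "finite Q" "finite X1" "finite X2" using V(1-3) fV by (auto intro: finite_subset)
  have finF: "finite F1" "finite F2" using F(1,2) fin by (auto intro: finite_subset)
  have "card F1 - 1 \<le> card (F1 - {a})" using finF by (simp add: card_Diff_singleton_if)
  then have "card (verts Ht) + 1 \<le> card (F1 - {a})" using F(3) by linarith
  from ex_subset_card[OF this] obtain N1 where N1: "N1 \<subseteq> F1 - {a}" "card N1 = card (verts Ht) + 1" "finite N1"
    by (elim exE conjE)
  have "card (verts Ht) + 1 \<le> card F2" using F(4) by simp
  from ex_subset_card[OF this] obtain N2 where N2: "N2 \<subseteq> F2" "card N2 = card (verts Ht) + 1" "finite N2"
    by (elim exE conjE)
  define \<Lambda> where "\<Lambda> = nbrs G a X1"
  have LX: "\<Lambda> \<subseteq> X1" unfolding \<Lambda>_def by (rule nbrs_subset)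
  have aL: "a \<notin> \<Lambda>" unfolding \<Lambda>_def by (rule not_self_nbr[OF G])
  have MaX: "\<Union>Ma \<subseteq> X1 - insert a \<Lambda>" using Ma(2) unfolding \<Lambda>_def by blast
  have MbX: "\<Union>Mb \<subseteq> X2" using Mb(2) by blast
  have ne_edge: "e \<noteq> {}" if "e \<in> edges G" for e using edge_ends[OF G that] by (elim exE conjE) simp
  have disj: "Ma \<inter> Mb = {}"
  proof (rule ccontr)
    assume "Ma \<inter> Mb \<noteq> {}"
    then obtain e where "e \<in> Ma" "e \<in> Mb" by blast
    then have "e \<subseteq> X1 \<inter> X2" "e \<in> edges G" using MaX MbX Ma(1) by (auto simp: matching_def)
    then show False using ne_edge[of e] V(6) by simp
  qed
  have m: "matching G (Ma \<union> Mb)"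
    unfolding matching_def
  proof (intro conjI ballI impI)
    show "Ma \<union> Mb \<subseteq> edges G" using Ma(1) Mb(1) by (simp add: matching_def)
    fix e e' assume e: "e \<in> Ma \<union> Mb" "e' \<in> Ma \<union> Mb" "e \<noteq> e'"
    have cross: "f \<inter> f' = {}" if "f \<in> Ma" "f' \<in> Mb" for f f'
    proof -
      have "f \<subseteq> X1" "f' \<subseteq> X2" using that MaX MbX by auto
      then show ?thesis using V(6) by blast
    qed
    consider "e \<in> Ma" "e' \<in> Ma" | "e \<in> Ma" "e' \<in> Mb" | "e \<in> Mb" "e' \<in> Ma" | "e \<in> Mb" "e' \<in> Mb" using e by blast
    then show "e \<inter> e' = {}"
    proof cases
      case 1 then show ?thesis using Ma(1) e(3) by (simp add: matching_def)
    next
      case 2 then show ?thesis by (rule cross)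
    next
      case 3 then show ?thesis using cross[of e' e] by (simp add: Int_commute)
    next
      case 4 then show ?thesis using Mb(1) e(3) by (simp add: matching_def)
    qed
  qed
  have Nout: "N1 \<inter> \<Lambda> = {}" "N1 \<inter> \<Union>Ma = {}" "N2 \<inter> \<Union>Mb = {}"
  proof -
    show "N1 \<inter> \<Lambda> = {}"
    proof (rule ccontr)
      assume "N1 \<inter> \<Lambda> \<noteq> {}"
      then obtain u where u: "u \<in> F1" "u \<in> nbrs G a X1" using N1(1) by (auto simp: \<Lambda>_def)
      have "a \<in> nbrs G u X1" by (rule nbrs_sym[OF u(2) a])
      then show False using iso(1)[OF u(1)] by simp
    qed
    have inner: "nbrs G u X \<noteq> {}" if e: "e \<in> edges G" "e \<subseteq> X" "u \<in> e" for e u X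
    proof -
      obtain x y where "e = {x, y}" using edge_ends[OF G e(1)] by (elim exE conjE)
      then obtain z where "e = {u, z}" using e(3) by auto
      then have "z \<in> nbrs G u X" using e by (auto simp: nbrs_def)
      then show ?thesis by blast
    qed
    show "N1 \<inter> \<Union>Ma = {}"
    proof (rule ccontr)
      assume "N1 \<inter> \<Union>Ma \<noteq> {}"
      then obtain u e where "u \<in> F1" "e \<in> Ma" "u \<in> e" using N1(1) by auto
      then show False using inner[of e X1 u] iso(1)[of u] Ma by (auto simp: matching_def)
    qed
    show "N2 \<inter> \<Union>Mb = {}"
    proof (rule ccontr)
      assume "N2 \<inter> \<Union>Mb \<noteq> {}"
      then obtain u e where "u \<in> F2" "e \<in> Mb" "u \<in> e" using N2(1) by auto
      then show False using inner[of e X2 u] iso(2)[of u] Mb by (auto simp: matching_def)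
    qed
  qed
  have NX: "N1 \<subseteq> X1" "N2 \<subseteq> X2" "a \<notin> N1" "N1 \<subseteq> F1" using N1(1) N2(1) F(1,2) by auto
  have j21: "joined G X1 F2" by (rule joined_sym[OF full(4)])
  have aX: "{a} \<subseteq> X1" using a by simp
  have "contains_copy G Ht"
  proof (rule embed_star[where ?F1.0 = Ma and ?F2.0 = Mb and W = Q and a = a and \<Lambda> = \<Lambda> and ?N1.0 = N1 and ?N2.0 = N2,
        OF bip ne G])
    show "kn - 1 < card \<Lambda> + card Ma + card Mb" using many by (simp add: \<Lambda>_def)
    show "matching G (Ma \<union> Mb)" "Ma \<inter> Mb = {}" by (rule m, rule disj)
    show "\<And>x. x \<in> \<Lambda> \<Longrightarrow> {a, x} \<in> edges G" by (simp add: \<Lambda>_def nbrs_def)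
    show "\<And>e. e \<in> Mb \<Longrightarrow> \<exists>b\<in>e. {a, b} \<in> edges G" using Mb(2) by blast
    show "Q \<inter> \<Lambda> = {}" "Q \<inter> \<Union>(Ma \<union> Mb) = {}" "\<Lambda> \<inter> \<Union>(Ma \<union> Mb) = {}" "a \<notin> Q" "a \<notin> \<Union>(Ma \<union> Mb)"
      using LX MaX MbX V(4-6) a by blast+
    show "N1 \<inter> N2 = {}" using NX V(6) by blast
    show "(N1 \<union> N2) \<inter> ({a} \<union> Q \<union> \<Lambda> \<union> \<Union>(Ma \<union> Mb)) = {}"
    proof -
      have "N1 \<inter> Q = {}" "N1 \<inter> \<Union>Mb = {}" using NX(1) V(4,6) MbX by blast+
      then have d1: "N1 \<inter> ({a} \<union> Q \<union> \<Lambda> \<union> \<Union>(Ma \<union> Mb)) = {}"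
        using NX(3) Nout(1,2) by (simp add: Int_Un_distrib Union_Un_distrib)
      have "a \<notin> N2" using NX(2) V(6) a by blast
      moreover have "N2 \<inter> Q = {}" using NX(2) V(5) by blast
      moreover have "N2 \<inter> \<Lambda> = {}" using NX(2) V(6) LX by blast
      moreover have "N2 \<inter> \<Union>Ma = {}"
        using NX(2) V(6) subset_trans[OF MaX Diff_subset] by blast
      ultimately have "N2 \<inter> ({a} \<union> Q \<union> \<Lambda> \<union> \<Union>(Ma \<union> Mb)) = {}"
        using Nout(3) by (simp add: Int_Un_distrib Union_Un_distrib)
      then show ?thesis using d1 by (simp only: Int_Un_distrib2 Un_empty_left)
    qed
    show "joined G N1 N2" by (rule joined_mono[OF full(3) NX(4) NX(2)])
    show "joined G Q N1" by (rule joined_mono[OF full(1) order_refl NX(4)])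
    show "joined G Q N2" by (rule joined_mono[OF full(2) order_refl N2(1)])
    show "joined G {a} N2" by (rule joined_mono[OF j21 aX N2(1)])
    show "joined G \<Lambda> N2" by (rule joined_mono[OF j21 LX N2(1)])
    show "joined G (\<Union>Ma) N2" by (rule joined_mono[OF j21 subset_trans[OF MaX Diff_subset] N2(1)])
    show "joined G (\<Union>Mb) N1" by (rule joined_mono[OF joined_sym[OF full(3)] MbX NX(4)])
    show "finite \<Lambda>" using LX fin(2) by (rule finite_subset)
    show "a \<in> verts G" "N1 \<subseteq> verts G" "N2 \<subseteq> verts G" using a V(2,3) NX by auto
    show "a \<notin> \<Lambda>" by (rule aL)
  qed (use V(1) fin Q N1 N2 in auto)
  then show False using no by simp
qed

text \<open>
  Each vertex of \<open>X1\<close> outside \<open>F\<close> is responsible for a missing edge or lies on an inner edge.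
\<close>

lemma full_vertices_count:
  fixes G :: "nat graph"
  assumes G: "simple_graph G" and fin: "finite X1" "finite X2" "finite Q"
  defines "F \<equiv> {u \<in> X1. nbrs G u Q = Q \<and> nbrs G u X2 = X2 \<and> nbrs G u X1 = {}}"
  shows "card X1 \<le> card F + nonadj G X1 Q + nonadj G X1 X2 + 2 * edges_in G X1"
proof -
  define t where "t u = card (Q - nbrs G u Q) + card (X2 - nbrs G u X2) + card (nbrs G u X1)" for u
  have "1 \<le> t u" if "u \<in> X1 - F" for u
  proof (rule ccontr)
    assume "\<not> 1 \<le> t u"
    then have "card (Q - nbrs G u Q) = 0" "card (X2 - nbrs G u X2) = 0" "card (nbrs G u X1) = 0"
      by (simp_all add: t_def)
    moreover have "finite (nbrs G u X1)" by (rule finite_subset[OF nbrs_subset fin(1)])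
    ultimately have "Q - nbrs G u Q = {}" "X2 - nbrs G u X2 = {}" "nbrs G u X1 = {}"
      using fin(2,3) by simp_all
    then have "nbrs G u Q = Q" "nbrs G u X2 = X2" using nbrs_subset[of G u Q] nbrs_subset[of G u X2] by auto
    then show False using that \<open>nbrs G u X1 = {}\<close> by (simp add: F_def)
  qed
  then have "(\<Sum>u\<in>X1 - F. 1) \<le> (\<Sum>u\<in>X1 - F. t u)" by (intro sum_mono)
  also have "\<dots> \<le> (\<Sum>u\<in>X1. t u)" using fin by (intro sum_mono2) auto
  also have "\<dots> = nonadj G X1 Q + nonadj G X1 X2 + 2 * edges_in G X1"
    using sum_degrees[OF G fin(1)] by (simp add: t_def nonadj_def sum.distrib)
  finally have "card (X1 - F) \<le> nonadj G X1 Q + nonadj G X1 X2 + 2 * edges_in G X1" by simp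
  moreover have "F \<subseteq> X1" by (auto simp: F_def)
  then have "card X1 = card F + card (X1 - F)"
    using fin card_mono[OF fin(1)] finite_subset[OF _ fin(1)] by (simp add: card_Diff_subset)
  ultimately show ?thesis by simp
qed

text \<open>
  Write the number of edges as the number in \<open>F(n, q)\<close> plus \<open>e(Q)\<close> plus inner edges, minus missing edges and
  minus the loss from unequal sides. Since \<open>G\<close> has at least as many edges as \<open>F(n, q)\<close>, the missing edges are
  bounded and most vertices of either side are full. They serve as pools, whence \<open>G[Q]\<close> is \<open>\<B>\<close>-free and
  \<open>inside_excess\<close> applies with \<open>\<kappa> = k - 1\<close>. In the case of equality each of these estimates is sharp.
\<close>

lemma upper_bound:
  assumes bip: "bipartite H" and ne: "edges H \<noteq> {}" and ext: "G \<in> extremal_graphs n {Ht}"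
    and part: "verts G = Q \<union> X1 \<union> X2" "Q \<inter> X1 = {}" "Q \<inter> X2 = {}" "X1 \<inter> X2 = {}" and cQ: "card Q = qn - 1"
    and K: "edges_in G X1 \<le> K" "edges_in G X2 \<le> K" and quarter: "n \<le> 4 * card X1" "n \<le> 4 * card X2"
    and n: "qn \<le> n" "4 * (qn * qn + 4 * K + card (verts Ht) + 2) \<le> n"
  shows "turan_number n {Ht} \<le> f_number n qn + turan_number (qn - 1) Bn + (kn - 1)^2 \<and>
    (turan_number n {Ht} = f_number n qn + turan_number (qn - 1) Bn + (kn - 1)^2 \<longrightarrow>
      (\<exists>G'\<in>F_family n qn (kn - 1) Bn. isomorphic G G'))"
proof -
  note G = extremalD[OF ext]
  have q1: "1 \<le> qn" by (rule optimal_classes(1)[OF bip ne])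
  have no: "\<not> contains_copy G Ht" using G(3) by (simp add: graph_free_def)
  have fV: "finite (verts G)" using G(1) by (simp add: simple_graph_def)
  have fin: "finite Q" "finite X1" "finite X2" using part(1) fV by auto
  have V: "Q \<subseteq> verts G" "X1 \<subseteq> verts G" "X2 \<subseteq> verts G" using part(1) by auto
  define N where "N = n - qn + 1"
  define X where "X = X1 \<union> X2"
  have finX: "finite X" using fin by (simp add: X_def)
  have cX: "card X = card X1 + card X2" unfolding X_def using fin part(4) by (rule_tac card_Un_disjoint)
  have tot: "card Q + card X1 + card X2 = n"
    using part fin G(2) by (simp add: card_Un_disjoint Int_Un_distrib2)
  have cN: "card X1 + card X2 = N" using tot cQ q1 n(1) by (simp add: N_def)
  have E: "card (edges G) + nonadj G Q X + nonadj G X1 X2 =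
      edges_in G Q + (qn - 1) * N + card X1 * card X2 + (edges_in G X1 + edges_in G X2)"
  proof -
    have "edges_in G (Q \<union> X) = edges_in G Q + edges_in G X + edges_btw G Q X"
      by (rule edges_in_Un[OF G(1) fin(1) finX]) (use part in \<open>auto simp: X_def\<close>)
    moreover have "edges_in G X = edges_in G X1 + edges_in G X2 + edges_btw G X1 X2"
      unfolding X_def by (rule edges_in_Un[OF G(1) fin(2,3) part(4)])
    moreover have "edges_in G (Q \<union> X) = card (edges G)"
      using edges_in_verts[OF G(1)] part(1) by (simp add: X_def Un_assoc)
    moreover have "nonadj G Q X + edges_btw G Q X = (qn - 1) * N"
      using nonadj_plus_edges_btw[OF fin(1) finX, of G] cQ cX cN by simp
    ultimately show ?thesis using nonadj_plus_edges_btw[OF fin(2,3), of G] by linarith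
  qed
  have f: "f_number n qn = (qn - 1) * N + half1 N * half2 N" unfolding f_number_eq N_def ..
  have low: "f_number n qn + turan_number (qn - 1) Bn \<le> card (edges G)"
    using lower_bound[OF bip ne n(1)] G(4) by simp
  have prod: "card X1 * card X2 \<le> half1 N * half2 N" by (rule product_le_half_product(1)[OF cN])
  have eQ: "edges_in G Q \<le> qn * qn"
  proof -
    have "2 * edges_in G Q \<le> (qn - 1) * (qn - 1)" using edges_in_le[OF G(1) fin(1)] cQ by simp
    also have "\<dots> \<le> qn * qn" by (intro mult_le_mono) auto
    finally show ?thesis by simp
  qed
  have missing: "nonadj G Q X + nonadj G X1 X2 \<le> qn * qn + 2 * K"
    using E low f prod eQ K by linarith
  have nQ: "nonadj G X1 Q \<le> nonadj G Q X" "nonadj G X2 Q \<le> nonadj G Q X"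
    using nonadj_mono[OF finX fin(1) _ order_refl, of X1 G] nonadj_mono[OF finX fin(1) _ order_refl, of X2 G]
      nonadj_swap[OF fin(1) finX, of G] by (simp_all add: X_def)
  define F1 where "F1 = {u \<in> X1. nbrs G u Q = Q \<and> nbrs G u X2 = X2 \<and> nbrs G u X1 = {}}"
  define F2 where "F2 = {u \<in> X2. nbrs G u Q = Q \<and> nbrs G u X1 = X1 \<and> nbrs G u X2 = {}}"
  have many: "v + 2 \<le> f" if "x \<le> f + m1 + m12 + 2 * e" "m + m12 \<le> r + 2 * K" "m1 \<le> m" "e \<le> K" "n \<le> 4 * x"
    "4 * (r + 4 * K + v + 2) \<le> n" for v f x m1 m12 e m r :: nat
  proof -
    have "4 * (r + 4 * K + v + 2) \<le> 4 * x" using that(5,6) by (rule order_trans[rotated])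
    then have "r + 4 * K + v + 2 \<le> x" by simp
    moreover have "m1 + m12 \<le> r + 2 * K" using that(2,3) by simp
    moreover have "2 * e \<le> 2 * K" using that(4) by simp
    ultimately show ?thesis using that(1) by simp
  qed
  have c1: "card (verts Ht) + 2 \<le> card F1"
    unfolding F1_def
    by (rule many[OF full_vertices_count[OF G(1) fin(2,3,1)] missing nQ(1) K(1) quarter(1) n(2)])
  have c2: "card (verts Ht) + 2 \<le> card F2"
    unfolding F2_def
    by (rule many[OF full_vertices_count[OF G(1) fin(3,2,1)] missing[unfolded nonadj_swap[OF fin(2,3), of G]]
          nQ(2) K(2) quarter(2) n(2)])
  have F: "F1 \<subseteq> X1" "F2 \<subseteq> X2" by (auto simp: F1_def F2_def)
  have join_if: "joined G R T" if "\<forall>u\<in>R. nbrs G u T = T" for R T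
    using that unfolding joined_def nbrs_def by blast
  have jF: "joined G F1 Q" "joined G F2 Q" "joined G F1 X2" "joined G F2 X1"
    by (rule join_if; simp add: F1_def F2_def)+
  have iso: "nbrs G u X1 = {}" if "u \<in> F1" for u using that by (simp add: F1_def)
  have iso': "nbrs G u X2 = {}" if "u \<in> F2" for u using that by (simp add: F2_def)
  have Q': "qn - 1 \<le> card Q" using cQ by simp
  have sb1: "star_bounded G X1 X2 (kn - 1)"
    by (rule full_star_bounded[OF bip ne G(1) no V part(2-4) Q' F c1 c2 joined_sym[OF jF(1)] joined_sym[OF jF(2)] jF(3,4) iso iso'])
  have sb2: "star_bounded G X2 X1 (kn - 1)"
    by (rule full_star_bounded[OF bip ne G(1) no V(1,3,2) part(3,2) _ Q' F(2,1) c2 c1 joined_sym[OF jF(2)] joined_sym[OF jF(1)] jF(4,3) iso' iso])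
      (use part(4) in auto)
  have mm: "card M1 + card M2 \<le> kn - 1"
    if M: "matching G M1" "matching G M2" "\<forall>e\<in>M1. e \<subseteq> X1" "\<forall>e\<in>M2. e \<subseteq> X2" for M1 M2
  proof -
    have "F1 \<noteq> {}" using c1 by auto
    then obtain a where a: "a \<in> F1" by blast
    have na: "nbrs G a X1 = {}" by (rule iso[OF a])
    have p1: "\<forall>e\<in>M1. e \<subseteq> X1 - insert a (nbrs G a X1)"
    proof
      fix e assume e: "e \<in> M1"
      have eG: "e \<in> edges G" "e \<subseteq> X1" using M(1,3) e by (auto simp: matching_def)
      obtain x y where xy: "e = {x, y}" using edge_ends[OF G(1) eG(1)] by (elim exE conjE)
      have "a \<notin> e"
      proof
        assume "a \<in> e"
        then obtain z where "e = {a, z}" using xy by auto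
        then have "z \<in> nbrs G a X1" using eG by (auto simp: nbrs_def)
        then show False using na by simp
      qed
      then show "e \<subseteq> X1 - insert a (nbrs G a X1)" using eG(2) na by auto
    qed
    have p2: "\<forall>e\<in>M2. e \<subseteq> X2 \<and> (\<exists>b\<in>e. {a, b} \<in> edges G)"
    proof
      fix e assume e: "e \<in> M2"
      have eG: "e \<in> edges G" "e \<subseteq> X2" using M(2,4) e by (auto simp: matching_def)
      obtain x y where xy: "e = {x, y}" using edge_ends[OF G(1) eG(1)] by (elim exE conjE)
      then have "{a, x} \<in> edges G" using jF(3) a eG(2) by (simp add: joined_def)
      then show "e \<subseteq> X2 \<and> (\<exists>b\<in>e. {a, b} \<in> edges G)" using eG(2) xy by blast
    qed
    have "a \<in> X1" using a F(1) by blast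
    from sb1[unfolded star_bounded_def, rule_format, OF this M(1) _ M(2)] p1 p2
    have "card (nbrs G a X1) + card M1 + card M2 \<le> kn - 1" by simp
    then show ?thesis by simp
  qed
  have exc: "edges_in G X1 + edges_in G X2 \<le> (kn - 1)^2 + nonadj G X1 X2 \<and>
    (edges_in G X1 + edges_in G X2 = (kn - 1)^2 + nonadj G X1 X2 \<longrightarrow> nonadj G X1 X2 = 0 \<and>
      (complete_inside G X1 (kn - 1) \<and> edges_in G X2 = 0 \<or> complete_inside G X2 (kn - 1) \<and> edges_in G X1 = 0))"
    by (rule inside_excess[OF G(1) fin(2,3) sb1 sb2 mm])
  define GQ where "GQ = induced_subgraph G Q"
  have freeQ: "graph_free Bn GQ"
    unfolding graph_free_def
  proof (intro ballI notI)
    fix B assume B: "B \<in> Bn" "contains_copy GQ B"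
    then obtain \<phi> where \<phi>: "inj_on \<phi> (verts B)" "\<phi> ` verts B \<subseteq> Q" "\<forall>e\<in>edges B. \<phi> ` e \<in> edges GQ"
      by (auto simp: contains_copy_def GQ_def induced_subgraph_def)
    from B_family_cases[OF bip ne B(1)] show False
    proof
      assume "B = complete_graph qn"
      then have "card (\<phi> ` verts B) = qn" using card_image[OF \<phi>(1)] by (simp add: complete_graph_def)
      moreover have "card (\<phi> ` verts B) \<le> card Q" by (rule card_mono[OF fin(1) \<phi>(2)])
      ultimately show False using cQ q1 by simp
    next
      assume "\<exists>M S. M \<in> fam \<and> covering M S \<and> card S < qn \<and> B = induced_subgraph M S \<and> edges B \<noteq> {}"
      then obtain M S where M: "M \<in> fam" "covering M S" "B = induced_subgraph M S" by blast
      have vB: "verts B = S" unfolding M(3) by (simp add: induced_subgraph_def)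
      have eB: "\<phi> ` e \<in> edges G" if "e \<in> edges M" "e \<subseteq> S" for e
      proof -
        have "e \<in> edges B" unfolding M(3) using that by (simp add: induced_subgraph_def)
        then show ?thesis using \<phi>(3) by (auto simp: GQ_def induced_subgraph_def)
      qed
      define P where "P i = (if i then F1 else F2)" for i
      have "contains_copy G Ht"
      proof (rule embed_covering[where W = Q and N = P, OF simple_Ht M(1,2)])
        show "inj_on \<phi> S" "\<phi> ` S \<subseteq> Q" using \<phi>(1,2) vB by auto
        show "joined G (P True) (P False)" using joined_mono[OF jF(3) order_refl F(2)] by (simp add: P_def)
        fix i
        show "joined G Q (P i)" using joined_sym[OF jF(1)] joined_sym[OF jF(2)] by (simp add: P_def)
        show "P i \<inter> Q = {}" using F part(2,3) by (auto simp: P_def)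
        show "finite (P i)" "P i \<subseteq> verts G" using F fin V by (auto simp: P_def intro: finite_subset)
        show "card (verts Ht) \<le> card (P i)" using c1 c2 by (simp add: P_def)
      qed (use eB V F part(4) in \<open>auto simp: P_def\<close>)
      then show False using no by simp
    qed
  qed
  have sQ: "simple_graph GQ" using G(1) fin(1) by (auto simp: simple_graph_def GQ_def induced_subgraph_def)
  have GQfree: "GQ \<in> free_graphs (qn - 1) Bn"
    using sQ freeQ cQ by (simp add: free_graphs_def GQ_def induced_subgraph_def)
  have cGQ: "card (edges GQ) = edges_in G Q" by (simp add: GQ_def induced_subgraph_def edges_in_def)
  have tQ: "edges_in G Q \<le> turan_number (qn - 1) Bn" using free_edges_le_turan[OF GQfree] cGQ by simp
  have up: "card (edges G) \<le> f_number n qn + turan_number (qn - 1) Bn + (kn - 1)^2"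
    using E f prod exc tQ by linarith
  have "\<exists>G'\<in>F_family n qn (kn - 1) Bn. isomorphic G G'"
    if eq: "card (edges G) = f_number n qn + turan_number (qn - 1) Bn + (kn - 1)^2"
  proof -
    have e1: "edges_in G Q = turan_number (qn - 1) Bn" "nonadj G Q X = 0" "card X1 * card X2 = half1 N * half2 N"
      "edges_in G X1 + edges_in G X2 = (kn - 1)^2 + nonadj G X1 X2"
      using E f prod exc tQ eq by linarith+
    then have ci: "nonadj G X1 X2 = 0"
      "complete_inside G X1 (kn - 1) \<and> edges_in G X2 = 0 \<or> complete_inside G X2 (kn - 1) \<and> edges_in G X1 = 0"
      using exc by auto
    have jX: "joined G Q X" by (rule nonadj_zero[OF fin(1) finX e1(2)])
    have j1: "joined G Q X1" "joined G Q X2" using joined_mono[OF jX order_refl] by (auto simp: X_def)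
    have j12: "joined G X1 X2" by (rule nonadj_zero[OF fin(2,3) ci(1)])
    have exQ: "induced_subgraph G Q \<in> extremal_graphs (qn - 1) Bn"
      using GQfree e1(1) cGQ by (simp add: extremal_graphs_def GQ_def)
    have ex_sides: "\<exists>U U'. {U, U'} = {X1, X2} \<and> complete_inside G U (kn - 1) \<and> edges_in G U' = 0"
      using ci(2)
    proof
      assume "complete_inside G X1 (kn - 1) \<and> edges_in G X2 = 0"
      then show ?thesis by (intro exI[of _ X1] exI[of _ X2]) simp
    next
      assume "complete_inside G X2 (kn - 1) \<and> edges_in G X1 = 0"
      then show ?thesis by (intro exI[of _ X2] exI[of _ X1]) (simp add: insert_commute)
    qed
    obtain U U' where U: "{U, U'} = {X1, X2}" "complete_inside G U (kn - 1)" "edges_in G U' = 0"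
      using ex_sides by (elim exE conjE)
    have Us: "U \<in> {X1, X2}" using U(1) by (rule subst) simp
    have U2: "{U, U'} = {X2, X1}" "U \<in> {X2, X1}" using U(1) Us by (simp_all only: insert_commute[of X2])
    have sz: "card X1 = half1 N \<and> card X2 = half2 N \<or> card X2 = half1 N \<and> card X1 = half2 N"
      using product_le_half_product(2)[OF cN e1(3)] cN by auto
    then show ?thesis
    proof
      assume c: "card X1 = half1 N \<and> card X2 = half2 N"
      show ?thesis
        by (rule F_family_member[OF G(1) part cQ _ _ j1 j12 Us U(2,1,3) exQ]) (use c in \<open>simp_all add: N_def\<close>)
    next
      assume c: "card X2 = half1 N \<and> card X1 = half2 N"
      show ?thesis
        by (rule F_family_member[OF G(1) _ part(3,2) _ cQ _ _ j1(2,1) joined_sym[OF j12] U2(2) U(2) U2(1) U(3) exQ])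
          (use c part(1,4) in \<open>auto simp: N_def\<close>)
    qed
  qed
  then show ?thesis using up G(4) by simp
qed

end

section \<open>Choice of the constants\<close>

lemma extremal_exists:
  assumes "free_graphs n \<L> \<noteq> {}"
  shows "\<exists>G. G \<in> extremal_graphs n \<L>"
proof -
  have "turan_number n \<L> \<in> (\<lambda>G. card (edges G)) ` free_graphs n \<L>"
    unfolding turan_number_def using assms finite_free_edges by (intro Max_in) auto
  then show ?thesis by (auto simp: extremal_graphs_def)
qed

context ballooning
begin

lemma extremal_Ht_exists:
  assumes ne: "edges H \<noteq> {}"
  shows "\<exists>G. G \<in> extremal_graphs n {Ht}"
proof (rule extremal_exists)
  obtain e where "e \<in> edges H" using ne by blast
  then have "e \<in> edges Ht" using on_cycle by (auto simp: edges_Ht)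
  then have "graph_free {Ht} (empty_graph n)" by (auto simp: graph_free_def contains_copy_def empty_graph_def)
  then have "empty_graph n \<in> free_graphs n {Ht}"
    by (simp add: free_graphs_def simple_graph_def empty_graph_def)
  then show "free_graphs n {Ht} \<noteq> {}" by blast
qed

lemma turan_number_asymptotics:
  assumes bip: "bipartite H" and ne: "edges H \<noteq> {}"
  shows "\<exists>N. \<forall>n\<ge>N. f_number n qn + turan_number (qn - 1) Bn \<le> turan_number n {Ht} \<and>
      turan_number n {Ht} \<le> f_number n qn + turan_number (qn - 1) Bn + (kn - 1)^2 \<and>
      (turan_number n {Ht} = f_number n qn + turan_number (qn - 1) Bn + (kn - 1)^2 \<longrightarrow>
        (\<forall>G\<in>extremal_graphs n {Ht}. \<exists>G'\<in>F_family n qn (kn - 1) Bn. isomorphic G G'))"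
proof -
  have q1: "1 \<le> qn" by (rule optimal_classes(1)[OF bip ne])
  have low: "real n^2/4 + (real qn - 1) * n / 2 - real qn^2 \<le> card (edges G)"
    if n: "qn \<le> n" and G: "G \<in> extremal_graphs n {Ht}" for n G
  proof -
    have "f_number n qn \<le> card (edges G)" using lower_bound[OF bip ne n] extremalD(4)[OF G] by linarith
    then have "real (f_number n qn) \<le> card (edges G)" by simp
    then show ?thesis using f_number_lower[OF q1 n] by linarith
  qed
  have low': "\<forall>n\<ge>qn. \<forall>G\<in>extremal_graphs n {Ht}. real n^2/4 - real qn^2 \<le> card (edges G)"
  proof (intro allI impI ballI)
    fix n G assume n: "qn \<le> n" and G: "G \<in> extremal_graphs n {Ht}"
    have "0 \<le> (real qn - 1) * n / 2" using q1 by simp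
    then show "real n^2/4 - real qn^2 \<le> card (edges G)" using low[OF n G] by linarith
  qed
  define h where "h = card (verts Ht) + card (edges H) + 2"
  define s where "s = 32 * h * qn"
  define a where "a = 32 * h * s"
  define K where "K = a + 2 * h"
  define h' where "h' = card (verts Ht) + kn + 1"
  define D where "D = 16 * K * 2 ^ K"
  have K1: "1 \<le> K" by (simp add: K_def h_def)
  \<comment> \<open>The summands of \<open>M\<close> are the reciprocals of the upper bounds that \<open>\<epsilon>\<close> has to satisfy.\<close>
  define M where "M = 64 * h + 2 * h * (s * 2 ^ s) + 8 + 4 * h' * D"
  define \<epsilon> where "\<epsilon> = 1 / real M"
  have M: "1 \<le> M" by (simp add: M_def)
  have \<epsilon>: "0 < \<epsilon>" using M by (simp add: \<epsilon>_def)
  have small: "real m * \<epsilon> \<le> 1" if "m \<le> M" for m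
  proof -
    have "real m \<le> real M" using that by simp
    then show ?thesis using M by (simp add: \<epsilon>_def field_simps)
  qed
  have e1: "64 * real h * \<epsilon> \<le> 1" using small[of "64 * h"] by (simp add: M_def)
  have e2: "2 * real h * (real s * 2 ^ s) * \<epsilon> \<le> 1" using small[of "2 * h * (s * 2 ^ s)"] by (simp add: M_def)
  have e3: "\<epsilon> \<le> 1/8" using small[of 8] by (simp add: M_def)
  have e4: "real (4 * h' * D) * \<epsilon> \<le> 1" by (rule small) (simp add: M_def)
  have verts1: "1 \<le> card (verts Ht)"
  proof -
    have "finite (verts Ht)" using simple_Ht by (simp add: simple_graph_def)
    moreover obtain e where e: "e \<in> edges H" using ne by blast
    have "set (c e) \<subseteq> verts Ht" using e by (auto simp: verts_Ht)
    moreover have "c e \<noteq> []" using len[OF e] by auto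
    ultimately show ?thesis by (simp add: Suc_le_eq card_gt_0_iff) (metis set_empty subset_empty)
  qed
  have tf: "triple_free G (card (verts Ht))"
    if "simple_graph G" "\<not> contains_copy G Ht" for G :: "nat graph"
    by (rule triple_free_Ht[OF bip ne that])
  obtain n0 where n0: "\<forall>n\<ge>n0. \<forall>G\<in>extremal_graphs n {Ht}. \<exists>V1 V2. V1 \<subseteq> verts G \<and> V2 \<subseteq> verts G \<and>
    near_bipartition G \<epsilon> n V1 V2 \<and> (\<forall>v\<in>verts G. (1/2 - \<epsilon>) * n \<le> card (nbrs G v (verts G)))"
    using extremal_near_bipartition[OF simple_Ht verts1 \<epsilon> tf low'] by (auto elim!: exE)
  define N where "N = n0 + qn + h * (a * 2 ^ a) + 2 * h * (s * 2 ^ s) + 64 * h + (4 * (a + 2 * h) + 1) +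
    2 * D * (2 * h' * K + 2 * h') + (8 * (K^2 + 2 * qn^2) + 1) + 8 * K +
    4 * (qn * qn + 4 * (K * (K + kn)) + card (verts Ht) + 2)"
  have main: "turan_number n {Ht} \<le> f_number n qn + turan_number (qn - 1) Bn + (kn - 1)^2 \<and>
      (turan_number n {Ht} = f_number n qn + turan_number (qn - 1) Bn + (kn - 1)^2 \<longrightarrow>
        (\<exists>G'\<in>F_family n qn (kn - 1) Bn. isomorphic G G'))"
    if n: "N \<le> n" and G: "G \<in> extremal_graphs n {Ht}" for n G
  proof -
    note G' = extremalD[OF G]
    have no: "\<not> contains_copy G Ht" using G'(3) by (simp add: graph_free_def)
    have cn: "n0 \<le> n" "qn \<le> n" "h * (a * 2 ^ a) \<le> n" "2 * h * (s * 2 ^ s) \<le> n" "64 * h \<le> n" "4 * (a + 2 * h) < n"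
      "2 * D * (2 * h' * K + 2 * h') \<le> n" "8 * (K^2 + 2 * qn^2) < n" "8 * K \<le> n"
      "4 * (qn * qn + 4 * (K * (K + kn)) + card (verts Ht) + 2) \<le> n"
      using n unfolding N_def by linarith+
    from n0[rule_format, OF cn(1) G] obtain V1 V2 where V: "V1 \<subseteq> verts G" "V2 \<subseteq> verts G" "near_bipartition G \<epsilon> n V1 V2"
      and deg: "\<forall>v\<in>verts G. (1/2 - \<epsilon>) * n \<le> card (nbrs G v (verts G))" by (elim exE conjE)
    from exceptional_set[OF bip ne G'(1) no G'(2)[symmetric] V deg \<epsilon>, folded h_def, folded s_def, folded a_def,
        OF e1 e2 cn(3-6)]
    obtain W U1 U2 where W: "verts G = W \<union> U1 \<union> U2" "W \<inter> U1 = {}" "W \<inter> U2 = {}" "U1 \<inter> U2 = {}" and cW: "card W \<le> a + 2 * h"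
      and U: "independent G U1" "independent G U2" "U1 \<noteq> {}" "U2 \<noteq> {}"
      by (elim exE conjE)
    have d: "real h' * (2 * \<epsilon> * n + 2 * real K) + 2 * real h' \<le> n / (16 * real K * 2 ^ K)"
    proof -
      have Dr: "16 * real K * 2 ^ K = real D" by (simp add: D_def)
      have D0: "0 < real D" using K1 by (simp add: D_def)
      have "(real (4 * h' * D) * \<epsilon>) * real n \<le> 1 * real n" by (rule mult_right_mono[OF e4]) simp
      then have "4 * (h' * \<epsilon> * n) * D \<le> n" by (simp add: algebra_simps)
      moreover have "real (2 * D * (2 * h' * K + 2 * h')) \<le> n" using cn(7) by (rule of_nat_mono)
      then have "2 * (2 * real h' * real K + 2 * real h') * D \<le> n" by (simp add: algebra_simps)
      moreover have "(real h' * (2 * \<epsilon> * n + 2 * real K) + 2 * real h') * D * 2 =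
          4 * (h' * \<epsilon> * n) * D + 2 * (2 * real h' * real K + 2 * real h') * D" by (simp add: algebra_simps)
      ultimately have "(real h' * (2 * \<epsilon> * n + 2 * real K) + 2 * real h') * D \<le> n" by linarith
      then show ?thesis unfolding Dr using D0 by (simp add: pos_le_divide_eq)
    qed
    have nK: "8 * (real K^2 + 2 * real qn^2) < n" "8 * real K \<le> n"
    proof -
      have "real (8 * (K^2 + 2 * qn^2)) < real n" using cn(8) by (simp only: of_nat_less_iff)
      then show "8 * (real K^2 + 2 * real qn^2) < n" by simp
      have "real (8 * K) \<le> n" using cn(9) by (rule of_nat_mono)
      then show "8 * real K \<le> n" by simp
    qed
    from full_vertices[OF bip ne G'(1) no G'(2)[symmetric] W cW[folded K_def] K1 U deg \<epsilon> e3 low[OF cn(2) G],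
        folded h'_def, OF d nK]
    obtain Q X1 X2 where Q: "verts G = Q \<union> X1 \<union> X2" "Q \<inter> X1 = {}" "Q \<inter> X2 = {}" "X1 \<inter> X2 = {}" "card Q = qn - 1"
      and E: "edges_in G X1 \<le> K * (K + kn)" "edges_in G X2 \<le> K * (K + kn)"
      and quarter: "n / 4 \<le> card X1" "n / 4 \<le> card X2" by (elim exE conjE)
    have "n \<le> 4 * card X1" "n \<le> 4 * card X2" using quarter by linarith+
    from upper_bound[OF bip ne G Q E this cn(2,10)] show ?thesis .
  qed
  have "f_number n qn + turan_number (qn - 1) Bn \<le> turan_number n {Ht} \<and>
      turan_number n {Ht} \<le> f_number n qn + turan_number (qn - 1) Bn + (kn - 1)^2 \<and>
      (turan_number n {Ht} = f_number n qn + turan_number (qn - 1) Bn + (kn - 1)^2 \<longrightarrow>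
        (\<forall>G\<in>extremal_graphs n {Ht}. \<exists>G'\<in>F_family n qn (kn - 1) Bn. isomorphic G G'))"
    if n: "N \<le> n" for n
  proof (intro conjI impI ballI)
    have "qn \<le> n" using n by (simp add: N_def)
    then show "f_number n qn + turan_number (qn - 1) Bn \<le> turan_number n {Ht}" by (rule lower_bound[OF bip ne])
    obtain G0 where "G0 \<in> extremal_graphs n {Ht}" using extremal_Ht_exists[OF ne] by (rule exE)
    from main[OF n this] show "turan_number n {Ht} \<le> f_number n qn + turan_number (qn - 1) Bn + (kn - 1)^2" by (rule conjunct1)
    fix G assume eq: "turan_number n {Ht} = f_number n qn + turan_number (qn - 1) Bn + (kn - 1)^2"
      and G: "G \<in> extremal_graphs n {Ht}"
    show "\<exists>G'\<in>F_family n qn (kn - 1) Bn. isomorphic G G'" by (rule mp[OF conjunct2[OF main[OF n G]] eq])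
  qed
  then show ?thesis by blast
qed

end

theorem theorem1p3:
  fixes H Ht :: "'a graph" and t :: nat
  assumes "simple_graph H" and "bipartite H" and "edges H \<noteq> {}"
    and "odd t" and "t \<ge> 5"
    and "odd_ballooning t H Ht"
  shows "let \<M> = decomposition_family Ht; q = q_number \<M>; \<B> = B_family \<M>; k = k_number \<M> in
    \<forall>\<^sub>F n in sequentially.
      f_number n q + turan_number (q - 1) \<B> \<le> turan_number n {Ht} \<and>
      turan_number n {Ht} \<le> f_number n q + turan_number (q - 1) \<B> + (k - 1)^2 \<and>
      (turan_number n {Ht} = f_number n q + turan_number (q - 1) \<B> + (k - 1)^2 \<longrightarrow>
        (\<forall>G\<in>extremal_graphs n {Ht}. \<exists>G'\<in>F_family n q (k - 1) \<B>. isomorphic G G'))"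
proof -
  obtain c where c1: "\<And>e. e \<in> edges H \<Longrightarrow> distinct (c e) \<and> odd (length (c e)) \<and> t \<le> length (c e) \<and>
      e \<in> cycle_edges (c e) \<and> set (c e) \<inter> verts H = e"
    and c2: "\<And>e e'. e \<in> edges H \<Longrightarrow> e' \<in> edges H \<Longrightarrow> e \<noteq> e' \<Longrightarrow> set (c e) \<inter> set (c e') \<subseteq> verts H"
    and c3: "verts Ht = verts H \<union> (\<Union>e\<in>edges H. set (c e))" "edges Ht = (\<Union>e\<in>edges H. cycle_edges (c e))"
    using assms(6) unfolding odd_ballooning_def by (elim exE conjE) blast
  interpret ballooning H Ht c
  proof
    fix e assume e: "e \<in> edges H"
    show "distinct (c e)" "odd (length (c e))" "e \<in> cycle_edges (c e)" "set (c e) \<inter> verts H = e"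
      using c1[OF e] by blast+
    show "5 \<le> length (c e)" using c1[OF e] assms(5) by linarith
  qed (use assms(1) c2 c3 in blast)+
  show ?thesis
    unfolding Let_def eventually_sequentially by (rule turan_number_asymptotics[OF assms(2,3)])
qed

end
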